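(* Let $m,n\in\mathbb{N}$, $n\geq2$. Let $\alpha\geq0$ and $R\in(0,\infty)$. For a rearrangement-invariant function space $X(B_R)$, let $Y_X(B_R,\mu_\alpha)$ be the rearrangement-invariant function space whose function norm is defined as $$\|u\|_{Y_X(B_R,\mu_\alpha)}=\|u^*(\mu_\alpha(B_R)t)\|_{\overline{Y_X}(0,1)},\quad u\in\mathcal{M}^+(B_R,\mu_\alpha),$$ where $\|\cdot\|_{\overline{Y_X}(0,1)}$ is the function norm whose associate norm satisfies $$\|g\|_{\overline{Y_X}'(0,1)}=\big\|t^{\frac{m+\alpha}{n}}g^{**}\big(t^{\frac{n+\alpha}{n}}\big)\big\|_{\overline{X}'(0,1)}\quad\text{for every } g\in\mathcal{M}^+(0,1).$$ Then $Y_X(B_R,\mu_\alpha)$ is the optimal target space in the weighted Sobolev embedding of $W^m_RX(B_R)$ in the following sense: the embedding $W^m_RX(B_R)\hookrightarrow Y_X(B_R,\mu_\alpha)$ is valid, and if $Z(B_R,\mu_\alpha)$ is a rearrangement-invariant function space such that $W^m_RX(B_R)\hookrightarrow Z(B_R,\mu_\alpha)$, then $Y_X(B_R,\mu_\alpha)\hookrightarrow Z(B_R,\mu_\alpha)$.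
   Context: $B_R\subseteq\mathbb{R}^n$ is the open ball centered at the origin with radius $R$; $\mu_\alpha$ is the weighted measure $d\mu_\alpha(x)=|x|^\alpha\,dx$. When no measure is indicated, the Lebesgue measure is used. For a $\sigma$-finite nonatomic nontrivial measure space $(S,\mu)$, let $\mathcal{M}(S,\mu)$ be the set of $\mu$-measurable functions and $\mathcal{M}^+(S,\mu)$ the set of those that are nonnegative $\mu$-a.e. The nonincreasing rearrangement of $f$ is $f^*(t)=\inf\{\lambda>0:\mu(\{|f|>\lambda\})\leq t\}$, $t\in(0,\infty)$, and $f^{**}(t)=\frac1t\int_0^tf^*(s)\,ds$. Two functions are equimeasurable if their distribution functions $\lambda\mapsto\mu(\{|f|>\lambda\})$ coincide. A functional $\|\cdot\|_{X(S,\mu)}:\mathcal{M}^+(S,\mu)\to[0,\infty]$ is a rearrangement-invariant (r.i.) function norm if for all $f,g,f_k\in\mathcal{M}^+(S,\mu)$, $\lambda\ge0$: (P1) $\|f+g\|\le\|f\|+\|g\|$, $\|f\|=0$ iff $f=0$ a.e., $\|\lambda f\|=\lambda\|f\|$; (P2) $f\le g$ a.e. implies $\|f\|\le\|g\|$; (P3) $f_k\nearrow f$ a.e. implies $\|f_k\|\nearrow\|f\|$; (P4) $\|\chi_E\|<\infty$ whenever $\mu(E)<\infty$; (P5) if $\mu(E)<\infty$ there is $C_E\in(0,\infty)$ independent of $f$ with $\int_E f\,d\mu\le C_E\|f\|$; (P6) $\|f\|=\|g\|$ whenever $f,g$ are equimeasurable. It is extended to $\mathcal{M}(S,\mu)$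 by $\|f\|=\|\,|f|\,\|$, and $X(S,\mu)=\{f:\|f\|_{X(S,\mu)}<\infty\}$ is the corresponding rearrangement-invariant function space. If $\mu(S)<\infty$, $\overline{X}(0,1)$ denotes the unique r.i. space over $(0,1)$ with $\|f\|_{X(S,\mu)}=\|f^*(\mu(S)t)\|_{\overline{X}(0,1)}$ for every $f\in\mathcal{M}(S,\mu)$. The associate norm of $\|\cdot\|_{X(S,\mu)}$ is $\|g\|_{X'(S,\mu)}=\sup_{\|f\|_{X(S,\mu)}\le1}\int_S|f||g|\,d\mu$; it is again an r.i. function norm, and $(X')'=X$ with equal norms, so an r.i. norm is determined by its associate norm. $\overline{X}'(0,1)$ is the associate space of $\overline{X}(0,1)$. $W^mX(B_R)$ is the set of $m$-times weakly differentiable $u\in X(B_R)$ with $|D^mu|\in X(B_R)$, where $D^mu$ is the vector of all weak derivatives of $u$ of orders $1,\dots,m$; the norm is $\|u\|_{X(B_R)}+\|\,|D^mu|\,\|_{X(B_R)}$. $W^m_RX(B_R)$ is the subspace of radially symmetric functions (functions equal a.e. to a function of $|x|$). $A\hookrightarrow B$ means $A\subseteq B$ with continuous inclusion. *)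

theory Defs
  imports "HOL-Analysis.Analysis"
begin

section \<open>Rearrangements and rearrangement-invariant function norms\<close>

text \<open>
  The nonnegative measurable functions on \<open>M\<close> are taken to be the measurable functions with values
  in \<^typ>\<open>ennreal\<close>: the value infinity must be allowed, because \<open>g\<^sup>*\<^sup>*\<close> is
  infinite for a nonintegrable \<open>g\<close>, and monotone limits need not be finite.
\<close>

definition equimeasurable :: "'a measure \<Rightarrow> ('a \<Rightarrow> ennreal) \<Rightarrow> ('a \<Rightarrow> ennreal) \<Rightarrow> bool" where
  "equimeasurable M f g \<longleftrightarrow>
     (\<forall>l. emeasure M {x \<in> space M. f x > l} = emeasure M {x \<in> space M. g x > l})"

definition rearrangement :: "'a measure \<Rightarrow> ('a \<Rightarrow> ennreal) \<Rightarrow> real \<Rightarrow> ennreal" where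
  "rearrangement M f t = Inf {l. l > 0 \<and> emeasure M {x \<in> space M. f x > l} \<le> ennreal t}"

definition maximal_rearrangement :: "'a measure \<Rightarrow> ('a \<Rightarrow> ennreal) \<Rightarrow> real \<Rightarrow> ennreal" where
  "maximal_rearrangement M f t =
     ennreal (1 / t) * (\<integral>\<^sup>+ s \<in> {0<..<t}. rearrangement M f s \<partial>lebesgue)"

text \<open>
  The functional \<open>N\<close> is constrained only on measurable functions; its values elsewhere are irrelevant.
  Underlying measure spaces are understood to be \<open>\<sigma>\<close>-finite and nonatomic, as are all those
  to which the notion is applied below (balls and the unit interval).
\<close>

locale ri_function_norm =
  fixes M :: "'a measure" and N :: "('a \<Rightarrow> ennreal) \<Rightarrow> ennreal"
  assumes triangle:
      "\<lbrakk>f \<in> borel_measurable M; g \<in> borel_measurable M\<rbrakk> \<Longrightarrow> N (\<lambda>x. f x + g x) \<le> N f + N g"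
    and zero_iff:
      "f \<in> borel_measurable M \<Longrightarrow> N f = 0 \<longleftrightarrow> (AE x in M. f x = 0)"
    and homogeneous:
      "\<lbrakk>f \<in> borel_measurable M; (c::real) \<ge> 0\<rbrakk> \<Longrightarrow> N (\<lambda>x. ennreal c * f x) = ennreal c * N f"
    and lattice:
      "\<lbrakk>f \<in> borel_measurable M; g \<in> borel_measurable M; AE x in M. f x \<le> g x\<rbrakk> \<Longrightarrow> N f \<le> N g"
    and fatou:
      "\<lbrakk>\<And>k::nat. F k \<in> borel_measurable M; f \<in> borel_measurable M;
        AE x in M. incseq (\<lambda>k. F k x) \<and> (\<lambda>k. F k x) \<longlonglongrightarrow> f x\<rbrakk>
       \<Longrightarrow> incseq (\<lambda>k. N (F k)) \<and> (\<lambda>k. N (F k)) \<longlonglongrightarrow> N f"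
    and finite_indicator:
      "\<lbrakk>E \<in> sets M; emeasure M E < \<infinity>\<rbrakk> \<Longrightarrow> N (indicator E) < \<infinity>"
    and locally_L1:
      "\<lbrakk>E \<in> sets M; emeasure M E < \<infinity>\<rbrakk> \<Longrightarrow>
       \<exists>C::real. C > 0 \<and> (\<forall>f \<in> borel_measurable M. (\<integral>\<^sup>+ x \<in> E. f x \<partial>M) \<le> ennreal C * N f)"
    and rearrangement_invariant:
      "\<lbrakk>f \<in> borel_measurable M; g \<in> borel_measurable M; equimeasurable M f g\<rbrakk> \<Longrightarrow> N f = N g"

definition fnorm :: "(('a \<Rightarrow> ennreal) \<Rightarrow> ennreal) \<Rightarrow> ('a \<Rightarrow> real) \<Rightarrow> ennreal" where
  "fnorm N u = N (\<lambda>x. ennreal \<bar>u x\<bar>)"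

text \<open>
  Functions of finite norm are finite almost everywhere, so the function space consists of
  real-valued functions. Functions equal almost everywhere are not identified.
\<close>

definition fspace :: "'a measure \<Rightarrow> (('a \<Rightarrow> ennreal) \<Rightarrow> ennreal) \<Rightarrow> ('a \<Rightarrow> real) set" where
  "fspace M N = {u \<in> borel_measurable M. fnorm N u < \<infinity>}"

definition associate_norm ::
    "'a measure \<Rightarrow> (('a \<Rightarrow> ennreal) \<Rightarrow> ennreal) \<Rightarrow> ('a \<Rightarrow> ennreal) \<Rightarrow> ennreal" where
  "associate_norm M N g = (SUP f \<in> {f \<in> borel_measurable M. N f \<le> 1}. \<integral>\<^sup>+ x. f x * g x \<partial>M)"

abbreviation unit_interval :: "real measure" where
  "unit_interval \<equiv> lebesgue_on {0<..<1}"

text \<open>Transport of a functional on \<open>(0,1)\<close> to a finite measure space: \<open>f \<mapsto> N (t \<mapsto> f\<^sup>*(\<mu>(S) t))\<close>.\<close>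

definition transported_norm ::
    "'a measure \<Rightarrow> ((real \<Rightarrow> ennreal) \<Rightarrow> ennreal) \<Rightarrow> ('a \<Rightarrow> ennreal) \<Rightarrow> ennreal" where
  "transported_norm M N f = N (\<lambda>t. rearrangement M f (measure M (space M) * t))"

text \<open>
  The representation norm on \<open>(0,1)\<close> is unique on measurable functions. As functionals carry
  unspecified values on nonmeasurable functions, the definition uses \<open>SOME\<close> rather than \<open>THE\<close>.
\<close>

definition representation_norm ::
    "'a measure \<Rightarrow> (('a \<Rightarrow> ennreal) \<Rightarrow> ennreal) \<Rightarrow> (real \<Rightarrow> ennreal) \<Rightarrow> ennreal" where
  "representation_norm M X =
     (SOME N. ri_function_norm unit_interval N \<and>
              (\<forall>f \<in> borel_measurable M. X f = transported_norm M N f))"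

definition embeds :: "'u set \<Rightarrow> ('u \<Rightarrow> ennreal) \<Rightarrow> 'u set \<Rightarrow> ('u \<Rightarrow> ennreal) \<Rightarrow> bool" where
  "embeds A normA B normB \<longleftrightarrow>
     A \<subseteq> B \<and> (\<exists>C::real. \<forall>u \<in> A. normB u \<le> ennreal C * normA u)"


section \<open>Weak derivatives and radial Sobolev spaces\<close>

definition partials :: "'n list \<Rightarrow> (real ^ 'n \<Rightarrow> real) \<Rightarrow> real ^ 'n \<Rightarrow> real" where
  "partials is f = foldr (\<lambda>i g x. frechet_derivative g (at x) (axis i 1)) is f"

text \<open>Smoothness is differentiability of all iterated partial derivatives.\<close>

definition test_function :: "(real ^ 'n) set \<Rightarrow> (real ^ 'n \<Rightarrow> real) \<Rightarrow> bool" where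
  "test_function \<Omega> \<phi> \<longleftrightarrow>
     (\<forall>is x. partials is \<phi> differentiable (at x)) \<and>
     compact (closure {x. \<phi> x \<noteq> 0}) \<and> closure {x. \<phi> x \<noteq> 0} \<subseteq> \<Omega>"

definition locally_integrable :: "(real ^ 'n) set \<Rightarrow> (real ^ 'n \<Rightarrow> real) \<Rightarrow> bool" where
  "locally_integrable \<Omega> u \<longleftrightarrow>
     u \<in> borel_measurable (lebesgue_on \<Omega>) \<and>
     (\<forall>K. compact K \<and> K \<subseteq> \<Omega> \<longrightarrow> set_integrable lebesgue K u)"

text \<open>
  A derivative is indexed by the list of its coordinate directions: \<open>[i\<^sub>1, \<dots>, i\<^sub>k]\<close> stands for
  \<open>\<partial>\<^sub>i\<^sub>1 \<dots> \<partial>\<^sub>i\<^sub>k\<close>, of order \<open>k\<close>.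
\<close>

definition has_weak_derivative ::
    "(real ^ 'n) set \<Rightarrow> 'n list \<Rightarrow> (real ^ 'n \<Rightarrow> real) \<Rightarrow> (real ^ 'n \<Rightarrow> real) \<Rightarrow> bool" where
  "has_weak_derivative \<Omega> is u v \<longleftrightarrow>
     locally_integrable \<Omega> u \<and> locally_integrable \<Omega> v \<and>
     (\<forall>\<phi>. test_function \<Omega> \<phi> \<longrightarrow>
        (LINT x|lebesgue_on \<Omega>. u x * partials is \<phi> x) =
        (-1) ^ length is * (LINT x|lebesgue_on \<Omega>. v x * \<phi> x))"

definition weakly_differentiable :: "(real ^ 'n) set \<Rightarrow> nat \<Rightarrow> (real ^ 'n \<Rightarrow> real) \<Rightarrow> bool" where
  "weakly_differentiable \<Omega> m u \<longleftrightarrow>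
     (\<forall>is. length is \<in> {1..m} \<longrightarrow> (\<exists>v. has_weak_derivative \<Omega> is u v))"

definition weak_derivative ::
    "(real ^ 'n) set \<Rightarrow> 'n list \<Rightarrow> (real ^ 'n \<Rightarrow> real) \<Rightarrow> real ^ 'n \<Rightarrow> real" where
  "weak_derivative \<Omega> is u = (SOME v. has_weak_derivative \<Omega> is u v)"

text \<open>
  The Euclidean length of the vector of all weak derivatives of orders \<open>1, \<dots>, m\<close>. A mixed derivative
  is listed once for each order of differentiation, which changes the length by a bounded factor
  compared with listing it once per multi-index.
\<close>

definition weak_gradient_length ::
    "(real ^ 'n) set \<Rightarrow> nat \<Rightarrow> (real ^ 'n \<Rightarrow> real) \<Rightarrow> real ^ 'n \<Rightarrow> real" where
  "weak_gradient_length \<Omega> m u x =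
     sqrt (\<Sum>is | length is \<in> {1..m}. (weak_derivative \<Omega> is u x)\<^sup>2)"

definition sobolev_space ::
    "(real ^ 'n) set \<Rightarrow> nat \<Rightarrow> ((real ^ 'n \<Rightarrow> ennreal) \<Rightarrow> ennreal) \<Rightarrow> (real ^ 'n \<Rightarrow> real) set" where
  "sobolev_space \<Omega> m X =
     {u \<in> fspace (lebesgue_on \<Omega>) X.
        weakly_differentiable \<Omega> m u \<and>
        weak_gradient_length \<Omega> m u \<in> fspace (lebesgue_on \<Omega>) X}"

definition sobolev_norm ::
    "(real ^ 'n) set \<Rightarrow> nat \<Rightarrow> ((real ^ 'n \<Rightarrow> ennreal) \<Rightarrow> ennreal) \<Rightarrow>
     (real ^ 'n \<Rightarrow> real) \<Rightarrow> ennreal" where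
  "sobolev_norm \<Omega> m X u = fnorm X u + fnorm X (weak_gradient_length \<Omega> m u)"

definition radial_sobolev_space ::
    "(real ^ 'n) set \<Rightarrow> nat \<Rightarrow> ((real ^ 'n \<Rightarrow> ennreal) \<Rightarrow> ennreal) \<Rightarrow> (real ^ 'n \<Rightarrow> real) set" where
  "radial_sobolev_space \<Omega> m X =
     {u \<in> sobolev_space \<Omega> m X.
        \<exists>h::real \<Rightarrow> real. AE x in lebesgue_on \<Omega>. u x = h (norm x)}"


section \<open>The weighted target space\<close>

text \<open>
  The measure \<open>|x|\<^sup>\<alpha> dx\<close> on the ball. For \<open>\<alpha> = 0\<close> the convention \<open>0 powr 0 = 0\<close> only affects
  the null set \<open>{0}\<close>.
\<close>

definition weighted_ball :: "real \<Rightarrow> real \<Rightarrow> (real ^ 'n) measure" where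
  "weighted_ball \<alpha> R = density (lebesgue_on (ball 0 R)) (\<lambda>x. ennreal (norm x powr \<alpha>))"

text \<open>
  \<open>\<parallel>t\<^bsup>(m+\<alpha>)/n\<^esup> g\<^sup>*\<^sup>*(t\<^bsup>(n+\<alpha>)/n\<^esup>)\<parallel>\<close> in the associate space of the representation space of \<open>X\<close>.
\<close>

definition target_associate ::
    "nat \<Rightarrow> real \<Rightarrow> real \<Rightarrow> ((real ^ 'n \<Rightarrow> ennreal) \<Rightarrow> ennreal) \<Rightarrow> (real \<Rightarrow> ennreal) \<Rightarrow> ennreal" where
  "target_associate m \<alpha> R X g =
     associate_norm unit_interval (representation_norm (lebesgue_on (ball 0 R)) X)
       (\<lambda>t. ennreal (t powr ((real m + \<alpha>) / real CARD('n))) *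
            maximal_rearrangement unit_interval g
              (t powr ((real CARD('n) + \<alpha>) / real CARD('n))))"

text \<open>
  As above, the r.i. norm with a prescribed associate norm is unique on measurable functions, hence
  \<open>SOME\<close>.
\<close>

definition target_norm_01 ::
    "nat \<Rightarrow> real \<Rightarrow> real \<Rightarrow> ((real ^ 'n \<Rightarrow> ennreal) \<Rightarrow> ennreal) \<Rightarrow> (real \<Rightarrow> ennreal) \<Rightarrow> ennreal" where
  "target_norm_01 m \<alpha> R X =
     (SOME N. ri_function_norm unit_interval N \<and>
              (\<forall>g \<in> borel_measurable unit_interval.
                 associate_norm unit_interval N g = target_associate m \<alpha> R X g))"

definition target_norm ::
    "nat \<Rightarrow> real \<Rightarrow> real \<Rightarrow> ((real ^ 'n \<Rightarrow> ennreal) \<Rightarrow> ennreal) \<Rightarrow> (real ^ 'n \<Rightarrow> ennreal) \<Rightarrow> ennreal" where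
  "target_norm m \<alpha> R X = transported_norm (weighted_ball \<alpha> R) (target_norm_01 m \<alpha> R X)"

end

theory Submission
 imports Defs "HOL-Analysis.Analysis"
begin

text \<open>
 Write \<open>n\<close> for the dimension and \<open>p = n + \<alpha>\<close>. In polar coordinates the functional that defines the target
 norm is the norm of a linear operator: with \<open>\<theta>\<^sub>g(t) = t\<^bsup>m/n-1\<^esup> \<integral>\<^sub>0\<^bsup>t^(p/n)\<^esup> g\<^sup>*\<close> its value at \<open>g\<close> is the
 associate norm of \<open>\<theta>\<^sub>g\<close>, and for a radial \<open>F\<close> with rearranged profile \<open>f\<close> the integral of
 \<open>f \<theta>\<^sub>g\<close> is, up to a constant, the integral of \<open>g\<^sup>*(s) H(R s\<^bsup>1/p\<^esup>)\<close>, where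
 \<open>H(r) = \<integral>\<^sub>r\<^sup>R F(\<rho>) \<rho>\<^bsup>m-1\<^esup> d\<rho>\<close>. So the target norm is the least r.i. norm that controls the
 functions \<open>H(|x|)\<close> in the weighted measure by the norm of \<open>F\<close> in \<open>X\<close>, and the theorem says that
 radial Sobolev functions and the functions \<open>H(|x|)\<close> are equally large.

 The functional in \<open>g\<close> is an r.i. norm on the unit interval: subadditivity comes from that of
 \<open>\<integral>\<^sub>0\<^sup>s g\<^sup>*\<close> and the monotonicity of r.i. norms under it (Hardy--Littlewood--Polya). By
 Lorentz--Luxemburg duality it is then the associate norm of its own associate norm, which
 produces the target norm. Duality is obtained from the projection onto the unit ball in
 \<open>L\<^sup>2\<close> of a bounded function (\<open>projection_exists\<close>, \<open>lorentz_luxemburg\<close>).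

 Embedding. A radial \<open>u\<close> satisfies \<open>|u(x)| \<le> C (\<parallel>u\<parallel> + \<integral>\<^bsub>|y|>|x|\<^esub> |D\<^sup>m u(y)| |y|\<^bsup>m-n\<^esup> dy)\<close> almost
 everywhere (\<open>radial_pointwise_bound\<close>). Absolute continuity on rays is avoided:
 for a profile \<open>\<phi>\<close> with compact support in \<open>(0,R)\<close> the sums over all \<open>|I| = k\<close> of
 \<open>\<integral> \<partial>\<^sub>I u x\<^sub>I \<phi>(|x|) |x|\<^bsup>1-n-k\<^esup> dx\<close> for \<open>k+1\<close> and \<open>\<phi>\<close>, and for \<open>k\<close> and \<open>\<phi>'\<close>, are opposite numbers,
 because the fields \<open>x x\<^sub>I |x|\<^bsup>-n-k\<^esup>\<close> are divergence free. Iterating,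
 \<open>\<integral> u \<phi>(|x|) |x|\<^bsup>1-n\<^esup> dx\<close> is bounded by derivatives of order \<open>m\<close> against iterated primitives of \<open>\<phi>\<close>, and approximation of indicators by such \<open>\<phi>\<close> yields
 the bound. The tail integral is then estimated by duality and Fubini (\<open>tail_pairing\<close>).

 Optimality. For bounded \<open>F \<ge> 0\<close> supported away from the origin put
 \<open>u(x) = \<integral> F(\<rho>) \<rho>\<^bsup>m-1\<^esup> \<Psi>(|x|/\<rho>) d\<rho>\<close>, where \<open>\<Psi>\<close> is a smooth step from 1 down to 0. Then \<open>u\<close> is smooth,
 \<open>u(x) \<ge> H(2|x|)\<close>, and all derivatives of orders \<open>1, \<dots>, m\<close> are bounded by the average of \<open>F\<close> over
 \<open>[|x|, 2|x|]\<close>; this averaging is a contraction in every r.i. norm (\<open>norm_average_le\<close>). The dilation by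
 2 is harmless because \<open>g\<^sup>*\<close> decreases (\<open>prim_nrearr_scale\<close>). Hence any admissible \<open>Z\<close> has an
 associate norm that dominates the functional above (\<open>test_fun_pairing\<close>, \<open>optimal_target\<close>).
\<close>

section \<open>Rearrangements on finite measure spaces\<close>

lemma space_ui: "space unit_interval = {0<..<1}" by simp

lemma emeasure_ui: "A \<subseteq> {0<..<1} ==> emeasure unit_interval A = emeasure lebesgue A"
 by (simp add: emeasure_restrict_space)

lemma borel_imp_sets_ui: "A \<in> sets borel ==> A \<subseteq> {0<..<1} ==> A \<in> sets unit_interval"
 by (auto simp: sets_restrict_space image_iff intro!: bexI[of _ A])

lemma borel_measurable_ui: "f \<in> borel_measurable borel ==> f \<in> borel_measurable unit_interval"
 by (intro measurable_restrict_space1 measurable_completion) simp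

text \<open>
 Rearrangements are normalized to live on \<open>(0,1)\<close>, so that finite measure spaces of different
 total mass can be compared; \<open>nrearr M f\<close> is the function \<open>t \<mapsto> f\<^sup>*(\<mu>(S) t)\<close>.
\<close>

locale pos_finite_measure = finite_measure +
 assumes total_pos: "measure M (space M) > 0"

lemma (in pos_finite_measure) emeasure_space_eq:
 "emeasure M (space M) = ennreal (measure M (space M))"
 by (simp add: emeasure_eq_measure)

lemma pos_finite_measure_ui: "pos_finite_measure unit_interval"
proof -
 have "finite_measure unit_interval" by (intro finite_measure_lebesgue_on) simp
 then show ?thesis
  by (simp add: pos_finite_measure_def pos_finite_measure_axioms_def measure_restrict_space)
qed

interpretation ui: pos_finite_measure unit_interval by (rule pos_finite_measure_ui)

lemma measure_ui [simp]: "measure unit_interval {0<..<1} = 1"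
 by (simp add: measure_restrict_space)

lemma emeasure_ui_space [simp]: "emeasure unit_interval {0<..<1} = 1"
 by (simp add: emeasure_ui)

definition ndist :: "'a measure => ('a => ennreal) => ennreal => real" where
 "ndist M f l = measure M {x \<in> space M. l < f x} / measure M (space M)"

definition nrearr :: "'a measure => ('a => ennreal) => real => ennreal" where
 "nrearr M f t = rearrangement M f (measure M (space M) * t)"

definition mean :: "'a measure => ('a => ennreal) => ennreal" where
 "mean M f = (\<integral>\<^sup>+x. f x \<partial>M) / emeasure M (space M)"

text \<open>
 The primitive \<open>s \<mapsto> \<integral>\<^sub>0\<^sup>s a\<close>; with \<open>a = g\<^sup>*\<close> it is \<open>s g\<^sup>*\<^sup>*(s)\<close>.
\<close>

definition prim :: "(real => ennreal) => real => ennreal" where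
 "prim a s = (\<integral>\<^sup>+t. a t * indicator {0<..<s} t \<partial>unit_interval)"

lemma mean_ui: "mean unit_interval f = (\<integral>\<^sup>+x. f x \<partial>unit_interval)"
 by (simp add: mean_def divide_ennreal_def)

text \<open>
 By right-continuity of the distribution function in \<open>l\<close>. Everything about rearrangements follows
 from this Galois connection.
\<close>

lemma rearrangement_le_iff:
 assumes f[measurable]: "f \<in> borel_measurable M"
 shows "rearrangement M f t \<le> l \<longleftrightarrow> emeasure M {x \<in> space M. l < f x} \<le> ennreal t"
proof
 let ?S = "{l. l > 0 \<and> emeasure M {x \<in> space M. f x > l} \<le> ennreal t}"
 assume "rearrangement M f t \<le> l"
 then have le: "Inf ?S \<le> l" by (simp add: rearrangement_def)
 show "emeasure M {x \<in> space M. l < f x} \<le> ennreal t"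
 proof (cases "l = top")
  case False
  have step: "emeasure M {x \<in> space M. l + ennreal (1 / Suc n) < f x} \<le> ennreal t" for n
  proof -
   have "l < l + ennreal (1 / Suc n)" using False
    by (cases l) (auto simp flip: ennreal_plus simp: ennreal_less_iff)
   then have "Inf ?S < l + ennreal (1 / Suc n)" using le by (rule le_less_trans[rotated])
   then obtain l' where "l' \<in> ?S" "l' < l + ennreal (1 / Suc n)" by (auto simp: Inf_less_iff)
   then have "emeasure M {x \<in> space M. l + ennreal (1 / Suc n) < f x} \<le> emeasure M {x \<in> space M. l' < f x}"
    by (intro emeasure_mono) auto
   then show ?thesis using \<open>l' \<in> ?S\<close> by auto
  qed
  have tend: "(\<lambda>n. l + ennreal (1 / Suc n)) \<longlonglongrightarrow> l + ennreal 0"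
   by (intro tendsto_add tendsto_const tendsto_ennrealI) (use LIMSEQ_inverse_real_of_nat in \<open>simp add: inverse_eq_divide\<close>)
  have un: "{x \<in> space M. l < f x} = (\<Union>n. {x \<in> space M. l + ennreal (1 / Suc n) < f x})"
  proof (intro equalityI subsetI)
   fix x assume x: "x \<in> {x \<in> space M. l < f x}"
   then have "eventually (\<lambda>n. l + ennreal (1 / Suc n) < f x) sequentially"
    using order_tendstoD(2)[OF tend, of "f x"] by simp
   then obtain n where "l + ennreal (1 / Suc n) < f x" by (auto simp: eventually_sequentially)
   then show "x \<in> (\<Union>n. {x \<in> space M. l + ennreal (1 / Suc n) < f x})" using x by auto
  next
   fix x assume "x \<in> (\<Union>n. {x \<in> space M. l + ennreal (1 / Suc n) < f x})"
   then show "x \<in> {x \<in> space M. l < f x}"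
    by (auto intro: le_less_trans[rotated] simp: le_iff_add)
  qed
  have inc: "incseq (\<lambda>n. {x \<in> space M. l + ennreal (1 / Suc n) < f x})"
  proof (rule incseq_SucI, safe)
   fix n x assume "l + ennreal (1 / Suc n) < f x"
   moreover have "l + ennreal (1 / Suc (Suc n)) \<le> l + ennreal (1 / Suc n)"
    by (intro add_left_mono ennreal_leI) (simp add: field_simps)
   ultimately show "l + ennreal (1 / Suc (Suc n)) < f x" by (rule le_less_trans[rotated])
  qed
  have "emeasure M {x \<in> space M. l < f x} = (SUP n. emeasure M {x \<in> space M. l + ennreal (1 / Suc n) < f x})"
   unfolding un by (rule SUP_emeasure_incseq[symmetric]) (use inc in auto)
  also have "... \<le> ennreal t" using step by (intro SUP_least) auto
  finally show ?thesis .
 qed simp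
next
 let ?S = "{l. l > 0 \<and> emeasure M {x \<in> space M. f x > l} \<le> ennreal t}"
 assume le: "emeasure M {x \<in> space M. l < f x} \<le> ennreal t"
 show "rearrangement M f t \<le> l"
 proof (cases "l = 0")
  case True
  have "Inf ?S \<le> l'" if "l' > 0" for l'
  proof (rule Inf_lower)
   have "emeasure M {x \<in> space M. l' < f x} \<le> emeasure M {x \<in> space M. l < f x}"
    using True that by (intro emeasure_mono) (auto intro: le_less_trans[rotated])
   then show "l' \<in> ?S" using le that by auto
  qed
  then have "Inf ?S \<le> 0" by (rule dense_ge)
  then show ?thesis using True by (simp add: rearrangement_def)
 next
  case False
  then show ?thesis unfolding rearrangement_def by (intro Inf_lower) (use le in \<open>auto simp: zero_less_iff_neq_zero\<close>)
 qed
qed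

lemma (in pos_finite_measure) nrearr_gt_iff:
 assumes f: "f \<in> borel_measurable M" and t: "t \<ge> 0"
 shows "l < nrearr M f t \<longleftrightarrow> t < ndist M f l"
proof -
 have "l < nrearr M f t \<longleftrightarrow> ennreal (measure M (space M) * t) < emeasure M {x \<in> space M. l < f x}"
  unfolding nrearr_def using rearrangement_le_iff[OF f, of _ l] by (simp add: not_le[symmetric])
 also have "... \<longleftrightarrow> measure M (space M) * t < measure M {x \<in> space M. l < f x}"
  using t by (simp add: emeasure_eq_measure ennreal_less_iff)
 also have "... \<longleftrightarrow> t < ndist M f l"
  using total_pos by (simp add: ndist_def field_simps)
 finally show ?thesis .
qed

lemma (in pos_finite_measure) ndist_nonneg: "0 \<le> ndist M f l"
 by (simp add: ndist_def)

lemma (in pos_finite_measure) ndist_le_1: "ndist M f l \<le> 1"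
 using bounded_measure[of "{x \<in> space M. l < f x}"] total_pos by (simp add: ndist_def divide_le_eq_1)

lemma nrearr_antimono:
 assumes "s \<le> t" shows "nrearr M f t \<le> nrearr M f s"
 unfolding nrearr_def rearrangement_def
proof (rule Inf_superset_mono, safe)
 fix l assume "emeasure M {x \<in> space M. l < f x} \<le> ennreal (measure M (space M) * s)"
 also have "... \<le> ennreal (measure M (space M) * t)"
  using assms by (intro ennreal_leI mult_left_mono) auto
 finally show "emeasure M {x \<in> space M. l < f x} \<le> ennreal (measure M (space M) * t)" .
qed

lemma antimono_borel_measurable_ennreal:
 fixes g :: "real => ennreal"
 assumes g: "\<And>s t. s \<le> t ==> g t \<le> g s"
 shows "g \<in> borel_measurable borel"
proof (rule borel_measurableI_greater)
 fix y
 have "is_interval {x. y < g x}"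
  unfolding is_interval_1 by (auto intro: less_le_trans g)
 then have "{x. y < g x} \<in> sets borel" by (rule real_interval_borel_measurable)
 then show "{x \<in> space borel. y < g x} \<in> sets borel" by simp
qed

lemma nrearr_borel [measurable]: "nrearr M f \<in> borel_measurable borel"
 by (intro antimono_borel_measurable_ennreal nrearr_antimono)

lemma nrearr_measurable_ui [measurable]: "nrearr M f \<in> borel_measurable unit_interval"
 by (intro borel_measurable_ui nrearr_borel)

lemma measure_ui_Ioo:
 assumes "0 \<le> s" "s \<le> 1" shows "measure unit_interval {0<..<s} = s"
proof -
 have "{0<..<s} \<subseteq> {0<..<1}" using assms by auto
 then show ?thesis using assms by (simp add: measure_restrict_space)
qed

lemma emeasure_ui_Ioo:
 assumes "0 \<le> s" "s \<le> 1" shows "emeasure unit_interval {0<..<s} = ennreal s"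
 using measure_ui_Ioo[OF assms] by (simp add: ui.emeasure_eq_measure)

lemma (in pos_finite_measure) ndist_nrearr:
 assumes f: "f \<in> borel_measurable M"
 shows "ndist unit_interval (nrearr M f) l = ndist M f l"
proof -
 have "{t \<in> {0<..<1}. l < nrearr M f t} = {0<..<ndist M f l}"
  using nrearr_gt_iff[OF f] ndist_le_1[of f l] by auto
 then show ?thesis by (simp add: ndist_def[of unit_interval] measure_ui_Ioo ndist_nonneg ndist_le_1)
qed

lemma nrearr_cong_ndist:
 assumes "pos_finite_measure M" "pos_finite_measure M'"
  and f: "f \<in> borel_measurable M" and g: "g \<in> borel_measurable M'"
  and eq: "\<And>l. ndist M f l = ndist M' g l" and t: "t \<ge> 0"
 shows "nrearr M f t = nrearr M' g t"
 using pos_finite_measure.nrearr_gt_iff[OF assms(1) f t] pos_finite_measure.nrearr_gt_iff[OF assms(2) g t] eq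
 by (metis linorder_less_linear order_less_irrefl)

lemma (in pos_finite_measure) equimeasurable_iff_ndist:
 "equimeasurable M f g \<longleftrightarrow> (\<forall>l. ndist M f l = ndist M g l)"
 using total_pos by (simp add: equimeasurable_def ndist_def emeasure_eq_measure)

lemma (in pos_finite_measure) mean_eq_scale:
 "mean M f = (\<integral>\<^sup>+x. f x \<partial>scale_measure (ennreal (1 / measure M (space M))) M)" if [measurable]: "f \<in> borel_measurable M"
 using total_pos
 by (simp add: mean_def nn_integral_scale_measure emeasure_space_eq divide_ennreal_def inverse_ennreal mult.commute inverse_eq_divide)

text \<open>
 Distribution functions determine image measures, the rays \<open>(l, \<infinity>]\<close> being a generator stable under
 intersection.
\<close>

lemma mean_cong_ndist:
 assumes M: "pos_finite_measure M" and M': "pos_finite_measure M'"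
  and f [measurable]: "f \<in> borel_measurable M" and g [measurable]: "g \<in> borel_measurable M'"
  and eq: "\<And>l. ndist M f l = ndist M' g l" and \<Phi> [measurable]: "\<Phi> \<in> borel_measurable borel"
 shows "mean M (\<lambda>x. \<Phi> (f x)) = mean M' (\<lambda>x. \<Phi> (g x))"
proof -
 interpret M: pos_finite_measure M by fact
 interpret M': pos_finite_measure M' by fact
 let ?P = "distr (scale_measure (ennreal (1 / measure M (space M))) M) borel f"
 let ?Q = "distr (scale_measure (ennreal (1 / measure M' (space M'))) M') borel g"
 have P: "emeasure ?P A = ennreal (measure M (f -` A \<inter> space M) / measure M (space M))" if [measurable]: "A \<in> sets borel" for A
  using M.total_pos by (simp add: emeasure_distr M.emeasure_eq_measure ennreal_mult[symmetric] space_scale_measure)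
 have Q: "emeasure ?Q A = ennreal (measure M' (g -` A \<inter> space M') / measure M' (space M'))" if [measurable]: "A \<in> sets borel" for A
  using M'.total_pos by (simp add: emeasure_distr M'.emeasure_eq_measure ennreal_mult[symmetric] space_scale_measure)
 have "?P = ?Q"
 proof (rule measure_eqI_generator_eq[where E="insert UNIV (range greaterThan)" and \<Omega>=UNIV and A="\<lambda>_. UNIV"])
  show "Int_stable (insert UNIV (range (greaterThan :: ennreal => _)))"
  proof (rule Int_stableI)
   fix a b :: "ennreal set"
   assume "a \<in> insert UNIV (range greaterThan)" "b \<in> insert UNIV (range greaterThan)"
   moreover have "{x<..} \<inter> {y<..} = {max x y<..}" for x y :: ennreal by auto
   ultimately show "a \<inter> b \<in> insert UNIV (range greaterThan)" by auto
  qed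
  have s: "sets (borel :: ennreal measure) = sigma_sets UNIV (insert UNIV (range greaterThan))"
  proof -
   have "sigma_sets UNIV (insert UNIV (range (greaterThan :: ennreal => _))) = sigma_sets UNIV (range greaterThan)"
    by (intro sigma_sets_eqI) (auto intro: sigma_sets_top)
   then show ?thesis by (simp add: borel_Ioi)
  qed
  show "sets ?P = sigma_sets UNIV (insert UNIV (range greaterThan))" "sets ?Q = sigma_sets UNIV (insert UNIV (range greaterThan))"
   using s by auto
  fix X :: "ennreal set" assume "X \<in> insert UNIV (range greaterThan)"
  then consider "X = UNIV" | l where "X = {l<..}" by auto
  then show "emeasure ?P X = emeasure ?Q X"
  proof cases
   case 1 then show ?thesis using M.total_pos M'.total_pos by (simp add: P Q del: scale_scale_measure emeasure_scale_measure)
  next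
   case 2
   have "f -` {l<..} \<inter> space M = {x \<in> space M. l < f x}" "g -` {l<..} \<inter> space M' = {x \<in> space M'. l < g x}" by auto
   then show ?thesis using eq[of l] 2 P[of "{l<..}"] Q[of "{l<..}"] by (simp add: ndist_def)
  qed
 next
  show "emeasure ?P UNIV \<noteq> \<infinity>" using P[of UNIV] by simp
 qed auto
 then have "(\<integral>\<^sup>+y. \<Phi> y \<partial>?P) = (\<integral>\<^sup>+y. \<Phi> y \<partial>?Q)" by simp
 then show ?thesis
  by (simp add: M.mean_eq_scale M'.mean_eq_scale nn_integral_distr)
qed

lemma (in pos_finite_measure) mean_nrearr:
 assumes f: "f \<in> borel_measurable M" and \<Phi>: "\<Phi> \<in> borel_measurable borel"
 shows "(\<integral>\<^sup>+t. \<Phi> (nrearr M f t) \<partial>unit_interval) = mean M (\<lambda>x. \<Phi> (f x))"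
 using mean_cong_ndist[OF pos_finite_measure_ui pos_finite_measure_axioms nrearr_measurable_ui f ndist_nrearr[OF f] \<Phi>]
 by (simp add: mean_ui)

lemma sub_ennreal_measurable [measurable]: "(\<lambda>x. x - ennreal l) \<in> borel_measurable borel"
 by simp

lemma ennreal_le_add_diff: "a \<le> b + (a - b)" for a b :: ennreal
 using ennreal_minus_le_iff[of a b "a - b"] by simp

lemma diff_real_eq_0: "x \<le> ennreal k ==> x - ennreal k = 0" for x :: ennreal
 by (simp add: diff_eq_0_iff_ennreal le_less_trans[of x "ennreal k"])

lemma add_diff_eq_ennreal': "a \<le> b ==> a + (b - a) = b" for a b :: ennreal
 using diff_add_cancel_ennreal[of a b] by (simp add: add.commute)

lemma sets_ui_Ioo [measurable]: "s \<le> 1 ==> {0<..<s} \<in> sets unit_interval"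
 by (intro borel_imp_sets_ui) auto

lemma indicator_Ioo_measurable_ui [measurable]: "indicator {0<..<s} \<in> borel_measurable unit_interval"
 by (intro borel_measurable_ui) measurable

lemma prim_const:
 assumes "0 \<le> s" "s \<le> 1" shows "prim (\<lambda>_. c) s = c * ennreal s"
 using assms unfolding prim_def
 by (subst nn_integral_cmult_indicator) (simp_all add: emeasure_ui_Ioo)

text \<open>
 This and the next lemma compute \<open>\<integral>\<^sub>0\<^sup>s f\<^sup>* = min\<^sub>l (l s + \<integral> (f - l)\<^sup>+)\<close>, the K-functional of \<open>(L\<^sup>1, L\<^sup>\<infinity>)\<close>. It turns
 comparisons of truncated means into comparisons of \<open>\<integral>\<^sub>0\<^sup>s f\<^sup>*\<close>, and gives subadditivity.
\<close>

lemma (in pos_finite_measure) prim_nrearr_le: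
 assumes f: "f \<in> borel_measurable M" and s: "0 \<le> s" "s \<le> 1"
 shows "prim (nrearr M f) s \<le> ennreal l * ennreal s + mean M (\<lambda>x. f x - ennreal l)"
proof -
 have "prim (nrearr M f) s \<le> (\<integral>\<^sup>+t. ennreal l * indicator {0<..<s} t + (nrearr M f t - ennreal l) \<partial>unit_interval)"
  unfolding prim_def
  by (intro nn_integral_mono) (auto simp: indicator_def ennreal_le_add_diff)
 also have "... = prim (\<lambda>_. ennreal l) s + (\<integral>\<^sup>+t. nrearr M f t - ennreal l \<partial>unit_interval)"
  unfolding prim_def by (subst nn_integral_add) auto
 also have "... = ennreal l * ennreal s + mean M (\<lambda>x. f x - ennreal l)"
  using mean_nrearr[OF f, of "\<lambda>x. x - ennreal l"] by (simp add: prim_const[OF s])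
 finally show ?thesis .
qed

lemma (in pos_finite_measure) prim_nrearr_attained:
 assumes f: "f \<in> borel_measurable M" and s: "0 < s" "s \<le> 1" and fin: "prim (nrearr M f) s \<noteq> top"
 obtains l where "l \<ge> 0" "prim (nrearr M f) s = ennreal l * ennreal s + mean M (\<lambda>x. f x - ennreal l)"
proof (cases "s = 1")
 case True
 have "prim (nrearr M f) s = (\<integral>\<^sup>+t. nrearr M f t \<partial>unit_interval)"
  unfolding prim_def by (intro nn_integral_cong) (auto simp: True)
 then show ?thesis using that[of 0] mean_nrearr[OF f, of "\<lambda>x. x"] by simp
next
 case False
 have "nrearr M f s \<noteq> top"
 proof
  assume t: "nrearr M f s = top"
  have "prim (\<lambda>_. top) s \<le> prim (nrearr M f) s" unfolding prim_def
   using nrearr_antimono[of _ s M f] t by (intro nn_integral_mono) (auto simp: indicator_def top_unique)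
  then show False using fin s by (simp add: prim_const ennreal_top_mult top_unique)
 qed
 then obtain l where l: "l \<ge> 0" "nrearr M f s = ennreal l" by (cases "nrearr M f s") auto
 have "prim (nrearr M f) s = (\<integral>\<^sup>+t. ennreal l * indicator {0<..<s} t + (nrearr M f t - ennreal l) \<partial>unit_interval)"
  unfolding prim_def
 proof (intro nn_integral_cong)
  fix t
  show "nrearr M f t * indicator {0<..<s} t = ennreal l * indicator {0<..<s} t + (nrearr M f t - ennreal l)"
   if "t \<in> space unit_interval"
   using that nrearr_antimono[of t s M f] nrearr_antimono[of s t M f] l(2)
   by (auto simp: indicator_def add_diff_eq_ennreal' diff_real_eq_0)
 qed
 also have "... = prim (\<lambda>_. ennreal l) s + (\<integral>\<^sup>+t. nrearr M f t - ennreal l \<partial>unit_interval)"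
  unfolding prim_def by (subst nn_integral_add) auto
 also have "... = ennreal l * ennreal s + mean M (\<lambda>x. f x - ennreal l)"
  using mean_nrearr[OF f, of "\<lambda>x. x - ennreal l"] s by (simp add: prim_const)
 finally show ?thesis using that l(1) by blast
qed

lemma prim_nrearr_mono_mean:
 assumes M: "pos_finite_measure M" and M': "pos_finite_measure M'"
  and f: "f \<in> borel_measurable M" and g: "g \<in> borel_measurable M'" and s: "0 < s" "s \<le> 1"
  and le: "\<And>l. l \<ge> 0 ==> mean M (\<lambda>x. f x - ennreal l) \<le> mean M' (\<lambda>x. g x - ennreal l)"
 shows "prim (nrearr M f) s \<le> prim (nrearr M' g) s"
proof (cases "prim (nrearr M' g) s = top")
 case False
 then obtain l where l: "l \<ge> 0" "prim (nrearr M' g) s = ennreal l * ennreal s + mean M' (\<lambda>x. g x - ennreal l)"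
  using pos_finite_measure.prim_nrearr_attained[OF M' g s] by metis
 have "prim (nrearr M f) s \<le> ennreal l * ennreal s + mean M (\<lambda>x. f x - ennreal l)"
  using pos_finite_measure.prim_nrearr_le[OF M f] s by simp
 also have "... \<le> prim (nrearr M' g) s" unfolding l(2) by (intro add_left_mono le l)
 finally show ?thesis .
qed simp

lemma mean_add: "f \<in> borel_measurable M ==> g \<in> borel_measurable M ==> mean M (\<lambda>x. f x + g x) = mean M f + mean M g"
 by (simp add: mean_def nn_integral_add divide_ennreal_def distrib_right)

lemma mean_mono: "(\<And>x. x \<in> space M ==> f x \<le> g x) ==> mean M f \<le> mean M g"
 by (simp add: mean_def divide_ennreal_def mult_right_mono nn_integral_mono)

lemma ennreal_add_diff_le: "f + g - (a + b) \<le> (f - a) + (g - b)" for f g a b :: ennreal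
proof -
 have "f + g \<le> (a + (f - a)) + (b + (g - b))" by (intro add_mono ennreal_le_add_diff)
 then have "f + g \<le> (a + b) + ((f - a) + (g - b))" by (simp add: ac_simps)
 then show ?thesis by (cases "a + b = top") (auto simp: ennreal_minus_le_iff)
qed

lemma (in pos_finite_measure) prim_nrearr_add_le:
 assumes [measurable]: "f \<in> borel_measurable M" "g \<in> borel_measurable M" and s: "0 < s" "s \<le> 1"
 shows "prim (nrearr M (\<lambda>x. f x + g x)) s \<le> prim (nrearr M f) s + prim (nrearr M g) s"
proof (cases "prim (nrearr M f) s = top \<or> prim (nrearr M g) s = top")
 case False
 obtain a where a: "a \<ge> 0" "prim (nrearr M f) s = ennreal a * ennreal s + mean M (\<lambda>x. f x - ennreal a)"
  using prim_nrearr_attained[OF assms(1) s] False by metis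
 obtain b where b: "b \<ge> 0" "prim (nrearr M g) s = ennreal b * ennreal s + mean M (\<lambda>x. g x - ennreal b)"
  using prim_nrearr_attained[OF assms(2) s] False by metis
 have "prim (nrearr M (\<lambda>x. f x + g x)) s \<le> ennreal (a + b) * ennreal s + mean M (\<lambda>x. f x + g x - ennreal (a + b))"
  using s by (intro prim_nrearr_le) auto
 also have "mean M (\<lambda>x. f x + g x - ennreal (a + b)) \<le> mean M (\<lambda>x. (f x - ennreal a) + (g x - ennreal b))"
  using a b by (intro mean_mono) (simp add: ennreal_add_diff_le)
 also have "... = mean M (\<lambda>x. f x - ennreal a) + mean M (\<lambda>x. g x - ennreal b)"
  by (intro mean_add) auto
 finally show ?thesis using a b by (simp add: distrib_right distrib_left ac_simps)
qed auto

lemma (in pos_finite_measure) mean_indicator_le_prim: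
 assumes f[measurable]: "f \<in> borel_measurable M" and E[measurable]: "E \<in> sets M"
 shows "mean M (\<lambda>x. f x * indicator E x) \<le> prim (nrearr M f) (measure M E / measure M (space M))"
proof -
 let ?s = "measure M E / measure M (space M)"
 have s1: "0 \<le> ?s" "?s \<le> 1" using bounded_measure[of E] total_pos by (auto simp: divide_le_eq_1)
 show ?thesis
 proof (cases "?s = 0 \<or> prim (nrearr M f) ?s = top")
  case True
  moreover have "mean M (\<lambda>x. f x * indicator E x) = 0" if "?s = 0"
  proof -
   have "E \<in> null_sets M" using that total_pos by (auto simp: null_sets_def emeasure_eq_measure)
   then have "(\<integral>\<^sup>+x. f x * indicator E x \<partial>M) = 0" by (rule nn_integral_null_set)
   then show ?thesis by (simp add: mean_def)
  qed
  ultimately show ?thesis by auto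
 next
  case False
  then obtain l where l: "l \<ge> 0" "prim (nrearr M f) ?s = ennreal l * ennreal ?s + mean M (\<lambda>x. f x - ennreal l)"
   using prim_nrearr_attained[OF f, of ?s] s1 by (metis less_eq_real_def)
  have "mean M (\<lambda>x. f x * indicator E x) \<le> mean M (\<lambda>x. ennreal l * indicator E x + (f x - ennreal l))"
   by (intro mean_mono) (auto simp: indicator_def ennreal_le_add_diff)
  also have "... = mean M (\<lambda>x. ennreal l * indicator E x) + mean M (\<lambda>x. f x - ennreal l)"
   by (intro mean_add) auto
  also have "mean M (\<lambda>x. ennreal l * indicator E x) = ennreal l * ennreal ?s"
   using total_pos by (simp add: mean_def nn_integral_cmult_indicator emeasure_eq_measure divide_ennreal[symmetric]
     divide_ennreal_def mult.assoc)
  finally show ?thesis using l by simp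
 qed
qed

lemma ennreal_top_eqI: "(\<And>n::nat. of_nat n \<le> x) ==> x = top" for x :: ennreal
 using SUP_least[of UNIV "of_nat :: nat => ennreal" x] by (simp add: ennreal_SUP_of_nat_eq_top top_unique)

lemma ennreal_mult_divide_cancel: "c \<noteq> 0 ==> c \<noteq> top ==> c * (x / c) = x" for c x :: ennreal
 by (simp add: ennreal_times_divide mult.commute[of c] mult_divide_eq_ennreal)

lemma emeasure_below_ennreal: "emeasure lborel {l::real. 0 \<le> l \<and> ennreal l < y} = y"
proof (cases y)
 case (real r)
 then have "{l::real. 0 \<le> l \<and> ennreal l < y} = {0..<r}" by (auto simp: ennreal_less_iff)
 then show ?thesis using real by simp
next
 case top
 then have "{l::real. 0 \<le> l \<and> ennreal l < y} = {0..}" by auto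
 moreover have "ennreal (real n) \<le> emeasure lborel {0::real..}" for n
  using emeasure_mono[of "{0..real n}" "{0..}" lborel] by simp
 then have "emeasure lborel {0::real..} = top"
  by (intro ennreal_top_eqI) (auto simp: ennreal_of_nat_eq_real_of_nat)
 ultimately show ?thesis using top by simp
qed

text \<open>
 Writing \<open>\<phi>\<close> as a superposition of indicators of superlevel sets reduces inequalities
 for \<open>\<integral> a \<phi>\<close> to inequalities for integrals of \<open>a\<close> over those sets.
\<close>

lemma nn_integral_layer_cake:
 assumes "sigma_finite_measure M" and [measurable]: "a \<in> borel_measurable M" "\<phi> \<in> borel_measurable M"
 shows "(\<integral>\<^sup>+x. a x * \<phi> x \<partial>M) =
  (\<integral>\<^sup>+l. (\<integral>\<^sup>+x. a x * indicator {x. ennreal l < \<phi> x} x \<partial>M) * indicator {0..} l \<partial>lborel)"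
proof -
 interpret sigma_finite_measure M by fact
 interpret pair_sigma_finite M lborel ..
 have "(\<integral>\<^sup>+x. a x * \<phi> x \<partial>M) = (\<integral>\<^sup>+x. (\<integral>\<^sup>+l. a x * indicator {(l, x). 0 \<le> l \<and> ennreal l < \<phi> x} (l, x) \<partial>lborel) \<partial>M)"
 proof (rule nn_integral_cong)
  fix x
  have "(\<integral>\<^sup>+l. a x * indicator {(l, x). 0 \<le> l \<and> ennreal l < \<phi> x} (l, x) \<partial>lborel)
    = (\<integral>\<^sup>+l. a x * indicator {l::real. 0 \<le> l \<and> ennreal l < \<phi> x} l \<partial>lborel)"
   by (intro nn_integral_cong) (simp add: indicator_def)
  also have "... = a x * \<phi> x" by (subst nn_integral_cmult_indicator) (auto simp: emeasure_below_ennreal)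
  finally show "a x * \<phi> x = (\<integral>\<^sup>+l. a x * indicator {(l, x). 0 \<le> l \<and> ennreal l < \<phi> x} (l, x) \<partial>lborel)" by simp
 qed
 also have "... = (\<integral>\<^sup>+l. (\<integral>\<^sup>+x. a x * indicator {(l, x). 0 \<le> l \<and> ennreal l < \<phi> x} (l, x) \<partial>M) \<partial>lborel)"
  by (rule Fubini'[symmetric]) measurable
 also have "... = (\<integral>\<^sup>+l. (\<integral>\<^sup>+x. a x * indicator {x. ennreal l < \<phi> x} x \<partial>M) * indicator {0..} l \<partial>lborel)"
  by (intro nn_integral_cong) (auto simp: indicator_def intro!: nn_integral_cong)
 finally show ?thesis .
qed

lemma nn_integral_mult_mono_levels:
 assumes "sigma_finite_measure M" "a \<in> borel_measurable M" "\<phi> \<in> borel_measurable M"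
  and "sigma_finite_measure M'" "b \<in> borel_measurable M'" "\<psi> \<in> borel_measurable M'"
  and le: "\<And>l. l \<ge> 0 ==> (\<integral>\<^sup>+x. a x * indicator {x. ennreal l < \<phi> x} x \<partial>M) \<le> (\<integral>\<^sup>+x. b x * indicator {x. ennreal l < \<psi> x} x \<partial>M')"
 shows "(\<integral>\<^sup>+x. a x * \<phi> x \<partial>M) \<le> (\<integral>\<^sup>+x. b x * \<psi> x \<partial>M')"
 unfolding nn_integral_layer_cake[OF assms(1-3)] nn_integral_layer_cake[OF assms(4-6)]
proof (rule nn_integral_mono)
 fix l :: real
 show "(\<integral>\<^sup>+x. a x * indicator {x. ennreal l < \<phi> x} x \<partial>M) * indicator {0..} l
  \<le> (\<integral>\<^sup>+x. b x * indicator {x. ennreal l < \<psi> x} x \<partial>M') * indicator {0..} l"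
  using le[of l] by (cases "l \<ge> 0") simp_all
qed

text \<open>
 Superlevel sets of a decreasing function are initial intervals up to a null set.
\<close>

lemma ui_downset:
 assumes D: "D \<subseteq> {0<..<1::real}" and down: "\<And>s t. s \<in> D ==> 0 < t ==> t \<le> s ==> t \<in> D"
 obtains s where "0 \<le> s" "s \<le> 1" "AE t in unit_interval. t \<in> D \<longleftrightarrow> t \<in> {0<..<s}"
proof (cases "D = {}")
 case True
 then show ?thesis using that[of 0] by auto
next
 case False
 have bdd: "bdd_above D" using D by (meson bdd_above_Ioo bdd_above_mono)
 have s: "0 \<le> Sup D" "Sup D \<le> 1"
 proof -
  obtain x where "x \<in> D" using False by auto
  then show "0 \<le> Sup D" using D cSup_upper[OF _ bdd, of x] by force
  show "Sup D \<le> 1" using False D by (intro cSup_least) (auto intro: less_imp_le dest!: subsetD)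
 qed
 have *: "t \<in> D \<longleftrightarrow> t \<in> {0<..<Sup D}" if t: "t \<in> {0<..<1}" "t \<noteq> Sup D" for t
  using t cSup_upper[OF _ bdd, of t] less_cSup_iff[OF False bdd, of t] down[of _ t]
  by (auto intro: less_imp_le)
 have "AE t in lebesgue. t \<noteq> Sup D"
  by (intro AE_completion AE_lborel_singleton)
 then have "AE t in unit_interval. t \<noteq> Sup D"
  by (simp add: AE_restrict_space_iff) (elim eventually_mono, simp)
 then have "AE t in unit_interval. t \<in> D \<longleftrightarrow> t \<in> {0<..<Sup D}"
  using AE_space by eventually_elim (use * in auto)
 then show ?thesis using that s by blast
qed

text \<open>
 Hardy's lemma. Against a decreasing function only primitives matter, because its superlevel sets are
 initial intervals.
\<close>

lemma hardy_prim_mono: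
 assumes a: "a \<in> borel_measurable unit_interval" and b: "b \<in> borel_measurable unit_interval"
  and \<phi>: "\<phi> \<in> borel_measurable unit_interval"
  and anti: "\<And>s t. 0 < s ==> s \<le> t ==> t < 1 ==> \<phi> t \<le> \<phi> s"
  and le: "\<And>s. 0 < s ==> s \<le> 1 ==> prim a s \<le> prim b s"
 shows "(\<integral>\<^sup>+t. a t * \<phi> t \<partial>unit_interval) \<le> (\<integral>\<^sup>+t. b t * \<phi> t \<partial>unit_interval)"
proof (rule nn_integral_mult_mono_levels[OF _ a \<phi> _ b \<phi>])
 fix l :: real
 obtain s where s: "0 \<le> s" "s \<le> 1" "AE t in unit_interval. t \<in> {t \<in> {0<..<1}. ennreal l < \<phi> t} \<longleftrightarrow> t \<in> {0<..<s}"
 proof (rule ui_downset)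
  fix s t assume "s \<in> {t \<in> {0<..<1}. ennreal l < \<phi> t}" "0 < t" "t \<le> s"
  then show "t \<in> {t \<in> {0<..<1}. ennreal l < \<phi> t}" using anti[of t s] by (auto intro: less_le_trans)
 qed auto
 have *: "(\<integral>\<^sup>+x. h x * indicator {x. ennreal l < \<phi> x} x \<partial>unit_interval) = prim h s" for h
 proof -
  have "AE t in unit_interval. h t * indicator {x. ennreal l < \<phi> x} t = h t * indicator {0<..<s} t"
   using s(3) AE_space by eventually_elim (auto simp: indicator_def)
  then show ?thesis unfolding prim_def by (rule nn_integral_cong_AE)
 qed
 show "(\<integral>\<^sup>+x. a x * indicator {x. ennreal l < \<phi> x} x \<partial>unit_interval) \<le> (\<integral>\<^sup>+x. b x * indicator {x. ennreal l < \<phi> x} x \<partial>unit_interval)"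
  unfolding * using s le[of s] by (cases "s = 0") (auto simp: prim_def)
qed (auto intro: ui.sigma_finite_measure_axioms)

lemma (in pos_finite_measure) nrearr_gt_set:
 assumes "f \<in> borel_measurable M"
 shows "{t \<in> {0<..<1}. l < nrearr M f t} = {0<..<ndist M f l}"
 using nrearr_gt_iff[OF assms, of _ l] ndist_le_1[of f l] by auto

lemma (in pos_finite_measure) hardy_littlewood:
 assumes f[measurable]: "f \<in> borel_measurable M" and g[measurable]: "g \<in> borel_measurable M"
 shows "mean M (\<lambda>x. f x * g x) \<le> (\<integral>\<^sup>+t. nrearr M f t * nrearr M g t \<partial>unit_interval)"
proof -
 let ?c = "emeasure M (space M)"
 have c: "?c \<noteq> 0" "?c \<noteq> top" using total_pos by (auto simp: emeasure_space_eq)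
 have "(\<integral>\<^sup>+x. f x * g x \<partial>M) \<le> (\<integral>\<^sup>+t. (?c * nrearr M f t) * nrearr M g t \<partial>unit_interval)"
 proof (rule nn_integral_mult_mono_levels)
  fix l :: real
  have m: "measure M {x \<in> space M. ennreal l < g x} / measure M (space M) = ndist M g l" by (simp add: ndist_def)
  have "(\<integral>\<^sup>+x. f x * indicator {x. ennreal l < g x} x \<partial>M) = ?c * mean M (\<lambda>x. f x * indicator {x \<in> space M. ennreal l < g x} x)"
   unfolding mean_def using c
   by (subst ennreal_mult_divide_cancel) (auto intro!: nn_integral_cong simp: indicator_def)
  also have "... \<le> ?c * prim (nrearr M f) (ndist M g l)"
   unfolding m[symmetric] by (intro mult_left_mono mean_indicator_le_prim) auto
  also have "... = ?c * (\<integral>\<^sup>+t. nrearr M f t * indicator {x. ennreal l < nrearr M g x} t \<partial>unit_interval)"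
   unfolding prim_def nrearr_gt_set[OF g, symmetric]
   by (intro arg_cong2[where f="(*)"] refl nn_integral_cong) (auto simp: indicator_def)
  also have "... = (\<integral>\<^sup>+t. ?c * nrearr M f t * indicator {x. ennreal l < nrearr M g x} t \<partial>unit_interval)"
   by (subst nn_integral_cmult[symmetric]) (auto simp: mult.assoc)
  finally show "(\<integral>\<^sup>+x. f x * indicator {x. ennreal l < g x} x \<partial>M) \<le> ..." .
 qed (auto intro: ui.sigma_finite_measure_axioms sigma_finite_measure_axioms)
 also have "... = ?c * (\<integral>\<^sup>+t. nrearr M f t * nrearr M g t \<partial>unit_interval)"
  by (subst nn_integral_cmult[symmetric]) (auto simp: mult.assoc)
 finally have "mean M (\<lambda>x. f x * g x) \<le> ?c * (\<integral>\<^sup>+t. nrearr M f t * nrearr M g t \<partial>unit_interval) / ?c"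
  unfolding mean_def by (rule divide_right_mono_ennreal)
 then show ?thesis using c by (simp add: mult.commute[of ?c] mult_divide_eq_ennreal)
qed

text \<open>
 Nonatomicity of the interval: the measure of \<open>A \<union> B \<inter> (0,z)\<close> is continuous in \<open>z\<close>.
\<close>

lemma ui_measure_IVT:
 assumes [measurable]: "A \<in> sets unit_interval" "B \<in> sets unit_interval" and AB: "A \<subseteq> B"
  and q: "measure unit_interval A \<le> q" "q \<le> measure unit_interval B"
 obtains z where "measure unit_interval (A \<union> B \<inter> {0<..<z}) = q"
proof -
 have Bs: "B \<subseteq> {0<..<1}" using sets.sets_into_space[OF assms(2)] by simp
 have m[measurable]: "A \<union> B \<inter> {0<..<z} \<in> sets unit_interval" for z
 proof -
  have "A \<union> B \<inter> {0<..<z} = A \<union> B \<inter> {0<..<min z 1}" using Bs by auto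
  then show ?thesis by simp
 qed
 define h where "h z = measure unit_interval (A \<union> B \<inter> {0<..<z})" for z
 have lip: "h y \<le> h x + (y - x) \<and> h x \<le> h y" if "0 \<le> x" "x \<le> y" "y \<le> 1" for x y
 proof
  have [measurable]: "{x..<y} \<inter> {0<..<1} \<in> sets unit_interval"
   by (intro borel_imp_sets_ui) auto
  have "h y \<le> measure unit_interval ((A \<union> B \<inter> {0<..<x}) \<union> {x..<y} \<inter> {0<..<1})"
   unfolding h_def using Bs by (intro ui.finite_measure_mono) auto
  also have "... \<le> h x + measure unit_interval ({x..<y} \<inter> {0<..<1})"
   unfolding h_def by (intro measure_Un_le) auto
  also have "measure unit_interval ({x..<y} \<inter> {0<..<1}) \<le> measure lebesgue {x..<y}"
   by (simp add: measure_restrict_space) (intro measure_mono_fmeasurable fmeasurableI, use that in auto)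
  finally show "h y \<le> h x + (y - x)" using that by simp
  show "h x \<le> h y" unfolding h_def using that by (intro ui.finite_measure_mono) auto
 qed
 have "1-lipschitz_on {0..1} h"
 proof (rule lipschitz_onI)
  fix x y :: real assume "x \<in> {0..1}" "y \<in> {0..1}"
  then show "dist (h x) (h y) \<le> 1 * dist x y"
   using lip[of x y] lip[of y x] by (cases "x \<le> y") (auto simp: dist_real_def)
 qed simp
 then have "continuous_on {0..1} h" by (rule lipschitz_on_continuous_on)
 moreover have "h 0 \<le> q" using q by (simp add: h_def)
 moreover have "q \<le> h 1"
 proof -
  have "A \<union> B \<inter> {0<..<1} = B" using AB Bs by auto
  then show ?thesis using q by (simp add: h_def)
 qed
 ultimately obtain z where "h z = q" using IVT'[of h 0 q 1] by auto
 then show ?thesis using that by (simp add: h_def)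
qed

text \<open>
 A set of prescribed measure \<open>q\<close> on which \<open>g\<close> takes its largest values; a level set of positive
 measure is cut by an initial interval.
\<close>

lemma top_part_exists:
 assumes g[measurable]: "g \<in> borel_measurable unit_interval" and q: "0 < q" "q < 1"
 defines "l \<equiv> nrearr unit_interval g q"
 obtains z where "measure unit_interval ({x \<in> {0<..<1}. l < g x} \<union> {x \<in> {0<..<1}. l \<le> g x} \<inter> {0<..<z}) = q"
proof (rule ui_measure_IVT)
 have [measurable]: "{x \<in> {0<..<1}. l < g x} \<in> sets unit_interval" "{x \<in> {0<..<1}. l \<le> g x} \<in> sets unit_interval"
  using measurable_sets[OF g, of "{l<..}"] measurable_sets[OF g, of "{l..}"]
  by (simp_all add: vimage_def Int_def conj_commute)
 then show "{x \<in> {0<..<1}. l < g x} \<in> sets unit_interval" "{x \<in> {0<..<1}. l \<le> g x} \<in> sets unit_interval" by auto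
 have S: "{x \<in> {0<..<1}. k < g x} \<in> sets unit_interval" for k
  using measurable_sets[OF g, of "{k<..}"] by (simp add: vimage_def Int_def conj_commute)
 have m: "measure unit_interval {x \<in> {0<..<1}. k < g x} = ndist unit_interval g k" for k by (simp add: ndist_def)
 show "measure unit_interval {x \<in> {0<..<1}. l < g x} \<le> q"
  unfolding m using ui.nrearr_gt_iff[OF g, of q l] q by (simp add: l_def)
 show "q \<le> measure unit_interval {x \<in> {0<..<1}. l \<le> g x}"
 proof (cases "l = 0")
  case True
  then have "{x \<in> {0<..<1}. l \<le> g x} = {0<..<1}" by auto
  then show ?thesis using q by simp
 next
  case False
  then have "0 < l" by (simp add: zero_less_iff_neq_zero)
  from approx_from_below_dense_linorder[OF this] obtain u where u: "\<And>n. u n < l" "u \<longlonglongrightarrow> l" by auto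
  define v where "v n = Max (u ` {..n})" for n
  have v: "v n < l" "u n \<le> v n" for n
  proof -
   show "v n < l" unfolding v_def by (subst Max_less_iff) (use u(1) in auto)
   show "u n \<le> v n" unfolding v_def by (rule Max_ge) auto
  qed
  have dec: "decseq (\<lambda>n. {x \<in> {0<..<1}. v n < g x})"
  proof (rule decseq_SucI, safe)
   fix n x assume "v (Suc n) < g x"
   moreover have "v n \<le> v (Suc n)" unfolding v_def by (intro Max_mono) auto
   ultimately show "v n < g x" by (rule le_less_trans[rotated])
  qed
  have "(\<Inter>n. {x \<in> {0<..<1}. v n < g x}) = {x \<in> {0<..<1}. l \<le> g x}"
  proof (intro equalityI subsetI)
   fix x assume x: "x \<in> (\<Inter>n. {x \<in> {0<..<1}. v n < g x})"
   have "u n \<le> g x" for n using x by (intro order_trans[OF v(2) less_imp_le]) auto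
   then have "l \<le> g x" using u(2) by (intro LIMSEQ_le_const2[of u l]) auto
   then show "x \<in> {x \<in> {0<..<1}. l \<le> g x}" using x by auto
  next
   fix x assume x: "x \<in> {x \<in> {0<..<1}. l \<le> g x}"
   have "v n < g x" for n by (rule less_le_trans[OF v(1)]) (use x in auto)
   then show "x \<in> (\<Inter>n. {x \<in> {0<..<1}. v n < g x})" using x by auto
  qed
  moreover have "range (\<lambda>n. {x \<in> {0<..<1}. v n < g x}) \<subseteq> sets unit_interval" by (rule image_subsetI) (rule S)
  ultimately have "(\<lambda>n. measure unit_interval {x \<in> {0<..<1}. v n < g x}) \<longlonglongrightarrow> measure unit_interval {x \<in> {0<..<1}. l \<le> g x}"
   using ui.finite_Lim_measure_decseq[OF _ dec] by metis
  moreover have "q \<le> measure unit_interval {x \<in> {0<..<1}. v n < g x}" for n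
   unfolding m using ui.nrearr_gt_iff[OF g, of q "v n"] v q by (simp add: l_def)
  ultimately show ?thesis by (intro LIMSEQ_le_const) auto
 qed
 show "{x \<in> {0<..<1}. l < g x} \<subseteq> {x \<in> {0<..<1}. l \<le> g x}" by auto
qed (rule that)

lemma nrearr_ui_restrict: "nrearr unit_interval g t = rearrangement unit_interval g t"
 by (simp add: nrearr_def)

text \<open>
 The Hardy--Littlewood inequality is attained: the top parts of \<open>g\<close> are nested sets \<open>S\<^sub>q\<close> of
 measure \<open>q\<close>, and \<open>\<sigma>(x) = inf {q. x \<in> S\<^sub>q}\<close> preserves measure, so \<open>f' = f\<^sup>* \<circ> \<sigma>\<close> is a rearrangement of \<open>f\<close>
 that is ordered like \<open>g\<close>.
\<close>

lemma ryff_transport: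
 assumes f[measurable]: "f \<in> borel_measurable unit_interval" and g[measurable]: "g \<in> borel_measurable unit_interval"
 obtains f' where "f' \<in> borel_measurable unit_interval" "equimeasurable unit_interval f f'"
  "(\<integral>\<^sup>+t. nrearr unit_interval f t * nrearr unit_interval g t \<partial>unit_interval) \<le> (\<integral>\<^sup>+t. f' t * g t \<partial>unit_interval)"
proof -
 let ?u = unit_interval
 define l where "l q = nrearr ?u g q" for q
 have lanti: "q \<le> q' ==> l q' \<le> l q" for q q' by (simp add: l_def nrearr_antimono)
 have "\<forall>q\<in>{0<..<1}. \<exists>z. measure ?u ({x \<in> {0<..<1}. l q < g x} \<union> {x \<in> {0<..<1}. l q \<le> g x} \<inter> {0<..<z}) = q"
 proof
  fix q :: real assume "q \<in> {0<..<1}"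
  then have q: "0 < q" "q < 1" by auto
  from top_part_exists[OF g q] show "\<exists>z. measure ?u ({x \<in> {0<..<1}. l q < g x} \<union> {x \<in> {0<..<1}. l q \<le> g x} \<inter> {0<..<z}) = q"
   unfolding l_def by blast
 qed
 from bchoice[OF this] obtain z where z: "\<And>q. q \<in> {0<..<1} ==>
  measure ?u ({x \<in> {0<..<1}. l q < g x} \<union> {x \<in> {0<..<1}. l q \<le> g x} \<inter> {0<..<z q}) = q" by blast
 define S where "S q = {x \<in> {0<..<1}. l q < g x} \<union> {x \<in> {0<..<1}. l q \<le> g x} \<inter> {0<..<z q}" for q
 have lev: "{x \<in> {0<..<1}. k < g x} \<in> sets ?u" "{x \<in> {0<..<1}. k \<le> g x} \<in> sets ?u" for k
  using measurable_sets[OF g, of "{k<..}"] measurable_sets[OF g, of "{k..}"]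
  by (simp_all add: vimage_def Int_def conj_commute)
 have Sm[measurable]: "S q \<in> sets ?u" for q
 proof -
  have "S q = {x \<in> {0<..<1}. l q < g x} \<union> {x \<in> {0<..<1}. l q \<le> g x} \<inter> {0<..<min (z q) 1}" by (auto simp: S_def)
  then show ?thesis using lev by (auto intro!: sets.Un sets.Int sets_ui_Ioo)
 qed
 have S01: "S q \<subseteq> {0<..<1}" for q by (auto simp: S_def)
 have Sq: "measure ?u (S q) = q" if "q \<in> {0<..<1}" for q using z[OF that] by (simp add: S_def)
 have Smono: "S q \<subseteq> S q'" if q: "q \<in> {0<..<1}" "q' \<in> {0<..<1}" "q < q'" for q q'
 proof (cases "l q = l q'")
  case True
  show ?thesis
  proof (cases "z q \<le> z q'")
   case le: True then show ?thesis using True by (auto simp: S_def)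
  next
   case False
   then have "S q' \<subseteq> S q" using True by (auto simp: S_def)
   then have "measure ?u (S q') \<le> measure ?u (S q)" by (intro ui.finite_measure_mono) auto
   then show ?thesis using q by (simp add: Sq)
  qed
 next
  case False
  then have "l q' < l q" using lanti[of q q'] q by auto
  then have "l q' < g x" if "l q \<le> g x" for x using that by (rule less_le_trans)
  then show ?thesis using \<open>l q' < l q\<close> by (auto simp: S_def)
 qed
 define \<sigma> where "\<sigma> x = Inf (insert 1 {q \<in> {0<..<1}. x \<in> S q})" for x
 have bdd: "bdd_below (insert 1 {q \<in> {0<..<1}. x \<in> S q})" for x by (auto intro!: bdd_belowI[of _ 0])
 have \<sigma>0: "0 \<le> \<sigma> x" for x unfolding \<sigma>_def by (intro cInf_greatest) auto
 define r where "r t n = t - t / (real n + 2)" for t n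
 have r: "r t n \<in> {0<..<1}" "r t n < t" if "0 < t" "t \<le> 1" for t n
 proof -
  have "0 < t / (real n + 2)" "t / (real n + 2) < t" using that by (auto simp: divide_less_eq)
  then show "r t n \<in> {0<..<1}" "r t n < t" using that unfolding r_def greaterThanLessThan_iff by linarith+
 qed
 have rinc: "r t n < r t m" if "0 < t" "t \<le> 1" "n < m" for t n m
  using that by (simp add: r_def frac_less2)
 have rlim: "r t \<longlonglongrightarrow> t" for t
 proof -
  have "(\<lambda>n. t - t / (real n + 2)) \<longlonglongrightarrow> t - 0"
  proof (intro tendsto_diff tendsto_const real_tendsto_divide_at_top[where c=t])
   show "filterlim (\<lambda>n. real n + 2) at_top sequentially"
    using filterlim_tendsto_add_at_top[OF tendsto_const filterlim_real_sequentially, of 2] by (simp add: add.commute)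
  qed
  then show ?thesis by (simp add: r_def[abs_def])
 qed
 have lt: "{x \<in> {0<..<1}. \<sigma> x < t} = (\<Union>n. S (r t n))" if t: "0 < t" "t \<le> 1" for t
 proof (intro equalityI subsetI)
  fix x assume x: "x \<in> {x \<in> {0<..<1}. \<sigma> x < t}"
  then have "Inf (insert 1 {q \<in> {0<..<1}. x \<in> S q}) < t" by (simp add: \<sigma>_def)
  then obtain q where "q \<in> insert 1 {q \<in> {0<..<1}. x \<in> S q}" "q < t"
   using cInf_less_iff[OF _ bdd, of x t] by blast
  then have q: "q \<in> {0<..<1}" "x \<in> S q" "q < t" using t by auto
  obtain n where "q < r t n" using order_tendstoD(1)[OF rlim \<open>q < t\<close>] by (auto simp: eventually_sequentially)
  then have "x \<in> S (r t n)" using Smono[OF q(1) r(1)[OF t]] q by auto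
  then show "x \<in> (\<Union>n. S (r t n))" by auto
 next
  fix x assume "x \<in> (\<Union>n. S (r t n))"
  then obtain n where n: "x \<in> S (r t n)" by auto
  have "\<sigma> x \<le> r t n" unfolding \<sigma>_def using n r(1)[OF t] by (intro cInf_lower bdd) auto
  then show "x \<in> {x \<in> {0<..<1}. \<sigma> x < t}" using r(2)[OF t, of n] n S01[of "r t n"] by auto
 qed
 have inc: "incseq (\<lambda>n. S (r t n))" if t: "0 < t" "t \<le> 1" for t
  by (rule incseq_SucI, rule Smono) (use r[OF t] rinc[OF t] in auto)
 have ltm: "{x \<in> {0<..<1}. \<sigma> x < t} \<in> sets ?u" and ltq: "measure ?u {x \<in> {0<..<1}. \<sigma> x < t} = t" if t: "0 \<le> t" "t \<le> 1" for t
 proof -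
  consider "t = 0" | "0 < t" using t by linarith
  then have "{x \<in> {0<..<1}. \<sigma> x < t} \<in> sets ?u \<and> measure ?u {x \<in> {0<..<1}. \<sigma> x < t} = t"
  proof cases
   case 1
   then have "{x \<in> {0<..<1}. \<sigma> x < t} = {}" using \<sigma>0 by (auto simp: not_less)
   then show ?thesis using 1 by (simp del: Collect_empty_eq)
  next
   case 2
   have "(\<lambda>n. measure ?u (S (r t n))) \<longlonglongrightarrow> measure ?u (\<Union>n. S (r t n))"
    using inc[OF 2 t(2)] by (intro ui.finite_Lim_measure_incseq) auto
   moreover have "(\<lambda>n. measure ?u (S (r t n))) = r t" using r(1)[OF 2 t(2)] Sq by auto
   ultimately show ?thesis unfolding lt[OF 2 t(2)] using LIMSEQ_unique rlim by auto
  qed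
  then show "{x \<in> {0<..<1}. \<sigma> x < t} \<in> sets ?u" "measure ?u {x \<in> {0<..<1}. \<sigma> x < t} = t" by auto
 qed
 define f' where "f' x = nrearr ?u f (\<sigma> x)" for x
 have f'gt: "{x \<in> {0<..<1}. k < f' x} = {x \<in> {0<..<1}. \<sigma> x < ndist ?u f k}" for k
  unfolding f'_def using ui.nrearr_gt_iff[OF f \<sigma>0] by auto
 have f'm[measurable]: "f' \<in> borel_measurable ?u"
  by (rule borel_measurableI_greater) (simp only: space_ui f'gt ltm ui.ndist_nonneg ui.ndist_le_1)
 have "equimeasurable ?u f f'"
  unfolding ui.equimeasurable_iff_ndist
  by (simp only: ndist_def[of _ f'] space_ui f'gt ltq ui.ndist_nonneg ui.ndist_le_1 measure_ui div_by_1 simp_thms)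
 have part: "prim (nrearr ?u g) q \<le> (\<integral>\<^sup>+t. g t * indicator (S q) t \<partial>?u)" if q: "q \<in> {0<..<1}" for q
 proof (cases "l q")
  case (real k)
  have "prim (nrearr ?u g) q \<le> ennreal k * ennreal q + mean ?u (\<lambda>x. g x - ennreal k)"
   using q by (intro ui.prim_nrearr_le) auto
  also have "... = (\<integral>\<^sup>+t. ennreal k * indicator (S q) t \<partial>?u) + (\<integral>\<^sup>+t. g t - ennreal k \<partial>?u)"
   using Sq[OF q] by (subst nn_integral_cmult_indicator) (auto simp: mean_ui ui.emeasure_eq_measure)
  also have "... = (\<integral>\<^sup>+t. ennreal k * indicator (S q) t + (g t - ennreal k) \<partial>?u)"
   by (intro nn_integral_add[symmetric]) auto
  also have "... = (\<integral>\<^sup>+t. g t * indicator (S q) t \<partial>?u)"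
   by (intro nn_integral_cong) (auto simp: indicator_def S_def real add_diff_eq_ennreal' not_less diff_real_eq_0 intro: less_imp_le)
  finally show ?thesis .
 next
  case top
  have "(\<integral>\<^sup>+t. g t * indicator (S q) t \<partial>?u) = (\<integral>\<^sup>+t. top * indicator (S q) t \<partial>?u)"
   by (intro nn_integral_cong) (auto simp: indicator_def S_def top top_unique)
  also have "... = top" using Sq[OF q] q
   by (subst nn_integral_cmult_indicator) (auto simp: ui.emeasure_eq_measure ennreal_top_mult)
  finally show ?thesis by simp
 qed
 have part': "prim (nrearr ?u g) t \<le> (\<integral>\<^sup>+x. g x * indicator {x \<in> {0<..<1}. \<sigma> x < t} x \<partial>?u)" if t: "0 \<le> t" "t \<le> 1" for t
 proof (cases "t = 0")
  case False
  then have t: "0 < t" "t \<le> 1" using t by auto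
  have un: "{0<..<t} = (\<Union>n. {0<..<r t n})"
  proof (intro equalityI subsetI)
   fix x assume "x \<in> {0<..<t}"
   then obtain n where "x < r t n" using order_tendstoD(1)[OF rlim, of x t] by (auto simp: eventually_sequentially)
   then show "x \<in> (\<Union>n. {0<..<r t n})" using \<open>x \<in> _\<close> by auto
  next
   fix x assume "x \<in> (\<Union>n. {0<..<r t n})"
   then obtain n where "0 < x" "x < r t n" by auto
   then show "x \<in> {0<..<t}" using r(2)[OF t, of n] by simp
  qed
  have em: "prim (nrearr ?u g) s = emeasure (density ?u (nrearr ?u g)) {0<..<s}" if "s \<le> 1" for s
   using that unfolding prim_def by (subst emeasure_density) auto
  have rt1: "r t n \<le> 1" for n using r(2)[OF t, of n] t by simp
  have "incseq (\<lambda>n. {0<..<r t n})"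
  proof (rule incseq_SucI)
   show "{0<..<r t n} \<subseteq> {0<..<r t (Suc n)}" for n using rinc[OF t, of n "Suc n"] by auto
  qed
  then have "(SUP n. emeasure (density ?u (nrearr ?u g)) {0<..<r t n}) = emeasure (density ?u (nrearr ?u g)) {0<..<t}"
   unfolding un using rt1 by (intro SUP_emeasure_incseq) auto
  then have "prim (nrearr ?u g) t = (SUP n. prim (nrearr ?u g) (r t n))"
   using rt1 t by (simp add: em)
  also have "... \<le> (\<integral>\<^sup>+x. g x * indicator {x \<in> {0<..<1}. \<sigma> x < t} x \<partial>?u)"
  proof (rule SUP_least)
   fix n
   have "prim (nrearr ?u g) (r t n) \<le> (\<integral>\<^sup>+x. g x * indicator (S (r t n)) x \<partial>?u)" by (intro part r t)
   also have "... \<le> (\<integral>\<^sup>+x. g x * indicator {x \<in> {0<..<1}. \<sigma> x < t} x \<partial>?u)"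
    unfolding lt[OF t] by (intro nn_integral_mono mult_left_mono) (auto simp: indicator_def)
   finally show "prim (nrearr ?u g) (r t n) \<le> (\<integral>\<^sup>+x. g x * indicator {x \<in> {0<..<1}. \<sigma> x < t} x \<partial>?u)" .
  qed
  finally show ?thesis .
 qed (simp add: prim_def)
 have "(\<integral>\<^sup>+t. nrearr ?u g t * nrearr ?u f t \<partial>?u) \<le> (\<integral>\<^sup>+t. g t * f' t \<partial>?u)"
 proof (rule nn_integral_mult_mono_levels)
  fix k :: real
  have "(\<integral>\<^sup>+x. nrearr ?u g x * indicator {x. ennreal k < nrearr ?u f x} x \<partial>?u) = prim (nrearr ?u g) (ndist ?u f k)"
   unfolding prim_def ui.nrearr_gt_set[OF f, symmetric] by (intro nn_integral_cong) (auto simp: indicator_def)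
  also have "... \<le> (\<integral>\<^sup>+x. g x * indicator {x \<in> {0<..<1}. \<sigma> x < ndist ?u f k} x \<partial>?u)"
   by (intro part' ui.ndist_nonneg ui.ndist_le_1)
  also have "... = (\<integral>\<^sup>+x. g x * indicator {x. ennreal k < f' x} x \<partial>?u)"
   unfolding f'gt[symmetric] by (intro nn_integral_cong) (auto simp: indicator_def)
  finally show "(\<integral>\<^sup>+x. nrearr ?u g x * indicator {x. ennreal k < nrearr ?u f x} x \<partial>?u) \<le> ..." .
 qed (use f'm f g in \<open>simp_all add: ui.sigma_finite_measure_axioms\<close>)
 then show ?thesis using that[OF f'm \<open>equimeasurable ?u f f'\<close>] by (simp add: mult.commute)
qed

section \<open>Associate norms and Hoelder inequality\<close>

lemma associate_norm_upper:
 "f \<in> borel_measurable M ==> N f \<le> 1 ==> (\<integral>\<^sup>+x. f x * g x \<partial>M) \<le> associate_norm M N g"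
 unfolding associate_norm_def by (rule SUP_upper) simp

lemma associate_norm_least:
 "(\<And>f. f \<in> borel_measurable M ==> N f \<le> 1 ==> (\<integral>\<^sup>+x. f x * g x \<partial>M) \<le> C) ==> associate_norm M N g \<le> C"
 unfolding associate_norm_def by (rule SUP_least) simp

lemma associate_norm_cmult:
 assumes [measurable]: "g \<in> borel_measurable M"
 shows "associate_norm M N (\<lambda>x. ennreal c * g x) = ennreal c * associate_norm M N g"
proof -
 have "(\<integral>\<^sup>+x. f x * (ennreal c * g x) \<partial>M) = ennreal c * (\<integral>\<^sup>+x. f x * g x \<partial>M)" if [measurable]: "f \<in> borel_measurable M" for f
  by (subst nn_integral_cmult[symmetric]) (auto simp: ac_simps)
 then show ?thesis unfolding associate_norm_def
  by (subst SUP_mult_left_ennreal) (auto intro!: SUP_cong)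
qed

lemma associate_norm_mono:
 assumes "AE x in M. g x \<le> h x"
 shows "associate_norm M N g \<le> associate_norm M N h"
 unfolding associate_norm_def
proof (rule SUP_mono)
 fix f assume "f \<in> {f \<in> borel_measurable M. N f \<le> 1}"
 moreover have "(\<integral>\<^sup>+x. f x * g x \<partial>M) \<le> (\<integral>\<^sup>+x. f x * h x \<partial>M)"
  by (rule nn_integral_mono_AE) (use assms in eventually_elim, simp add: mult_left_mono)
 ultimately show "\<exists>k\<in>{f \<in> borel_measurable M. N f \<le> 1}. (\<integral>\<^sup>+x. f x * g x \<partial>M) \<le> (\<integral>\<^sup>+x. k x * h x \<partial>M)"
  by blast
qed

context ri_function_norm begin

lemma norm_cong_AE:
 assumes "f \<in> borel_measurable M" "g \<in> borel_measurable M" "AE x in M. f x = g x"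
 shows "N f = N g"
 by (intro antisym lattice assms) (use assms(3) in \<open>auto elim: eventually_mono\<close>)

lemma norm_mono:
 assumes "f \<in> borel_measurable M" "g \<in> borel_measurable M" "\<And>x. x \<in> space M ==> f x \<le> g x"
 shows "N f \<le> N g"
 by (intro lattice assms AE_I2)

lemma norm_zero [simp]: "N (\<lambda>_. 0) = 0"
 using zero_iff[of "\<lambda>_. 0"] by simp

text \<open>
 Scaling reduces to \<open>N f \<le> 1\<close>. If \<open>N f = \<infinity>\<close> and \<open>N' g = 0\<close>, testing with a constant shows \<open>g = 0\<close>.
\<close>

lemma hoelder:
 assumes fin: "emeasure M (space M) < \<infinity>" and f[measurable]: "f \<in> borel_measurable M" and g[measurable]: "g \<in> borel_measurable M"
 shows "(\<integral>\<^sup>+x. f x * g x \<partial>M) \<le> N f * associate_norm M N g"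
proof -
 have scaled: "(\<integral>\<^sup>+x. h x * g x \<partial>M) \<le> ennreal r * associate_norm M N g"
  if [measurable]: "h \<in> borel_measurable M" and r: "N h = ennreal r" "r > 0" for h r
 proof -
  have "N (\<lambda>x. ennreal (1 / r) * h x) = ennreal (1/r) * ennreal r"
   using r by (subst homogeneous) auto
  also have "... = 1" using r by (simp add: ennreal_mult[symmetric])
  finally have "(\<integral>\<^sup>+x. (ennreal (1 / r) * h x) * g x \<partial>M) \<le> associate_norm M N g"
   by (intro associate_norm_upper) auto
  then have "ennreal r * (\<integral>\<^sup>+x. (ennreal (1 / r) * h x) * g x \<partial>M) \<le> ennreal r * associate_norm M N g"
   by (rule mult_left_mono) simp
  also have "ennreal r * (\<integral>\<^sup>+x. (ennreal (1 / r) * h x) * g x \<partial>M) = (\<integral>\<^sup>+x. h x * g x \<partial>M)"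
   using r by (subst nn_integral_cmult[symmetric]) (auto simp: mult.assoc[symmetric] ennreal_mult[symmetric])
  finally show ?thesis .
 qed
 consider "N f = 0" | "N f = top" | r where "r > 0" "N f = ennreal r"
  by (cases "N f") (auto simp: less_le)
 then show ?thesis
 proof cases
  case 1
  then have "AE x in M. f x * g x = 0" using zero_iff[OF f] by (auto elim: eventually_mono)
  then have "(\<integral>\<^sup>+x. f x * g x \<partial>M) = 0" by (subst nn_integral_0_iff_AE) auto
  then show ?thesis by simp
 next
  case 2
  show ?thesis
  proof (cases "associate_norm M N g = 0")
   case True
   have "N (indicator (space M)) < \<infinity>" using fin by (intro finite_indicator) auto
   then consider "N (indicator (space M)) = 0" | r where "r > 0" "N (indicator (space M)) = ennreal r"
    by (cases "N (indicator (space M))") (auto simp: less_le)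
   then have "AE x in M. g x = 0"
   proof cases
    case 1
    then have "AE x in M. (indicator (space M) x :: ennreal) = 0" using zero_iff[of "indicator (space M)"] by auto
    with AE_space show ?thesis by eventually_elim simp
   next
    case (2 r)
    have "(\<integral>\<^sup>+x. indicator (space M) x * g x \<partial>M) \<le> 0" using scaled[OF _ 2(2,1)] True by simp
    then have "AE x in M. indicator (space M) x * g x = 0" by (subst (asm) le_zero_eq, subst (asm) nn_integral_0_iff_AE) auto
    with AE_space show ?thesis by eventually_elim simp
   qed
   then have "AE x in M. f x * g x = 0" by (auto elim: eventually_mono)
   then have "(\<integral>\<^sup>+x. f x * g x \<partial>M) = 0" by (subst nn_integral_0_iff_AE) auto
   then show ?thesis by simp
  qed (simp add: 2 ennreal_top_mult)
 qed (use scaled[OF f] in simp)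
qed

end

section \<open>Lorentz--Luxemburg duality\<close>

locale ri_norm_finite = ri_function_norm + finite_measure M
begin

text \<open>
 Restricting the unit ball to bounded functions puts it inside \<open>L\<^sup>2\<close>, where the geometry is available.
\<close>

definition bounded_ball :: "('a => real) set" where
 "bounded_ball = {h \<in> borel_measurable M. (\<forall>x. 0 \<le> h x) \<and> (\<exists>c. \<forall>x. h x \<le> c) \<and> N (\<lambda>x. ennreal (h x)) \<le> 1}"

lemma bounded_ball_convex:
 assumes h: "h \<in> bounded_ball" and k: "k \<in> bounded_ball" and s: "0 \<le> s" "s \<le> 1"
 shows "(\<lambda>x. (1 - s) * h x + s * k x) \<in> bounded_ball"
proof -
 have [measurable]: "h \<in> borel_measurable M" "k \<in> borel_measurable M" using h k by (auto simp: bounded_ball_def)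
 obtain c d where cd: "\<And>x. h x \<le> c" "\<And>x. k x \<le> d" using h k by (auto simp: bounded_ball_def)
 have nn: "0 \<le> h x" "0 \<le> k x" for x using h k by (auto simp: bounded_ball_def)
 have "N (\<lambda>x. ennreal ((1 - s) * h x + s * k x)) = N (\<lambda>x. ennreal (1-s) * ennreal (h x) + ennreal s * ennreal (k x))"
  using s nn by (simp add: ennreal_mult' ennreal_plus)
 also have "... \<le> N (\<lambda>x. ennreal (1-s) * ennreal (h x)) + N (\<lambda>x. ennreal s * ennreal (k x))"
  by (rule triangle) auto
 also have "... = ennreal (1-s) * N (\<lambda>x. ennreal (h x)) + ennreal s * N (\<lambda>x. ennreal (k x))"
  using s by (simp add: homogeneous)
 also have "... \<le> ennreal (1-s) * 1 + ennreal s * 1"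
  using h k by (intro add_mono mult_left_mono) (auto simp: bounded_ball_def)
 also have "... = 1" using s by (simp flip: ennreal_plus)
 finally have *: "N (\<lambda>x. ennreal ((1 - s) * h x + s * k x)) \<le> 1" .
 have "(1 - s) * h x + s * k x \<le> (1 - s) * c + s * d" for x
  using s cd by (intro add_mono mult_left_mono) auto
 moreover have "0 \<le> (1 - s) * h x + s * k x" for x using s nn by auto
 ultimately show ?thesis using * unfolding bounded_ball_def by auto
qed

lemma bounded_ball_mono:
 assumes h: "h \<in> bounded_ball" and k: "k \<in> borel_measurable M" "\<And>x. 0 \<le> k x" "\<And>x. k x \<le> h x"
 shows "k \<in> bounded_ball"
proof -
 obtain c where c: "\<And>x. h x \<le> c" using h by (auto simp: bounded_ball_def)
 have "N (\<lambda>x. ennreal (k x)) \<le> N (\<lambda>x. ennreal (h x))"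
  using h k by (intro norm_mono) (auto simp: bounded_ball_def intro!: ennreal_leI)
 also have "... \<le> 1" using h by (auto simp: bounded_ball_def)
 finally show ?thesis using k order_trans[OF k(3) c] by (auto simp: bounded_ball_def)
qed

lemma norm_Fatou:
 assumes h[measurable]: "\<And>n::nat. h n \<in> borel_measurable M" and le: "\<And>n. N (h n) \<le> C"
  and lim: "AE x in M. (\<lambda>n. h n x) \<longlonglongrightarrow> k x" and k[measurable]: "k \<in> borel_measurable M"
 shows "N k \<le> C"
proof -
 define F where "F n x = (INF m\<in>{n..}. h m x)" for n x
 have [measurable]: "F n \<in> borel_measurable M" for n unfolding F_def by measurable
 have "AE x in M. incseq (\<lambda>n. F n x) \<and> (\<lambda>n. F n x) \<longlonglongrightarrow> k x"
  using lim
 proof eventually_elim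
  case (elim x)
  have inc: "incseq (\<lambda>n. F n x)" unfolding F_def incseq_def by (auto intro!: INF_superset_mono)
  have "(\<lambda>n. F n x) \<longlonglongrightarrow> (SUP n. F n x)" by (rule LIMSEQ_SUP[OF inc])
  also have "(SUP n. F n x) = liminf (\<lambda>n. h n x)" by (simp add: F_def liminf_SUP_INF)
  also have "... = k x" using elim by (rule lim_imp_Liminf[rotated]) simp
  finally show ?case using inc by simp
 qed
 then have "(\<lambda>n. N (F n)) \<longlonglongrightarrow> N k" using fatou[of F k] by auto
 moreover have "N (F n) \<le> C" for n
 proof -
  have "N (F n) \<le> N (h n)" by (intro norm_mono) (auto simp: F_def intro: INF_lower)
  then show ?thesis using le[of n] by simp
 qed
 ultimately show ?thesis by (intro LIMSEQ_le_const2) auto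
qed

lemma bounded_integrable: "f \<in> borel_measurable M ==> (\<And>x. \<bar>f x\<bar> \<le> c) ==> integrable M f" for f :: "'a => real"
 by (rule integrable_const_bound[of _ c]) auto

text \<open>
 A minimizing sequence with excess \<open>4\<^sup>-\<^sup>n\<close> has consecutive \<open>L\<^sup>2\<close> distances of order \<open>2\<^sup>-\<^sup>n\<close> by the
 parallelogram law. It therefore converges almost everywhere, and the Fatou property keeps the
 limit in the unit ball.
\<close>

lemma projection_exists:
 assumes f[measurable]: "f \<in> borel_measurable M" and f0: "\<And>x. 0 \<le> f x" and fc: "\<And>x. f x \<le> c"
 obtains h where "h \<in> bounded_ball" "\<And>k. k \<in> bounded_ball ==> (LINT x|M. (f x - h x)\<^sup>2) \<le> (LINT x|M. (f x - k x)\<^sup>2)"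
proof -
 define D where "D h = (LINT x|M. (f x - h x)\<^sup>2)" for h
 define B where "B = {h \<in> bounded_ball. \<forall>x. h x \<le> c}"
 have c0: "0 \<le> c" using f0 fc order_trans by blast
 have zero: "(\<lambda>_. 0) \<in> B" using c0 by (auto simp: B_def bounded_ball_def)
 have Bm: "h \<in> borel_measurable M" if "h \<in> B" for h using that by (auto simp: B_def bounded_ball_def)
 have B0: "0 \<le> h x" "h x \<le> c" if "h \<in> B" for h x using that by (simp_all add: B_def bounded_ball_def)
 have sq: "(a - b)\<^sup>2 \<le> c\<^sup>2" if "0 \<le> a" "a \<le> c" "0 \<le> b" "b \<le> c" for a b :: real
  using that by (intro abs_le_square_iff[THEN iffD1]) auto
 have int: "integrable M (\<lambda>x. (a x - b x)\<^sup>2)" if [measurable]: "a \<in> borel_measurable M" "b \<in> borel_measurable M" and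
   "\<And>x. 0 \<le> a x" "\<And>x. a x \<le> c" "\<And>x. 0 \<le> b x" "\<And>x. b x \<le> c" for a b
 proof (rule bounded_integrable[of _ "c\<^sup>2"])
  show "\<bar>(a x - b x)\<^sup>2\<bar> \<le> c\<^sup>2" for x using sq[OF that(3,4,5,6), of x x] by simp
 qed (use that in simp)
 define d where "d = Inf (D ` B)"
 have bdd: "bdd_below (D ` B)" by (intro bdd_belowI[of _ 0]) (auto simp: D_def)
 have dle: "d \<le> D h" if "h \<in> B" for h unfolding d_def using that bdd by (intro cInf_lower) auto
 have "\<exists>h\<in>B. D h < d + (1/4)^n" for n :: nat
 proof -
  have "Inf (D ` B) < d + (1/4)^n" by (simp add: d_def)
  then obtain y where "y \<in> D ` B" "y < d + (1/4)^n" using cInf_lessD[of "D ` B"] zero by blast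
  then show ?thesis by blast
 qed
 then have "\<forall>n. \<exists>h. h \<in> B \<and> D h < d + (1/4)^n" by blast
 from choice[OF this] obtain h where h: "\<And>n. h n \<in> B" "\<And>n. D (h n) < d + (1/4)^n" by blast
 have [measurable]: "h n \<in> borel_measurable M" for n by (rule Bm[OF h(1)])
 have hb: "0 \<le> h n x" "h n x \<le> c" for n x using B0[OF h(1)] by simp_all
 have ih: "integrable M (\<lambda>x. (f x - h n x)\<^sup>2)" for n by (intro int f0 fc hb) auto
 have ih2: "integrable M (\<lambda>x. (h n x - h m x)\<^sup>2)" for n m by (intro int f0 fc hb) auto
 have cauchy: "(LINT x|M. (h n x - h (Suc n) x)\<^sup>2) \<le> 4 * (1/4)^n" for n
 proof -
  let ?g = "\<lambda>x. (1 - 1/2) * h n x + 1/2 * h (Suc n) x"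
  have "?g \<in> bounded_ball" using h by (intro bounded_ball_convex) (auto simp: B_def)
  moreover have gb: "0 \<le> ?g x" "?g x \<le> c" for x using hb[of n x] hb[of "Suc n" x] by auto
  ultimately have "?g \<in> B" by (auto simp: B_def)
  have ig: "integrable M (\<lambda>x. (f x - ?g x)\<^sup>2)" by (intro int f0 fc gb) auto
  have "(LINT x|M. (h n x - h (Suc n) x)\<^sup>2) =
   (LINT x|M. 2 * (f x - h n x)\<^sup>2 + 2 * (f x - h (Suc n) x)\<^sup>2 - 4 * (f x - ?g x)\<^sup>2)"
   by (intro Bochner_Integration.integral_cong refl) (simp add: power2_eq_square field_simps)
  also have "... = 2 * D (h n) + 2 * D (h (Suc n)) - 4 * D ?g"
   unfolding D_def using ih[of n] ih[of "Suc n"] ig by simp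
  also have "... \<le> 2 * (d + (1/4)^n) + 2 * (d + (1/4)^Suc n) - 4 * d"
  proof -
   have lin: "2 * a + 2 * b - 4 * e \<le> 2 * (d + u) + 2 * (d + v) - 4 * d" if "a < d + u" "b < d + v" "d \<le> e" for a b e u v :: real
    using that by (auto simp: algebra_simps)
   show ?thesis by (rule lin[OF h(2) h(2) dle[OF \<open>?g \<in> B\<close>]])
  qed
  also have "... \<le> 4 * (1/4)^n" by simp
  finally show ?thesis .
 qed
 have abs_int: "integrable M (\<lambda>x. \<bar>h n x - h (Suc n) x\<bar>)" for n
 proof (rule bounded_integrable[of _ c])
  show "\<bar>\<bar>h n x - h (Suc n) x\<bar>\<bar> \<le> c" for x using hb[of n x] hb[of "Suc n" x] by linarith
 qed simp
 have l1: "(LINT x|M. \<bar>h n x - h (Suc n) x\<bar>) \<le> (2 + measure M (space M)) * (1/2)^n" for n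
 proof -
  have "\<bar>y\<bar> \<le> (2^n * y\<^sup>2 + (1/2)^n) / 2" for y :: real
  proof -
   have "0 \<le> (2^n * \<bar>y\<bar> - 1)\<^sup>2" by simp
   also have "(2^n * \<bar>y\<bar> - 1)\<^sup>2 = 2^n * (2^n * y\<^sup>2 - 2 * \<bar>y\<bar> + (1/2)^n)"
   proof -
    have "(t * \<bar>y\<bar> - 1)\<^sup>2 = t * (t * y\<^sup>2 - 2 * \<bar>y\<bar> + 1 / t)" if "t \<noteq> 0" for t :: real
     using that abs_mult_self_eq[of y] by (simp add: power2_eq_square algebra_simps)
    from this[of "2^n"] show ?thesis by (simp add: power_one_over)
   qed
   finally have "0 \<le> 2^n * y\<^sup>2 - 2 * \<bar>y\<bar> + (1/2)^n"
    using mult_le_cancel_left_pos[of "2^n" 0 "2^n * y\<^sup>2 - 2 * \<bar>y\<bar> + (1/2)^n"] by simp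
   then show ?thesis by simp
  qed
  then have "(LINT x|M. \<bar>h n x - h (Suc n) x\<bar>) \<le> (LINT x|M. (2^n * (h n x - h (Suc n) x)\<^sup>2 + (1/2)^n) / 2)"
   using abs_int ih2 by (intro integral_mono) auto
  also have "... = (2^n * (LINT x|M. (h n x - h (Suc n) x)\<^sup>2) + (1/2)^n * measure M (space M)) / 2"
   using ih2 by (simp add: mult.commute)
  also have "... \<le> (2^n * (4 * (1/4)^n) + (1/2)^n * measure M (space M)) / 2"
   using cauchy[of n] by (intro divide_right_mono add_right_mono mult_left_mono) auto
  also have "... = (2 + measure M (space M) / 2) * (1/2)^n"
   by (simp add: field_simps power_mult_distrib[symmetric] flip: power_mult)
  also have "... \<le> (2 + measure M (space M)) * (1/2)^n" by (intro mult_right_mono) auto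
  finally show ?thesis .
 qed
 have "AE x in M. summable (\<lambda>n. \<bar>h n x - h (Suc n) x\<bar>)"
 proof -
  have "(\<integral>\<^sup>+x. (\<Sum>n. ennreal \<bar>h n x - h (Suc n) x\<bar>) \<partial>M) = (\<Sum>n. \<integral>\<^sup>+x. ennreal \<bar>h n x - h (Suc n) x\<bar> \<partial>M)"
   by (intro nn_integral_suminf) auto
  also have "... = (\<Sum>n. ennreal (LINT x|M. \<bar>h n x - h (Suc n) x\<bar>))"
   by (intro suminf_cong nn_integral_eq_integral abs_int) auto
  also have "... \<le> (\<Sum>n. ennreal ((2 + measure M (space M)) * (1/2)^n))"
   by (intro suminf_le ennreal_leI l1) auto
  also have "... < \<infinity>"
   by (subst suminf_ennreal2) (auto intro!: summable_mult)
  finally have "AE x in M. (\<Sum>n. ennreal \<bar>h n x - h (Suc n) x\<bar>) \<noteq> \<infinity>"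
   by (intro nn_integral_PInf_AE) auto
  then show ?thesis by eventually_elim (auto intro!: summable_suminf_not_top)
 qed
 then have conv: "AE x in M. (\<lambda>n. h n x) \<longlonglongrightarrow> lim (\<lambda>n. h n x)"
 proof eventually_elim
  case (elim x)
  then have "summable (\<lambda>n. h n x - h (Suc n) x)" by (rule summable_rabs_cancel)
  then have "summable (\<lambda>n. h (Suc n) x - h n x)" using summable_minus[of "\<lambda>n. h n x - h (Suc n) x"] by simp
  then have "convergent (\<lambda>n. h n x - h 0 x)"
   by (simp add: summable_iff_convergent sum_lessThan_telescope[of "\<lambda>n. h n x"])
  from convergent_add[OF this convergent_const[of "h 0 x"]] have "convergent (\<lambda>n. h n x)" by simp
  then show ?case by (simp add: convergent_LIMSEQ_iff)
 qed
 define k where "k x = max 0 (min c (lim (\<lambda>n. h n x)))" for x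
 have [measurable]: "k \<in> borel_measurable M" unfolding k_def by measurable
 have kb: "0 \<le> k x" "k x \<le> c" for x using c0 by (auto simp: k_def)
 have convk: "AE x in M. (\<lambda>n. h n x) \<longlonglongrightarrow> k x"
  using conv
 proof eventually_elim
  case (elim x)
  have "0 \<le> lim (\<lambda>n. h n x)" by (rule LIMSEQ_le_const[OF elim]) (use hb in auto)
  moreover have "lim (\<lambda>n. h n x) \<le> c" by (rule LIMSEQ_le_const2[OF elim]) (use hb in auto)
  ultimately show ?case using elim by (simp add: k_def)
 qed
 have "N (\<lambda>x. ennreal (k x)) \<le> 1"
 proof (rule norm_Fatou)
  show "N (\<lambda>x. ennreal (h n x)) \<le> 1" for n using h(1)[of n] by (auto simp: B_def bounded_ball_def)
  show "AE x in M. (\<lambda>n. ennreal (h n x)) \<longlonglongrightarrow> ennreal (k x)" using convk by eventually_elim (auto intro: tendsto_ennrealI)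
 qed auto
 then have kB: "k \<in> bounded_ball" using kb by (auto simp: bounded_ball_def)
 have "(\<lambda>n. D (h n)) \<longlonglongrightarrow> D k" unfolding D_def
 proof (rule integral_dominated_convergence[where w="\<lambda>_. c\<^sup>2"])
  show "AE x in M. (\<lambda>n. (f x - h n x)\<^sup>2) \<longlonglongrightarrow> (f x - k x)\<^sup>2" using convk
   by eventually_elim (auto intro!: tendsto_intros)
  show "AE x in M. norm ((f x - h n x)\<^sup>2) \<le> c\<^sup>2" for n using sq[OF f0 fc hb] by auto
 qed auto
 moreover have "(\<lambda>n. d + (1/4)^n) \<longlonglongrightarrow> d + 0" by (intro tendsto_intros LIMSEQ_power_zero) auto
 ultimately have Dk: "D k \<le> d"
  by (intro LIMSEQ_le) (use h(2) in \<open>auto intro: less_imp_le\<close>)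
 have "D k \<le> D j" if j: "j \<in> bounded_ball" for j
 proof -
  have [measurable]: "j \<in> borel_measurable M" and j0: "\<And>x. 0 \<le> j x" using j by (auto simp: bounded_ball_def)
  obtain e where e: "\<And>x. j x \<le> e" using j by (auto simp: bounded_ball_def)
  let ?m = "\<lambda>x. min c (j x)"
  have mb: "?m \<in> bounded_ball" by (rule bounded_ball_mono[OF j]) (use c0 j0 in auto)
  then have "d \<le> D ?m" by (intro dle) (auto simp: B_def)
  also have "D ?m \<le> D j" unfolding D_def
  proof (rule integral_mono)
   show "integrable M (\<lambda>x. (f x - min c (j x))\<^sup>2)" using c0 j0 by (intro int f0 fc) auto
   have "\<bar>f x - j x\<bar> \<le> c + \<bar>e\<bar>" for x using f0[of x] fc[of x] j0[of x] e[of x] by linarith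
   then have "(f x - j x)\<^sup>2 \<le> (c + \<bar>e\<bar>)\<^sup>2" for x by (metis power2_abs power_mono abs_ge_zero)
   then show "integrable M (\<lambda>x. (f x - j x)\<^sup>2)" by (intro bounded_integrable[of _ "(c + \<bar>e\<bar>)\<^sup>2"]) auto
   show "(f x - min c (j x))\<^sup>2 \<le> (f x - j x)\<^sup>2" for x
    using fc[of x] by (auto simp: min_def intro!: abs_le_square_iff[THEN iffD1])
  qed
  finally show ?thesis using Dk by simp
 qed
 then show ?thesis using that[OF kB] by (simp add: D_def)
qed

text \<open>
 With \<open>h\<close> the projection of \<open>f\<close> onto the unit ball, the variational inequality makes \<open>(f - h)\<^sup>+\<close> a
 functional that separates \<open>f\<close> from the ball.
\<close>

lemma lorentz_luxemburg_bounded: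
 assumes f[measurable]: "f \<in> borel_measurable M" and f0: "\<And>x. 0 \<le> f x" and fc: "\<And>x. f x \<le> c"
  and Nf: "1 < N (\<lambda>x. ennreal (f x))"
 shows "1 < associate_norm M (associate_norm M N) (\<lambda>x. ennreal (f x))"
proof -
 obtain h where hB: "h \<in> bounded_ball" and
  min: "\<And>k. k \<in> bounded_ball ==> (LINT x|M. (f x - h x)\<^sup>2) \<le> (LINT x|M. (f x - k x)\<^sup>2)"
  using projection_exists[OF f f0 fc] by blast
 have hm[measurable]: "h \<in> borel_measurable M" and h0: "\<And>x. 0 \<le> h x" and Nh: "N (\<lambda>x. ennreal (h x)) \<le> 1"
  using hB by (auto simp: bounded_ball_def)
 obtain e where he: "\<And>x. h x \<le> e" using hB by (auto simp: bounded_ball_def)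
 define g where "g x = f x - h x" for x
 have [measurable]: "g \<in> borel_measurable M" unfolding g_def by measurable
 have gb: "\<bar>g x\<bar> \<le> c + e" for x unfolding g_def using f0[of x] fc[of x] h0[of x] he[of x] by linarith
 have prod_int: "integrable M (\<lambda>x. a x * b x)" if "a \<in> borel_measurable M" "b \<in> borel_measurable M"
  "\<And>x. \<bar>a x\<bar> \<le> A" "\<And>x. \<bar>b x\<bar> \<le> B" for a b :: "'a => real" and A B
 proof (rule bounded_integrable[of _ "A * B"])
  show "\<bar>a x * b x\<bar> \<le> A * B" for x
   unfolding abs_mult using that(3)[of x] that(4)[of x] by (intro mult_mono) auto
 qed (use that in measurable)
 define A where "A = (LINT x|M. g x * h x)"
 have hb: "\<bar>h x\<bar> \<le> e" for x using h0[of x] he[of x] by simp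
 have int_gh: "integrable M (\<lambda>x. g x * h x)" by (rule prod_int) (use gb hb in auto)
 have var: "(LINT x|M. g x * k x) \<le> A" if k: "k \<in> bounded_ball" for k
 proof -
  have km[measurable]: "k \<in> borel_measurable M" and k0: "\<And>x. 0 \<le> k x" using k by (auto simp: bounded_ball_def)
  obtain d where kd: "\<And>x. k x \<le> d" using k by (auto simp: bounded_ball_def)
  have kb: "\<bar>k x\<bar> \<le> d" for x using k0[of x] kd[of x] by simp
  have int_gk: "integrable M (\<lambda>x. g x * k x)" by (rule prod_int) (use gb kb in auto)
  have dif: "\<bar>k x - h x\<bar> \<le> d + e" for x using hb[of x] kb[of x] by linarith
  have int_kh: "integrable M (\<lambda>x. (k x - h x) * (k x - h x))" by (rule prod_int) (use dif in auto)
  have int_gg: "integrable M (\<lambda>x. g x * g x)" by (rule prod_int) (use gb in auto)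
  define Q where "Q = (LINT x|M. (k x - h x) * (k x - h x))"
  define P where "P = (LINT x|M. g x * k x) - A"
  have key: "2 * P \<le> s * Q" if s: "0 < s" "s \<le> 1" for s
  proof -
   have "(LINT x|M. (f x - h x)\<^sup>2) \<le> (LINT x|M. (f x - ((1 - s) * h x + s * k x))\<^sup>2)"
    using s by (intro min bounded_ball_convex hB k) auto
   also have "... = (LINT x|M. g x * g x - 2 * s * (g x * k x) + 2 * s * (g x * h x) + s^2 * ((k x - h x) * (k x - h x)))"
    by (intro Bochner_Integration.integral_cong refl) (simp add: g_def power2_eq_square algebra_simps)
   also have "... = (LINT x|M. g x * g x) - 2 * s * (LINT x|M. g x * k x) + 2 * s * A + s^2 * Q"
    unfolding A_def Q_def using int_gk int_kh int_gg int_gh by simp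
   also have "(LINT x|M. (f x - h x)\<^sup>2) = (LINT x|M. g x * g x)" by (simp add: g_def power2_eq_square)
   finally have "s * (2 * P) \<le> s * (s * Q)" by (simp add: P_def algebra_simps power2_eq_square)
   then show ?thesis using s by simp
  qed
  have "P \<le> 0"
  proof (rule ccontr)
   assume "\<not> P \<le> 0"
   then have P: "0 < P" by simp
   have "Q > 0" using key[of 1] P by simp
   define s where "s = min 1 (P / Q)"
   have s: "0 < s" "s \<le> 1" using P \<open>Q > 0\<close> by (auto simp: s_def)
   have "s * Q \<le> P / Q * Q" using \<open>Q > 0\<close> by (intro mult_right_mono) (auto simp: s_def)
   then show False using key[OF s] P \<open>Q > 0\<close> by simp
  qed
  then show ?thesis by (simp add: P_def)
 qed
 have A0: "0 \<le> A"
 proof -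
  have "(\<lambda>_. 0) \<in> bounded_ball" by (auto simp: bounded_ball_def)
  from var[OF this] show ?thesis by simp
 qed
 define G where "G x = max 0 (g x)" for x
 have [measurable]: "G \<in> borel_measurable M" unfolding G_def by measurable
 have G0: "0 \<le> G x" for x by (simp add: G_def)
 have assocG: "associate_norm M N (\<lambda>x. ennreal (G x)) \<le> ennreal A"
 proof (rule associate_norm_least)
  fix F assume F[measurable]: "F \<in> borel_measurable M" and NF: "N F \<le> 1"
  define k where "k j x = (if 0 < g x then enn2real (inf (F x) (of_nat j)) else 0)" for j x
  have [measurable]: "k j \<in> borel_measurable M" for j unfolding k_def by measurable
  have e2r: "ennreal (enn2real (inf (F x) (of_nat j))) = inf (F x) (of_nat j)" for x j
   by (rule ennreal_enn2real, rule le_less_trans[of _ "of_nat j"]) (auto simp: ennreal_of_nat_eq_real_of_nat)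
  have kF: "ennreal (k j x) = (if 0 < g x then inf (F x) (of_nat j) else 0)" for j x by (simp add: k_def e2r)
  have kB: "k j \<in> bounded_ball" for j
  proof -
   have "N (\<lambda>x. ennreal (k j x)) \<le> N F" by (intro norm_mono) (auto simp: kF)
   moreover have "k j x \<le> real j" for x
    unfolding k_def using enn2real_mono[of "inf (F x) (of_nat j)" "of_nat j"] by (auto simp: ennreal_of_nat_eq_real_of_nat)
   moreover have "0 \<le> k j x" for x by (simp add: k_def)
   ultimately show ?thesis using NF unfolding bounded_ball_def by (auto intro: order_trans)
  qed
  have bd: "(\<integral>\<^sup>+x. inf (F x) (of_nat j) * ennreal (G x) \<partial>M) \<le> ennreal A" for j
  proof -
   have kj: "0 \<le> k j x" "k j x \<le> real j" for x
    unfolding k_def using enn2real_mono[of "inf (F x) (of_nat j)" "of_nat j"] by (auto simp: ennreal_of_nat_eq_real_of_nat)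
   have "(\<integral>\<^sup>+x. inf (F x) (of_nat j) * ennreal (G x) \<partial>M) = (\<integral>\<^sup>+x. ennreal (g x * k j x) \<partial>M)"
   proof (intro nn_integral_cong)
    fix x show "inf (F x) (of_nat j) * ennreal (G x) = ennreal (g x * k j x)"
     using kF[of j x] by (cases "0 < g x") (auto simp: G_def ennreal_mult kj mult.commute)
   qed
   also have "... = ennreal (LINT x|M. g x * k j x)"
   proof (rule nn_integral_eq_integral)
    have "\<bar>k j x\<bar> \<le> real j" for x using kj[of x] by simp
    then show "integrable M (\<lambda>x. g x * k j x)" using gb by (intro prod_int) auto
    show "AE x in M. 0 \<le> g x * k j x" by (auto simp: k_def)
   qed
   also have "... \<le> ennreal A" by (intro ennreal_leI var kB)
   finally show ?thesis .
  qed
  have sup: "(SUP j. inf (F x) (of_nat j)) = F x" for x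
  proof -
   have "(SUP j. inf (F x) (of_nat j)) = inf (F x) (SUP j. of_nat j)" by (rule inf_SUP[symmetric])
   then show ?thesis by (simp add: ennreal_SUP_of_nat_eq_top)
  qed
  have "(\<integral>\<^sup>+x. F x * ennreal (G x) \<partial>M) = (\<integral>\<^sup>+x. (SUP j. inf (F x) (of_nat j) * ennreal (G x)) \<partial>M)"
   by (simp add: sup flip: SUP_mult_right_ennreal)
  also have "... = (SUP j. \<integral>\<^sup>+x. inf (F x) (of_nat j) * ennreal (G x) \<partial>M)"
   by (rule nn_integral_monotone_convergence_SUP)
    (auto intro!: incseq_SucI le_funI mult_right_mono inf_mono simp: of_nat_mono)
  also have "... \<le> ennreal A" using bd by (intro SUP_least)
  finally show "(\<integral>\<^sup>+x. F x * ennreal (G x) \<partial>M) \<le> ennreal A" .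
 qed
 have Gb: "\<bar>G x\<bar> \<le> c + e" for x using gb[of x] by (auto simp: G_def)
 have fb: "\<bar>f x\<bar> \<le> c" for x using f0[of x] fc[of x] by simp
 have int_fG: "integrable M (\<lambda>x. f x * G x)" by (rule prod_int) (use fb Gb in auto)
 have int_gg: "integrable M (\<lambda>x. g x * g x)" by (rule prod_int) (use gb in auto)
 have int_fg: "integrable M (\<lambda>x. f x * g x)" by (rule prod_int) (use gb fb in auto)
 have pos: "0 < (LINT x|M. g x * g x)"
 proof (rule ccontr)
  assume "\<not> 0 < (LINT x|M. g x * g x)"
  moreover have "0 \<le> (LINT x|M. g x * g x)" by simp
  ultimately have "(LINT x|M. g x * g x) = 0" by simp
  then have "AE x in M. g x * g x = 0" using int_gg by (subst (asm) integral_nonneg_eq_0_iff_AE) auto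
  then have "AE x in M. ennreal (f x) = ennreal (h x)" by eventually_elim (simp add: g_def)
  then have "N (\<lambda>x. ennreal (f x)) = N (\<lambda>x. ennreal (h x))" by (intro norm_cong_AE) auto
  then show False using Nf Nh by simp
 qed
 have "A + (LINT x|M. g x * g x) = (LINT x|M. g x * h x + g x * g x)"
  unfolding A_def using int_gg int_gh by simp
 also have "... = (LINT x|M. f x * g x)" by (intro Bochner_Integration.integral_cong refl) (simp add: g_def algebra_simps)
 also have "... \<le> (LINT x|M. f x * G x)"
  using int_fg int_fG f0 by (intro integral_mono) (auto simp: G_def intro: mult_left_mono)
 finally have lt: "A < (LINT x|M. f x * G x)" using pos by simp
 define A' where "A' = (A + (LINT x|M. f x * G x)) / 2"
 have A': "A < A'" "A' < (LINT x|M. f x * G x)" "0 < A'" using lt A0 by (auto simp: A'_def)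
 have "associate_norm M N (\<lambda>x. ennreal (1 / A') * ennreal (G x)) = ennreal (1/A') * associate_norm M N (\<lambda>x. ennreal (G x))"
  by (rule associate_norm_cmult) measurable
 also have "... \<le> ennreal (1/A') * ennreal A" by (intro mult_left_mono assocG) simp
 also have "... = ennreal (A / A')" using A' A0 by (simp flip: ennreal_mult)
 also have "... \<le> ennreal 1" using A' by (intro ennreal_leI) simp
 finally have "(\<integral>\<^sup>+x. (ennreal (1 / A') * ennreal (G x)) * ennreal (f x) \<partial>M) \<le> associate_norm M (associate_norm M N) (\<lambda>x. ennreal (f x))"
  by (intro associate_norm_upper) auto
 moreover have "1 < (\<integral>\<^sup>+x. (ennreal (1 / A') * ennreal (G x)) * ennreal (f x) \<partial>M)"
 proof -
  have "(\<integral>\<^sup>+x. (ennreal (1 / A') * ennreal (G x)) * ennreal (f x) \<partial>M) = (\<integral>\<^sup>+x. ennreal (1 / A') * ennreal (f x * G x) \<partial>M)"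
   using f0 G0 by (intro nn_integral_cong) (simp add: ennreal_mult ac_simps)
  also have "... = ennreal (1/A') * ennreal (LINT x|M. f x * G x)"
   using f0 G0 int_fG by (subst nn_integral_cmult) (auto simp: nn_integral_eq_integral)
  also have "... = ennreal ((LINT x|M. f x * G x) / A')" using A' A0 by (simp flip: ennreal_mult)
  finally show ?thesis using A' by (simp add: less_divide_eq)
 qed
 ultimately show ?thesis by simp
qed

theorem lorentz_luxemburg:
 assumes f[measurable]: "f \<in> borel_measurable M"
 shows "N f \<le> associate_norm M (associate_norm M N) f"
proof (rule ccontr)
 let ?N2 = "associate_norm M (associate_norm M N)"
 assume "\<not> N f \<le> ?N2 f"
 then obtain y where y: "?N2 f < y" "y < N f" using dense by (auto simp: not_le)
 then obtain r where r: "y = ennreal r" "r \<ge> 0" by (cases y) auto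
 then have r0: "r > 0" using y by (cases "r = 0") auto
 define F where "F j x = inf (ennreal (1/r) * f x) (of_nat j)" for j :: nat and x
 have [measurable]: "F j \<in> borel_measurable M" for j unfolding F_def by measurable
 have sup: "(SUP j. F j x) = ennreal (1/r) * f x" for x
 proof -
  have "(SUP j. F j x) = inf (ennreal (1/r) * f x) (SUP j. of_nat j)" unfolding F_def by (rule inf_SUP[symmetric])
  then show ?thesis by (simp add: ennreal_SUP_of_nat_eq_top)
 qed
 have "incseq (\<lambda>j. F j x)" for x
  by (rule incseq_SucI, unfold F_def, rule inf_mono[OF order_refl of_nat_mono]) simp
 then have "(\<lambda>j. F j x) \<longlonglongrightarrow> ennreal (1/r) * f x" for x using LIMSEQ_SUP[of "\<lambda>j. F j x"] by (simp add: sup)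
 then have "(\<lambda>j. N (F j)) \<longlonglongrightarrow> N (\<lambda>x. ennreal (1/r) * f x)"
  using \<open>\<And>x. incseq (\<lambda>j. F j x)\<close> fatou[of F "\<lambda>x. ennreal (1/r) * f x"] by auto
 moreover have "1 < N (\<lambda>x. ennreal (1/r) * f x)"
 proof -
  have "1 = ennreal (1/r) * ennreal r" using r0 by (simp flip: ennreal_mult)
  also have "... < ennreal (1/r) * N f" using y r r0 by (intro ennreal_mult_strict_left_mono) auto
  also have "... = N (\<lambda>x. ennreal (1/r) * f x)" using r0 by (subst homogeneous) auto
  finally show ?thesis .
 qed
 ultimately have "eventually (\<lambda>j. 1 < N (F j)) sequentially" by (rule order_tendstoD(1))
 then obtain j where j: "1 < N (F j)" by (auto simp: eventually_sequentially)
 define h where "h x = enn2real (F j x)" for x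
 have [measurable]: "h \<in> borel_measurable M" unfolding h_def by measurable
 have Fle: "F j x \<le> ennreal (real j)" for x by (simp add: F_def ennreal_of_nat_eq_real_of_nat)
 have hF: "ennreal (h x) = F j x" for x unfolding h_def using Fle[of x] by (simp add: le_less_trans[of _ "ennreal (real j)"])
 have "1 < ?N2 (\<lambda>x. ennreal (h x))"
 proof (rule lorentz_luxemburg_bounded)
  show "h x \<le> real j" for x unfolding h_def using Fle[of x] by (intro enn2real_leI) auto
  show "1 < N (\<lambda>x. ennreal (h x))" using j by (simp add: hF)
 qed (auto simp: h_def)
 also have "... \<le> ?N2 (\<lambda>x. ennreal (1/r) * f x)"
  by (intro associate_norm_mono AE_I2) (auto simp: hF F_def)
 also have "... = ennreal (1/r) * ?N2 f" by (intro associate_norm_cmult) auto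
 also have "... \<le> ennreal (1/r) * ennreal r" using y r by (intro mult_left_mono) auto
 also have "... = 1" using r0 by (simp flip: ennreal_mult)
 finally show False by simp
qed

end

section \<open>Norms on the unit interval\<close>

lemma LIMSEQ_incseq_SUP: "incseq a ==> a \<longlonglongrightarrow> y ==> (SUP n. a n) = y" for a :: "nat => ennreal"
 using LIMSEQ_SUP LIMSEQ_unique by blast

locale ri_norm_ui = ri_function_norm unit_interval N for N
begin

sublocale ri_norm_finite unit_interval N ..

lemma ui_fin: "emeasure unit_interval (space unit_interval) < \<infinity>" by simp

lemma hardy_littlewood_hoelder:
 assumes f: "f \<in> borel_measurable unit_interval" and g: "g \<in> borel_measurable unit_interval"
 shows "(\<integral>\<^sup>+t. nrearr unit_interval f t * nrearr unit_interval g t \<partial>unit_interval) \<le> N f * associate_norm unit_interval N g"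
proof -
 obtain f' where f': "f' \<in> borel_measurable unit_interval" "equimeasurable unit_interval f f'"
  "(\<integral>\<^sup>+t. nrearr unit_interval f t * nrearr unit_interval g t \<partial>unit_interval) \<le> (\<integral>\<^sup>+t. f' t * g t \<partial>unit_interval)"
  using ryff_transport[OF f g] .
 note f'(3)
 also have "(\<integral>\<^sup>+t. f' t * g t \<partial>unit_interval) \<le> N f' * associate_norm unit_interval N g"
  by (rule hoelder[OF ui_fin f'(1) g])
 also have "N f' = N f" using rearrangement_invariant[OF f f'(1,2)] by simp
 finally show ?thesis .
qed

text \<open>
 By \<open>ryff_transport\<close> the supremum in the associate norm of \<open>g\<close> depends on \<open>g\<^sup>*\<close> alone.
\<close>

lemma associate_norm_le_equimeasurable:
 assumes f: "f \<in> borel_measurable unit_interval" and g: "g \<in> borel_measurable unit_interval" and eq: "equimeasurable unit_interval f g"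
 shows "associate_norm unit_interval N f \<le> associate_norm unit_interval N g"
proof (rule associate_norm_least)
 fix F assume F: "F \<in> borel_measurable unit_interval" "N F \<le> 1"
 have *: "nrearr unit_interval f t = nrearr unit_interval g t" if "t \<ge> 0" for t
  using eq by (intro nrearr_cong_ndist pos_finite_measure_ui f g that) (simp add: ui.equimeasurable_iff_ndist)
 have "(\<integral>\<^sup>+x. F x * f x \<partial>unit_interval) \<le> (\<integral>\<^sup>+t. nrearr unit_interval F t * nrearr unit_interval f t \<partial>unit_interval)"
  using ui.hardy_littlewood[OF F(1) f] by (simp add: mean_ui)
 also have "... = (\<integral>\<^sup>+t. nrearr unit_interval F t * nrearr unit_interval g t \<partial>unit_interval)"
  by (intro nn_integral_cong) (simp add: *)
 also have "... \<le> N F * associate_norm unit_interval N g" by (rule hardy_littlewood_hoelder[OF F(1) g])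
 also have "... \<le> associate_norm unit_interval N g" using mult_right_mono[OF F(2)] by simp
 finally show "(\<integral>\<^sup>+x. F x * f x \<partial>unit_interval) \<le> associate_norm unit_interval N g" .
qed

theorem associate_norm_ri: "ri_function_norm unit_interval (associate_norm unit_interval N)"
proof
 let ?u = unit_interval
 fix f g :: "real => ennreal"
 assume f[measurable]: "f \<in> borel_measurable ?u"
 show "associate_norm ?u N f = 0 \<longleftrightarrow> (AE x in ?u. f x = 0)"
 proof
  assume "associate_norm ?u N f = 0"
  then have "(\<integral>\<^sup>+x. 1 * f x \<partial>?u) \<le> 0" using hoelder[OF ui_fin _ f, of "\<lambda>_. 1"] by simp
  then show "AE x in ?u. f x = 0" by (subst (asm) le_zero_eq, subst (asm) nn_integral_0_iff_AE) auto
 next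
  assume ae: "AE x in ?u. f x = 0"
  have "associate_norm ?u N f \<le> 0"
  proof (rule associate_norm_least)
   fix F :: "real => ennreal" assume [measurable]: "F \<in> borel_measurable ?u"
   have "(\<integral>\<^sup>+x. F x * f x \<partial>?u) = 0"
    by (subst nn_integral_0_iff_AE) (use ae in \<open>auto elim: eventually_mono\<close>)
   then show "(\<integral>\<^sup>+x. F x * f x \<partial>?u) \<le> 0" by simp
  qed
  then show "associate_norm ?u N f = 0" by simp
 qed
 show "associate_norm ?u N (\<lambda>x. ennreal c * f x) = ennreal c * associate_norm ?u N f" for c by (rule associate_norm_cmult[OF f])
 assume g[measurable]: "g \<in> borel_measurable ?u"
 show "associate_norm ?u N (\<lambda>x. f x + g x) \<le> associate_norm ?u N f + associate_norm ?u N g"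
 proof (rule associate_norm_least)
  fix F :: "real => ennreal" assume [measurable]: "F \<in> borel_measurable ?u" and F: "N F \<le> 1"
  have "(\<integral>\<^sup>+x. F x * (f x + g x) \<partial>?u) = (\<integral>\<^sup>+x. F x * f x \<partial>?u) + (\<integral>\<^sup>+x. F x * g x \<partial>?u)"
   by (simp add: distrib_left nn_integral_add)
  also have "... \<le> associate_norm ?u N f + associate_norm ?u N g" by (intro add_mono associate_norm_upper F) auto
  finally show "(\<integral>\<^sup>+x. F x * (f x + g x) \<partial>?u) \<le> ..." .
 qed
 show "AE x in ?u. f x \<le> g x ==> associate_norm ?u N f \<le> associate_norm ?u N g" by (rule associate_norm_mono)
 assume eq: "equimeasurable ?u f g"
 then have "equimeasurable ?u g f" by (auto simp: ui.equimeasurable_iff_ndist)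
 then show "associate_norm ?u N f = associate_norm ?u N g"
  by (intro antisym associate_norm_le_equimeasurable f g eq)
next
 let ?u = unit_interval
 fix F :: "nat => real => ennreal" and f
 assume F[measurable]: "\<And>k. F k \<in> borel_measurable ?u" and f[measurable]: "f \<in> borel_measurable ?u"
  and ae: "AE x in ?u. incseq (\<lambda>k. F k x) \<and> (\<lambda>k. F k x) \<longlonglongrightarrow> f x"
 have inc: "incseq (\<lambda>k. associate_norm ?u N (F k))"
  by (rule incseq_SucI, rule associate_norm_mono) (use ae in eventually_elim, simp add: incseq_Suc_iff)
 have "associate_norm ?u N f = (SUP k. associate_norm ?u N (F k))"
 proof (rule antisym)
  show "associate_norm ?u N f \<le> (SUP k. associate_norm ?u N (F k))"
  proof (rule associate_norm_least)
   fix h :: "real => ennreal" assume [measurable]: "h \<in> borel_measurable ?u" and h: "N h \<le> 1"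
   have "(\<integral>\<^sup>+x. h x * f x \<partial>?u) = (\<integral>\<^sup>+x. (SUP k. h x * F k x) \<partial>?u)"
   proof (rule nn_integral_cong_AE)
    show "AE x in ?u. h x * f x = (SUP k. h x * F k x)"
     using ae
    proof eventually_elim
     case (elim x)
     then have "(SUP k. F k x) = f x" by (intro LIMSEQ_incseq_SUP) auto
     then show ?case by (simp flip: SUP_mult_left_ennreal)
    qed
   qed
   also have "... = (SUP k. \<integral>\<^sup>+x. h x * F k x \<partial>?u)"
    by (rule nn_integral_monotone_convergence_SUP_AE)
     (use ae in \<open>auto elim!: eventually_mono simp: incseq_Suc_iff mult_left_mono\<close>)
   also have "... \<le> (SUP k. associate_norm ?u N (F k))"
    by (intro SUP_mono' associate_norm_upper h) auto
   finally show "(\<integral>\<^sup>+x. h x * f x \<partial>?u) \<le> ..." .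
  qed
  show "(SUP k. associate_norm ?u N (F k)) \<le> associate_norm ?u N f"
  proof (rule SUP_least, rule associate_norm_mono)
   fix k show "AE x in ?u. F k x \<le> f x" using ae by eventually_elim (auto intro: incseq_le)
  qed
 qed
 then show "incseq (\<lambda>k. associate_norm ?u N (F k)) \<and> (\<lambda>k. associate_norm ?u N (F k)) \<longlonglongrightarrow> associate_norm ?u N f"
  using inc LIMSEQ_SUP[OF inc] by simp
next
 let ?u = unit_interval
 fix E :: "real set" assume E[measurable]: "E \<in> sets ?u" and fin: "emeasure ?u E < \<infinity>"
 obtain C :: real where C: "C > 0" "\<And>f. f \<in> borel_measurable ?u ==> (\<integral>\<^sup>+ x \<in> E. f x \<partial>?u) \<le> ennreal C * N f"
  using locally_L1[OF E fin] by auto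
 have "associate_norm ?u N (indicator E) \<le> ennreal C"
 proof (rule associate_norm_least)
  fix F assume F: "F \<in> borel_measurable ?u" "N F \<le> 1"
  have "(\<integral>\<^sup>+ x \<in> E. F x \<partial>?u) \<le> ennreal C * N F" by (rule C(2)[OF F(1)])
  also have "... \<le> ennreal C" using mult_left_mono[OF F(2), of "ennreal C"] by simp
  finally show "(\<integral>\<^sup>+ x. F x * indicator E x \<partial>?u) \<le> ennreal C" .
 qed
 then show "associate_norm ?u N (indicator E) < \<infinity>" by (simp add: le_less_trans[of _ "ennreal C"])
 define C' where "C' = enn2real (N (indicator E)) + 1"
 have "N (indicator E) < \<infinity>" by (rule finite_indicator[OF E fin])
 then have C': "N (indicator E) \<le> ennreal C'" unfolding C'_def
  by (cases "N (indicator E)") (auto intro!: ennreal_leI)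
 have "C' > 0" by (simp add: C'_def add_nonneg_pos)
 moreover have "(\<integral>\<^sup>+ x \<in> E. f x \<partial>?u) \<le> ennreal C' * associate_norm ?u N f" if f: "f \<in> borel_measurable ?u" for f
 proof -
  have "(\<integral>\<^sup>+ x \<in> E. f x \<partial>?u) = (\<integral>\<^sup>+x. indicator E x * f x \<partial>?u)" by (simp add: mult.commute)
  also have "... \<le> N (indicator E) * associate_norm ?u N f" by (intro hoelder ui_fin f) auto
  also have "... \<le> ennreal C' * associate_norm ?u N f" by (intro mult_right_mono C') auto
  finally show ?thesis .
 qed
 ultimately show "\<exists>C>0. \<forall>f\<in>borel_measurable ?u. (\<integral>\<^sup>+ x \<in> E. f x \<partial>?u) \<le> ennreal C * associate_norm ?u N f" by blast
qed

lemma equimeasurable_nrearr_ui: "f \<in> borel_measurable unit_interval ==> equimeasurable unit_interval (nrearr unit_interval f) f"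
 by (simp add: ui.equimeasurable_iff_ndist ui.ndist_nrearr)

lemma norm_nrearr: "f \<in> borel_measurable unit_interval ==> N (nrearr unit_interval f) = N f"
 by (intro rearrangement_invariant equimeasurable_nrearr_ui) auto

text \<open>
 The Hardy--Littlewood--Polya principle, by duality and Hardy's lemma.
\<close>

lemma norm_nrearr_le_if_prim_le:
 assumes M: "pos_finite_measure M" and f: "f \<in> borel_measurable M" and b: "b \<in> borel_measurable unit_interval"
  and le: "\<And>s. 0 < s ==> s \<le> 1 ==> prim (nrearr M f) s \<le> prim b s"
 shows "N (nrearr M f) \<le> N b"
proof -
 let ?u = unit_interval
 interpret A: ri_norm_ui "associate_norm ?u N"
  by (intro ri_norm_ui.intro associate_norm_ri)
 have "N (nrearr M f) \<le> associate_norm ?u (associate_norm ?u N) (nrearr M f)" by (rule lorentz_luxemburg) simp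
 also have "... \<le> N b"
 proof (rule associate_norm_least)
  fix \<phi> assume \<phi>: "\<phi> \<in> borel_measurable ?u" "associate_norm ?u N \<phi> \<le> 1"
  have "(\<integral>\<^sup>+x. \<phi> x * nrearr M f x \<partial>?u) \<le> (\<integral>\<^sup>+t. nrearr ?u \<phi> t * nrearr ?u (nrearr M f) t \<partial>?u)"
   using ui.hardy_littlewood[OF \<phi>(1), of "nrearr M f"] by (simp add: mean_ui)
  also have "... = (\<integral>\<^sup>+t. nrearr M f t * nrearr ?u \<phi> t \<partial>?u)"
  proof (rule nn_integral_cong)
   fix t assume "t \<in> space ?u"
   then have "nrearr ?u (nrearr M f) t = nrearr M f t"
    using pos_finite_measure.ndist_nrearr[OF M f]
    by (intro nrearr_cong_ndist pos_finite_measure_ui M f) auto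
   then show "nrearr ?u \<phi> t * nrearr ?u (nrearr M f) t = nrearr M f t * nrearr ?u \<phi> t" by (simp add: mult.commute)
  qed
  also have "... \<le> (\<integral>\<^sup>+t. b t * nrearr ?u \<phi> t \<partial>?u)"
   by (rule hardy_prim_mono[OF _ b _ _ le]) (auto simp: nrearr_antimono)
  also have "... \<le> N b * associate_norm ?u N (nrearr ?u \<phi>)" by (intro hoelder ui_fin b) simp
  also have "... = N b * associate_norm ?u N \<phi>" by (simp add: A.norm_nrearr \<phi>)
  also have "... \<le> N b" using mult_left_mono[OF \<phi>(2), of "N b"] by simp
  finally show "(\<integral>\<^sup>+x. \<phi> x * nrearr M f x \<partial>?u) \<le> N b" .
 qed
 finally show ?thesis .
qed

end

lemma nrearr_mono_AE:
 assumes [measurable]: "f \<in> borel_measurable M" "g \<in> borel_measurable M" and le: "AE x in M. f x \<le> g x"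
 shows "nrearr M f t \<le> nrearr M g t"
 unfolding nrearr_def rearrangement_def
proof (rule Inf_superset_mono, safe)
 fix l assume *: "emeasure M {x \<in> space M. l < g x} \<le> ennreal (measure M (space M) * t)"
 have "emeasure M {x \<in> space M. l < f x} \<le> emeasure M {x \<in> space M. l < g x}"
  by (rule emeasure_mono_AE) (use le in eventually_elim, auto intro: less_le_trans)
 then show "emeasure M {x \<in> space M. l < f x} \<le> ennreal (measure M (space M) * t)" using * by simp
qed

lemma nrearr_equimeasurable: "equimeasurable M f g ==> nrearr M f = nrearr M g"
 by (simp add: equimeasurable_def nrearr_def[abs_def] rearrangement_def[abs_def])

lemma (in pos_finite_measure) nrearr_SUP:
 assumes F[measurable]: "\<And>k::nat. F k \<in> borel_measurable M" and f[measurable]: "f \<in> borel_measurable M"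
  and ae: "AE x in M. incseq (\<lambda>k. F k x) \<and> (\<lambda>k. F k x) \<longlonglongrightarrow> f x" and t: "t \<ge> 0"
 shows "incseq (\<lambda>k. nrearr M (F k) t) \<and> (\<lambda>k. nrearr M (F k) t) \<longlonglongrightarrow> nrearr M f t"
proof -
 have inc: "incseq (\<lambda>k. nrearr M (F k) t)"
  by (rule incseq_SucI, rule nrearr_mono_AE[OF F F]) (use ae in eventually_elim, simp add: incseq_Suc_iff)
 have "nrearr M f t = (SUP k. nrearr M (F k) t)"
 proof (rule antisym)
  show "(SUP k. nrearr M (F k) t) \<le> nrearr M f t"
   by (rule SUP_least, rule nrearr_mono_AE[OF F f]) (use ae in eventually_elim, auto intro: incseq_le)
  show "nrearr M f t \<le> (SUP k. nrearr M (F k) t)"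
  proof (rule dense_le)
   fix l assume "l < nrearr M f t"
   then have l: "t < ndist M f l" using nrearr_gt_iff[OF f t] by simp
   have "(\<integral>\<^sup>+x. (indicator {l<..} (f x)) \<partial>M) = (\<integral>\<^sup>+x. (SUP k. indicator {l<..} (F k x)) \<partial>M)"
   proof (rule nn_integral_cong_AE)
    show "AE x in M. (indicator {l<..} (f x) :: ennreal) = (SUP k. indicator {l<..} (F k x))"
     using ae
    proof eventually_elim
     case (elim x)
     then have s: "f x = (SUP k. F k x)" using LIMSEQ_incseq_SUP[of "\<lambda>k. F k x" "f x"] by simp
     show ?case
     proof (cases "l < f x")
      case True
      then obtain k where "l < F k x" by (auto simp: s less_SUP_iff)
      then have "(1::ennreal) \<le> (SUP k. indicator {l<..} (F k x))" by (intro SUP_upper2[of k]) auto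
      moreover have "(SUP k. indicator {l<..} (F k x)) \<le> (1::ennreal)" by (intro SUP_least) (auto simp: indicator_def)
      ultimately show ?thesis using True by simp
     next
      case False
      then have "\<not> l < F k x" for k using SUP_upper[of k UNIV "\<lambda>k. F k x"] by (auto simp: s)
      then show ?thesis using False by simp
     qed
    qed
   qed
   also have "... = (SUP k. \<integral>\<^sup>+x. indicator {l<..} (F k x) \<partial>M)"
   proof (rule nn_integral_monotone_convergence_SUP_AE)
    fix k show "AE x in M. (indicator {l<..} (F k x) :: ennreal) \<le> indicator {l<..} (F (Suc k) x)"
     using ae by eventually_elim (auto simp: indicator_def incseq_Suc_iff intro: less_le_trans)
   qed simp
   finally have "emeasure M {x \<in> space M. l < f x} = (SUP k. emeasure M {x \<in> space M. l < F k x})"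
   proof -
    have *: "(\<integral>\<^sup>+x. indicator {l<..} (h x) \<partial>M) = emeasure M {x \<in> space M. l < h x}" if [measurable]: "h \<in> borel_measurable M" for h
    proof -
     have "(\<integral>\<^sup>+x. indicator {l<..} (h x) \<partial>M) = (\<integral>\<^sup>+x. indicator {x \<in> space M. l < h x} x \<partial>M)"
      by (intro nn_integral_cong) (simp add: indicator_def)
     then show ?thesis by simp
    qed
    assume "(\<integral>\<^sup>+x. indicator {l<..} (f x) \<partial>M) = (SUP k. \<integral>\<^sup>+x. indicator {l<..} (F k x) \<partial>M)"
    then show ?thesis by (simp add: *)
   qed
   moreover have "ennreal (t * measure M (space M)) < emeasure M {x \<in> space M. l < f x}"
    using l t total_pos by (simp add: ndist_def emeasure_eq_measure ennreal_less_iff field_simps)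
   ultimately obtain k where "ennreal (t * measure M (space M)) < emeasure M {x \<in> space M. l < F k x}"
    by (auto simp: less_SUP_iff)
   then have "t < ndist M (F k) l" using t total_pos by (simp add: ndist_def emeasure_eq_measure ennreal_less_iff field_simps)
   then have "l < nrearr M (F k) t" using nrearr_gt_iff[OF F t] by simp
   also have "... \<le> (SUP k. nrearr M (F k) t)" by (rule SUP_upper) simp
   finally show "l \<le> (SUP k. nrearr M (F k) t)" by simp
  qed
 qed
 then show ?thesis using inc LIMSEQ_SUP[OF inc] by simp
qed

lemma transported_norm_eq: "transported_norm M N f = N (nrearr M f)"
 by (simp add: transported_norm_def nrearr_def[abs_def])

lemma prim_add: "a \<in> borel_measurable unit_interval ==> b \<in> borel_measurable unit_interval ==>
 prim (\<lambda>t. a t + b t) s = prim a s + prim b s"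
 unfolding prim_def by (simp add: distrib_right nn_integral_add)

lemma less_ennreal_mult_iff:
 assumes "c > 0" shows "l < ennreal c * x \<longleftrightarrow> ennreal (1/c) * l < x"
proof -
 have "l = ennreal c * (ennreal (1/c) * l)" using assms by (simp add: mult.assoc[symmetric] flip: ennreal_mult)
 then have "l < ennreal c * x \<longleftrightarrow> ennreal c * (ennreal (1/c) * l) < ennreal c * x" by simp
 also have "... \<longleftrightarrow> ennreal (1/c) * l < x"
  using assms by (auto simp: not_le[symmetric] ennreal_mult_le_mult_iff)
 finally show ?thesis .
qed

lemma (in pos_finite_measure) nrearr_cmult:
 assumes f[measurable]: "f \<in> borel_measurable M" and c: "c \<ge> 0" and t: "t \<ge> 0"
 shows "nrearr M (\<lambda>x. ennreal c * f x) t = ennreal c * nrearr M f t"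
proof (cases "c = 0")
 case True
 have "\<not> 0 < nrearr M (\<lambda>x. 0) t" using nrearr_gt_iff[of "\<lambda>_. 0" t 0] t by (simp add: ndist_def)
 then show ?thesis using True by simp
next
 case False
 then have c: "c > 0" using c by simp
 have "l < nrearr M (\<lambda>x. ennreal c * f x) t \<longleftrightarrow> l < ennreal c * nrearr M f t" for l
 proof -
  have "l < nrearr M (\<lambda>x. ennreal c * f x) t \<longleftrightarrow> t < ndist M f (ennreal (1/c) * l)"
   using t by (subst nrearr_gt_iff) (auto simp: ndist_def less_ennreal_mult_iff[OF c])
  also have "... \<longleftrightarrow> ennreal (1/c) * l < nrearr M f t" using nrearr_gt_iff[OF f t] by simp
  also have "... \<longleftrightarrow> l < ennreal c * nrearr M f t" by (rule less_ennreal_mult_iff[OF c, symmetric])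
  finally show ?thesis .
 qed
 then show ?thesis by (metis linorder_less_linear order_less_irrefl)
qed

lemma (in pos_finite_measure) nrearr_indicator_le_1: "t \<ge> 0 ==> nrearr M (indicator E) t \<le> 1" if "E \<in> sets M"
 using nrearr_gt_iff[of "indicator E" t 1] that by (simp add: ndist_def indicator_def not_less[symmetric])

theorem (in pos_finite_measure) transported_norm_ri:
 assumes N: "ri_function_norm unit_interval N"
 shows "ri_function_norm M (transported_norm M N)"
 unfolding transported_norm_eq[abs_def]
proof
 let ?u = unit_interval
 interpret N: ri_norm_ui N by (rule ri_norm_ui.intro) fact
 fix f g :: "'a => ennreal"
 assume f[measurable]: "f \<in> borel_measurable M"
 show "N (nrearr M f) = 0 \<longleftrightarrow> (AE x in M. f x = 0)"
 proof -
  have "N (nrearr M f) = 0 \<longleftrightarrow> (\<integral>\<^sup>+t. nrearr M f t \<partial>?u) = 0"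
   by (subst N.zero_iff) (auto simp: nn_integral_0_iff_AE)
  also have "... \<longleftrightarrow> mean M f = 0" using mean_nrearr[OF f, of "\<lambda>x. x"] by simp
  also have "... \<longleftrightarrow> (\<integral>\<^sup>+x. f x \<partial>M) = 0" by (simp add: mean_def divide_ennreal_def)
  finally show ?thesis by (simp add: nn_integral_0_iff_AE)
 qed
 show "N (nrearr M (\<lambda>x. ennreal c * f x)) = ennreal c * N (nrearr M f)" if "c \<ge> 0" for c
 proof -
  have "N (nrearr M (\<lambda>x. ennreal c * f x)) = N (\<lambda>t. ennreal c * nrearr M f t)"
   by (rule N.norm_cong_AE) (auto intro!: AE_I2 nrearr_cmult[OF f that])
  then show ?thesis using that by (simp add: N.homogeneous)
 qed
 assume g[measurable]: "g \<in> borel_measurable M"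
 show "N (nrearr M (\<lambda>x. f x + g x)) \<le> N (nrearr M f) + N (nrearr M g)"
 proof -
  have "N (nrearr M (\<lambda>x. f x + g x)) \<le> N (\<lambda>t. nrearr M f t + nrearr M g t)"
   by (rule N.norm_nrearr_le_if_prim_le[OF pos_finite_measure_axioms]) (auto simp: prim_add prim_nrearr_add_le)
  also have "... \<le> N (nrearr M f) + N (nrearr M g)" by (rule N.triangle) auto
  finally show ?thesis .
 qed
 show "N (nrearr M f) \<le> N (nrearr M g)" if "AE x in M. f x \<le> g x"
  by (intro N.norm_mono nrearr_mono_AE that) auto
 show "N (nrearr M f) = N (nrearr M g)" if "equimeasurable M f g"
  using nrearr_equimeasurable[OF that] by simp
next
 let ?u = unit_interval
 interpret N: ri_norm_ui N by (rule ri_norm_ui.intro) fact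
 fix F :: "nat => 'a => ennreal" and f
 assume "\<And>k. F k \<in> borel_measurable M" "f \<in> borel_measurable M"
  and "AE x in M. incseq (\<lambda>k. F k x) \<and> (\<lambda>k. F k x) \<longlonglongrightarrow> f x"
 from nrearr_SUP[OF this] show "incseq (\<lambda>k. N (nrearr M (F k))) \<and> (\<lambda>k. N (nrearr M (F k))) \<longlonglongrightarrow> N (nrearr M f)"
  by (intro N.fatou AE_I2) auto
next
 let ?u = unit_interval
 interpret N: ri_norm_ui N by (rule ri_norm_ui.intro) fact
 fix E assume E[measurable]: "E \<in> sets M" and fin: "emeasure M E < \<infinity>"
 have "N (nrearr M (indicator E)) \<le> N (indicator (space ?u))"
  by (intro N.norm_mono) (auto simp: nrearr_indicator_le_1[OF E])
 also have "... < \<infinity>" by (intro N.finite_indicator) auto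
 finally show "N (nrearr M (indicator E)) < \<infinity>" .
 obtain C :: real where C: "C > 0" "\<And>f. f \<in> borel_measurable ?u ==> (\<integral>\<^sup>+ x \<in> space ?u. f x \<partial>?u) \<le> ennreal C * N f"
  using N.locally_L1[of "space ?u"] by auto
 let ?c = "measure M (space M)"
 have "(\<integral>\<^sup>+ x \<in> E. f x \<partial>M) \<le> ennreal (?c * C) * N (nrearr M f)" if f[measurable]: "f \<in> borel_measurable M" for f
 proof -
  have "(\<integral>\<^sup>+ x \<in> E. f x \<partial>M) \<le> (\<integral>\<^sup>+ x. f x \<partial>M)" by (intro nn_integral_mono) (auto simp: indicator_def)
  also have "... = ennreal ?c * mean M f"
   using total_pos by (simp add: mean_def emeasure_space_eq ennreal_mult_divide_cancel)
  also have "mean M f = (\<integral>\<^sup>+ t. nrearr M f t \<partial>?u)" using mean_nrearr[OF f, of "\<lambda>x. x"] by simp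
  also have "... = (\<integral>\<^sup>+ t \<in> space ?u. nrearr M f t \<partial>?u)" by (intro nn_integral_cong) auto
  also have "ennreal ?c * ... \<le> ennreal ?c * (ennreal C * N (nrearr M f))" by (intro mult_left_mono C) auto
  also have "... = ennreal (?c * C) * N (nrearr M f)" using C(1) by (simp add: ennreal_mult mult.assoc)
  finally show ?thesis .
 qed
 moreover have "?c * C > 0" using C total_pos by simp
 ultimately show "\<exists>C>0. \<forall>f\<in>borel_measurable M. (\<integral>\<^sup>+ x \<in> E. f x \<partial>M) \<le> ennreal C * N (nrearr M f)" by blast
qed

section \<open>Representation norms\<close>

text \<open>
 The map \<open>T\<close> pushes the normalized measure to Lebesgue measure on \<open>(0,1)\<close>, as \<open>x \<mapsto> (|x|/R)\<^sup>p\<close> does on a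
 weighted ball. Pulling functions back along \<open>T\<close> yields the representation norm directly.
\<close>

locale unit_factor = pos_finite_measure +
 fixes T :: "'a => real"
 assumes T_measurable: "T \<in> measurable M lebesgue"
  and T_push: "\<And>A. A \<in> sets unit_interval ==> measure M {x \<in> space M. T x \<in> A} = measure M (space M) * measure unit_interval A"
begin

definition pull :: "(real => ennreal) => 'a => ennreal" where
 "pull g x = (if T x \<in> {0<..<1} then g (T x) else 0)"

lemma T_sets: "A \<in> sets unit_interval ==> {x \<in> space M. T x \<in> A} \<in> sets M"
proof -
 assume "A \<in> sets unit_interval"
 then have "A \<in> sets lebesgue" by (auto simp: sets_restrict_space_iff)
 from measurable_sets[OF T_measurable this] show ?thesis by (simp add: vimage_def Int_def conj_commute)
qed

lemma pull_measurable [measurable]: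
 assumes "g \<in> borel_measurable unit_interval" shows "pull g \<in> borel_measurable M"
proof (rule borel_measurableI_greater)
 fix y :: ennreal
 have "{t \<in> space unit_interval. y < g t} \<in> sets unit_interval" using assms by measurable
 then have "{x \<in> space M. T x \<in> {t \<in> space unit_interval. y < g t}} \<in> sets M" by (rule T_sets)
 also have "{x \<in> space M. T x \<in> {t \<in> space unit_interval. y < g t}} = {x \<in> space M. y < pull g x}"
  by (auto simp: pull_def)
 finally show "{x \<in> space M. y < pull g x} \<in> sets M" .
qed

lemma ndist_pull:
 assumes [measurable]: "g \<in> borel_measurable unit_interval"
 shows "ndist M (pull g) l = ndist unit_interval g l"
proof -
 have m: "{t \<in> space unit_interval. l < g t} \<in> sets unit_interval" by measurable
 have "{x \<in> space M. l < pull g x} = {x \<in> space M. T x \<in> {t \<in> space unit_interval. l < g t}}"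
  by (auto simp: pull_def)
 then show ?thesis using T_push[OF m] total_pos by (simp add: ndist_def)
qed

lemma AE_pull:
 assumes "AE t in unit_interval. P t"
 shows "AE x in M. T x \<in> {0<..<1} \<longrightarrow> P (T x)"
proof -
 obtain A where A: "A \<in> null_sets unit_interval" "{t \<in> space unit_interval. \<not> P t} \<subseteq> A"
  using assms by (auto simp: eventually_ae_filter)
 have "measure unit_interval A = 0" using A(1) by (simp add: null_sets_def measure_def)
 then have "measure M {x \<in> space M. T x \<in> A} = 0" using T_push A(1) by auto
 then have "{x \<in> space M. T x \<in> A} \<in> null_sets M"
  using T_sets A(1) by (auto simp: null_sets_def emeasure_eq_measure)
 then show ?thesis by (rule AE_I') (use A(2) in auto)
qed

lemma mean_pull:
 assumes [measurable]: "g \<in> borel_measurable unit_interval"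
 shows "mean M (pull g) = (\<integral>\<^sup>+t. g t \<partial>unit_interval)"
 using mean_cong_ndist[OF pos_finite_measure_axioms pos_finite_measure_ui pull_measurable[OF assms] assms ndist_pull[OF assms] measurable_ident]
 by (simp add: mean_ui)

theorem pull_norm_ri:
 assumes X: "ri_function_norm M X"
 shows "ri_function_norm unit_interval (\<lambda>g. X (pull g))"
proof -
 let ?u = unit_interval
 interpret X: ri_function_norm M X by fact
 show ?thesis
 proof
  fix f g :: "real => ennreal"
  assume f[measurable]: "f \<in> borel_measurable ?u"
  show "X (pull f) = 0 \<longleftrightarrow> (AE x in ?u. f x = 0)"
  proof -
   have "X (pull f) = 0 \<longleftrightarrow> (\<integral>\<^sup>+x. pull f x \<partial>M) = 0" by (subst X.zero_iff) (auto simp: nn_integral_0_iff_AE)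
   also have "... \<longleftrightarrow> mean M (pull f) = 0" by (simp add: mean_def divide_ennreal_def)
   also have "... \<longleftrightarrow> (AE x in ?u. f x = 0)" by (simp add: mean_pull nn_integral_0_iff_AE)
   finally show ?thesis .
  qed
  show "X (pull (\<lambda>x. ennreal c * f x)) = ennreal c * X (pull f)" if "c \<ge> 0" for c
  proof -
   have "pull (\<lambda>x. ennreal c * f x) = (\<lambda>x. ennreal c * pull f x)" by (auto simp: pull_def)
   then show ?thesis using that by (simp add: X.homogeneous)
  qed
  assume g[measurable]: "g \<in> borel_measurable ?u"
  show "X (pull (\<lambda>x. f x + g x)) \<le> X (pull f) + X (pull g)"
  proof -
   have "pull (\<lambda>x. f x + g x) = (\<lambda>x. pull f x + pull g x)" by (auto simp: pull_def)
   then show ?thesis by (simp add: X.triangle)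
  qed
  show "X (pull f) \<le> X (pull g)" if "AE x in ?u. f x \<le> g x"
   by (rule X.lattice) (use AE_pull[OF that] in \<open>auto elim!: eventually_mono simp: pull_def\<close>)
  show "X (pull f) = X (pull g)" if "equimeasurable ?u f g"
   using that by (intro X.rearrangement_invariant) (auto simp: equimeasurable_iff_ndist ui.equimeasurable_iff_ndist ndist_pull)
 next
  fix F :: "nat => real => ennreal" and f
  assume [measurable]: "\<And>k. F k \<in> borel_measurable ?u" "f \<in> borel_measurable ?u"
   and ae: "AE x in ?u. incseq (\<lambda>k. F k x) \<and> (\<lambda>k. F k x) \<longlonglongrightarrow> f x"
  show "incseq (\<lambda>k. X (pull (F k))) \<and> (\<lambda>k. X (pull (F k))) \<longlonglongrightarrow> X (pull f)"
   by (rule X.fatou) (use AE_pull[OF ae] in \<open>auto elim!: eventually_mono simp: pull_def incseq_def\<close>)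
 next
  fix E assume E[measurable]: "E \<in> sets ?u"
  have "X (pull (indicator E)) \<le> X (indicator (space M))"
   by (intro X.norm_mono) (auto simp: pull_def indicator_def)
  also have "... < \<infinity>" by (intro X.finite_indicator) (auto simp: emeasure_space_eq)
  finally show "X (pull (indicator E)) < \<infinity>" .
  obtain C :: real where C: "C > 0" "\<And>f. f \<in> borel_measurable M ==> (\<integral>\<^sup>+ x \<in> space M. f x \<partial>M) \<le> ennreal C * X f"
   using X.locally_L1[of "space M"] by (auto simp: emeasure_space_eq)
  let ?c = "measure M (space M)"
  have "(\<integral>\<^sup>+ t \<in> E. f t \<partial>?u) \<le> ennreal (C / ?c) * X (pull f)" if [measurable]: "f \<in> borel_measurable ?u" for f
  proof -
   have "(\<integral>\<^sup>+ t \<in> E. f t \<partial>?u) \<le> (\<integral>\<^sup>+ t. f t \<partial>?u)" by (intro nn_integral_mono) (auto simp: indicator_def)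
   also have "... = (\<integral>\<^sup>+ x. pull f x \<partial>M) / ennreal ?c" by (simp add: mean_pull[symmetric] mean_def emeasure_space_eq)
   also have "(\<integral>\<^sup>+ x. pull f x \<partial>M) = (\<integral>\<^sup>+ x \<in> space M. pull f x \<partial>M)" by (intro nn_integral_cong) auto
   also have "... / ennreal ?c \<le> (ennreal C * X (pull f)) / ennreal ?c" by (intro divide_right_mono_ennreal C) auto
   also have "... = ennreal (C / ?c) * X (pull f)"
    using C total_pos by (simp add: divide_ennreal_def divide_ennreal[symmetric] ac_simps)
   finally show ?thesis .
  qed
  moreover have "C / ?c > 0" using C total_pos by simp
  ultimately show "\<exists>C>0. \<forall>f\<in>borel_measurable ?u. (\<integral>\<^sup>+ t \<in> E. f t \<partial>?u) \<le> ennreal C * X (pull f)" by blast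
 qed
qed

lemma norm_eq_pull_nrearr:
 assumes X: "ri_function_norm M X" and f: "f \<in> borel_measurable M"
 shows "X f = transported_norm M (\<lambda>g. X (pull g)) f"
 unfolding transported_norm_eq
 by (rule ri_function_norm.rearrangement_invariant[OF X f])
  (auto simp: equimeasurable_iff_ndist ndist_pull ndist_nrearr f)

theorem representation_norm:
 assumes X: "ri_function_norm M X"
 shows "ri_function_norm unit_interval (representation_norm M X)"
  "\<And>f. f \<in> borel_measurable M ==> X f = representation_norm M X (nrearr M f)"
proof -
 have "\<exists>N. ri_function_norm unit_interval N \<and> (\<forall>f \<in> borel_measurable M. X f = transported_norm M N f)"
  using pull_norm_ri[OF X] norm_eq_pull_nrearr[OF X] by blast
 from someI_ex[OF this] show "ri_function_norm unit_interval (representation_norm M X)"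
  "\<And>f. f \<in> borel_measurable M ==> X f = representation_norm M X (nrearr M f)"
  by (auto simp: representation_norm_def transported_norm_eq)
qed

lemma norm_pull:
 assumes X: "ri_function_norm M X" and g[measurable]: "g \<in> borel_measurable unit_interval"
 shows "X (pull g) = representation_norm M X g"
proof -
 interpret N: ri_norm_ui "representation_norm M X" by (rule ri_norm_ui.intro, rule representation_norm(1)[OF X])
 have "X (pull g) = representation_norm M X (nrearr M (pull g))" by (rule representation_norm(2)[OF X]) simp
 also have "... = representation_norm M X g"
  by (rule N.rearrangement_invariant) (auto simp: ui.equimeasurable_iff_ndist ndist_nrearr ndist_pull)
 finally show ?thesis .
qed

text \<open>
 Calderon's interpolation principle: what contracts both \<open>L\<^sup>1\<close> and \<open>L\<^sup>\<infinity>\<close> is a contraction in \<open>X\<close>.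
\<close>

lemma norm_le_if_mean_le:
 assumes X: "ri_function_norm M X" and f: "f \<in> borel_measurable M" and g: "g \<in> borel_measurable M"
  and le: "\<And>l. l \<ge> 0 ==> (\<integral>\<^sup>+x. f x - ennreal l \<partial>M) \<le> (\<integral>\<^sup>+x. g x - ennreal l \<partial>M)"
 shows "X f \<le> X g"
proof -
 interpret N: ri_norm_ui "representation_norm M X" by (rule ri_norm_ui.intro, rule representation_norm(1)[OF X])
 show ?thesis unfolding representation_norm(2)[OF X f] representation_norm(2)[OF X g]
 proof (rule N.norm_nrearr_le_if_prim_le[OF pos_finite_measure_axioms f])
  fix s :: real assume s: "0 < s" "s \<le> 1"
  show "prim (nrearr M f) s \<le> prim (nrearr M g) s"
  proof (rule prim_nrearr_mono_mean[OF pos_finite_measure_axioms pos_finite_measure_axioms f g s])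
   fix l :: real assume "0 \<le> l"
   then show "mean M (\<lambda>x. f x - ennreal l) \<le> mean M (\<lambda>x. g x - ennreal l)"
    unfolding mean_def by (intro divide_right_mono_ennreal le)
  qed
 qed simp
qed

end

section \<open>Radial integration\<close>

lemma measure_eqI_atMost:
 fixes M N :: "real measure"
 assumes sets: "sets M = sets borel" "sets N = sets borel"
  and fin: "\<And>x. emeasure M {..x} < \<infinity>" and eq: "\<And>x. emeasure M {..x} = emeasure N {..x}"
 shows "M = N"
proof (rule measure_eqI_generator_eq[where E="range atMost" and \<Omega>=UNIV and A="\<lambda>i. {..real i}"])
 show "Int_stable (range (atMost :: real => _))"
 proof (rule Int_stableI)
  fix a b :: "real set" assume "a \<in> range atMost" "b \<in> range atMost"
  moreover have "{..x} \<inter> {..y} = {..min x y}" for x y :: real by auto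
  ultimately show "a \<inter> b \<in> range atMost" by auto
 qed
 show "sets M = sigma_sets UNIV (range atMost)" "sets N = sigma_sets UNIV (range atMost)"
  using sets by (simp_all add: borel_eq_atMost)
 show "(\<Union>i. {..real i}) = UNIV" using real_arch_simple by auto
 show "emeasure M {..real i} \<noteq> \<infinity>" for i using fin[of "real i"] by simp
qed (use eq in auto)

definition sphere_area :: "nat => real" where
 "sphere_area n = real n * unit_ball_vol (real n)"

lemma nn_integral_powr_from_0:
 assumes p: "p > 0" and c: "0 \<le> c"
 shows "(\<integral>\<^sup>+r. ennreal (r powr (p - 1)) * indicator {0<..<c} r \<partial>lborel) = ennreal (c powr p / p)"
proof -
 have "(\<integral>\<^sup>+r. ennreal (r powr (p - 1)) * indicator {0<..<c} r \<partial>lborel) = (\<integral>\<^sup>+r. ennreal (r powr (p - 1)) * indicator {0..c} r \<partial>lborel)"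
 proof (rule nn_integral_cong_AE)
  have "AE r in lborel. r \<noteq> 0 \<and> r \<noteq> c" by (intro AE_conjI AE_lborel_singleton)
  then show "AE r in lborel. ennreal (r powr (p - 1)) * indicator {0<..<c} r = ennreal (r powr (p - 1)) * indicator {0..c} r"
   by eventually_elim (auto simp: indicator_def)
 qed
 also have "... = ennreal (c powr (p - 1 + 1) / (p - 1 + 1))"
  using has_integral_powr_from_0[of "p - 1" c] p c
  by (intro nn_integral_has_integral_lebesgue') auto
 finally show ?thesis by simp
qed

lemma distr_norm_lborel:
 "distr lborel borel (norm :: 'a::euclidean_space => real) =
  density lborel (\<lambda>r. ennreal (sphere_area DIM('a) * r powr (real DIM('a) - 1)) * indicator {0<..} r)" (is "?M = ?N")
proof (rule measure_eqI_atMost)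
 let ?n = "real DIM('a)"
 have M: "emeasure ?M {..x} = ennreal (unit_ball_vol ?n * x powr ?n * indicator {0..} x)" for x
 proof (cases "x \<ge> 0")
  case True
  have "emeasure ?M {..x} = emeasure lborel (cball (0::'a) x)"
   by (subst emeasure_distr) (auto intro!: arg_cong[where f="emeasure lborel"])
  then show ?thesis using True by (cases "x = 0") (simp_all add: emeasure_cball powr_realpow)
 next
  case False
  then have "norm y \<le> x \<longleftrightarrow> False" for y :: 'a using order_trans[OF norm_ge_zero[of y], of x] by auto
  then show ?thesis using False by (subst emeasure_distr) (auto simp: vimage_def)
 qed
 have N: "emeasure ?N {..x} = ennreal (unit_ball_vol ?n * x powr ?n * indicator {0..} x)" for x
 proof -
  have "emeasure ?N {..x} = (\<integral>\<^sup>+r. ennreal (sphere_area DIM('a)) * (ennreal (r powr (?n - 1)) * indicator {0<..<max 0 x} r) \<partial>lborel)"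
  proof (subst emeasure_density, simp, simp, rule nn_integral_cong_AE)
   have "AE r in lborel. r \<noteq> x" by (rule AE_lborel_singleton)
   then show "AE r in lborel. ennreal (sphere_area DIM('a) * r powr (?n - 1)) * indicator {0<..} r * indicator {..x} r =
     ennreal (sphere_area DIM('a)) * (ennreal (r powr (?n - 1)) * indicator {0<..<max 0 x} r)"
    by eventually_elim (auto simp: indicator_def ennreal_mult sphere_area_def)
  qed
  also have "... = ennreal (sphere_area DIM('a)) * ennreal (max 0 x powr ?n / ?n)"
   by (subst nn_integral_cmult) (auto simp: nn_integral_powr_from_0)
  also have "... = ennreal (unit_ball_vol ?n * x powr ?n * indicator {0..} x)"
   by (auto simp: sphere_area_def ennreal_mult[symmetric] indicator_def max_def)
  finally show ?thesis .
 qed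
 show "emeasure ?M {..x} < \<infinity>" for x by (simp add: M)
 show "emeasure ?M {..x} = emeasure ?N {..x}" for x by (simp only: M N)
qed simp_all

lemma nn_integral_radial:
 assumes [measurable]: "g \<in> borel_measurable borel"
 shows "(\<integral>\<^sup>+x. g (norm (x::'a::euclidean_space)) \<partial>lborel) =
  (\<integral>\<^sup>+r. g r * (ennreal (sphere_area DIM('a) * r powr (real DIM('a) - 1)) * indicator {0<..} r) \<partial>lborel)"
proof -
 have "(\<integral>\<^sup>+x. g (norm (x::'a)) \<partial>lborel) = (\<integral>\<^sup>+r. g r \<partial>distr lborel borel (norm :: 'a => real))"
  by (rule nn_integral_distr[symmetric]) auto
 then show ?thesis unfolding distr_norm_lborel by (simp add: nn_integral_density mult.commute)
qed

lemma borel_measurable_lebesgue_on: "f \<in> borel_measurable borel ==> f \<in> borel_measurable (lebesgue_on S)"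
 by (intro measurable_restrict_space1 measurable_completion) simp

section \<open>The weighted ball\<close>

lemma space_weighted_ball [simp]: "space (weighted_ball \<alpha> R) = ball 0 R"
 by (simp add: weighted_ball_def)

lemma sets_weighted_ball [simp]: "sets (weighted_ball \<alpha> R) = sets (lebesgue_on (ball 0 R))"
 by (simp add: weighted_ball_def)

lemma measurable_weighted_ball [simp]: "measurable (weighted_ball \<alpha> R) N = measurable (lebesgue_on (ball 0 R)) N"
 by (intro measurable_cong_sets) auto

lemma weight_measurable [measurable]: "(\<lambda>x. ennreal (norm x powr \<alpha>)) \<in> borel_measurable (lebesgue_on S)"
 by (intro borel_measurable_lebesgue_on) measurable

lemma nn_integral_weighted_ball:
 "g \<in> borel_measurable (lebesgue_on (ball 0 R)) ==>
  (\<integral>\<^sup>+x. g x \<partial>weighted_ball \<alpha> R) = (\<integral>\<^sup>+x. ennreal (norm x powr \<alpha>) * g x \<partial>lebesgue_on (ball 0 R))"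
 unfolding weighted_ball_def by (rule nn_integral_density[OF weight_measurable])

lemma nn_integral_lebesgue_on_borel:
 assumes [measurable]: "g \<in> borel_measurable borel" "S \<in> sets borel"
 shows "(\<integral>\<^sup>+x. g x \<partial>lebesgue_on S) = (\<integral>\<^sup>+x. g x * indicator S x \<partial>lborel)"
proof -
 have "(\<integral>\<^sup>+x. g x \<partial>lebesgue_on S) = (\<integral>\<^sup>+x. g x * indicator S x \<partial>lebesgue)"
  by (rule nn_integral_restrict_space) simp
 also have "... = (\<integral>\<^sup>+x. g x * indicator S x \<partial>lborel)"
  by (rule nn_integral_completion)
 finally show ?thesis .
qed

lemma nn_integral_weighted_radial:
 fixes R \<alpha> :: real
 assumes [measurable]: "g \<in> borel_measurable borel"
 shows "(\<integral>\<^sup>+x. g (norm (x :: real ^ 'n)) \<partial>weighted_ball \<alpha> R) =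
  (\<integral>\<^sup>+r. g r * (ennreal (sphere_area CARD('n) * r powr (real CARD('n) + \<alpha> - 1)) * indicator {0<..<R} r) \<partial>lborel)"
proof -
 have "(\<integral>\<^sup>+x. g (norm (x :: real ^ 'n)) \<partial>weighted_ball \<alpha> R) = (\<integral>\<^sup>+x. ennreal (norm x powr \<alpha>) * g (norm (x :: real ^ 'n)) \<partial>lebesgue_on (ball 0 R))"
  by (intro nn_integral_weighted_ball borel_measurable_lebesgue_on) measurable
 also have "... = (\<integral>\<^sup>+x. ennreal (norm x powr \<alpha>) * g (norm (x :: real ^ 'n)) * indicator (ball 0 R) x \<partial>lborel)"
  by (rule nn_integral_lebesgue_on_borel) measurable
 also have "... = (\<integral>\<^sup>+x. (\<lambda>r. ennreal (r powr \<alpha>) * g r * indicator {..<R} r) (norm (x :: real ^ 'n)) \<partial>lborel)"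
  by (intro nn_integral_cong) (auto simp: indicator_def)
 also have "... = (\<integral>\<^sup>+r. (ennreal (r powr \<alpha>) * g r * indicator {..<R} r) *
   (ennreal (sphere_area CARD('n) * r powr (real CARD('n) - 1)) * indicator {0<..} r) \<partial>lborel)"
  by (subst nn_integral_radial) auto
 also have "... = (\<integral>\<^sup>+r. g r * (ennreal (sphere_area CARD('n) * r powr (real CARD('n) + \<alpha> - 1)) * indicator {0<..<R} r) \<partial>lborel)"
 proof (intro nn_integral_cong)
  fix r :: real
  have "r powr (real CARD('n) + \<alpha> - 1) = r powr \<alpha> * r powr (real CARD('n) - 1)" by (simp add: powr_add[symmetric] algebra_simps)
  then show "(ennreal (r powr \<alpha>) * g r * indicator {..<R} r) * (ennreal (sphere_area CARD('n) * r powr (real CARD('n) - 1)) * indicator {0<..} r)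
    = g r * (ennreal (sphere_area CARD('n) * r powr (real CARD('n) + \<alpha> - 1)) * indicator {0<..<R} r)"
   by (auto simp: indicator_def sphere_area_def ennreal_mult ac_simps)
 qed
 finally show ?thesis .
qed

lemma AE_lebesgue_on_nonzero: "S \<in> sets lebesgue ==> AE x in lebesgue_on S. x \<noteq> (0 :: 'a::euclidean_space)"
 using AE_completion[OF AE_lborel_singleton[of "0 :: 'a"]]
 by (auto simp: AE_restrict_space_iff elim: eventually_mono)

lemma weighted_ball_zero: "weighted_ball 0 R = lebesgue_on (ball (0 :: real ^ 'n) R)"
proof -
 have "AE x in lebesgue_on (ball (0 :: real ^ 'n) R). x \<noteq> 0" by (rule AE_lebesgue_on_nonzero) simp
 then have "density (lebesgue_on (ball (0 :: real ^ 'n) R)) (\<lambda>x. ennreal (norm x powr 0)) = density (lebesgue_on (ball 0 R)) (\<lambda>_. 1)"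
  by (intro density_cong weight_measurable) (auto elim!: eventually_mono)
 then show ?thesis by (simp add: weighted_ball_def density_1)
qed

lemma complete_measure_lebesgue_on: "S \<in> sets lebesgue ==> complete_measure (lebesgue_on S)"
proof
 fix A B assume S: "S \<in> sets lebesgue" and AB: "B \<subseteq> A" "A \<in> null_sets (lebesgue_on S)"
 then have "A \<in> null_sets lebesgue" "A \<subseteq> S" by (auto simp: null_sets_restrict_space)
 then have "B \<in> null_sets lebesgue" using AB(1) null_sets_completion_subset by blast
 then have "B \<in> sets lebesgue" "B \<subseteq> S" using AB(1) \<open>A \<subseteq> S\<close> by auto
 then show "B \<in> sets (lebesgue_on S)" using S by (simp add: sets_restrict_space_iff)
qed

lemma null_sets_weighted_ball:
 "null_sets (weighted_ball \<alpha> R) = null_sets (lebesgue_on (ball (0 :: real ^ 'n) R))"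
proof -
 have z: "AE x in lebesgue_on (ball (0 :: real ^ 'n) R). x \<noteq> 0" by (rule AE_lebesgue_on_nonzero) simp
 show ?thesis
 proof (intro set_eqI iffI)
  fix A assume "A \<in> null_sets (weighted_ball \<alpha> R :: (real ^ 'n) measure)"
  then have A: "A \<in> sets (lebesgue_on (ball 0 R))" "AE x in lebesgue_on (ball 0 R). x \<in> A \<longrightarrow> x = 0"
   unfolding weighted_ball_def by (simp_all add: null_sets_density_iff[OF weight_measurable])
  from A(2) z have "AE x in lebesgue_on (ball 0 R). x \<notin> A" by eventually_elim auto
  then show "A \<in> null_sets (lebesgue_on (ball 0 R))" using A(1) by (simp add: AE_iff_null_sets)
 next
  fix A assume "A \<in> null_sets (lebesgue_on (ball (0 :: real ^ 'n) R))"
  then have "A \<in> sets (lebesgue_on (ball 0 R))" "AE x in lebesgue_on (ball 0 R). x \<notin> A" by (auto simp: AE_not_in)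
  then show "A \<in> null_sets (weighted_ball \<alpha> R)" unfolding weighted_ball_def
   by (auto simp: null_sets_density_iff[OF weight_measurable] elim: eventually_mono)
 qed
qed

lemma AE_weighted_ball:
 "(AE x in weighted_ball \<alpha> R. P x) \<longleftrightarrow> (AE x in lebesgue_on (ball (0 :: real ^ 'n) R). P x)"
 by (simp add: eventually_ae_filter null_sets_weighted_ball)

lemma complete_measure_weighted_ball: "complete_measure (weighted_ball \<alpha> R :: (real ^ 'n) measure)"
proof -
 interpret complete_measure "lebesgue_on (ball (0 :: real ^ 'n) R)" by (rule complete_measure_lebesgue_on) simp
 show ?thesis by unfold_locales (auto simp: null_sets_weighted_ball intro: complete)
qed

text \<open>
 The share of the weighted mass of the ball that lies closer to the origin than \<open>x\<close>.
\<close>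

definition ball_factor :: "real => real => real ^ 'n => real" where
 "ball_factor \<alpha> R x = (norm x / R) powr (real CARD('n) + \<alpha>)"

lemma ball_factor_borel [measurable]: "ball_factor \<alpha> R \<in> borel_measurable borel"
 unfolding ball_factor_def by measurable

lemma powr_mono_iff: "0 < p ==> 0 \<le> x ==> 0 \<le> y ==> x powr p \<le> y powr p \<longleftrightarrow> x \<le> (y::real)"
 using powr_mono2[of p x y] powr_less_mono2[of p y x] by (cases "x \<le> y") auto

lemma emeasure_weighted_ball_Collect:
 fixes R \<alpha> :: real
 assumes R: "R > 0" and \<alpha>: "\<alpha> \<ge> 0" and r: "0 \<le> r" "r \<le> R"
 shows "emeasure (weighted_ball \<alpha> R) {x \<in> ball (0 :: real ^ 'n) R. norm x \<le> r} =
  ennreal (sphere_area CARD('n) / (real CARD('n) + \<alpha>) * r powr (real CARD('n) + \<alpha>))"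
proof -
 let ?p = "real CARD('n) + \<alpha>"
 have p: "?p > 0" using \<alpha> by (simp add: add_pos_nonneg)
 have m: "{x \<in> ball (0 :: real ^ 'n) R. norm x \<le> r} \<in> sets (lebesgue_on (ball 0 R))"
  by (auto simp: sets_restrict_space image_iff intro!: bexI[of _ "{x \<in> ball (0 :: real ^ 'n) R. norm x \<le> r}"])
 have "emeasure (weighted_ball \<alpha> R) {x \<in> ball (0 :: real ^ 'n) R. norm x \<le> r} = (\<integral>\<^sup>+x. indicator {..r} (norm (x :: real ^ 'n)) \<partial>weighted_ball \<alpha> R)"
 proof -
  have "(\<integral>\<^sup>+x. indicator {..r} (norm (x :: real ^ 'n)) \<partial>weighted_ball \<alpha> R) =
   (\<integral>\<^sup>+x. indicator {x \<in> ball (0 :: real ^ 'n) R. norm x \<le> r} x \<partial>weighted_ball \<alpha> R)"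
   by (intro nn_integral_cong) (auto simp: indicator_def)
  also have "... = emeasure (weighted_ball \<alpha> R) {x \<in> ball (0 :: real ^ 'n) R. norm x \<le> r}"
   by (rule nn_integral_indicator) (use m in simp)
  finally show ?thesis by simp
 qed
 also have "... = (\<integral>\<^sup>+s. indicator {..r} s * (ennreal (sphere_area CARD('n) * s powr (?p - 1)) * indicator {0<..<R} s) \<partial>lborel)"
  by (rule nn_integral_weighted_radial) simp
 also have "... = (\<integral>\<^sup>+s. ennreal (sphere_area CARD('n)) * (ennreal (s powr (?p - 1)) * indicator {0<..<r} s) \<partial>lborel)"
 proof (rule nn_integral_cong_AE)
  have "AE s in lborel. s \<noteq> r" by (rule AE_lborel_singleton)
  then show "AE s in lborel. indicator {..r} s * (ennreal (sphere_area CARD('n) * s powr (?p - 1)) * indicator {0<..<R} s) =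
   ennreal (sphere_area CARD('n)) * (ennreal (s powr (?p - 1)) * indicator {0<..<r} s)"
   by eventually_elim (use r in \<open>auto simp: indicator_def ennreal_mult sphere_area_def\<close>)
 qed
 also have "... = ennreal (sphere_area CARD('n)) * ennreal (r powr ?p / ?p)"
  using p r by (subst nn_integral_cmult) (auto simp: nn_integral_powr_from_0)
 finally show ?thesis using p by (simp add: ennreal_mult[symmetric] sphere_area_def)
qed

lemma sphere_area_pos: "n > 0 ==> sphere_area n > 0"
 by (simp add: sphere_area_def)

lemma pos_finite_measure_weighted_ball:
 assumes R: "R > 0" and \<alpha>: "\<alpha> \<ge> 0"
 shows "pos_finite_measure (weighted_ball \<alpha> R :: (real ^ 'n) measure)"
  "measure (weighted_ball \<alpha> R) (ball (0 :: real ^ 'n) R) = sphere_area CARD('n) / (real CARD('n) + \<alpha>) * R powr (real CARD('n) + \<alpha>)"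
proof -
 have p: "real CARD('n) + \<alpha> > 0" using \<alpha> by (simp add: add_pos_nonneg)
 have eq: "{x \<in> ball (0 :: real ^ 'n) R. norm x \<le> R} = ball 0 R" by auto
 have em: "emeasure (weighted_ball \<alpha> R) (ball (0 :: real ^ 'n) R) = ennreal (sphere_area CARD('n) / (real CARD('n) + \<alpha>) * R powr (real CARD('n) + \<alpha>))"
  using emeasure_weighted_ball_Collect[OF R \<alpha>, of R, where 'n='n] R unfolding eq by simp
 have pos: "sphere_area CARD('n) / (real CARD('n) + \<alpha>) * R powr (real CARD('n) + \<alpha>) > 0"
  using R p sphere_area_pos[of "CARD('n)"] by simp
 show meas: "measure (weighted_ball \<alpha> R) (ball (0 :: real ^ 'n) R) = sphere_area CARD('n) / (real CARD('n) + \<alpha>) * R powr (real CARD('n) + \<alpha>)"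
  using pos unfolding measure_def em by simp
 show "pos_finite_measure (weighted_ball \<alpha> R :: (real ^ 'n) measure)"
 proof (intro pos_finite_measure.intro finite_measureI pos_finite_measure_axioms.intro)
  show "emeasure (weighted_ball \<alpha> R :: (real ^ 'n) measure) (space (weighted_ball \<alpha> R)) \<noteq> \<infinity>"
   unfolding space_weighted_ball em by simp
  show "0 < measure (weighted_ball \<alpha> R :: (real ^ 'n) measure) (space (weighted_ball \<alpha> R))"
   unfolding space_weighted_ball meas by (rule pos)
 qed
qed

theorem unit_factor_ball:
 fixes R \<alpha> :: real
 assumes R: "R > 0" and \<alpha>: "\<alpha> \<ge> 0"
 shows "unit_factor (weighted_ball \<alpha> R :: (real ^ 'n) measure) (ball_factor \<alpha> R)"
proof -
 let ?W = "weighted_ball \<alpha> R :: (real ^ 'n) measure" and ?T = "ball_factor \<alpha> R :: real ^ 'n => real"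
 let ?p = "real CARD('n) + \<alpha>"
 have p: "?p > 0" using \<alpha> by (simp add: add_pos_nonneg)
 interpret W: pos_finite_measure ?W by (rule pos_finite_measure_weighted_ball[OF assms])
 interpret WC: complete_measure ?W by (rule complete_measure_weighted_ball)
 let ?c = "measure ?W (space ?W)"
 have Tm0[measurable, simp]: "?T \<in> borel_measurable (lebesgue_on (ball 0 R))"
  by (rule borel_measurable_lebesgue_on[OF ball_factor_borel])
 have Tm[measurable]: "?T \<in> measurable ?W borel" by simp
 have eq: "distr ?W borel ?T = density lborel (\<lambda>t. ennreal ?c * indicator {0<..<1} t)" (is "?D = ?E")
 proof (rule measure_eqI_atMost)
  have D: "emeasure ?D {..t} = ennreal (?c * max 0 (min 1 t))" for t
  proof -
   have "emeasure ?D {..t} = emeasure ?W {x \<in> ball 0 R. ?T x \<le> t}"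
    by (subst emeasure_distr) (auto intro!: arg_cong[where f="emeasure ?W"])
   also have "... = ennreal (?c * max 0 (min 1 t))"
   proof (cases "t < 0")
    case True
    have "\<not> ?T x \<le> t" for x
     using True powr_ge_zero[of "norm x / R" ?p] unfolding ball_factor_def by linarith
    then have e: "{x \<in> ball 0 R. ?T x \<le> t} = {}" by blast
    show ?thesis unfolding e using True by simp
   next
    case False
    define r where "r = R * min 1 t powr (1 / ?p)"
    have t: "0 \<le> min 1 t" "min 1 t \<le> 1" using False by auto
    have r: "0 \<le> r" "r \<le> R" using t R p powr_mono2[of "1 / ?p" "min 1 t" 1] by (auto simp: r_def mult_le_cancel_left1)
    have rp: "(r / R) powr ?p = min 1 t" using R p t by (simp add: r_def powr_powr)
    have "{x \<in> ball 0 R. ?T x \<le> t} = {x \<in> ball (0 :: real ^ 'n) R. norm x \<le> r}"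
    proof (intro Collect_cong conj_cong refl)
     fix x :: "real ^ 'n" assume "x \<in> ball 0 R"
     then have "norm x / R \<le> 1" using R by simp
     then have "(norm x / R) powr ?p \<le> 1" using R p powr_mono2[of ?p "norm x / R" 1] by simp
     then have "?T x \<le> t \<longleftrightarrow> (norm x / R) powr ?p \<le> (r / R) powr ?p" unfolding rp by (auto simp: ball_factor_def)
     also have "... \<longleftrightarrow> norm x / R \<le> r / R" using R r p by (intro powr_mono_iff) auto
     finally show "?T x \<le> t \<longleftrightarrow> norm x \<le> r" using R by (simp add: divide_le_cancel)
    qed
    also have "emeasure ?W ... = ennreal (sphere_area CARD('n) / ?p * r powr ?p)"
     by (rule emeasure_weighted_ball_Collect[OF assms r])
    also have "r powr ?p = R powr ?p * min 1 t" using rp R r by (simp add: powr_divide field_simps)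
    finally show ?thesis using t by (simp add: pos_finite_measure_weighted_ball(2)[OF assms] mult.assoc)
   qed
   finally show ?thesis .
  qed
  have E: "emeasure ?E {..t} = ennreal (?c * max 0 (min 1 t))" for t
  proof -
   have "emeasure ?E {..t} = (\<integral>\<^sup>+s. ennreal ?c * indicator ({0<..<1} \<inter> {..t}) s \<partial>lborel)"
    by (subst emeasure_density) (auto intro!: nn_integral_cong simp: indicator_def)
   also have "... = ennreal ?c * emeasure lborel ({0<..<1} \<inter> {..t})" by (subst nn_integral_cmult_indicator) auto
   also have "emeasure lborel ({0<..<1} \<inter> {..t}) = ennreal (max 0 (min 1 t))"
   proof -
    have "{0<..<1} \<inter> {..t} = (if t < 1 then {0<..t} else {0<..<1})" by auto
    then show ?thesis by (cases "0 \<le> t") (auto simp: max_def min_def)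
   qed
   finally show ?thesis by (simp add: ennreal_mult)
  qed
  show "emeasure ?D {..t} < \<infinity>" for t by (simp add: D)
  show "emeasure ?D {..t} = emeasure ?E {..t}" for t by (simp only: D E)
 qed simp_all
 have push: "emeasure ?W (?T -` A \<inter> ball 0 R) = ennreal ?c * emeasure lborel (A \<inter> {0<..<1})" if [measurable]: "A \<in> sets borel" for A
 proof -
  have "emeasure ?W (?T -` A \<inter> space ?W) = emeasure ?D A" by (rule emeasure_distr[symmetric]) auto
  also have "... = emeasure ?E A" by (simp only: eq)
  also have "... = (\<integral>\<^sup>+s. ennreal ?c * indicator (A \<inter> {0<..<1}) s \<partial>lborel)"
   by (subst emeasure_density) (auto intro!: nn_integral_cong simp: indicator_def)
  also have "... = ennreal ?c * emeasure lborel (A \<inter> {0<..<1})" by (subst nn_integral_cmult_indicator) auto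
  finally show ?thesis by simp
 qed
 have null: "?T -` A \<inter> space ?W \<in> null_sets ?W" if A: "A \<in> null_sets lborel" for A
 proof -
  have [measurable]: "A \<in> sets borel" using A by auto
  have "A \<inter> {0<..<1} \<in> null_sets lborel" using A by (intro null_set_Int2) auto
  then have "emeasure ?W (?T -` A \<inter> ball 0 R) = 0" by (simp add: push null_setsD1)
  moreover have "?T -` A \<inter> space ?W \<in> sets ?W" by (rule measurable_sets[OF Tm]) simp
  ultimately show ?thesis by auto
 qed
 show ?thesis
 proof
  show TL: "?T \<in> measurable ?W lebesgue"
  proof (rule WC.measurable_completion2)
   show TL: "?T \<in> measurable ?W lborel" using Tm by (simp add: measurable_def)
   show "null_sets lborel \<subseteq> null_sets (distr ?W lborel ?T)"
   proof
    fix A assume A: "A \<in> null_sets (lborel :: real measure)"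
    then have "A \<in> sets lborel" by (rule null_setsD2)
    then show "A \<in> null_sets (distr ?W lborel ?T)" using null[OF A] by (simp only: null_sets_distr_iff[OF TL])
   qed
  qed
  fix A :: "real set" assume "A \<in> sets unit_interval"
  then have A: "A \<in> sets lebesgue" "A \<subseteq> {0<..<1}" by (auto simp: sets_restrict_space_iff)
  obtain S N N' where S: "A = S \<union> N" "N \<subseteq> N'" "N' \<in> null_sets lborel" "S \<in> sets lborel"
   by (rule sets_completionE[OF A(1)])
  have Sb: "S \<in> sets borel" using S by simp
  have S01: "S \<inter> {0<..<1} = S" using S A by auto
  have N0: "?T -` N' \<inter> space ?W \<in> null_sets ?W" by (rule null[OF S(3)])
  have "emeasure ?W {x \<in> space ?W. ?T x \<in> A} = emeasure ?W (?T -` S \<inter> ball 0 R)"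
  proof (rule emeasure_eq_AE)
   show "AE x in ?W. (x \<in> {x \<in> space ?W. ?T x \<in> A}) = (x \<in> ?T -` S \<inter> ball 0 R)"
    by (rule AE_I'[OF N0]) (use S in auto)
   show "{x \<in> space ?W. ?T x \<in> A} \<in> sets ?W" using measurable_sets[OF TL A(1)] by (simp add: vimage_def Int_def conj_commute)
   show "?T -` S \<inter> ball 0 R \<in> sets ?W" using measurable_sets[OF Tm Sb] by simp
  qed
  also have "... = ennreal ?c * emeasure lborel S" using push[OF Sb] by (simp only: S01)
  also have "emeasure lborel S = emeasure lebesgue A"
  proof -
   have "emeasure lebesgue A = emeasure lebesgue S"
   proof (rule emeasure_eq_AE)
    have "N' \<in> null_sets lebesgue" using S(3) by (rule null_sets_completionI)
    then show "AE x in lebesgue. (x \<in> A) = (x \<in> S)" by (rule AE_I') (use S in auto)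
   qed (use A S in auto)
   then show ?thesis using S(4) by simp
  qed
  also have "emeasure lebesgue A = emeasure unit_interval A" using A(2) by (simp add: emeasure_ui)
  finally show "measure ?W {x \<in> space ?W. ?T x \<in> A} = measure ?W (space ?W) * measure unit_interval A"
   by (simp add: measure_def enn2real_mult del: space_weighted_ball)
 qed
qed

section \<open>The target norm\<close>

lemma prim_cmult: "a \<in> borel_measurable unit_interval ==> prim (\<lambda>t. ennreal c * a t) s = ennreal c * prim a s"
 unfolding prim_def by (subst nn_integral_cmult[symmetric]) (auto simp: mult.assoc)

lemma prim_mono: "(\<And>t. 0 < t ==> t < 1 ==> a t \<le> b t) ==> prim a s \<le> prim b s"
 unfolding prim_def by (intro nn_integral_mono mult_right_mono) auto

lemma prim_cong: "(\<And>t. 0 < t ==> t < 1 ==> a t = b t) ==> prim a s = prim b s"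
 unfolding prim_def by (intro nn_integral_cong) auto

lemma prim_mono_upper: "s \<le> t ==> prim a s \<le> prim a t"
 unfolding prim_def by (intro nn_integral_mono mult_left_mono) (auto simp: indicator_def)

lemma prim_borel [measurable]: "prim a \<in> borel_measurable borel"
proof (rule borel_measurableI_greater)
 fix y
 have "is_interval {x. y < prim a x}"
  unfolding is_interval_1 using prim_mono_upper[of _ _ a] less_le_trans by blast
 then have "{x. y < prim a x} \<in> sets borel" by (rule real_interval_borel_measurable)
 then show "{x \<in> space borel. y < prim a x} \<in> sets borel" by simp
qed

lemma maximal_rearrangement_ui:
 assumes "s \<le> 1"
 shows "maximal_rearrangement unit_interval g s = ennreal (1 / s) * prim (nrearr unit_interval g) s"
proof -
 have "(\<integral>\<^sup>+ x \<in> {0<..<s}. rearrangement unit_interval g x \<partial>lebesgue) =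
  (\<integral>\<^sup>+ x. (nrearr unit_interval g x * indicator {0<..<s} x) * indicator {0<..<1} x \<partial>lebesgue)"
  using assms by (intro nn_integral_cong) (auto simp: nrearr_ui_restrict indicator_def)
 also have "... = prim (nrearr unit_interval g) s"
  unfolding prim_def by (rule nn_integral_restrict_space[symmetric]) simp
 finally show ?thesis by (simp add: maximal_rearrangement_def)
qed

text \<open>
 Concavity of \<open>\<integral>\<^sub>0\<^sup>s g\<^sup>*\<close> in the form that is needed: \<open>g\<^sup>*\<close> decreases.
\<close>

lemma prim_nrearr_scale:
 assumes g: "g \<in> borel_measurable unit_interval" and l: "0 < l" "l \<le> 1" and s: "0 \<le> s" "s \<le> 1"
 shows "ennreal l * prim (nrearr unit_interval g) s \<le> prim (nrearr unit_interval g) (l * s)"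
proof -
 let ?g = "nrearr unit_interval g"
 have e: "prim ?g s = (\<integral>\<^sup>+t. ?g t * indicator {0<..<s} t \<partial>lborel)" if "0 \<le> s" "s \<le> 1" for s
  unfolding prim_def using that by (subst nn_integral_lebesgue_on_borel) (auto intro!: nn_integral_cong simp: indicator_def)
 have ls: "0 \<le> l * s" "l * s \<le> 1" using l s by (auto intro: mult_le_one)
 have "prim ?g (l * s) = (\<integral>\<^sup>+t. ?g t * indicator {0<..<l * s} t \<partial>lborel)" by (rule e[OF ls])
 also have "... = ennreal l * (\<integral>\<^sup>+t. ?g (0 + l * t) * indicator {0<..<l * s} (0 + l * t) \<partial>lborel)"
  using l by (subst nn_integral_real_affine[where c=l and t=0]) auto
 finally have 1: "prim ?g (l * s) = ennreal l * (\<integral>\<^sup>+t. ?g (0 + l * t) * indicator {0<..<l * s} (0 + l * t) \<partial>lborel)" .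
 have "prim ?g s \<le> (\<integral>\<^sup>+t. ?g (0 + l * t) * indicator {0<..<l * s} (0 + l * t) \<partial>lborel)"
  unfolding e[OF s]
 proof (rule nn_integral_mono)
  fix t
  show "?g t * indicator {0<..<s} t \<le> ?g (0 + l * t) * indicator {0<..<l * s} (0 + l * t)"
  proof (cases "t \<in> {0<..<s}")
   case True
   then have "l * t \<le> t" using l by (simp add: mult_left_le_one_le)
   then have "?g t \<le> ?g (l * t)" by (rule nrearr_antimono)
   then show ?thesis using True l by auto
  qed simp
 qed
 then show ?thesis unfolding 1 by (rule mult_left_mono) simp
qed

lemma prim_nrearr_ge_average:
 assumes g: "g \<in> borel_measurable unit_interval" and s: "0 < s" "s < 1"
 shows "ennreal s * (\<integral>\<^sup>+t. g t \<partial>unit_interval) \<le> prim (nrearr unit_interval g) s"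
proof -
 have "(\<integral>\<^sup>+t. g t \<partial>unit_interval) = (\<integral>\<^sup>+t. nrearr unit_interval g t \<partial>unit_interval)"
  using ui.mean_nrearr[OF g, of "\<lambda>x. x"] by (simp add: mean_ui)
 also have "... = prim (nrearr unit_interval g) 1"
  unfolding prim_def by (intro nn_integral_cong) simp
 finally show ?thesis using prim_nrearr_scale[OF g, of s 1] s by simp
qed

locale target_setting =
 fixes m :: nat and n \<alpha> R :: real and X :: "(real ^ 'n => ennreal) => ennreal"
 assumes n_eq: "n = real CARD('n)" and m_pos: "m \<ge> 1" and n_ge_2: "CARD('n) \<ge> 2" and \<alpha>_nonneg: "\<alpha> \<ge> 0" and R_pos: "R > 0"
  and X_ri: "ri_function_norm (lebesgue_on (ball 0 R)) X"
begin

abbreviation Xbar where "Xbar \<equiv> representation_norm (lebesgue_on (ball 0 R)) X"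
abbreviation T_assoc where "T_assoc \<equiv> target_associate m \<alpha> R X"
abbreviation Wb :: "(real ^ 'n) measure" where "Wb \<equiv> weighted_ball \<alpha> R"
abbreviation Lb :: "(real ^ 'n) measure" where "Lb \<equiv> lebesgue_on (ball 0 R)"

lemma n_pos: "n > 0" "n \<ge> 2" using n_ge_2 by (auto simp: n_eq)

text \<open>
 The function inside the norm that defines the target, with \<open>g\<^sup>*\<^sup>*\<close> written through \<open>\<integral>\<^sub>0\<^sup>s g\<^sup>*\<close>.
\<close>

definition theta :: "(real => ennreal) => real => ennreal" where
 "theta g t = ennreal (t powr (real m / n - 1)) * prim (nrearr unit_interval g) (t powr ((n + \<alpha>) / n))"

sublocale L: unit_factor Lb "ball_factor 0 R"
 using unit_factor_ball[OF R_pos, of 0] by (simp add: weighted_ball_zero)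

sublocale W: unit_factor Wb "ball_factor \<alpha> R"
 using unit_factor_ball[OF R_pos \<alpha>_nonneg] .

sublocale Xb: ri_norm_ui Xbar
 by (rule ri_norm_ui.intro, rule L.representation_norm(1)[OF X_ri])

sublocale Xa: ri_norm_ui "associate_norm unit_interval Xbar"
 by (rule ri_norm_ui.intro, rule Xb.associate_norm_ri)

lemma theta_measurable [measurable]: "theta g \<in> borel_measurable borel"
 unfolding theta_def by measurable

lemma theta_measurable_ui [measurable]: "theta g \<in> borel_measurable unit_interval"
 by (intro borel_measurable_ui theta_measurable)

lemma powr_lt_1: "0 < t ==> t < 1 ==> 0 < p ==> t powr p < (1::real)"
 using powr_less_mono2[of p t 1] by simp

lemma exponent_pos: "(n + \<alpha>) / n > 0" using n_pos \<alpha>_nonneg by (intro divide_pos_pos) auto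

lemma T_assoc_eq: "T_assoc g = associate_norm unit_interval Xbar (theta g)"
proof -
 have "ennreal (t powr ((real m + \<alpha>) / n)) * maximal_rearrangement unit_interval g (t powr ((n + \<alpha>) / n)) = theta g t"
  if t: "0 < t" "t < 1" for t
 proof -
  have "t powr ((n + \<alpha>) / n) \<le> 1" using powr_lt_1[OF t exponent_pos] by simp
  then have "ennreal (t powr ((real m + \<alpha>) / n)) * maximal_rearrangement unit_interval g (t powr ((n + \<alpha>) / n)) =
   ennreal (t powr ((real m + \<alpha>) / n)) * ennreal (1 / t powr ((n + \<alpha>) / n)) * prim (nrearr unit_interval g) (t powr ((n + \<alpha>) / n))"
   by (simp add: maximal_rearrangement_ui mult.assoc)
  also have "ennreal (t powr ((real m + \<alpha>) / n)) * ennreal (1 / t powr ((n + \<alpha>) / n)) = ennreal (t powr (real m / n - 1))"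
  proof -
   have "t powr ((real m + \<alpha>) / n) * (1 / t powr ((n + \<alpha>) / n)) = t powr ((real m + \<alpha>) / n - (n + \<alpha>) / n)"
    using t by (simp add: powr_diff)
   also have "(real m + \<alpha>) / n - (n + \<alpha>) / n = real m / n - 1" using n_pos by (simp add: field_simps)
   finally show ?thesis by (simp flip: ennreal_mult)
  qed
  finally show ?thesis by (simp add: theta_def)
 qed
 then show ?thesis
  unfolding target_associate_def associate_norm_def n_eq[symmetric]
  by (intro SUP_cong refl nn_integral_cong) auto
qed

text \<open>
 Most axioms are inherited from the associate norm of \<open>X\<close> through \<open>g \<mapsto> \<theta>\<^sub>g\<close>. Definiteness and local
 integrability follow from \<open>\<integral>\<^sub>0\<^sup>s g\<^sup>* \<ge> s \<integral> g\<close>, and indicators are mapped to bounded functions since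
 \<open>m + \<alpha> \<ge> 0\<close>.
\<close>

theorem T_assoc_ri: "ri_function_norm unit_interval T_assoc"
proof
 let ?u = unit_interval
 define b where "b = (n + \<alpha>) / n"
 have b: "b > 0" using exponent_pos by (simp add: b_def)
 have tb: "0 < t powr b" "t powr b < 1" if "0 < t" "t < 1" for t using that powr_lt_1[OF that b] by auto
 have th: "theta g t = ennreal (t powr (real m / n - 1)) * prim (nrearr ?u g) (t powr b)" for g t
  by (simp add: theta_def b_def)
 fix f g :: "real => ennreal"
 assume f[measurable]: "f \<in> borel_measurable ?u"
 show "T_assoc (\<lambda>x. ennreal c * f x) = ennreal c * T_assoc f" if c: "c \<ge> 0" for c
 proof -
  have "prim (nrearr ?u (\<lambda>x. ennreal c * f x)) s = ennreal c * prim (nrearr ?u f) s" for s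
  proof -
   have "prim (nrearr ?u (\<lambda>x. ennreal c * f x)) s = prim (\<lambda>t. ennreal c * nrearr ?u f t) s"
    by (rule prim_cong) (simp add: ui.nrearr_cmult[OF f c])
   then show ?thesis by (simp add: prim_cmult)
  qed
  then have "theta (\<lambda>x. ennreal c * f x) = (\<lambda>t. ennreal c * theta f t)"
   by (auto simp: th ac_simps)
  then show ?thesis by (simp add: T_assoc_eq associate_norm_cmult)
 qed
 assume g[measurable]: "g \<in> borel_measurable ?u"
 show "T_assoc (\<lambda>x. f x + g x) \<le> T_assoc f + T_assoc g"
 proof -
  have "T_assoc (\<lambda>x. f x + g x) \<le> associate_norm ?u Xbar (\<lambda>t. theta f t + theta g t)"
   unfolding T_assoc_eq
  proof (rule Xa.norm_mono)
   fix t assume "t \<in> space ?u"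
   then have "prim (nrearr ?u (\<lambda>x. f x + g x)) (t powr b) \<le> prim (nrearr ?u f) (t powr b) + prim (nrearr ?u g) (t powr b)"
    using tb[of t] by (intro ui.prim_nrearr_add_le f g) auto
   then show "theta (\<lambda>x. f x + g x) t \<le> theta f t + theta g t"
    unfolding th distrib_left[symmetric] by (rule mult_left_mono) simp
  qed auto
  also have "... \<le> T_assoc f + T_assoc g" unfolding T_assoc_eq by (rule Xa.triangle) auto
  finally show ?thesis .
 qed
 show "T_assoc f \<le> T_assoc g" if "AE x in ?u. f x \<le> g x"
  unfolding T_assoc_eq
  by (rule Xa.norm_mono) (auto simp: th intro!: mult_left_mono prim_mono nrearr_mono_AE f g that)
 show "T_assoc f = T_assoc g" if "equimeasurable ?u f g"
  using nrearr_equimeasurable[OF that] by (simp add: T_assoc_eq theta_def[abs_def])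
next
 let ?u = unit_interval
 fix F :: "nat => real => ennreal" and f
 assume F[measurable]: "\<And>k. F k \<in> borel_measurable ?u" "f \<in> borel_measurable ?u"
  and ae: "AE x in ?u. incseq (\<lambda>k. F k x) \<and> (\<lambda>k. F k x) \<longlonglongrightarrow> f x"
 have nr: "incseq (\<lambda>k. nrearr ?u (F k) t) \<and> (\<lambda>k. nrearr ?u (F k) t) \<longlonglongrightarrow> nrearr ?u f t" if "t \<ge> 0" for t
  using ui.nrearr_SUP[OF F ae that] .
 have pinc: "incseq (\<lambda>k. prim (nrearr ?u (F k)) s)" for s
  by (rule incseq_SucI, rule prim_mono) (use nr in \<open>auto simp: incseq_Suc_iff\<close>)
 have plim: "(\<lambda>k. prim (nrearr ?u (F k)) s) \<longlonglongrightarrow> prim (nrearr ?u f) s" for s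
 proof -
  have "prim (nrearr ?u f) s = (\<integral>\<^sup>+t. (SUP k. nrearr ?u (F k) t * indicator {0<..<s} t) \<partial>?u)"
   unfolding prim_def
  proof (rule nn_integral_cong)
   fix t assume "t \<in> space ?u"
   then have "(SUP k. nrearr ?u (F k) t) = nrearr ?u f t" using nr[of t] by (intro LIMSEQ_incseq_SUP) auto
   then show "nrearr ?u f t * indicator {0<..<s} t = (SUP k. nrearr ?u (F k) t * indicator {0<..<s} t)"
    by (simp flip: SUP_mult_right_ennreal)
  qed
  also have "... = (SUP k. prim (nrearr ?u (F k)) s)"
   unfolding prim_def
  proof (rule nn_integral_monotone_convergence_SUP_AE)
   fix k show "AE t in ?u. nrearr ?u (F k) t * indicator {0<..<s} t \<le> nrearr ?u (F (Suc k)) t * indicator {0<..<s} t"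
    using nr by (intro AE_I2 mult_right_mono) (auto simp: incseq_Suc_iff)
  qed simp
  finally show ?thesis using LIMSEQ_SUP[OF pinc, of s] by simp
 qed
 show "incseq (\<lambda>k. T_assoc (F k)) \<and> (\<lambda>k. T_assoc (F k)) \<longlonglongrightarrow> T_assoc f"
  unfolding T_assoc_eq
 proof (rule Xa.fatou)
  show "AE t in ?u. incseq (\<lambda>k. theta (F k) t) \<and> (\<lambda>k. theta (F k) t) \<longlonglongrightarrow> theta f t"
   unfolding theta_def
  proof (intro AE_I2 conjI)
   fix t
   show "incseq (\<lambda>k. ennreal (t powr (real m / n - 1)) * prim (nrearr ?u (F k)) (t powr ((n + \<alpha>) / n)))"
    using pinc[of "t powr ((n + \<alpha>) / n)"] by (auto simp: incseq_def intro!: mult_left_mono)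
   show "(\<lambda>k. ennreal (t powr (real m / n - 1)) * prim (nrearr ?u (F k)) (t powr ((n + \<alpha>) / n))) \<longlonglongrightarrow>
    ennreal (t powr (real m / n - 1)) * prim (nrearr ?u f) (t powr ((n + \<alpha>) / n))"
    by (intro ennreal_tendsto_cmult plim) simp
  qed
 qed auto
next
 let ?u = unit_interval
 fix E assume E[measurable]: "E \<in> sets ?u"
 have "T_assoc (indicator E) \<le> associate_norm ?u Xbar (indicator (space ?u))"
  unfolding T_assoc_eq
 proof (rule Xa.norm_mono)
  fix t assume "t \<in> space ?u"
  then have t: "0 < t" "t < 1" by auto
  let ?b = "(n + \<alpha>) / n"
  have tb: "0 \<le> t powr ?b" "t powr ?b \<le> 1" using powr_lt_1[OF t exponent_pos] by auto
  have "prim (nrearr ?u (indicator E)) (t powr ?b) \<le> prim (\<lambda>_. 1) (t powr ?b)"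
   by (rule prim_mono) (simp add: ui.nrearr_indicator_le_1[OF E])
  also have "... = ennreal (t powr ?b)" using tb by (simp add: prim_const)
  finally have "theta (indicator E) t \<le> ennreal (t powr (real m / n - 1)) * ennreal (t powr ?b)"
   unfolding theta_def by (intro mult_left_mono) auto
  also have "... = ennreal (t powr (real m / n + \<alpha> / n))"
   using n_pos by (simp add: ennreal_mult[symmetric] powr_add[symmetric] add_divide_distrib)
  also have "... \<le> ennreal 1"
  proof (rule ennreal_leI)
   have "0 \<le> real m / n + \<alpha> / n" using n_pos \<alpha>_nonneg by simp
   then show "t powr (real m / n + \<alpha> / n) \<le> 1" using t powr_mono2[of "real m / n + \<alpha> / n" t 1] by simp
  qed
  finally show "theta (indicator E) t \<le> indicator (space ?u) t" using t by simp
 qed auto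
 also have "... < \<infinity>" by (rule Xa.finite_indicator) auto
 finally show "T_assoc (indicator E) < \<infinity>" .
next
 let ?u = unit_interval
 have "Xbar (indicator (space ?u)) < \<infinity>" by (rule Xb.finite_indicator) auto
 then obtain k where k: "k > 0" "Xbar (indicator (space ?u)) \<le> ennreal k"
  by (cases "Xbar (indicator (space ?u))")
   (auto intro!: that[of "enn2real (Xbar (indicator (space ?u))) + 1"] ennreal_leI add_nonneg_pos)
 have Xk: "Xbar (\<lambda>x. ennreal (1/k) * indicator (space ?u) x) \<le> 1"
 proof -
  have "Xbar (\<lambda>x. ennreal (1/k) * indicator (space ?u) x) = ennreal (1/k) * Xbar (indicator (space ?u))"
   using k by (intro Xb.homogeneous) auto
  also have "... \<le> ennreal (1/k) * ennreal k" by (intro mult_left_mono k) simp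
  also have "... = 1" using k by (simp flip: ennreal_mult)
  finally show ?thesis .
 qed
 define q where "q = real m / n + \<alpha> / n"
 have q: "q > 0" using n_pos \<alpha>_nonneg m_pos by (simp add: q_def add_pos_nonneg)
 have key: "ennreal (1 / (k * (q + 1))) * (\<integral>\<^sup>+t. f t \<partial>?u) \<le> T_assoc f" if f[measurable]: "f \<in> borel_measurable ?u" for f
 proof -
  have i: "(\<integral>\<^sup>+t. ennreal (t powr q) \<partial>?u) = ennreal (1 / (q + 1))"
  proof -
   have "(\<integral>\<^sup>+t. ennreal (t powr q) \<partial>?u) = (\<integral>\<^sup>+t. ennreal (t powr (q + 1 - 1)) * indicator {0<..<1} t \<partial>lborel)"
    by (subst nn_integral_lebesgue_on_borel) auto
   also have "... = ennreal (1 powr (q + 1) / (q + 1))" by (rule nn_integral_powr_from_0) (use q in auto)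
   finally show ?thesis by simp
  qed
  have "ennreal (1 / (k * (q + 1))) * (\<integral>\<^sup>+t. f t \<partial>?u) = ennreal (1/k) * (\<integral>\<^sup>+t. f t \<partial>?u) * (\<integral>\<^sup>+t. ennreal (t powr q) \<partial>?u)"
   using k q by (simp add: i ennreal_mult[symmetric] ac_simps) (simp add: mult.assoc[symmetric] ennreal_mult[symmetric] mult.commute)
  also have "... = (\<integral>\<^sup>+t. ennreal (1/k) * (\<integral>\<^sup>+t. f t \<partial>?u) * ennreal (t powr q) \<partial>?u)"
   by (rule nn_integral_cmult[symmetric]) (intro borel_measurable_ui, measurable)
  also have "... \<le> (\<integral>\<^sup>+t. ennreal (1/k) * indicator (space ?u) t * theta f t \<partial>?u)"
  proof (rule nn_integral_mono)
   fix t assume "t \<in> space ?u"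
   then have t: "0 < t" "t < 1" by auto
   let ?b = "(n + \<alpha>) / n"
   have tb: "0 < t powr ?b" "t powr ?b < 1" using powr_lt_1[OF t exponent_pos] t by auto
   have "(\<integral>\<^sup>+t. f t \<partial>?u) * ennreal (t powr q) = ennreal (t powr (real m / n - 1)) * (ennreal (t powr ?b) * (\<integral>\<^sup>+t. f t \<partial>?u))"
    using n_pos by (simp add: mult.assoc[symmetric] ennreal_mult[symmetric] powr_add[symmetric] q_def add_divide_distrib mult.commute add.commute)
   also have "... \<le> theta f t"
    unfolding theta_def by (intro mult_left_mono prim_nrearr_ge_average f tb) simp
   finally show "ennreal (1/k) * (\<integral>\<^sup>+t. f t \<partial>?u) * ennreal (t powr q) \<le> ennreal (1/k) * indicator (space ?u) t * theta f t"
    using t mult_left_mono[of _ _ "ennreal (1/k)"] by (simp add: mult.assoc)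
  qed
  also have "... \<le> T_assoc f" unfolding T_assoc_eq
  proof (rule associate_norm_upper)
   show "(\<lambda>t. ennreal (1/k) * indicator (space ?u) t) \<in> borel_measurable ?u" by measurable
  qed (rule Xk)
  finally show ?thesis .
 qed
 define C where "C = k * (q + 1)"
 have C: "C > 0" using k q by (simp add: C_def)
 have key': "(\<integral>\<^sup>+t. f t \<partial>?u) \<le> ennreal C * T_assoc f" if "f \<in> borel_measurable ?u" for f
 proof -
  have "(\<integral>\<^sup>+t. f t \<partial>?u) = ennreal C * (ennreal (1 / C) * (\<integral>\<^sup>+t. f t \<partial>?u))"
   using C by (simp add: mult.assoc[symmetric] ennreal_mult[symmetric])
  also have "... \<le> ennreal C * T_assoc f" unfolding C_def by (intro mult_left_mono key that) simp
  finally show ?thesis .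
 qed
 have zero: "T_assoc f = 0 \<longleftrightarrow> (AE x in ?u. f x = 0)" if f[measurable]: "f \<in> borel_measurable ?u" for f
 proof
  assume "T_assoc f = 0"
  then have "(\<integral>\<^sup>+t. f t \<partial>?u) = 0" using key'[OF f] by simp
  then show "AE x in ?u. f x = 0" by (simp add: nn_integral_0_iff_AE)
 next
  assume "AE x in ?u. f x = 0"
  then have "(\<integral>\<^sup>+t. f t \<partial>?u) = 0" by (simp add: nn_integral_0_iff_AE)
  then have z: "(\<integral>\<^sup>+t. nrearr ?u f t \<partial>?u) = 0" using ui.mean_nrearr[OF f, of "\<lambda>x. x"] by (simp add: mean_ui)
  have "prim (nrearr ?u f) s \<le> (\<integral>\<^sup>+t. nrearr ?u f t \<partial>?u)" for s
   unfolding prim_def by (intro nn_integral_mono) (auto simp: indicator_def)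
  then have "theta f = (\<lambda>_. 0)" using z by (auto simp: theta_def)
  then show "T_assoc f = 0" by (simp add: T_assoc_eq)
 qed
 show "T_assoc f = 0 \<longleftrightarrow> (AE x in ?u. f x = 0)" if "f \<in> borel_measurable ?u" for f by (rule zero[OF that])
 fix E assume E[measurable]: "E \<in> sets ?u"
 have "(\<integral>\<^sup>+ t \<in> E. f t \<partial>?u) \<le> ennreal C * T_assoc f" if f: "f \<in> borel_measurable ?u" for f
 proof -
  have "(\<integral>\<^sup>+ t \<in> E. f t \<partial>?u) \<le> (\<integral>\<^sup>+ t. f t \<partial>?u)" by (intro nn_integral_mono) (auto simp: indicator_def)
  also have "... \<le> ennreal C * T_assoc f" by (rule key'[OF f])
  finally show ?thesis .
 qed
 then show "\<exists>C>0. \<forall>f\<in>borel_measurable ?u. (\<integral>\<^sup>+ t \<in> E. f t \<partial>?u) \<le> ennreal C * T_assoc f" using C by blast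
qed

sublocale Ta: ri_norm_ui T_assoc by (rule ri_norm_ui.intro, rule T_assoc_ri)

lemma bidual_le:
 assumes "ri_function_norm unit_interval N" and f: "f \<in> borel_measurable unit_interval"
 shows "associate_norm unit_interval (associate_norm unit_interval N) f \<le> N f"
proof (rule associate_norm_least)
 interpret N: ri_norm_ui N by (rule ri_norm_ui.intro) fact
 fix g assume g: "g \<in> borel_measurable unit_interval" "associate_norm unit_interval N g \<le> 1"
 have "(\<integral>\<^sup>+x. g x * f x \<partial>unit_interval) = (\<integral>\<^sup>+x. f x * g x \<partial>unit_interval)" by (simp add: mult.commute)
 also have "... \<le> N f * associate_norm unit_interval N g" by (rule N.hoelder[OF N.ui_fin f g(1)])
 also have "... \<le> N f" using mult_left_mono[OF g(2), of "N f"] by simp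
 finally show "(\<integral>\<^sup>+x. g x * f x \<partial>unit_interval) \<le> N f" .
qed

abbreviation target01 where "target01 \<equiv> target_norm_01 m \<alpha> R X"
abbreviation target where "target \<equiv> target_norm m \<alpha> R X"
abbreviation Sob where "Sob \<equiv> radial_sobolev_space (ball 0 R) m X"
abbreviation Sob_norm where "Sob_norm \<equiv> sobolev_norm (ball 0 R) m X"

text \<open>
 By duality, the associate norm of the functional is a norm with the prescribed associate.
\<close>

theorem target_norm_01:
 "ri_function_norm unit_interval target01"
 "\<And>g. g \<in> borel_measurable unit_interval ==> associate_norm unit_interval target01 g = T_assoc g"
proof -
 have "\<exists>N. ri_function_norm unit_interval N \<and> (\<forall>g \<in> borel_measurable unit_interval. associate_norm unit_interval N g = T_assoc g)"
  using Ta.associate_norm_ri Ta.lorentz_luxemburg bidual_le[OF T_assoc_ri] by (intro exI[of _ "associate_norm unit_interval T_assoc"]) (auto intro: antisym)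
 from someI_ex[OF this] show "ri_function_norm unit_interval target01"
  "\<And>g. g \<in> borel_measurable unit_interval ==> associate_norm unit_interval target01 g = T_assoc g"
  by (auto simp: target_norm_01_def)
qed

sublocale Tn: ri_norm_ui "target01" by (rule ri_norm_ui.intro, rule target_norm_01)

theorem target_norm_ri: "ri_function_norm Wb target"
 unfolding target_norm_def by (rule W.transported_norm_ri[OF target_norm_01(1)])

lemma target_norm_eq: "target u = target01 (nrearr Wb u)"
 by (simp add: target_norm_def transported_norm_eq)

end

section \<open>Smooth functions\<close>

text \<open>
 Being \<open>k\<close> times differentiable along coordinate directions. The recursion on the order makes closure
 properties provable by induction.
\<close>

primrec Ck :: "nat => ('a::euclidean_space => real) => bool" where
 "Ck 0 f = True"
| "Ck (Suc k) f = ((\<forall>x. f differentiable (at x)) \<and> (\<forall>b\<in>Basis. Ck k (\<lambda>x. frechet_derivative f (at x) b)))"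

definition smooth :: "('a::euclidean_space => real) => bool" where
 "smooth f \<longleftrightarrow> (\<forall>k. Ck k f)"

lemma Ck_SucI:
 assumes "\<And>x. (f has_derivative D x) (at x)" and "\<And>b. b \<in> Basis ==> Ck k (\<lambda>x. D x b)"
 shows "Ck (Suc k) f"
proof -
 have "frechet_derivative f (at x) = D x" for x using frechet_derivative_at[OF assms(1)] by simp
 then show ?thesis using assms by (auto simp: differentiable_def)
qed

lemma Ck_Suc_has_derivative: "Ck (Suc k) f ==> (f has_derivative frechet_derivative f (at x)) (at x)"
 by (simp add: frechet_derivative_works)

lemma Ck_Suc_partial: "Ck (Suc k) f ==> b \<in> Basis ==> Ck k (\<lambda>x. frechet_derivative f (at x) b)"
 by simp

lemma Ck_Suc_imp: "Ck (Suc k) f ==> Ck k f"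
proof (induction k arbitrary: f)
 case (Suc k)
 then show ?case by (metis Ck.simps(2))
qed simp

lemma smooth_has_derivative: "smooth f ==> (f has_derivative frechet_derivative f (at x)) (at x)"
 using Ck_Suc_has_derivative[of 0 f x] by (simp add: smooth_def)

lemma smooth_partial: "smooth f ==> b \<in> Basis ==> smooth (\<lambda>x. frechet_derivative f (at x) b)"
 unfolding smooth_def using Ck_Suc_partial by blast

lemma smooth_continuous: "smooth f ==> continuous_on S f"
 by (intro continuous_at_imp_continuous_on ballI has_derivative_continuous[OF smooth_has_derivative])

lemma Ck_const: "Ck k (\<lambda>_. c)"
proof (induction k arbitrary: c)
 case (Suc k)
 show ?case by (rule Ck_SucI[where D="\<lambda>_ _. 0"]) (use Suc in \<open>auto intro: has_derivative_const\<close>)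
qed simp

lemma Ck_add: "Ck k f ==> Ck k g ==> Ck k (\<lambda>x. f x + g x)"
proof (induction k arbitrary: f g)
 case (Suc k)
 show ?case
  by (rule Ck_SucI[where D="\<lambda>x h. frechet_derivative f (at x) h + frechet_derivative g (at x) h"])
   (use Suc in \<open>auto intro!: has_derivative_add Ck_Suc_has_derivative[of k]\<close>)
qed simp

lemma Ck_mult: "Ck k f ==> Ck k g ==> Ck k (\<lambda>x. f x * g x)"
proof (induction k arbitrary: f g)
 case (Suc k)
 show ?case
 proof (rule Ck_SucI)
  show "((\<lambda>x. f x * g x) has_derivative (\<lambda>h. f x * frechet_derivative g (at x) h + frechet_derivative f (at x) h * g x)) (at x)" for x
   using Suc.prems by (intro has_derivative_mult Ck_Suc_has_derivative[of k])
  fix b :: 'a assume b: "b \<in> Basis"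
  show "Ck k (\<lambda>x. f x * frechet_derivative g (at x) b + frechet_derivative f (at x) b * g x)"
   using Suc.prems b by (intro Ck_add Suc.IH Ck_Suc_imp[of k f] Ck_Suc_imp[of k g] Ck_Suc_partial[of k])
 qed
qed simp

lemma Ck_inner: "Ck k (\<lambda>x. x \<bullet> c)"
proof (cases k)
 case (Suc k)
 show ?thesis unfolding Suc
  by (rule Ck_SucI[where D="\<lambda>_ h. h \<bullet> c"]) (auto intro!: Ck_const bounded_linear_imp_has_derivative bounded_linear_inner_left)
qed simp

lemma Ck_compose:
 fixes \<phi> :: "real => real"
 shows "Ck k \<phi> ==> Ck k g ==> Ck k (\<lambda>x. \<phi> (g x))"
proof (induction k arbitrary: \<phi> g)
 case (Suc k)
 show ?case
 proof (rule Ck_SucI)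
  fix x
  have lin: "frechet_derivative \<phi> (at y) h = h * frechet_derivative \<phi> (at y) 1" for y h
  proof -
   have "linear (frechet_derivative \<phi> (at y))"
    using Ck_Suc_has_derivative[OF Suc.prems(1)] by (rule has_derivative_linear)
   then show ?thesis using linear_cmul[of "frechet_derivative \<phi> (at y)" h 1] by simp
  qed
  have "((\<lambda>x. \<phi> (g x)) has_derivative (\<lambda>h. frechet_derivative \<phi> (at (g x)) (frechet_derivative g (at x) h))) (at x)"
   by (rule has_derivative_compose[OF Ck_Suc_has_derivative[OF Suc.prems(2)] Ck_Suc_has_derivative[OF Suc.prems(1)]])
  then show "((\<lambda>x. \<phi> (g x)) has_derivative (\<lambda>h. frechet_derivative g (at x) h * frechet_derivative \<phi> (at (g x)) 1)) (at x)"
   by (simp add: lin[symmetric])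
 next
  fix b :: 'a assume b: "b \<in> Basis"
  have "Ck k (\<lambda>x. frechet_derivative \<phi> (at x) 1)" using Ck_Suc_partial[OF Suc.prems(1), of 1] by simp
  from Suc.IH[OF this Ck_Suc_imp[OF Suc.prems(2)]]
  show "Ck k (\<lambda>x. frechet_derivative g (at x) b * frechet_derivative \<phi> (at (g x)) 1)"
   by (intro Ck_mult Ck_Suc_partial[OF Suc.prems(2) b])
 qed
qed simp

lemma smooth_const: "smooth (\<lambda>_. c)" by (simp add: smooth_def Ck_const)
lemma smooth_add: "smooth f ==> smooth g ==> smooth (\<lambda>x. f x + g x)" by (simp add: smooth_def Ck_add)
lemma smooth_mult: "smooth f ==> smooth g ==> smooth (\<lambda>x. f x * g x)" by (simp add: smooth_def Ck_mult)
lemma smooth_inner: "smooth (\<lambda>x. x \<bullet> c)" by (simp add: smooth_def Ck_inner)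
lemma smooth_compose: "smooth \<phi> ==> smooth g ==> smooth (\<lambda>x. \<phi> (g x))" for \<phi> :: "real => real"
 by (simp add: smooth_def Ck_compose)
lemma smooth_diff: "smooth f ==> smooth g ==> smooth (\<lambda>x. f x - g x)"
 using smooth_add[of f "\<lambda>x. (-1) * g x"] smooth_mult[OF smooth_const[of "-1"], of g] by simp
lemma smooth_power: "smooth f ==> smooth (\<lambda>x. f x ^ k)"
 by (induction k) (simp_all add: smooth_const smooth_mult)
lemma smooth_prod: "(\<And>i. i \<in> I ==> smooth (f i)) ==> smooth (\<lambda>x. \<Prod>i\<in>I. f i x)"
 by (induction I rule: infinite_finite_induct) (simp_all add: smooth_const smooth_mult)
lemma smooth_sum: "(\<And>i. i \<in> I ==> smooth (f i)) ==> smooth (\<lambda>x. \<Sum>i\<in>I. f i x)"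
 by (induction I rule: infinite_finite_induct) (simp_all add: smooth_const smooth_add)
lemma smooth_prod_list: "(\<And>i. i \<in> set is ==> smooth (f i)) ==> smooth (\<lambda>x. \<Prod>i\<leftarrow>is. f i x)"
 by (induction "is") (simp_all add: smooth_const smooth_mult)

lemma Ck_has_real_derivative:
 fixes f :: "real => real"
 assumes "Ck (Suc k) f" shows "(f has_real_derivative frechet_derivative f (at x) 1) (at x)"
proof -
 have d: "(f has_derivative frechet_derivative f (at x)) (at x)" by (rule Ck_Suc_has_derivative[OF assms])
 have "frechet_derivative f (at x) h = frechet_derivative f (at x) 1 * h" for h
  using linear_cmul[OF has_derivative_linear[OF d], of h 1] by (simp add: mult.commute)
 then have "frechet_derivative f (at x) = (*) (frechet_derivative f (at x) 1)" by blast
 then show ?thesis using d unfolding has_field_derivative_def by simp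
qed

lemma frechet_derivative_real: "Ck (Suc k) f ==> frechet_derivative f (at x) 1 = deriv f x" for f :: "real => real"
 by (rule DERIV_imp_deriv[symmetric], rule Ck_has_real_derivative)

lemma smooth_real_has_derivative:
 fixes f :: "real => real"
 assumes "smooth f" shows "(f has_real_derivative deriv f x) (at x)"
proof -
 have "Ck (Suc 0) f" using assms unfolding smooth_def by blast
 then show ?thesis using Ck_has_real_derivative[of 0 f x] frechet_derivative_real[of 0 f x] by simp
qed

lemma Ck_realI:
 fixes f f' :: "real => real"
 assumes "\<And>x. (f has_real_derivative f' x) (at x)" "Ck k f'"
 shows "Ck (Suc k) f"
 by (rule Ck_SucI[where D="\<lambda>x h. f' x * h"]) (use assms in \<open>auto simp: has_field_derivative_def\<close>)

lemma smooth_realI: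
 fixes f f' :: "real => real"
 assumes "\<And>x. (f has_real_derivative f' x) (at x)" "smooth f'"
 shows "smooth f"
 unfolding smooth_def
proof
 fix k show "Ck k f" using Ck_realI[OF assms(1), of "k"] assms(2) Ck_Suc_imp[of k f] by (simp add: smooth_def)
qed

lemma Ck_real_deriv: "Ck (Suc k) f ==> Ck k (deriv f)" for f :: "real => real"
proof -
 assume a: "Ck (Suc k) f"
 have "frechet_derivative f (at x) 1 = deriv f x" for x by (rule frechet_derivative_real[OF a])
 then show ?thesis using Ck_Suc_partial[OF a, of 1] by simp
qed

lemma smooth_deriv: "smooth f ==> smooth (deriv f)" for f :: "real => real"
 unfolding smooth_def using Ck_real_deriv by blast

text \<open>
 The family \<open>x\<^sup>-\<^sup>j e\<^bsup>-1/x\<^esup>\<close> extended by zero: it is closed under differentiation up to linear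
 combinations.
\<close>

definition ebump :: "nat => real => real" where
 "ebump j x = (if x > 0 then exp (- (1 / x)) * (1 / x) ^ j else 0)"

lemma ebump_tendsto_0: "(ebump j \<longlongrightarrow> 0) (at 0)"
proof -
 have "((\<lambda>x. (inverse x) ^ j / exp (inverse x)) \<longlongrightarrow> (0::real)) (at_right 0)"
  using filterlim_compose[OF tendsto_power_div_exp_0 filterlim_inverse_at_top_right] .
 then have r: "(ebump j \<longlongrightarrow> 0) (at_right 0)"
  by (rule Lim_transform_eventually) (auto simp: eventually_at_right_field ebump_def exp_minus inverse_eq_divide intro!: exI[of _ 1])
 have l: "(ebump j \<longlongrightarrow> 0) (at_left 0)"
  by (rule tendsto_eventually) (auto simp: eventually_at_left_field ebump_def intro!: exI[of _ "-1"])
 show ?thesis using l r by (rule filterlim_split_at)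
qed

lemma ebump_deriv: "(ebump j has_real_derivative (ebump (j + 2) x - real j * ebump (j + 1) x)) (at x)"
proof -
 consider "x > 0" | "x < 0" | "x = 0" by linarith
 then show ?thesis
 proof cases
  case 1
  have "((\<lambda>x. exp (- (1 / x)) * (1 / x) ^ j) has_real_derivative (ebump (j + 2) x - real j * ebump (j + 1) x)) (at x)"
   using 1 by (auto intro!: derivative_eq_intros simp: ebump_def power2_eq_square field_simps)
    (cases j; auto simp: field_simps)
  then show ?thesis
   by (rule has_field_derivative_transform_within_open[of _ _ _ "{0<..}"]) (use 1 in \<open>auto simp: ebump_def\<close>)
 next
  case 2
  have "((\<lambda>x. 0) has_real_derivative 0) (at x)" by simp
  then have "(ebump j has_real_derivative 0) (at x)"
   by (rule has_field_derivative_transform_within_open[of _ _ _ "{..<0}"]) (use 2 in \<open>auto simp: ebump_def\<close>)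
  then show ?thesis using 2 by (simp add: ebump_def)
 next
  case 3
  have "((\<lambda>y. (ebump j y - ebump j 0) / (y - 0)) \<longlongrightarrow> 0) (at 0)"
  proof (rule Lim_transform_eventually[OF ebump_tendsto_0[of "Suc j"]])
   show "eventually (\<lambda>y. ebump (Suc j) y = (ebump j y - ebump j 0) / (y - 0)) (at 0)"
    by (auto simp: eventually_at ebump_def field_simps intro!: exI[of _ 1])
  qed
  then show ?thesis using 3 by (simp add: has_field_derivative_iff ebump_def)
 qed
qed

lemma smooth_ebump: "smooth (ebump j)"
 unfolding smooth_def
proof
 fix k show "Ck k (ebump j)"
 proof (induction k arbitrary: j)
  case (Suc k)
  have "Ck k (\<lambda>x. ebump (j + 2) x + (- real j) * ebump (j + 1) x)"
   by (intro Ck_add Ck_mult Ck_const Suc)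
  then show ?case by (intro Ck_realI[OF ebump_deriv]) simp
 qed simp
qed

definition ball_bump :: "'a::euclidean_space => real => 'a => real" where
 "ball_bump w r x = ebump 0 (r\<^sup>2 - (x - w) \<bullet> (x - w))"

lemma smooth_ball_bump: "smooth (ball_bump w r)"
proof -
 have "(\<lambda>x. r\<^sup>2 - (x - w) \<bullet> (x - w)) = (\<lambda>x. r\<^sup>2 - (\<Sum>b\<in>Basis. (x \<bullet> b - w \<bullet> b) * (x \<bullet> b - w \<bullet> b)))"
  by (subst euclidean_inner) (simp add: inner_diff_left)
 moreover have "smooth (\<lambda>x. r\<^sup>2 - (\<Sum>b\<in>Basis. (x \<bullet> b - w \<bullet> b) * (x \<bullet> b - w \<bullet> b)))"
  by (intro smooth_diff smooth_const smooth_sum smooth_mult smooth_inner)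
 ultimately show ?thesis unfolding ball_bump_def[abs_def] using smooth_compose[OF smooth_ebump] by metis
qed

lemma ball_bump_bounds: "0 \<le> ball_bump w r x" "ball_bump w r x \<le> 1"
 by (auto simp: ball_bump_def ebump_def)

lemma ball_bump_pos_iff: "r \<ge> 0 ==> ball_bump w r x > 0 \<longleftrightarrow> x \<in> ball w r"
proof -
 assume r: "r \<ge> 0"
 have "ball_bump w r x > 0 \<longleftrightarrow> (x - w) \<bullet> (x - w) < r\<^sup>2" by (auto simp: ball_bump_def ebump_def)
 also have "... \<longleftrightarrow> (norm (x - w))\<^sup>2 < r\<^sup>2" by (simp add: power2_norm_eq_inner)
 also have "... \<longleftrightarrow> x \<in> ball w r" using r by (simp add: dist_norm norm_minus_commute power_strict_mono abs_le_square_iff not_le[symmetric])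
 finally show ?thesis .
qed

text \<open>
 Cover the complement of \<open>C\<close> by countably many balls with bumps \<open>b\<^sub>j\<close>, let \<open>b\<close> be a bump of a ball
 around \<open>C\<close>, and take \<open>(1 - (1 - b)\<^bsup>k+1\<^esup>) \<Prod>\<^bsub>j<k\<^esub> (1 - b\<^sub>j)\<^sup>k\<close>: the first factor tends to 1 inside that ball,
 the product is 1 on \<open>C\<close> and tends to 0 elsewhere.
\<close>

theorem smooth_approx_indicator:
 fixes C :: "'a::euclidean_space set"
 assumes C: "compact C" "C \<subseteq> ball z R"
 obtains \<phi> :: "nat => 'a => real" and r where "r < R" "\<And>k. smooth (\<phi> k)" "\<And>k x. 0 \<le> \<phi> k x" "\<And>k x. \<phi> k x \<le> 1"
  "\<And>k x. x \<notin> cball z r ==> \<phi> k x = 0" "\<And>x. (\<lambda>k. \<phi> k x) \<longlonglongrightarrow> indicator C x"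
proof (cases "C = {}")
 case True
 then show ?thesis using that[of "R - 1" "\<lambda>_ _. 0"] by (simp add: smooth_const)
next
 case False
 have "\<exists>x\<in>C. \<forall>y\<in>C. dist z y \<le> dist z x"
  by (rule continuous_attains_sup[OF C(1) False]) (intro continuous_intros)
 then obtain x0 where x0: "x0 \<in> C" "\<And>y. y \<in> C ==> dist z y \<le> dist z x0" by auto
 define r where "r = (dist z x0 + R) / 2"
 have dR: "dist z x0 < R" using x0 C by auto
 have r: "0 \<le> r" "r < R" "dist z x0 < r"
  using dR zero_le_dist[of z x0] unfolding r_def by (simp_all del: zero_le_dist)
 have Cr: "C \<subseteq> ball z r" using x0(2) r(3) by force
 define \<F> where "\<F> = {B. \<exists>w s. s \<ge> 0 \<and> B = ball w s \<and> B \<inter> C = {}}"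
 obtain \<F>' where F': "\<F>' \<subseteq> \<F>" "countable \<F>'" "\<Union>\<F>' = \<Union>\<F>"
  using Lindelof[of \<F>] by (auto simp: \<F>_def)
 have un: "\<Union>\<F> = - C"
 proof -
  have "x \<in> \<Union>\<F>" if "x \<notin> C" for x
  proof -
   have "open (- C)" using C(1) by (simp add: compact_imp_closed open_Compl)
   moreover have "x \<in> - C" using that by simp
   ultimately obtain e where e: "e > 0" "ball x e \<subseteq> - C" by (rule openE)
   have "e \<ge> 0 \<and> ball x e = ball x e \<and> ball x e \<inter> C = {}" using e by auto
   then have "ball x e \<in> \<F>" unfolding \<F>_def by blast
   moreover have "x \<in> ball x e" using e by simp
   ultimately have "ball x e \<in> \<F>" "x \<in> ball x e" .
   then show ?thesis by blast
  qed
  then show ?thesis by (auto simp: \<F>_def)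
 qed
 have "(0::real) \<ge> 0 \<and> {} = ball (0::'a) 0 \<and> {} \<inter> C = {}" by simp
 then have "{} \<in> \<F>" unfolding \<F>_def by blast
 define D where "D = from_nat_into (insert {} \<F>')"
 have D: "D j \<in> \<F>" for j
  using from_nat_into[of "insert {} \<F>'" j] F'(1) \<open>{} \<in> \<F>\<close> by (auto simp: D_def)
 have Drange: "range D = insert {} \<F>'" unfolding D_def using F'(2) by (intro range_from_nat_into) auto
 have "\<forall>j. \<exists>p. snd p \<ge> 0 \<and> D j = ball (fst p) (snd p)"
 proof
  fix j
  obtain w s where "s \<ge> 0" "D j = ball w s" using D[of j] unfolding \<F>_def by blast
  then show "\<exists>p. snd p \<ge> 0 \<and> D j = ball (fst p) (snd p)" by (intro exI[of _ "(w, s)"]) simp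
 qed
 from choice[OF this] obtain p where p: "\<And>j. snd (p j) \<ge> 0" "\<And>j. D j = ball (fst (p j)) (snd (p j))" by blast
 define \<beta> where "\<beta> j x = ball_bump (fst (p j)) (snd (p j)) x" for j x
 have \<beta>: "0 \<le> \<beta> j x" "\<beta> j x \<le> 1" "\<beta> j x > 0 \<longleftrightarrow> x \<in> D j" for j x
 proof -
  show "0 \<le> \<beta> j x" "\<beta> j x \<le> 1" unfolding \<beta>_def by (rule ball_bump_bounds)+
  show "\<beta> j x > 0 \<longleftrightarrow> x \<in> D j" unfolding \<beta>_def p(2)[of j] by (rule ball_bump_pos_iff[OF p(1)])
 qed
 define \<gamma> where "\<gamma> x = ball_bump z r x" for x
 have \<gamma>: "0 \<le> \<gamma> x" "\<gamma> x \<le> 1" "\<gamma> x > 0 \<longleftrightarrow> x \<in> ball z r" for x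
 proof -
  show "0 \<le> \<gamma> x" "\<gamma> x \<le> 1" unfolding \<gamma>_def by (rule ball_bump_bounds)+
  show "\<gamma> x > 0 \<longleftrightarrow> x \<in> ball z r" unfolding \<gamma>_def by (rule ball_bump_pos_iff[OF r(1)])
 qed
 define \<phi> where "\<phi> k x = (1 - (1 - \<gamma> x) ^ Suc k) * (\<Prod>j<k. (1 - \<beta> j x) ^ k)" for k x
 have prod01: "0 \<le> (\<Prod>j<k. (1 - \<beta> j x) ^ k)" "(\<Prod>j<k. (1 - \<beta> j x) ^ k) \<le> 1" for k x
  using \<beta> by (auto intro!: prod_nonneg prod_le_1 power_le_one)
 have g01: "0 \<le> 1 - (1 - \<gamma> x) ^ k" "1 - (1 - \<gamma> x) ^ k \<le> 1" for k x
  using \<gamma>(1,2)[of x] power_le_one[of "1 - \<gamma> x" k] by auto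
 show ?thesis
 proof (rule that[of r \<phi>])
  show "r < R" by fact
  show "smooth (\<phi> k)" for k
   unfolding \<phi>_def[abs_def] \<gamma>_def \<beta>_def
   by (intro smooth_mult smooth_diff smooth_const smooth_power smooth_prod smooth_ball_bump)
  show "0 \<le> \<phi> k x" for k x unfolding \<phi>_def by (intro mult_nonneg_nonneg prod01 g01)
  show "\<phi> k x \<le> 1" for k x unfolding \<phi>_def by (intro mult_le_one g01 prod01)
  show "\<phi> k x = 0" if "x \<notin> cball z r" for k x
  proof -
   have "\<gamma> x = 0" using that \<gamma>(1,3)[of x] by force
   then show ?thesis by (simp add: \<phi>_def)
  qed
  show "(\<lambda>k. \<phi> k x) \<longlonglongrightarrow> indicator C x" for x
  proof (cases "x \<in> C")
   case True
   have "\<gamma> x > 0" using True Cr \<gamma>(3) by auto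
   then have "(\<lambda>k. (1 - \<gamma> x) ^ Suc k) \<longlonglongrightarrow> 0"
    using \<gamma>(2)[of x] by (intro LIMSEQ_Suc LIMSEQ_power_zero) auto
   then have "(\<lambda>k. 1 - (1 - \<gamma> x) ^ Suc k) \<longlonglongrightarrow> 1 - 0" by (intro tendsto_intros)
   moreover have "\<beta> j x = 0" for j
   proof -
    have "x \<notin> D j" using D[of j] True by (auto simp: \<F>_def)
    then show ?thesis using \<beta>(1,3)[of j x] by auto
   qed
   ultimately show ?thesis using True by (simp add: \<phi>_def)
  next
   case False
   then have "x \<in> \<Union>\<F>'" using un F'(3) by auto
   then obtain j0 where j0: "x \<in> D j0" using Drange by (metis UnionE insertI2 rangeE)
   then have b: "0 < \<beta> j0 x" using \<beta>(3) by auto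
   have lim: "(\<lambda>k. (1 - \<beta> j0 x) ^ k) \<longlonglongrightarrow> 0"
    using b \<beta>(2)[of j0 x] by (intro LIMSEQ_power_zero) auto
   have up: "eventually (\<lambda>k. \<phi> k x \<le> (1 - \<beta> j0 x) ^ k) sequentially"
    using eventually_gt_at_top[of j0]
   proof eventually_elim
    case (elim k)
    have "\<phi> k x \<le> 1 * (\<Prod>j<k. (1 - \<beta> j x) ^ k)"
     unfolding \<phi>_def by (intro mult_right_mono g01 prod01)
    also have "... = (1 - \<beta> j0 x) ^ k * (\<Prod>j\<in>{..<k} - {j0}. (1 - \<beta> j x) ^ k)"
     using elim by (simp add: prod.remove[of _ j0])
    also have "... \<le> (1 - \<beta> j0 x) ^ k * 1"
     using \<beta> by (intro mult_left_mono prod_le_1) (auto intro!: power_le_one)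
    finally show ?case by simp
   qed
   have low: "eventually (\<lambda>k. 0 \<le> \<phi> k x) sequentially"
    unfolding \<phi>_def by (intro always_eventually allI mult_nonneg_nonneg prod01 g01)
   have "(\<lambda>k. \<phi> k x) \<longlonglongrightarrow> 0" by (rule tendsto_sandwich[OF low up tendsto_const lim])
   then show ?thesis using False by simp
  qed
 qed
qed

lemma partials_Nil [simp]: "partials [] f = f" by (simp add: partials_def)
lemma partials_Cons: "partials (i # is) f = (\<lambda>x. frechet_derivative (partials is f) (at x) (axis i 1))"
 by (simp add: partials_def)
lemma partials_append: "partials (is @ js) f = partials is (partials js f)"
 by (simp add: partials_def)

lemma smooth_partials: "smooth f ==> smooth (partials is f)"
 by (induction "is") (auto simp: partials_Cons axis_in_Basis_iff intro!: smooth_partial)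

lemma smooth_differentiable: "smooth f ==> f differentiable (at x)"
 by (rule differentiableI[OF smooth_has_derivative])

lemma test_functionI:
 assumes "smooth \<phi>" and "\<And>x. x \<notin> K ==> \<phi> x = 0" and "compact K" "K \<subseteq> \<Omega>"
 shows "test_function \<Omega> \<phi>"
proof -
 have "{x. \<phi> x \<noteq> 0} \<subseteq> K" using assms(2) by auto
 then have cl: "closure {x. \<phi> x \<noteq> 0} \<subseteq> K" using assms(3) by (simp add: closure_minimal compact_imp_closed)
 have "bounded {x. \<phi> x \<noteq> 0}" using bounded_subset[OF compact_imp_bounded[OF assms(3)]] \<open>{x. \<phi> x \<noteq> 0} \<subseteq> K\<close> by simp
 then have "compact (closure {x. \<phi> x \<noteq> 0})" by (simp add: compact_closure)
 then show ?thesis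
  unfolding test_function_def using cl assms(4) smooth_differentiable[OF smooth_partials[OF assms(1)]] by blast
qed

section \<open>Smooth radial functions\<close>

lemma deriv_zero_below:
 fixes f :: "real => real"
 assumes z: "\<And>x. x < a ==> f x = 0" and x: "x < a"
 shows "deriv f x = 0"
proof -
 have "((\<lambda>x. 0) has_real_derivative 0) (at x)" by simp
 then have "(f has_real_derivative 0) (at x)"
  by (rule has_field_derivative_transform_within_open[of _ _ _ "{..<a}"]) (use z x in auto)
 then show ?thesis by (rule DERIV_imp_deriv)
qed

lemma smooth_mult_powr:
 fixes f :: "real => real"
 assumes f: "smooth f" and a: "a > 0" and z: "\<And>x. x < a ==> f x = 0"
 shows "smooth (\<lambda>x. f x * x powr q)"
 unfolding smooth_def
proof
 fix k show "Ck k (\<lambda>x. f x * x powr q)" using f z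
 proof (induction k arbitrary: f q)
  case (Suc k)
  have dz: "deriv f x = 0" if "x < a" for x by (rule deriv_zero_below[OF Suc.prems(2) that])
  have "((\<lambda>x. f x * x powr q) has_real_derivative (deriv f x * x powr q + q * (f x * x powr (q - 1)))) (at x)" for x
  proof (cases "x < a")
   case True
   have "((\<lambda>x. 0) has_real_derivative 0) (at x)" by simp
   then have "((\<lambda>x. f x * x powr q) has_real_derivative 0) (at x)"
    by (rule has_field_derivative_transform_within_open[of _ _ _ "{..<a}"]) (use Suc.prems True in auto)
   then show ?thesis using True Suc.prems dz by simp
  next
   case False
   then have x: "x > 0" using a by simp
   show ?thesis
    using x by (auto intro!: derivative_eq_intros smooth_real_has_derivative[OF Suc.prems(1)] simp: powr_diff field_simps)
  qed
  moreover have "Ck k (\<lambda>x. deriv f x * x powr q + q * (f x * x powr (q - 1)))"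
   by (intro Ck_add Ck_mult Ck_const Suc.IH Suc.prems smooth_deriv dz)
  ultimately show ?case by (rule Ck_realI)
 qed simp
qed

text \<open>
 Vanishing near 0 removes the singularity of the norm.
\<close>

lemma norm_compose_has_derivative:
 fixes f :: "real => real" and x :: "'a::euclidean_space"
 assumes f: "smooth f" and a: "a > 0" and z: "\<And>x. x < a ==> f x = 0"
 shows "((\<lambda>x. f (norm x)) has_derivative (\<lambda>h. deriv f (norm x) * norm x powr (-1) * (h \<bullet> x))) (at x)"
proof (cases "norm x < a")
 case True
 have d: "deriv f (norm x) = 0" by (rule deriv_zero_below[OF z True])
 have "((\<lambda>x. 0) has_derivative (\<lambda>h. 0)) (at x)" by simp
 then have "((\<lambda>x. f (norm x)) has_derivative (\<lambda>h. 0)) (at x)"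
  by (rule has_derivative_transform_within_open[of _ _ _ _ "ball 0 a"]) (use z True in auto)
 then show ?thesis using d by simp
next
 case False
 then have x: "x \<noteq> 0" using a by auto
 have "(f has_derivative (*) (deriv f (norm x))) (at (norm x))"
  using smooth_real_has_derivative[OF f] by (simp add: has_field_derivative_def)
 from has_derivative_compose[OF has_derivative_norm[OF x] this]
 have "((\<lambda>x. f (norm x)) has_derivative (\<lambda>h. deriv f (norm x) * (h \<bullet> sgn x))) (at x)" by (simp add: inner_commute)
 moreover have "(\<lambda>h. deriv f (norm x) * (h \<bullet> sgn x)) = (\<lambda>h. deriv f (norm x) * norm x powr (-1) * (h \<bullet> x))"
  using x by (auto simp: sgn_div_norm powr_minus field_simps)
 ultimately show ?thesis by simp
qed

lemma smooth_norm_compose: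
 fixes f :: "real => real"
 assumes f: "smooth f" and a: "a > 0" and z: "\<And>x. x < a ==> f x = 0"
 shows "smooth (\<lambda>x::'a::euclidean_space. f (norm x))"
 unfolding smooth_def
proof
 fix k show "Ck k (\<lambda>x::'a. f (norm x))" using f z
 proof (induction k arbitrary: f)
  case (Suc k)
  define g where "g x = deriv f x * x powr (-1)" for x
  have dz: "deriv f x = 0" if "x < a" for x by (rule deriv_zero_below[OF Suc.prems(2) that])
  have g: "smooth g" "\<And>x. x < a ==> g x = 0"
  proof -
   show "smooth g" unfolding g_def[abs_def] by (rule smooth_mult_powr[OF smooth_deriv[OF Suc.prems(1)] a dz])
  qed (simp add: dz g_def)
  have "((\<lambda>x. f (norm x)) has_derivative (\<lambda>h. g (norm x) * (h \<bullet> x))) (at x)" for x :: 'a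
   unfolding g_def by (rule norm_compose_has_derivative[OF Suc.prems(1) a Suc.prems(2)])
  moreover have "Ck k (\<lambda>x::'a. g (norm x) * (b \<bullet> x))" for b
   using Ck_inner[of k b] by (intro Ck_mult Suc.IH g) (simp_all add: inner_commute)
  ultimately show ?case by (intro Ck_SucI)
 qed simp
qed

section \<open>Divergence of homogeneous radial kernels\<close>

lemma weak_derivative_step:
 assumes v: "has_weak_derivative \<Omega> is u v" and w: "has_weak_derivative \<Omega> (is @ [j]) u w"
  and \<phi>: "smooth \<phi>" "\<And>x. x \<notin> K ==> \<phi> x = 0" and K: "compact K" "K \<subseteq> \<Omega>"
 shows "(LINT x|lebesgue_on \<Omega>. w x * \<phi> x) = - (LINT x|lebesgue_on \<Omega>. v x * frechet_derivative \<phi> (at x) (axis j 1))"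
proof -
 let ?\<psi> = "\<lambda>x. frechet_derivative \<phi> (at x) (axis j 1)"
 have \<psi>: "partials [j] \<phi> = ?\<psi>" by (simp add: partials_Cons)
 have Ck\<psi>: "smooth ?\<psi>" by (rule smooth_partial[OF \<phi>(1)]) (simp add: axis_in_Basis_iff)
 have z\<psi>: "?\<psi> x = 0" if "x \<notin> K" for x
 proof -
  have "((\<lambda>x. 0) has_derivative (\<lambda>h. 0)) (at x)" by simp
  then have "(\<phi> has_derivative (\<lambda>h. 0)) (at x)"
   by (rule has_derivative_transform_within_open[of _ _ _ _ "- K"]) (use that \<phi>(2) K(1) in \<open>auto simp: compact_imp_closed open_Compl\<close>)
  then have "frechet_derivative \<phi> (at x) = (\<lambda>h. 0)" by (rule frechet_derivative_at[symmetric])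
  then show ?thesis by simp
 qed
 have t1: "test_function \<Omega> \<phi>" by (rule test_functionI[OF \<phi> K])
 have t2: "test_function \<Omega> ?\<psi>" by (rule test_functionI[OF Ck\<psi> z\<psi> K])
 have "(-1) ^ length (is @ [j]) * (LINT x|lebesgue_on \<Omega>. w x * \<phi> x) = (LINT x|lebesgue_on \<Omega>. u x * partials (is @ [j]) \<phi> x)"
  using w t1 unfolding has_weak_derivative_def by simp
 also have "... = (LINT x|lebesgue_on \<Omega>. u x * partials is ?\<psi> x)" by (simp add: partials_append \<psi>)
 also have "... = (-1) ^ length is * (LINT x|lebesgue_on \<Omega>. v x * ?\<psi> x)"
  using v t2 unfolding has_weak_derivative_def by simp
 finally have "(-1) ^ length is * - (LINT x|lebesgue_on \<Omega>. w x * \<phi> x) = (-1) ^ length is * (LINT x|lebesgue_on \<Omega>. v x * ?\<psi> x)"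
  by simp
 then have "- (LINT x|lebesgue_on \<Omega>. w x * \<phi> x) = (LINT x|lebesgue_on \<Omega>. v x * ?\<psi> x)"
  by (subst (asm) mult_left_cancel) auto
 then show ?thesis by simp
qed

definition mon :: "'n list => real ^ 'n => real" where
 "mon is x = (\<Prod>i\<leftarrow>is. x $ i)"

lemma smooth_mon: "smooth (mon is)"
proof -
 have "smooth (\<lambda>x. \<Prod>i\<leftarrow>is. (x :: real ^ _) \<bullet> axis i 1)" by (intro smooth_prod_list smooth_inner)
 then show ?thesis by (simp add: mon_def[abs_def] inner_axis)
qed

lemma mon_append: "mon (is @ [j]) x = mon is x * x $ j" by (simp add: mon_def)

lemma mon_bound: "\<bar>mon is x\<bar> \<le> norm x ^ length is"
proof (induction "is")
 case (Cons i "is")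
 have "\<bar>x $ i * mon is x\<bar> \<le> norm x * norm x ^ length is"
  unfolding abs_mult by (intro mult_mono Cons component_le_norm_cart) auto
 then show ?case by (simp add: mon_def)
qed (simp add: mon_def)

text \<open>
 Euler's identity for homogeneous polynomials.
\<close>

lemma mon_euler: "frechet_derivative (mon is) (at x) x = real (length is) * mon is x"
proof -
 have "\<exists>D. (mon is has_derivative D) (at x) \<and> D x = real (length is) * mon is x"
 proof (induction "is")
  case Nil
  show ?case by (intro exI[of _ "\<lambda>_. 0"]) (simp add: mon_def[abs_def])
 next
  case (Cons i "is")
  then obtain D where D: "(mon is has_derivative D) (at x)" "D x = real (length is) * mon is x" by blast
  have i: "((\<lambda>x. x $ i) has_derivative (\<lambda>h. h $ i)) (at x)"
   by (rule bounded_linear_imp_has_derivative[OF bounded_linear_vec_nth])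
  have e: "mon (i # is) = (\<lambda>x. x $ i * mon is x)" by (auto simp: mon_def)
  from has_derivative_mult[OF i D(1)]
  have "(mon (i # is) has_derivative (\<lambda>h. x $ i * D h + h $ i * mon is x)) (at x)" by (simp add: e)
  then show ?case by (intro exI[of _ "\<lambda>h. x $ i * D h + h $ i * mon is x"] conjI) (simp_all add: D(2) e algebra_simps)
 qed
 then obtain D where D: "(mon is has_derivative D) (at x)" "D x = real (length is) * mon is x" by blast
 from frechet_derivative_at[OF D(1)] D(2) show ?thesis by simp
qed

lemma divergence_radial_field:
 fixes g :: "real ^ 'n => real"
 assumes g: "smooth g"
 shows "(\<Sum>j\<in>UNIV. frechet_derivative (\<lambda>x. x $ j * g x) (at x) (axis j 1)) = real CARD('n) * g x + frechet_derivative g (at x) x"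
proof -
 let ?D = "frechet_derivative g (at x)"
 have D: "(g has_derivative ?D) (at x)" by (rule smooth_has_derivative[OF g])
 have "frechet_derivative (\<lambda>x. x $ j * g x) (at x) = (\<lambda>h. x $ j * ?D h + h $ j * g x)" for j
  by (rule frechet_derivative_at[symmetric], rule has_derivative_mult[OF _ D])
   (rule bounded_linear_imp_has_derivative[OF bounded_linear_vec_nth])
 then have "(\<Sum>j\<in>UNIV. frechet_derivative (\<lambda>x. x $ j * g x) (at x) (axis j 1)) = (\<Sum>j\<in>UNIV. x $ j * ?D (axis j 1) + g x)"
  by simp
 also have "... = (\<Sum>j\<in>UNIV. ?D (x $ j *\<^sub>R axis j 1)) + real CARD('n) * g x"
  using linear_cmul[OF has_derivative_linear[OF D]] by (simp add: sum.distrib)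
 also have "(\<Sum>j\<in>UNIV. ?D (x $ j *\<^sub>R axis j 1)) = ?D (\<Sum>j\<in>UNIV. x $ j *\<^sub>R axis j 1)"
  by (rule linear_sum[OF has_derivative_linear[OF D], symmetric])
 also have "(\<Sum>j\<in>UNIV. x $ j *\<^sub>R axis j 1) = x"
  using basis_expansion[of x] by (simp add: scalar_mult_eq_scaleR)
 finally show ?thesis by simp
qed

text \<open>
 Smooth with support in \<open>[a,b]\<close>.
\<close>

definition smooth_in :: "real => real => (real => real) => bool" where
 "smooth_in a b \<phi> \<longleftrightarrow> smooth \<phi> \<and> (\<forall>\<tau>. \<tau> < a \<or> b < \<tau> \<longrightarrow> \<phi> \<tau> = 0)"

lemma smooth_in_deriv:
 assumes "smooth_in a b \<phi>" shows "smooth_in a b (deriv \<phi>)"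
 unfolding smooth_in_def
proof (intro conjI allI impI)
 show "smooth (deriv \<phi>)" using assms smooth_deriv by (auto simp: smooth_in_def)
 fix \<tau> assume \<tau>: "\<tau> < a \<or> b < \<tau>"
 have "((\<lambda>x. 0) has_real_derivative 0) (at \<tau>)" by simp
 then have "(\<phi> has_real_derivative 0) (at \<tau>)"
  by (rule has_field_derivative_transform_within_open[of _ _ _ "{..<a} \<union> {b<..}"]) (use assms \<tau> in \<open>auto simp: smooth_in_def\<close>)
 then show "deriv \<phi> \<tau> = 0" by (rule DERIV_imp_deriv)
qed

lemma smooth_in_mono: "smooth_in a b \<phi> ==> a' \<le> a ==> b \<le> b' ==> smooth_in a' b' \<phi>"
 by (auto simp: smooth_in_def)

lemma smooth_in_diff_scale: "smooth_in a b \<phi> ==> smooth_in a b \<kappa> ==> smooth_in a b (\<lambda>x. \<phi> x - c * \<kappa> x)"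
 by (auto simp: smooth_in_def intro!: smooth_diff smooth_mult smooth_const)

text \<open>
 The test functions \<open>x\<^sub>I \<phi>(|x|) |x|\<^sup>p\<close>; for \<open>p = 1 - n - |I|\<close> divergences of such fields
 are again of this form.
\<close>

definition kern :: "'n list => (real => real) => real => real ^ 'n => real" where
 "kern is \<phi> p x = mon is x * (\<phi> (norm x) * norm x powr p)"

lemma smooth_kern:
 assumes "smooth_in a b \<phi>" "a > 0" shows "smooth (kern is \<phi> p)"
proof -
 have \<phi>: "smooth \<phi>" "\<And>x. x < a ==> \<phi> x = 0" using assms(1) by (auto simp: smooth_in_def)
 have "smooth (\<lambda>x::real ^ 'n. (\<lambda>\<tau>. \<phi> \<tau> * \<tau> powr p) (norm x))"
 proof (rule smooth_norm_compose[OF smooth_mult_powr[OF \<phi>(1) assms(2) \<phi>(2)] assms(2)])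
  show "\<phi> x * x powr p = 0" if "x < a" for x using \<phi>(2)[OF that] by simp
 qed
 from smooth_mult[OF smooth_mon this] show ?thesis by (simp add: kern_def[abs_def])
qed

lemma kern_support:
 assumes "smooth_in a b \<phi>" "x \<notin> cball 0 b" shows "kern is \<phi> p x = 0"
 using assms by (auto simp: smooth_in_def kern_def)

text \<open>
 The field has the form \<open>x g(x)\<close> with divergence \<open>n g + x \<cdot> \<nabla>g\<close>. On \<open>x\<^sub>I |x|\<^sup>p\<close>, homogeneous of degree \<open>|I| + p = -n\<close>,
 this vanishes, so only the derivative of \<open>\<phi>\<close> survives.
\<close>

lemma kern_divergence:
 fixes x :: "real ^ 'n"
 assumes \<phi>: "smooth_in a b \<phi>" "a > 0" and p: "p = - real CARD('n) - real (length is)"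
 shows "(\<Sum>j\<in>UNIV. frechet_derivative (kern (is @ [j]) \<phi> p) (at x) (axis j 1)) = kern is (deriv \<phi>) (p + 1) x"
proof -
 let ?g = "kern is \<phi> p"
 have e: "kern (is @ [j]) \<phi> p = (\<lambda>x. x $ j * ?g x)" for j by (auto simp: kern_def mon_append)
 have "(\<Sum>j\<in>UNIV. frechet_derivative (kern (is @ [j]) \<phi> p) (at x) (axis j 1)) = real CARD('n) * ?g x + frechet_derivative ?g (at x) x"
  unfolding e by (rule divergence_radial_field[OF smooth_kern[OF \<phi>]])
 also have "frechet_derivative ?g (at x) x = real (length is) * ?g x + mon is x * (norm x * (deriv \<phi> (norm x) * norm x powr p + p * (\<phi> (norm x) * norm x powr (p - 1))))"
 proof (cases "x = 0")
  case True
  have "((\<lambda>x. 0) has_derivative (\<lambda>h. 0)) (at x)" by simp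
  then have "(?g has_derivative (\<lambda>h. 0)) (at x)"
   by (rule has_derivative_transform_within_open[of _ _ _ _ "ball 0 a"]) (use \<phi> True in \<open>auto simp: kern_def smooth_in_def\<close>)
  then have "frechet_derivative ?g (at x) = (\<lambda>h. 0)" by (rule frechet_derivative_at[symmetric])
  then show ?thesis using True by (simp add: kern_def)
 next
  case False
  then have nx: "norm x > 0" by simp
  have s\<phi>: "smooth \<phi>" using \<phi> by (simp add: smooth_in_def)
  let ?d = "deriv \<phi> (norm x) * norm x powr p + p * (\<phi> (norm x) * norm x powr (p - 1))"
  have "((\<lambda>\<tau>. \<phi> \<tau> * \<tau> powr p) has_real_derivative ?d) (at (norm x))"
   using nx by (auto intro!: derivative_eq_intros smooth_real_has_derivative[OF s\<phi>] simp: powr_diff field_simps)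
  then have "((\<lambda>\<tau>. \<phi> \<tau> * \<tau> powr p) has_derivative (*) ?d) (at (norm x))" by (simp add: has_field_derivative_def)
  from has_derivative_compose[OF has_derivative_norm[OF False] this]
  have r: "((\<lambda>x. \<phi> (norm x) * norm x powr p) has_derivative (\<lambda>h. ?d * (h \<bullet> sgn x))) (at x)" by simp
  have "(?g has_derivative (\<lambda>h. mon is x * (?d * (h \<bullet> sgn x)) + frechet_derivative (mon is) (at x) h * (\<phi> (norm x) * norm x powr p))) (at x)"
   unfolding kern_def[abs_def] by (rule has_derivative_mult[OF smooth_has_derivative[OF smooth_mon] r])
  then have "frechet_derivative ?g (at x) = (\<lambda>h. mon is x * (?d * (h \<bullet> sgn x)) + frechet_derivative (mon is) (at x) h * (\<phi> (norm x) * norm x powr p))"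
   by (rule frechet_derivative_at[symmetric])
  then have "frechet_derivative ?g (at x) x = mon is x * (?d * (x \<bullet> sgn x)) + frechet_derivative (mon is) (at x) x * (\<phi> (norm x) * norm x powr p)"
   by simp
  moreover have "x \<bullet> sgn x = norm x"
   using nx by (simp add: sgn_div_norm power2_norm_eq_inner[symmetric] power2_eq_square)
  ultimately show ?thesis by (simp add: mon_euler kern_def algebra_simps)
 qed
 also have "real CARD('n) * ?g x + (real (length is) * ?g x + mon is x * (norm x * (deriv \<phi> (norm x) * norm x powr p + p * (\<phi> (norm x) * norm x powr (p - 1)))))
   = kern is (deriv \<phi>) (p + 1) x"
 proof (cases "x = 0")
  case True
  have "\<phi> 0 = 0" "deriv \<phi> 0 = 0" using \<phi> smooth_in_deriv[OF \<phi>(1)] by (auto simp: smooth_in_def)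
  then show ?thesis using True by (simp add: kern_def)
 next
  case False
  then have nx: "norm x > 0" by simp
  have 1: "norm x * norm x powr (p - 1) = norm x powr p" "norm x * norm x powr p = norm x powr (p + 1)"
   using nx powr_add[of "norm x" 1 "p - 1"] powr_add[of "norm x" 1 p] by (simp_all add: add.commute)
  have "mon is x * (norm x * (deriv \<phi> (norm x) * norm x powr p + p * (\<phi> (norm x) * norm x powr (p - 1))))
   = mon is x * (deriv \<phi> (norm x) * (norm x * norm x powr p) + p * (\<phi> (norm x) * (norm x * norm x powr (p - 1))))"
   by (simp add: algebra_simps)
  also have "... = kern is (deriv \<phi>) (p + 1) x + p * ?g x"
   unfolding 1 by (simp add: kern_def algebra_simps)
  finally show ?thesis by (simp add: p algebra_simps)
 qed
 finally show ?thesis .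
qed

lemma kern_bound:
 assumes "length is = k"
 shows "\<bar>kern is \<phi> (q - real k) x\<bar> \<le> \<bar>\<phi> (norm x)\<bar> * norm x powr q"
proof (cases "x = 0")
 case False
 have "\<bar>kern is \<phi> (q - real k) x\<bar> \<le> norm x ^ k * (\<bar>\<phi> (norm x)\<bar> * norm x powr (q - real k))"
  unfolding kern_def abs_mult using mon_bound[of "is" x] assms by (intro mult_mono) auto
 also have "... = \<bar>\<phi> (norm x)\<bar> * (norm x powr real k * norm x powr (q - real k))"
  using False by (simp add: powr_realpow ac_simps)
 also have "... = \<bar>\<phi> (norm x)\<bar> * norm x powr q" by (simp add: powr_add[symmetric])
 finally show ?thesis .
qed (simp add: kern_def)

section \<open>One-dimensional primitives\<close>

lemma prim_has_derivative:
 fixes f :: "real => real"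
 assumes f: "continuous_on UNIV f" and a: "a > 0" and z: "\<And>x. x < a ==> f x = 0"
 shows "((\<lambda>x. integral {0..x} f) has_real_derivative f x) (at x)"
proof (cases "x < a")
 case True
 have "((\<lambda>x. 0) has_real_derivative 0) (at x)" by simp
 then have "((\<lambda>x. integral {0..x} f) has_real_derivative 0) (at x)"
 proof (rule has_field_derivative_transform_within_open[of _ _ _ "{..<a}"])
  fix y assume "y \<in> {..<a}"
  then have "integral {0..y} f = integral {0..y} (\<lambda>_. 0)" by (intro Henstock_Kurzweil_Integration.integral_cong) (use z in auto)
  then show "0 = integral {0..y} f" by simp
 qed (use True in auto)
 then show ?thesis using z[OF True] by simp
next
 case False
 have "((\<lambda>x. integral {0..x} f) has_real_derivative f x) (at x within {0..x+1})"
  by (rule integral_has_real_derivative) (use f False a in \<open>auto intro: continuous_on_subset\<close>)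
 moreover have "at x within {0..x+1} = at x" using False a by (intro at_within_interior) auto
 ultimately show ?thesis by simp
qed

lemma integral_beyond_support:
 fixes f :: "real => real"
 assumes f: "continuous_on UNIV f" and z: "\<And>x. b < x ==> f x = 0" and b: "0 \<le> b" "b \<le> x"
 shows "integral {0..x} f = integral {0..b} f"
proof -
 have "integral {0..b} f + integral {b..x} f = integral {0..x} f"
  using b by (intro Henstock_Kurzweil_Integration.integral_combine integrable_continuous_interval continuous_on_subset[OF f]) auto
 moreover have "integral {b..x} f = 0"
 proof -
  have "integral {b..x} f = integral {b..x} (\<lambda>_. 0)"
   by (rule integral_spike[of "{b}"]) (use z in \<open>auto simp: less_le\<close>)
  then show ?thesis by simp
 qed
 ultimately show ?thesis by simp
qed

section \<open>Testing a radial Sobolev function\<close>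

lemma continuous_powr_mult:
 fixes g :: "real => real"
 assumes g: "continuous_on UNIV g" and a: "a > 0" and z: "\<And>x. x < a ==> g x = 0"
 shows "continuous_on UNIV (\<lambda>x. x powr q * g x)"
proof -
 have "continuous_on ({..<a} \<union> {a/2<..}) (\<lambda>x. x powr q * g x)"
 proof (rule continuous_on_open_Un)
  have "continuous_on {..<a} (\<lambda>x. 0 :: real)" by simp
  then show "continuous_on {..<a} (\<lambda>x. x powr q * g x)"
   by (rule continuous_on_eq) (use z in auto)
  show "continuous_on {a/2<..} (\<lambda>x. x powr q * g x)"
   by (intro continuous_intros continuous_on_subset[OF g]) (use a in auto)
 qed auto
 moreover have "{..<a} \<union> {a/2<..} = UNIV" using a by auto
 ultimately show ?thesis by simp
qed

lemma continuous_on_compact_bound: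
 fixes f :: "'a::topological_space => real"
 assumes "continuous_on S f" "compact S"
 obtains C where "\<And>x. x \<in> S ==> \<bar>f x\<bar> \<le> C"
proof -
 have "bounded (f ` S)" by (rule compact_imp_bounded[OF compact_continuous_image[OF assms]])
 then obtain C where "\<forall>x\<in>f ` S. norm x \<le> C" unfolding bounded_iff by blast
 then show ?thesis using that[of C] by simp
qed

lemma integrable_mult_bounded:
 assumes v: "integrable (lebesgue_on S) v" and f: "f \<in> borel_measurable borel" and b: "\<And>x. x \<in> S ==> \<bar>f x\<bar> \<le> C"
  and S: "S \<in> sets lebesgue"
 shows "integrable (lebesgue_on S) (\<lambda>x. v x * f x :: real)"
proof (rule Bochner_Integration.integrable_bound[of _ "\<lambda>x. C * v x"])
 show "integrable (lebesgue_on S) (\<lambda>x. C * v x)" using v by simp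
 have [measurable]: "f \<in> borel_measurable (lebesgue_on S)" by (rule borel_measurable_lebesgue_on[OF f])
 have [measurable]: "v \<in> borel_measurable (lebesgue_on S)" using v by auto
 show "(\<lambda>x. v x * f x) \<in> borel_measurable (lebesgue_on S)" by measurable
 show "AE x in lebesgue_on S. norm (v x * f x) \<le> norm (C * v x)"
 proof (rule AE_I2)
  fix x assume "x \<in> space (lebesgue_on S)"
  then have "\<bar>f x\<bar> \<le> C" using b by simp
  then have "\<bar>v x\<bar> * \<bar>f x\<bar> \<le> \<bar>v x\<bar> * \<bar>C\<bar>" by (intro mult_left_mono) auto
  then show "norm (v x * f x) \<le> norm (C * v x)" by (simp add: abs_mult mult.commute)
 qed
qed

text \<open>
 A bound for the \<open>j\<close>-fold primitive of \<open>\<phi>\<close>.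
\<close>

fun iterated :: "nat => (real => real) => real => real" where
 "iterated 0 \<phi> r = \<bar>\<phi> r\<bar>"
| "iterated (Suc i) \<phi> r = r ^ i * integral {0..r} (\<lambda>t. \<bar>\<phi> t\<bar>)"

lemma iterated_continuous:
 assumes \<phi>: "continuous_on UNIV \<phi>" and a: "a > 0" and z: "\<And>x. x < a ==> \<phi> x = 0"
 shows "continuous_on UNIV (iterated j \<phi>)" "\<And>x. x < a ==> iterated j \<phi> x = 0"
proof -
 have c: "continuous_on UNIV (\<lambda>t. \<bar>\<phi> t\<bar>)" by (intro continuous_intros \<phi>)
 have d: "((\<lambda>x. integral {0..x} (\<lambda>t. \<bar>\<phi> t\<bar>)) has_real_derivative \<bar>\<phi> x\<bar>) (at x)" for x
  by (rule prim_has_derivative[OF c a]) (simp add: z)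
 have ci: "continuous_on UNIV (\<lambda>x. integral {0..x} (\<lambda>t. \<bar>\<phi> t\<bar>))"
  using DERIV_isCont[OF d] by (simp add: continuous_on_eq_continuous_at)
 show "continuous_on UNIV (iterated j \<phi>)"
 proof (cases j)
  case 0
  then have "iterated j \<phi> = (\<lambda>t. \<bar>\<phi> t\<bar>)" by auto
  then show ?thesis using c by simp
 next
  case (Suc i)
  then have "iterated j \<phi> = (\<lambda>r. r ^ i * integral {0..r} (\<lambda>t. \<bar>\<phi> t\<bar>))" by auto
  then show ?thesis using ci by (simp add: continuous_intros)
 qed
 have i0: "integral {0..x} (\<lambda>t. \<bar>\<phi> t\<bar>) = 0" if "x < a" for x
 proof -
  have "integral {0..x} (\<lambda>t. \<bar>\<phi> t\<bar>) = integral {0..x} (\<lambda>_. 0)" by (intro Henstock_Kurzweil_Integration.integral_cong) (use z that in auto)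
  then show ?thesis by simp
 qed
 show "iterated j \<phi> x = 0" if "x < a" for x
  using i0[OF that] z[OF that] by (cases j) auto
qed

definition cutoff :: "real => real => real" where
 "cutoff R x = 1 / integral {0..R} (ball_bump (3*R/4) (R/8)) * ball_bump (3*R/4) (R/8) x"

lemma cutoff:
 fixes R :: real assumes R: "R > 0"
 shows "smooth_in (5*R/8) (7*R/8) (cutoff R)" "0 \<le> cutoff R x" "integral {0..R} (cutoff R) = 1"
proof -
 define \<beta> where "\<beta> = ball_bump (3*R/4) (R/8)"
 have s: "smooth \<beta>" unfolding \<beta>_def by (rule smooth_ball_bump)
 have nn: "0 \<le> \<beta> x" for x unfolding \<beta>_def by (rule ball_bump_bounds)
 have c: "continuous_on {0..R} \<beta>" by (rule smooth_continuous[OF s])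
 have pos: "0 < \<beta> (3*R/4)" unfolding \<beta>_def using R by (subst ball_bump_pos_iff) auto
 have "integral {0..R} \<beta> \<noteq> 0"
  using integral_eq_0_iff[OF c R nn] pos R by (auto dest!: bspec[of _ _ "3*R/4"])
 moreover have "0 \<le> integral {0..R} \<beta>" by (rule integral_nonneg[OF integrable_continuous_interval[OF c] nn])
 ultimately have I: "integral {0..R} \<beta> > 0" by simp
 have z: "\<beta> x = 0" if "x < 5*R/8 \<or> 7*R/8 < x" for x
 proof -
  have "x \<notin> ball (3*R/4) (R/8)" using that by (auto simp: dist_real_def abs_if)
  then have "\<not> \<beta> x > 0" unfolding \<beta>_def using ball_bump_pos_iff[of "R/8" "3*R/4" x] R by simp
  then show ?thesis using nn[of x] by simp
 qed
 have e: "cutoff R = (\<lambda>x. 1 / integral {0..R} \<beta> * \<beta> x)" by (simp add: fun_eq_iff cutoff_def \<beta>_def)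
 have "smooth (cutoff R)" unfolding e by (rule smooth_mult[OF smooth_const s])
 then show "smooth_in (5*R/8) (7*R/8) (cutoff R)" using z by (auto simp: smooth_in_def e)
 show "0 \<le> cutoff R x" unfolding e using I nn by simp
 show "integral {0..R} (cutoff R) = 1" unfolding e using I by simp
qed

context target_setting begin

abbreviation cut :: "real => real" where "cut \<equiv> cutoff R"

lemmas cut = cutoff[OF R_pos]

definition cut_bound :: real where
 "cut_bound = (SUP r\<in>{0..R}. \<bar>r powr (1 - n) * \<bar>cut r\<bar>\<bar>)"

lemma cut_bound: "r \<in> {0..R} ==> \<bar>r powr (1 - n) * \<bar>cut r\<bar>\<bar> \<le> cut_bound"
proof -
 assume r: "r \<in> {0..R}"
 have s: "smooth cut" "\<And>x. x < 5*R/8 ==> cut x = 0" using cut(1) by (auto simp: smooth_in_def)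
 have cont: "continuous_on UNIV (\<lambda>x. \<bar>cut x\<bar>)" by (intro continuous_intros smooth_continuous[OF s(1)])
 have "continuous_on UNIV (\<lambda>r. r powr (1 - n) * \<bar>cut r\<bar>)" by (rule continuous_powr_mult[OF cont, of "5*R/8"]) (use s(2) R_pos in auto)
 then have c': "continuous_on {0..R} (\<lambda>r. r powr (1 - n) * \<bar>cut r\<bar>)" by (rule continuous_on_subset) simp
 obtain C0 where C0: "\<And>r. r \<in> {0..R} ==> \<bar>r powr (1 - n) * \<bar>cut r\<bar>\<bar> \<le> C0"
  using continuous_on_compact_bound[OF c'] by auto
 have "bdd_above ((\<lambda>r. \<bar>r powr (1 - n) * \<bar>cut r\<bar>\<bar>) ` {0..R})" by (rule bdd_aboveI[of _ C0]) (use C0 in blast)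
 from cSUP_upper[OF r this] show ?thesis by (simp only: cut_bound_def)
qed

lemma cut_bound_nonneg: "0 \<le> cut_bound"
 using cut_bound[of 0] R_pos by (auto intro: order_trans[OF abs_ge_zero])

text \<open>
 The constants depend on the setting alone, not on the function; this is what makes the
 embedding bounded.
\<close>

primrec pair_const :: "nat => real" where
 "pair_const 0 = 0"
| "pair_const (Suc j) = pair_const j * (2 * R) + n ^ (m - Suc j) * cut_bound + n ^ m * ((R/2) powr (1 - n) * R ^ j)"

lemma pair_const_nonneg: "0 \<le> pair_const j"
 using n_pos R_pos cut_bound_nonneg by (induction j) auto

lemma card_lists: "real (card {is :: 'n list. length is = k}) = n ^ k"
 using card_lists_length_eq[of "UNIV :: 'n set" k] by (simp add: n_eq)

end

text \<open>
 Data extracted from a radial Sobolev function: \<open>d is\<close> are its weak derivatives, with \<open>u\<close> itself at the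
 empty list, and \<open>D\<close> dominates the derivatives.
\<close>

locale radial_sobolev_function = target_setting m n \<alpha> R X
 for m :: nat and n \<alpha> R :: real and X :: "(real ^ 'n => ennreal) => ennreal" +
 fixes u D :: "real ^ 'n => real" and d :: "'n list => real ^ 'n => real" and h :: "real => real"
 assumes d_Nil: "d [] = u"
  and d_weak: "\<And>is. length is \<le> m ==> has_weak_derivative (ball 0 R) is u (d is)"
  and d_int: "\<And>is. length is \<le> m ==> integrable Lb (d is)"
  and D_int: "integrable Lb D" and D_nonneg: "\<And>x. 0 \<le> D x"
  and d_le: "\<And>is x. length is \<in> {1..m} ==> \<bar>d is x\<bar> \<le> D x"
  and radial: "AE x in Lb. u x = h (norm x)"
begin

lemma ball_lebesgue: "ball (0::real ^ 'n) R \<in> sets lebesgue" by simp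

definition U where "U = (LINT x|Lb. \<bar>u x\<bar>) + (LINT x|Lb. D x)"

lemma U_nonneg: "0 \<le> U" and D_le_U: "(LINT x|Lb. D x) \<le> U"
 unfolding U_def using D_nonneg by (simp_all add: integral_nonneg_AE)

lemma d_le_sum: "length is \<le> m ==> \<bar>d is x\<bar> \<le> \<bar>u x\<bar> + D x"
 using d_le[of "is" x] D_nonneg[of x] d_Nil by (cases "is") auto

lemma u_int: "integrable Lb u" using d_int[of "[]"] by (simp add: d_Nil)

definition pair :: "nat => (real => real) => real" where
 "pair k \<phi> = (\<Sum>is | length is = k. LINT x|Lb. d is x * kern is \<phi> (1 - n - real k) x)"

lemma integrable_radial:
 assumes v: "integrable Lb v" and g: "continuous_on UNIV g" and a: "a > 0" and z: "\<And>x. x < a ==> g x = 0"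
 shows "integrable Lb (\<lambda>x. v x * (norm x powr q * g (norm x)))"
proof -
 have c: "continuous_on UNIV (\<lambda>r. r powr q * g r)" by (rule continuous_powr_mult[OF g a z])
 have c': "continuous_on {0..R} (\<lambda>r. r powr q * g r)" by (rule continuous_on_subset[OF c]) simp
 obtain C where C: "\<And>r. r \<in> {0..R} ==> \<bar>r powr q * g r\<bar> \<le> C"
  using continuous_on_compact_bound[OF c'] by auto
 have m: "(\<lambda>r. r powr q * g r) \<in> borel_measurable borel" by (rule borel_measurable_continuous_onI[OF c])
 show ?thesis
 proof (rule integrable_mult_bounded[OF v _ _ ball_lebesgue])
  show "(\<lambda>x. norm x powr q * g (norm x)) \<in> borel_measurable borel"
   by (rule measurable_compose[OF _ m]) simp
  show "\<bar>norm x powr q * g (norm x)\<bar> \<le> C" if "x \<in> ball 0 R" for x :: "real ^ 'n" using that by (intro C) auto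
 qed
qed

lemma integrable_smooth:
 assumes v: "integrable Lb v" and f: "smooth f"
 shows "integrable Lb (\<lambda>x. v x * f x)"
proof -
 have c: "continuous_on UNIV f" by (rule smooth_continuous[OF f])
 obtain C where C: "\<And>x. x \<in> cball 0 R ==> \<bar>f x\<bar> \<le> C"
  using continuous_on_compact_bound[OF continuous_on_subset[OF c], of "cball 0 R"] by auto
 show ?thesis
  by (rule integrable_mult_bounded[OF v borel_measurable_continuous_onI[OF c] _ ball_lebesgue]) (rule C, simp)
qed

lemma pair_step:
 assumes \<phi>: "smooth_in a b \<phi>" and a: "0 < a" and b: "b < R" and k: "k < m"
 shows "pair (Suc k) \<phi> = - pair k (deriv \<phi>)"
proof -
 let ?p = "1 - n - real (Suc k)"
 have inj: "inj_on (\<lambda>(is, j). is @ [j]) ({is :: 'n list. length is = k} \<times> UNIV)" by (auto simp: inj_on_def)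
 have im: "(\<lambda>(is, j). is @ [j]) ` ({is :: 'n list. length is = k} \<times> UNIV) = {is. length is = Suc k}"
 proof (intro equalityI subsetI)
  fix xs :: "'n list" assume "xs \<in> {is. length is = Suc k}"
  then obtain ys y where "xs = ys @ [y]" "length ys = k" by (cases xs rule: rev_cases) auto
  then show "xs \<in> (\<lambda>(is, j). is @ [j]) ` ({is :: 'n list. length is = k} \<times> UNIV)"
   by (intro image_eqI[of _ _ "(ys, y)"]) auto
 qed auto
 have "pair (Suc k) \<phi> = (\<Sum>(is, j)\<in>{is. length is = k} \<times> UNIV. LINT x|Lb. d (is @ [j]) x * kern (is @ [j]) \<phi> ?p x)"
  unfolding pair_def im[symmetric] by (subst sum.reindex[OF inj]) (simp add: case_prod_beta)
 also have "... = (\<Sum>is | length is = k. \<Sum>j\<in>UNIV. LINT x|Lb. d (is @ [j]) x * kern (is @ [j]) \<phi> ?p x)"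
  by (rule sum.cartesian_product[symmetric])
 also have "... = (\<Sum>is | length is = k. - (LINT x|Lb. d is x * kern is (deriv \<phi>) (1 - n - real k) x))"
 proof (rule sum.cong[OF refl])
  fix "is" :: "'n list" assume "is \<in> {is. length is = k}"
  then have l: "length is = k" by simp
  let ?f = "\<lambda>j x. frechet_derivative (kern (is @ [j]) \<phi> ?p) (at x) (axis j 1)"
  have sk: "smooth (kern (is @ [j]) \<phi> ?p)" for j by (rule smooth_kern[OF \<phi> a])
  have sf: "smooth (?f j)" for j by (rule smooth_partial[OF sk]) (simp add: axis_in_Basis_iff)
  have step: "(LINT x|Lb. d (is @ [j]) x * kern (is @ [j]) \<phi> ?p x) = - (LINT x|Lb. d is x * ?f j x)" for j
   by (rule weak_derivative_step[OF d_weak d_weak sk kern_support[OF \<phi>], where K="cball 0 b"]) (use l k b in auto)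
  have "(\<Sum>j\<in>UNIV. LINT x|Lb. d (is @ [j]) x * kern (is @ [j]) \<phi> ?p x) = - (\<Sum>j\<in>UNIV. LINT x|Lb. d is x * ?f j x)"
   by (simp only: step sum_negf)
  also have "(\<Sum>j\<in>UNIV. LINT x|Lb. d is x * ?f j x) = (LINT x|Lb. (\<Sum>j\<in>UNIV. d is x * ?f j x))"
   by (rule Bochner_Integration.integral_sum[symmetric], rule integrable_smooth[OF d_int sf]) (use l k in simp)
  also have "... = (LINT x|Lb. d is x * kern is (deriv \<phi>) (1 - n - real k) x)"
  proof (rule Bochner_Integration.integral_cong[OF refl])
   fix x
   have "?p = - real CARD('n) - real (length is)" using l by (simp add: n_eq)
   from kern_divergence[OF \<phi> a this, of x] have "(\<Sum>j\<in>UNIV. ?f j x) = kern is (deriv \<phi>) (?p + 1) x" .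
   moreover have "?p + 1 = 1 - n - real k" by simp
   ultimately show "(\<Sum>j\<in>UNIV. d is x * ?f j x) = d is x * kern is (deriv \<phi>) (1 - n - real k) x"
    by (simp only: sum_distrib_left[symmetric])
  qed
  finally show "(\<Sum>j\<in>UNIV. LINT x|Lb. d (is @ [j]) x * kern (is @ [j]) \<phi> ?p x) = - (LINT x|Lb. d is x * kern is (deriv \<phi>) (1 - n - real k) x)" .
 qed
 finally show ?thesis by (simp add: pair_def sum_negf)
qed

lemma pair_diff_scale:
 assumes "smooth_in a b \<phi>" "smooth_in a b \<kappa>" "0 < a" "k \<le> m"
 shows "pair k (\<lambda>x. \<phi> x - c * \<kappa> x) = pair k \<phi> - c * pair k \<kappa>"
proof -
 have "(LINT x|Lb. d is x * kern is (\<lambda>x. \<phi> x - c * \<kappa> x) (1 - n - real k) x)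
   = (LINT x|Lb. d is x * kern is \<phi> (1 - n - real k) x) - c * (LINT x|Lb. d is x * kern is \<kappa> (1 - n - real k) x)" if "length is = k" for "is"
 proof -
  have "integrable Lb (\<lambda>x. d is x * kern is \<phi> (1 - n - real k) x)" "integrable Lb (\<lambda>x. d is x * kern is \<kappa> (1 - n - real k) x)"
   using that assms by (auto intro!: integrable_smooth d_int smooth_kern)
  then have "(LINT x|Lb. d is x * kern is \<phi> (1 - n - real k) x) - c * (LINT x|Lb. d is x * kern is \<kappa> (1 - n - real k) x)
   = (LINT x|Lb. d is x * kern is \<phi> (1 - n - real k) x - c * (d is x * kern is \<kappa> (1 - n - real k) x))" by simp
  also have "... = (LINT x|Lb. d is x * kern is (\<lambda>x. \<phi> x - c * \<kappa> x) (1 - n - real k) x)"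
   by (rule Bochner_Integration.integral_cong[OF refl]) (simp add: kern_def algebra_simps)
  finally show ?thesis by simp
 qed
 then show ?thesis unfolding pair_def by (simp add: sum_subtractf sum_distrib_left)
qed

lemma pair_abs_le:
 assumes \<phi>: "smooth_in a b \<phi>" and a: "0 < a" and k: "k \<le> m" and V: "integrable Lb V" and le: "\<And>is x. length is = k ==> \<bar>d is x\<bar> \<le> V x"
 shows "\<bar>pair k \<phi>\<bar> \<le> real (card {is :: 'n list. length is = k}) * (LINT x|Lb. V x * (norm x powr (1 - n) * \<bar>\<phi> (norm x)\<bar>))"
proof -
 have s: "smooth \<phi>" "\<And>x. x < a ==> \<phi> x = 0" using \<phi> by (auto simp: smooth_in_def)
 have cont: "continuous_on UNIV (\<lambda>x. \<bar>\<phi> x\<bar>)" by (intro continuous_intros smooth_continuous[OF s(1)])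
 have intV: "integrable Lb (\<lambda>x. V x * (norm x powr (1 - n) * \<bar>\<phi> (norm x)\<bar>))"
  by (rule integrable_radial[OF V cont a]) (simp add: s(2))
 have "\<bar>pair k \<phi>\<bar> \<le> (\<Sum>is | length is = k. \<bar>LINT x|Lb. d is x * kern is \<phi> (1 - n - real k) x\<bar>)"
  unfolding pair_def by (rule sum_abs)
 also have "... \<le> (\<Sum>is :: 'n list | length is = k. LINT x|Lb. V x * (norm x powr (1 - n) * \<bar>\<phi> (norm x)\<bar>))"
 proof (rule sum_mono)
  fix "is" :: "'n list" assume "is \<in> {is. length is = k}"
  then have l: "length is = k" by simp
  have "\<bar>LINT x|Lb. d is x * kern is \<phi> (1 - n - real k) x\<bar> \<le> (LINT x|Lb. \<bar>d is x * kern is \<phi> (1 - n - real k) x\<bar>)"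
   by (rule integral_abs_bound)
  also have "... \<le> (LINT x|Lb. V x * (norm x powr (1 - n) * \<bar>\<phi> (norm x)\<bar>))"
  proof (rule integral_mono[OF _ intV])
   show "integrable Lb (\<lambda>x. \<bar>d is x * kern is \<phi> (1 - n - real k) x\<bar>)"
    using l k by (intro integrable_abs integrable_smooth d_int smooth_kern[OF \<phi> a]) simp
   fix x :: "real ^ 'n"
   show "\<bar>d is x * kern is \<phi> (1 - n - real k) x\<bar> \<le> V x * (norm x powr (1 - n) * \<bar>\<phi> (norm x)\<bar>)"
    unfolding abs_mult using le[OF l, of x] kern_bound[OF l, of \<phi> "1 - n" x]
    by (intro mult_mono) (auto simp: mult.commute intro: order_trans[OF abs_ge_zero])
  qed
  finally show "\<bar>LINT x|Lb. d is x * kern is \<phi> (1 - n - real k) x\<bar> \<le> (LINT x|Lb. V x * (norm x powr (1 - n) * \<bar>\<phi> (norm x)\<bar>))" .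
 qed
 also have "... = real (card {is :: 'n list. length is = k}) * (LINT x|Lb. V x * (norm x powr (1 - n) * \<bar>\<phi> (norm x)\<bar>))"
  by simp
 finally show ?thesis .
qed

lemma pair_cut_le:
 assumes k: "k \<le> m"
 shows "\<bar>pair k cut\<bar> \<le> n ^ k * cut_bound * U"
proof -
 let ?V = "\<lambda>x. \<bar>u x\<bar> + D x"
 have a: "0 < 5*R/8" using R_pos by simp
 have s: "smooth cut" "\<And>x. x < 5*R/8 ==> cut x = 0" using cut(1) by (auto simp: smooth_in_def)
 have cont: "continuous_on UNIV (\<lambda>x. \<bar>cut x\<bar>)" by (intro continuous_intros smooth_continuous[OF s(1)])
 have V: "integrable Lb ?V" using u_int D_int by simp
 have "\<bar>pair k cut\<bar> \<le> n ^ k * (LINT x|Lb. ?V x * (norm x powr (1 - n) * \<bar>cut (norm x)\<bar>))"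
  unfolding card_lists[symmetric] by (rule pair_abs_le[OF cut(1) a k V]) (use d_le_sum k in auto)
 also have "... \<le> n ^ k * (LINT x|Lb. cut_bound * ?V x)"
 proof (intro mult_left_mono integral_mono)
  show "integrable Lb (\<lambda>x. ?V x * (norm x powr (1 - n) * \<bar>cut (norm x)\<bar>))"
   by (rule integrable_radial[OF V cont a]) (simp add: s(2))
  show "integrable Lb (\<lambda>x. cut_bound * ?V x)" using V by simp
  fix x assume "x \<in> space Lb"
  then have "norm x powr (1 - n) * \<bar>cut (norm x)\<bar> \<le> cut_bound" using cut_bound[of "norm x"] by auto
  then show "?V x * (norm x powr (1 - n) * \<bar>cut (norm x)\<bar>) \<le> cut_bound * ?V x"
   using D_nonneg[of x] by (subst mult.commute) (intro mult_right_mono, auto)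
 qed (use n_pos in auto)
 also have "(LINT x|Lb. cut_bound * ?V x) = cut_bound * U" unfolding U_def using u_int D_int by simp
 finally show ?thesis by (simp add: mult.assoc)
qed

definition l1 :: "(real => real) => real" where "l1 \<phi> = integral {0..R} (\<lambda>t. \<bar>\<phi> t\<bar>)"

text \<open>
 To integrate \<open>\<phi>\<close> while keeping compact support, subtract the multiple of the fixed cutoff that
 has the same integral. The primitive \<open>\<psi>\<close> of the difference is an admissible profile, and \<open>pair_step\<close>
 trades it for one more derivative of \<open>u\<close>; the cutoff only contributes a multiple of the \<open>L\<^sup>1\<close> norms.
\<close>

theorem pair_bound:
 "j \<le> m ==> 0 < a ==> a \<le> R/2 ==> 7*R/8 \<le> b ==> b < R ==> smooth_in a b \<phi> ==>
  \<bar>pair (m - j) \<phi>\<bar> \<le> pair_const j * l1 \<phi> * U + n ^ m * (LINT x|Lb. D x * (norm x powr (1 - n) * iterated j \<phi> (norm x)))"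
proof (induction j arbitrary: \<phi>)
 case 0
 then have "\<bar>pair m \<phi>\<bar> \<le> n ^ m * (LINT x|Lb. D x * (norm x powr (1 - n) * \<bar>\<phi> (norm x)\<bar>))"
  unfolding card_lists[symmetric] by (intro pair_abs_le[OF _ _ _ D_int]) (use d_le m_pos in auto)
 then show ?case by simp
next
 case (Suc j)
 note a = Suc.prems(2,3) and b = Suc.prems(4,5) and \<phi> = Suc.prems(6)
 define k where "k = m - Suc j"
 have k: "k < m" "Suc k = m - j" using Suc.prems(1) by (auto simp: k_def)
 note \<kappa> = cut
 have C: "\<bar>pair k cut\<bar> \<le> n ^ k * cut_bound * U" using pair_cut_le[of k] k by simp
 define K where "K = (R/2) powr (1 - n) * R ^ j"
 have K: "K \<ge> 0" using R_pos by (simp add: K_def)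
 have lc: "n ^ m \<ge> 0" using n_pos by simp
 show ?case
 proof -
  have \<kappa>': "smooth_in a b cut" by (rule smooth_in_mono[OF \<kappa>(1)]) (use a b R_pos in auto)
  have sp: "smooth \<phi>" "\<And>x. x < a ==> \<phi> x = 0" "\<And>x. b < x ==> \<phi> x = 0" using \<phi> by (auto simp: smooth_in_def)
  have sk: "smooth cut" "\<And>x. x < 5*R/8 ==> cut x = 0" "\<And>x. b < x ==> cut x = 0" using \<kappa>(1) b by (auto simp: smooth_in_def)
  have cp: "continuous_on S \<phi>" for S by (rule smooth_continuous[OF sp(1)])
  have ck: "continuous_on S cut" for S by (rule smooth_continuous[OF sk(1)])
  define I where "I = integral {0..R} \<phi>"
  define f where "f x = \<phi> x - I * cut x" for x
  have tff: "smooth_in a b f" unfolding f_def[abs_def] by (rule smooth_in_diff_scale[OF \<phi> \<kappa>'])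
  have fz: "\<And>x. x < a ==> f x = 0" "\<And>x. b < x ==> f x = 0" and sf: "smooth f" using tff by (auto simp: smooth_in_def)
  have cf: "continuous_on S f" for S by (rule smooth_continuous[OF sf])
  define \<psi> where "\<psi> x = integral {0..x} f" for x
  have d\<psi>: "(\<psi> has_real_derivative f x) (at x)" for x
   unfolding \<psi>_def[abs_def] by (rule prim_has_derivative[OF cf a(1) fz(1)])
  have der: "deriv \<psi> = f" using DERIV_imp_deriv[OF d\<psi>] by blast
  have s\<psi>: "smooth \<psi>" by (rule smooth_realI[OF d\<psi> sf])
  have lin: "integral {0..x} f = integral {0..x} \<phi> - I * integral {0..x} cut" for x
   unfolding f_def[abs_def] using integrable_continuous_interval[OF cp] integrable_continuous_interval[OF ck]
   by (subst Henstock_Kurzweil_Integration.integral_diff) (auto intro: integrable_on_mult_right)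
  have tot: "integral {0..R} f = 0" unfolding lin using \<kappa>(3) by (simp add: I_def)
  have t\<psi>: "smooth_in a b \<psi>"
   unfolding smooth_in_def
  proof (intro conjI allI impI s\<psi>)
   fix x assume "x < a \<or> b < x"
   then show "\<psi> x = 0"
   proof
    assume x: "x < a"
    have "integral {0..x} f = integral {0..x} (\<lambda>_. 0)" by (intro Henstock_Kurzweil_Integration.integral_cong) (use fz(1) x in auto)
    then show ?thesis by (simp add: \<psi>_def)
   next
    assume x: "b < x"
    have b0: "0 \<le> b" using b R_pos by simp
    have "\<psi> x = integral {0..b} f" unfolding \<psi>_def by (rule integral_beyond_support[OF cf fz(2) b0]) (use x in auto)
    also have "... = integral {0..R} f" by (rule integral_beyond_support[OF cf fz(2) b0, symmetric]) (use b in auto)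
    finally show ?thesis using tot by simp
   qed
  qed
  have l1nn: "0 \<le> l1 \<phi>" unfolding l1_def by (rule integral_nonneg) (auto intro!: integrable_continuous_interval continuous_intros cp)
  have Pmono: "integral {0..x} (\<lambda>t. \<bar>\<phi> t\<bar>) \<le> integral {0..y} (\<lambda>t. \<bar>\<phi> t\<bar>)" if "x \<le> y" for x y
   using that by (intro integral_subset_le) (auto intro!: integrable_continuous_interval continuous_intros cp)
  have absI: "\<bar>I\<bar> \<le> l1 \<phi>" unfolding I_def l1_def real_norm_def[symmetric]
   by (rule integral_norm_bound_integral) (auto intro!: integrable_continuous_interval continuous_intros cp)
  define P where "P x = integral {0..x} (\<lambda>t. \<bar>\<phi> t\<bar>)" for x
  \<comment> \<open>the contribution of the cutoff, which vanishes below \<open>R/2\<close>\<close>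
  define E where "E x = (if R/2 < x then l1 \<phi> else 0)" for x
  have E0: "0 \<le> E x" and Emono: "x \<le> y ==> E x \<le> E y" for x y using l1nn by (auto simp: E_def)
  have P0: "0 \<le> P x" for x unfolding P_def by (rule integral_nonneg) (auto intro!: integrable_continuous_interval continuous_intros cp)
  have \<psi>le: "\<bar>\<psi> x\<bar> \<le> P x + E x" if x: "0 \<le> x" "x \<le> R" for x
  proof -
   have "\<bar>integral {0..x} \<phi>\<bar> \<le> P x" unfolding P_def real_norm_def[symmetric]
    by (rule integral_norm_bound_integral) (auto intro!: integrable_continuous_interval continuous_intros cp)
   moreover have "\<bar>I * integral {0..x} cut\<bar> \<le> E x"
   proof (cases "R/2 < x")
    case True
    have "0 \<le> integral {0..x} cut" by (rule integral_nonneg[OF integrable_continuous_interval[OF ck] \<kappa>(2)])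
    moreover have "integral {0..x} cut \<le> integral {0..R} cut"
     using x \<kappa>(2) by (intro integral_subset_le integrable_continuous_interval ck) auto
    ultimately have "\<bar>I\<bar> * \<bar>integral {0..x} cut\<bar> \<le> l1 \<phi> * 1" using \<kappa>(3) absI l1nn by (intro mult_mono) auto
    then show ?thesis using True by (simp add: E_def abs_mult)
   next
    case False
    have "integral {0..x} cut = integral {0..x} (\<lambda>_. 0)"
     by (intro Henstock_Kurzweil_Integration.integral_cong) (use sk(2) False R_pos in auto)
    then show ?thesis using E0 by simp
   qed
   ultimately show ?thesis unfolding \<psi>_def lin by linarith
  qed
  have Ple: "P x \<le> l1 \<phi>" if "x \<le> R" for x unfolding P_def l1_def using Pmono[OF that] .
  have El: "E x \<le> l1 \<phi>" for x using l1nn by (simp add: E_def)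
  have c\<psi>: "continuous_on S (\<lambda>t. \<bar>\<psi> t\<bar>)" for S by (intro continuous_intros smooth_continuous[OF s\<psi>])
  have P\<psi>: "integral {0..x} (\<lambda>t. \<bar>\<psi> t\<bar>) \<le> x * (P x + E x)" if x: "0 \<le> x" "x \<le> R" for x
  proof -
   have "integral {0..x} (\<lambda>t. \<bar>\<psi> t\<bar>) \<le> integral {0..x} (\<lambda>t. P x + E x)"
   proof (rule integral_le)
    fix t assume t: "t \<in> {0..x}"
    have "\<bar>\<psi> t\<bar> \<le> P t + E t" using t x by (intro \<psi>le) auto
    also have "... \<le> P x + E x" using t Pmono[of t x] Emono[of t x] by (simp add: P_def add_mono)
    finally show "\<bar>\<psi> t\<bar> \<le> P x + E x" .
   qed (auto intro: integrable_continuous_interval c\<psi>)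
   then show ?thesis using x by simp
  qed
  have l1\<psi>: "l1 \<psi> \<le> 2 * R * l1 \<phi>"
  proof -
   have "l1 \<psi> \<le> R * (P R + E R)" unfolding l1_def[of \<psi>] using P\<psi>[of R] R_pos by simp
   also have "... \<le> R * (l1 \<phi> + l1 \<phi>)" using R_pos Ple[of R] El[of R] by (intro mult_left_mono add_mono) auto
   finally show ?thesis by simp
  qed
  have it: "iterated j \<psi> x \<le> iterated (Suc j) \<phi> x + x ^ j * E x" if x: "0 \<le> x" "x \<le> R" for x
  proof (cases j)
   case 0 then show ?thesis using \<psi>le[OF x] by (simp add: P_def)
  next
   case (Suc i)
   have "iterated j \<psi> x \<le> x ^ i * (x * (P x + E x))"
    unfolding Suc iterated.simps using P\<psi>[OF x] x by (intro mult_left_mono) auto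
   also have "... = iterated (Suc j) \<phi> x + x ^ j * E x" by (simp add: Suc P_def algebra_simps)
   finally show ?thesis .
  qed
  have pt: "norm x powr (1 - n) * iterated j \<psi> (norm x) \<le> norm x powr (1 - n) * iterated (Suc j) \<phi> (norm x) + K * l1 \<phi>"
   if x: "x \<in> ball 0 R" for x :: "real ^ 'n"
  proof -
   have nx: "0 \<le> norm x" "norm x \<le> R" using x by auto
   have "norm x powr (1 - n) * iterated j \<psi> (norm x) \<le> norm x powr (1 - n) * (iterated (Suc j) \<phi> (norm x) + norm x ^ j * E (norm x))"
    by (intro mult_left_mono it nx) simp
   also have "... = norm x powr (1 - n) * iterated (Suc j) \<phi> (norm x) + norm x powr (1 - n) * (norm x ^ j * E (norm x))"
    by (simp add: distrib_left)
   also have "norm x powr (1 - n) * (norm x ^ j * E (norm x)) \<le> K * l1 \<phi>"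
   proof (cases "R/2 < norm x")
    case True
    have "norm x powr (1 - n) \<le> (R/2) powr (1 - n)" using True R_pos n_pos by (intro powr_mono2') auto
    moreover have "norm x ^ j \<le> R ^ j" by (intro power_mono nx)
    ultimately have "norm x powr (1 - n) * norm x ^ j \<le> K" unfolding K_def by (intro mult_mono) auto
    then have "norm x powr (1 - n) * norm x ^ j * l1 \<phi> \<le> K * l1 \<phi>" by (intro mult_right_mono l1nn)
    then show ?thesis using True by (simp add: E_def mult.assoc)
   next
    case False then show ?thesis using K l1nn by (simp add: E_def)
   qed
   finally show ?thesis by simp
  qed
  have "pair k f = pair k \<phi> - I * pair k cut"
   unfolding f_def[abs_def] using k by (intro pair_diff_scale[OF \<phi> \<kappa>' a(1)]) simp
  moreover have "pair (m - j) \<psi> = - pair k f" using pair_step[OF t\<psi> a(1) b(2) k(1)] by (simp add: k(2) der)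
  ultimately have e1: "\<bar>pair k \<phi>\<bar> \<le> \<bar>pair (m - j) \<psi>\<bar> + \<bar>I\<bar> * \<bar>pair k cut\<bar>" by (simp add: abs_mult[symmetric])
  have e2: "\<bar>I\<bar> * \<bar>pair k cut\<bar> \<le> l1 \<phi> * (n ^ k * cut_bound * U)" by (intro mult_mono absI C l1nn) auto
  have e3: "\<bar>pair (m - j) \<psi>\<bar> \<le> pair_const j * l1 \<psi> * U + n ^ m * (LINT x|Lb. D x * (norm x powr (1 - n) * iterated j \<psi> (norm x)))"
   by (rule Suc.IH) (use Suc.prems(1) a b t\<psi> in auto)
  have e4: "pair_const j * l1 \<psi> * U \<le> pair_const j * (2 * R * l1 \<phi>) * U" by (intro mult_right_mono mult_left_mono l1\<psi> pair_const_nonneg U_nonneg)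
  have "(LINT x|Lb. D x * (norm x powr (1 - n) * iterated j \<psi> (norm x)))
   \<le> (LINT x|Lb. D x * (norm x powr (1 - n) * iterated (Suc j) \<phi> (norm x)) + K * l1 \<phi> * D x)"
  proof (rule integral_mono)
   show "integrable Lb (\<lambda>x. D x * (norm x powr (1 - n) * iterated j \<psi> (norm x)))"
    by (rule integrable_radial[OF D_int iterated_continuous(1)[of \<psi> a] a(1) iterated_continuous(2)[of \<psi> a]])
     (use t\<psi> a in \<open>auto simp: smooth_in_def intro: smooth_continuous\<close>)
   have "integrable Lb (\<lambda>x. D x * (norm x powr (1 - n) * iterated (Suc j) \<phi> (norm x)))"
    by (rule integrable_radial[OF D_int iterated_continuous(1)[of \<phi> a] a(1) iterated_continuous(2)[of \<phi> a]])
     (use \<phi> a in \<open>auto simp: smooth_in_def intro: smooth_continuous\<close>)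
   then show "integrable Lb (\<lambda>x. D x * (norm x powr (1 - n) * iterated (Suc j) \<phi> (norm x)) + K * l1 \<phi> * D x)"
    using D_int by simp
   fix x assume "x \<in> space Lb"
   then have "D x * (norm x powr (1 - n) * iterated j \<psi> (norm x)) \<le> D x * (norm x powr (1 - n) * iterated (Suc j) \<phi> (norm x) + K * l1 \<phi>)"
    by (intro mult_left_mono pt D_nonneg) simp
   then show "D x * (norm x powr (1 - n) * iterated j \<psi> (norm x)) \<le> D x * (norm x powr (1 - n) * iterated (Suc j) \<phi> (norm x)) + K * l1 \<phi> * D x"
    by (simp add: algebra_simps)
  qed
  also have "... = (LINT x|Lb. D x * (norm x powr (1 - n) * iterated (Suc j) \<phi> (norm x))) + K * l1 \<phi> * (LINT x|Lb. D x)"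
  proof -
   have "integrable Lb (\<lambda>x. D x * (norm x powr (1 - n) * iterated (Suc j) \<phi> (norm x)))"
    by (rule integrable_radial[OF D_int iterated_continuous(1)[of \<phi> a] a(1) iterated_continuous(2)[of \<phi> a]])
     (use \<phi> a in \<open>auto simp: smooth_in_def intro: smooth_continuous\<close>)
   then show ?thesis using D_int by simp
  qed
  also have "K * l1 \<phi> * (LINT x|Lb. D x) \<le> K * l1 \<phi> * U" by (intro mult_left_mono D_le_U mult_nonneg_nonneg K l1nn)
  finally have "(LINT x|Lb. D x * (norm x powr (1 - n) * iterated j \<psi> (norm x))) \<le>
   (LINT x|Lb. D x * (norm x powr (1 - n) * iterated (Suc j) \<phi> (norm x))) + K * l1 \<phi> * U" by simp
  from mult_left_mono[OF this lc] have e5: "n ^ m * (LINT x|Lb. D x * (norm x powr (1 - n) * iterated j \<psi> (norm x))) \<le>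
   n ^ m * (LINT x|Lb. D x * (norm x powr (1 - n) * iterated (Suc j) \<phi> (norm x))) + n ^ m * (K * l1 \<phi> * U)"
   by (simp only: distrib_left)
  have comb: "p \<le> (pair_const j * (2 * R) + n ^ k * cut_bound + n ^ m * K) * l1 \<phi> * U + J"
   if "p \<le> q + r" "r \<le> l1 \<phi> * (n ^ k * cut_bound * U)" "q \<le> s + t" "s \<le> pair_const j * (2 * R * l1 \<phi>) * U" "t \<le> J + n ^ m * (K * l1 \<phi> * U)" for p q r s t J
  proof -
   have "p \<le> l1 \<phi> * (n ^ k * cut_bound * U) + pair_const j * (2 * R * l1 \<phi>) * U + (J + n ^ m * (K * l1 \<phi> * U))" using that by linarith
   then show ?thesis by (simp add: algebra_simps)
  qed
  show ?thesis using comb[OF e1 e2 e3 e4 e5] by (simp only: k_def K_def pair_const.simps)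
 qed
qed

end

section \<open>The pointwise bound\<close>

lemma nn_integral_interval_continuous:
 fixes f :: "real => real"
 assumes f: "continuous_on UNIV f" and nn: "\<And>x. 0 \<le> f x" and r: "0 \<le> r"
 shows "(\<integral>\<^sup>+t. ennreal (f t) * indicator {0<..<r} t \<partial>lborel) = ennreal (integral {0..r} f)"
proof -
 have "(f has_integral integral {0..r} f) {0..r}"
  by (intro integrable_integral integrable_continuous_interval continuous_on_subset[OF f]) simp
 then have "(\<integral>\<^sup>+t. ennreal (f t) * indicator {0..r} t \<partial>lborel) = ennreal (integral {0..r} f)"
  by (intro nn_integral_has_integral_lebesgue') (use nn in auto)
 moreover have "(\<integral>\<^sup>+t. ennreal (f t) * indicator {0<..<r} t \<partial>lborel) = (\<integral>\<^sup>+t. ennreal (f t) * indicator {0..r} t \<partial>lborel)"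
 proof (rule nn_integral_cong_AE)
  have "AE t in lborel. t \<noteq> 0 \<and> t \<noteq> r" by (intro AE_conjI AE_lborel_singleton)
  then show "AE t in lborel. ennreal (f t) * indicator {0<..<r} t = ennreal (f t) * indicator {0..r} t"
   by eventually_elim (auto simp: indicator_def)
 qed
 ultimately show ?thesis by simp
qed

text \<open>
 Inner regularity.
\<close>

lemma compact_subset_of_positive_measure:
 fixes S :: "'a::euclidean_space set"
 assumes S: "S \<in> sets lebesgue" "S \<notin> null_sets lebesgue"
 obtains K where "compact K" "K \<subseteq> S" "K \<notin> null_sets lebesgue"
proof -
 obtain C T where CT: "fsigma C" "T \<in> null_sets lebesgue" "C \<union> T = S" using lebesgue_set_almost_fsigma[OF S(1)] by blast
 obtain F :: "nat => 'a set" where F: "range F \<subseteq> Collect compact" "C = \<Union>(F ` UNIV)"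
  using CT(1) unfolding fsigma_Union_compact by blast
 have "\<exists>i. F i \<notin> null_sets lebesgue"
 proof (rule ccontr)
  assume "\<nexists>i. F i \<notin> null_sets lebesgue"
  then have "(\<Union>i. F i) \<in> null_sets lebesgue" by (intro null_sets_UN) auto
  then have "C \<union> T \<in> null_sets lebesgue" using CT(2) F(2) by auto
  then show False using S(2) CT(3) by simp
 qed
 then obtain i where "F i \<notin> null_sets lebesgue" by blast
 moreover have "compact (F i)" "F i \<subseteq> S" using F CT(3) by auto
 ultimately show ?thesis using that by blast
qed

context target_setting begin

lemma AE_Lb_nonzero: "AE x in Lb. x \<noteq> 0"
 by (rule AE_lebesgue_on_nonzero) simp

definition \<Omega> :: real where "\<Omega> = n * unit_ball_vol n"

lemma sphere_area_n: "sphere_area CARD('n) = \<Omega>" by (simp add: sphere_area_def \<Omega>_def n_eq[symmetric])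

lemma \<Omega>_pos: "\<Omega> > 0" using n_pos by (simp add: \<Omega>_def)

lemma inverse_\<Omega>_finite: "inverse (ennreal \<Omega>) < top" using \<Omega>_pos by (simp add: inverse_ennreal)

lemma nn_integral_ball_radial:
 assumes [measurable]: "g \<in> borel_measurable borel"
 shows "(\<integral>\<^sup>+x. ennreal (norm x powr (1 - n)) * g (norm x) \<partial>Lb) = ennreal \<Omega> * (\<integral>\<^sup>+r. g r * indicator {0<..<R} r \<partial>lborel)"
proof -
 have "(\<integral>\<^sup>+x. ennreal (norm x powr (1 - n)) * g (norm x) \<partial>Lb) =
  (\<integral>\<^sup>+r. (ennreal (r powr (1 - n)) * g r) * (ennreal (\<Omega> * r powr (real CARD('n) + 0 - 1)) * indicator {0<..<R} r) \<partial>lborel)"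
  unfolding weighted_ball_zero[symmetric] sphere_area_n[symmetric] by (rule nn_integral_weighted_radial) measurable
 also have "... = (\<integral>\<^sup>+r. ennreal \<Omega> * (g r * indicator {0<..<R} r) \<partial>lborel)"
 proof (rule nn_integral_cong)
  fix r :: real
  show "(ennreal (r powr (1 - n)) * g r) * (ennreal (\<Omega> * r powr (real CARD('n) + 0 - 1)) * indicator {0<..<R} r) = ennreal \<Omega> * (g r * indicator {0<..<R} r)"
  proof (cases "r \<in> {0<..<R}")
   case True
   have "r powr (1 - n) * (\<Omega> * r powr (real CARD('n) + 0 - 1)) = \<Omega> * (r powr (1 - n) * r powr (n - 1))" by (simp add: n_eq)
   also have "r powr (1 - n) * r powr (n - 1) = 1" using True by (simp add: powr_add[symmetric])
   finally have "ennreal (r powr (1 - n)) * ennreal (\<Omega> * r powr (real CARD('n) + 0 - 1)) = ennreal \<Omega>"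
    using \<Omega>_pos by (subst ennreal_mult[symmetric]) auto
   then show ?thesis using True by (simp add: ac_simps)
  qed simp
 qed
 also have "... = ennreal \<Omega> * (\<integral>\<^sup>+r. g r * indicator {0<..<R} r \<partial>lborel)" by (rule nn_integral_cmult) measurable
 finally show ?thesis .
qed

text \<open>
 In polar coordinates and up to a constant, \<open>\<integral>\<^sub>r\<^sup>R D(\<rho>) \<rho>\<^bsup>m-1\<^esup> d\<rho>\<close> for radial \<open>D\<close>.
\<close>

definition tail :: "(real ^ 'n => real) => real => ennreal" where
 "tail D r = (\<integral>\<^sup>+y. ennreal (D y * norm y powr (real m - n)) * indicator {r<..} (norm y) \<partial>Lb)"

lemma tail_antimono: "r \<le> s ==> tail D s \<le> tail D r"
 unfolding tail_def by (intro nn_integral_mono mult_left_mono) (auto simp: indicator_def)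

lemma tail_borel [measurable]: "tail D \<in> borel_measurable borel"
 by (rule antimono_borel_measurable_ennreal) (rule tail_antimono)

end

context radial_sobolev_function begin

definition G :: "real => ennreal" where
 "G r = ennreal (pair_const m * U) + ennreal (n ^ m) * tail D r"

lemma G_borel [measurable]: "G \<in> borel_measurable borel"
 unfolding G_def by measurable

lemma G_antimono: "r \<le> s ==> G s \<le> G r"
 unfolding G_def by (intro add_left_mono mult_left_mono tail_antimono) auto

lemma D_measurable [measurable]: "D \<in> borel_measurable Lb" using D_int by auto
lemma u_measurable [measurable]: "u \<in> borel_measurable Lb" using u_int by auto

lemma norm_measurable_Lb [measurable]: "(\<lambda>x. norm x) \<in> borel_measurable Lb"
 by (rule borel_measurable_lebesgue_on) simp

lemma G_finite: assumes "r > 0" shows "G r < top"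
proof -
 define C where "C = max (r powr (real m - n)) (R powr (real m - n))"
 have "tail D r \<le> (\<integral>\<^sup>+y. ennreal (C * D y) \<partial>Lb)"
  unfolding tail_def
 proof (rule nn_integral_mono)
  fix y assume "y \<in> space Lb"
  then have yR: "norm y \<le> R" by simp
  show "ennreal (D y * norm y powr (real m - n)) * indicator {r<..} (norm y) \<le> ennreal (C * D y)"
  proof (cases "r < norm y")
   case True
   have "norm y powr (real m - n) \<le> C"
   proof (cases "real m - n \<ge> 0")
    case True
    then have "norm y powr (real m - n) \<le> R powr (real m - n)" using yR by (intro powr_mono2) auto
    then show ?thesis by (simp add: C_def)
   next
    case False
    then have "norm y powr (real m - n) \<le> r powr (real m - n)" using \<open>r < norm y\<close> assms by (intro powr_mono2') auto
    then show ?thesis by (simp add: C_def)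
   qed
   then have "D y * norm y powr (real m - n) \<le> C * D y" using D_nonneg[of y] by (subst mult.commute) (rule mult_right_mono)
   then show ?thesis using True by (simp add: ennreal_leI)
  qed simp
 qed
 also have "... < top"
 proof -
  have "integrable Lb (\<lambda>y. C * D y)" using D_int by simp
  then show ?thesis using D_nonneg by (subst nn_integral_eq_integral) (auto simp: C_def max_def intro!: AE_I2)
 qed
 finally show ?thesis unfolding G_def by (auto simp: ennreal_mult_less_top)
qed

text \<open>
 Fubini moves the primitives in \<open>pair_bound\<close> from \<open>\<phi>\<close> to the derivatives of \<open>u\<close>, where they
 become the tail integral.
\<close>

lemma test_inequality:
 assumes a: "0 < a" "a \<le> R/2" and b: "7*R/8 \<le> b" "b < R" and \<phi>: "smooth_in a b \<phi>"
 shows "ennreal \<bar>LINT x|Lb. u x * (norm x powr (1 - n) * \<phi> (norm x))\<bar> \<le>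
   (\<integral>\<^sup>+x. ennreal (norm x powr (1 - n)) * (ennreal \<bar>\<phi> (norm x)\<bar> * (G (norm x) / ennreal \<Omega>)) \<partial>Lb)"
proof -
 have s: "smooth \<phi>" "\<And>x. x < a ==> \<phi> x = 0" "\<And>x. b < x ==> \<phi> x = 0" using \<phi> by (auto simp: smooth_in_def)
 have c\<phi>: "continuous_on UNIV \<phi>" by (rule smooth_continuous[OF s(1)])
 have cont: "continuous_on UNIV (\<lambda>x. \<bar>\<phi> x\<bar>)" by (intro continuous_intros c\<phi>)
 have [measurable]: "\<phi> \<in> borel_measurable borel" by (rule borel_measurable_continuous_onI[OF c\<phi>])
 define P where "P r = integral {0..r} (\<lambda>t. \<bar>\<phi> t\<bar>)" for r
 have P: "ennreal (P r) = (\<integral>\<^sup>+t. ennreal \<bar>\<phi> t\<bar> * indicator {0<..<r} t \<partial>lborel)" if "0 \<le> r" for r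
  unfolding P_def by (rule nn_integral_interval_continuous[OF cont _ that, symmetric]) simp
 have P0: "0 \<le> P r" for r unfolding P_def by (rule integral_nonneg) (auto intro!: integrable_continuous_interval continuous_on_subset[OF cont])
 obtain i where i: "m = Suc i" using m_pos by (cases m) auto
 define J where "J = (LINT x|Lb. D x * (norm x powr (1 - n) * iterated m \<phi> (norm x)))"
 have intJ: "integrable Lb (\<lambda>x. D x * (norm x powr (1 - n) * iterated m \<phi> (norm x)))"
  by (rule integrable_radial[OF D_int iterated_continuous(1)[OF c\<phi> a(1) s(2)] a(1) iterated_continuous(2)[OF c\<phi> a(1) s(2)]])
 have itnn: "0 \<le> iterated m \<phi> (norm x)" for x :: "real ^ 'n" unfolding i using P0[of "norm x"] by (simp add: P_def)
 have "ennreal J = (\<integral>\<^sup>+x. ennreal (D x * (norm x powr (1 - n) * iterated m \<phi> (norm x))) \<partial>Lb)"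
  unfolding J_def using D_nonneg itnn by (intro nn_integral_eq_integral[symmetric] intJ AE_I2) simp
 also have "... = (\<integral>\<^sup>+x. (\<integral>\<^sup>+t. ennreal (D x * norm x powr (real m - n)) * (ennreal \<bar>\<phi> t\<bar> * indicator {(t, x). 0 < t \<and> t < norm x} (t, x)) \<partial>lborel) \<partial>Lb)"
 proof (rule nn_integral_cong)
  fix x :: "real ^ 'n"
  have e: "norm x powr (1 - n) * iterated m \<phi> (norm x) = norm x powr (real m - n) * P (norm x)"
  proof (cases "x = 0")
   case False
   have "norm x powr (1 - n) * norm x ^ i = norm x powr (1 - n + real i)" using False by (simp add: powr_add powr_realpow)
   also have "1 - n + real i = real m - n" by (simp add: i)
   finally show ?thesis unfolding i P_def by (simp add: mult.assoc[symmetric])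
  qed (simp add: P_def)
  have "ennreal (D x * (norm x powr (1 - n) * iterated m \<phi> (norm x))) = ennreal (D x * norm x powr (real m - n)) * ennreal (P (norm x))"
   unfolding e using D_nonneg[of x] P0 by (simp add: ennreal_mult[symmetric] mult.assoc)
  also have "ennreal (P (norm x)) = (\<integral>\<^sup>+t. ennreal \<bar>\<phi> t\<bar> * indicator {(t, x). 0 < t \<and> t < norm x} (t, x) \<partial>lborel)"
   by (subst P) (auto intro!: nn_integral_cong simp: indicator_def)
  also have "ennreal (D x * norm x powr (real m - n)) * ... = (\<integral>\<^sup>+t. ennreal (D x * norm x powr (real m - n)) * (ennreal \<bar>\<phi> t\<bar> * indicator {(t, x). 0 < t \<and> t < norm x} (t, x)) \<partial>lborel)"
  proof (rule nn_integral_cmult[symmetric])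
   have "(\<lambda>t. ennreal \<bar>\<phi> t\<bar> * indicator {(t, x). 0 < t \<and> t < norm x} (t, x)) = (\<lambda>t. ennreal \<bar>\<phi> t\<bar> * indicator {0<..<norm x} t)"
    by (auto simp: indicator_def)
   then show "(\<lambda>t. ennreal \<bar>\<phi> t\<bar> * indicator {(t, x). 0 < t \<and> t < norm x} (t, x)) \<in> borel_measurable lborel" by simp
  qed
  finally show "ennreal (D x * (norm x powr (1 - n) * iterated m \<phi> (norm x))) = ..." .
 qed
 also have "... = (\<integral>\<^sup>+t. (\<integral>\<^sup>+x. ennreal (D x * norm x powr (real m - n)) * (ennreal \<bar>\<phi> t\<bar> * indicator {(t, x). 0 < t \<and> t < norm x} (t, x)) \<partial>Lb) \<partial>lborel)"
 proof -
  interpret PS: pair_sigma_finite Lb lborel by (intro pair_sigma_finite.intro L.sigma_finite_measure_axioms sigma_finite_lborel)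
  show ?thesis by (rule PS.Fubini'[symmetric]) measurable
 qed
 also have "... = (\<integral>\<^sup>+t. ennreal \<bar>\<phi> t\<bar> * tail D t * indicator {0<..<R} t \<partial>lborel)"
 proof (rule nn_integral_cong)
  fix t :: real
  have "(\<integral>\<^sup>+x. ennreal (D x * norm x powr (real m - n)) * (ennreal \<bar>\<phi> t\<bar> * indicator {(t, x). 0 < t \<and> t < norm x} (t, x)) \<partial>Lb)
   = (\<integral>\<^sup>+x. (ennreal \<bar>\<phi> t\<bar> * indicator {0<..<R} t) * (ennreal (D x * norm x powr (real m - n)) * indicator {t<..} (norm x)) \<partial>Lb)"
   by (intro nn_integral_cong) (auto simp: indicator_def mult.commute)
  also have "... = (ennreal \<bar>\<phi> t\<bar> * indicator {0<..<R} t) * tail D t"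
   unfolding tail_def by (rule nn_integral_cmult) measurable
  finally show "(\<integral>\<^sup>+x. ennreal (D x * norm x powr (real m - n)) * (ennreal \<bar>\<phi> t\<bar> * indicator {(t, x). 0 < t \<and> t < norm x} (t, x)) \<partial>Lb)
   = ennreal \<bar>\<phi> t\<bar> * tail D t * indicator {0<..<R} t" by (simp add: ac_simps)
 qed
 finally have J: "ennreal J = (\<integral>\<^sup>+t. ennreal \<bar>\<phi> t\<bar> * tail D t * indicator {0<..<R} t \<partial>lborel)" .
 have J0: "0 \<le> J" unfolding J_def using D_nonneg itnn by (intro integral_nonneg_AE AE_I2) simp
 have l1: "ennreal (l1 \<phi>) = (\<integral>\<^sup>+t. ennreal \<bar>\<phi> t\<bar> * indicator {0<..<R} t \<partial>lborel)"
  using P[of R] R_pos by (simp add: P_def l1_def)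
 have l10: "0 \<le> l1 \<phi>" using P0[of R] by (simp add: P_def l1_def)
 have pair0: "pair 0 \<phi> = (LINT x|Lb. u x * (norm x powr (1 - n) * \<phi> (norm x)))"
  by (simp add: pair_def d_Nil kern_def mon_def mult.commute)
 have "ennreal \<bar>pair 0 \<phi>\<bar> \<le> ennreal (pair_const m * l1 \<phi> * U + n ^ m * J)"
  using pair_bound[OF order_refl a b \<phi>] unfolding J_def by (intro ennreal_leI) simp
 also have "... = ennreal (pair_const m * U) * ennreal (l1 \<phi>) + ennreal (n ^ m) * ennreal J"
  using pair_const_nonneg[of m] l10 U_nonneg J0 n_pos
  by (simp add: ennreal_mult[symmetric] ennreal_plus[symmetric] ac_simps del: ennreal_plus)
 also have "... = (\<integral>\<^sup>+t. ennreal (pair_const m * U) * (ennreal \<bar>\<phi> t\<bar> * indicator {0<..<R} t) + ennreal (n ^ m) * (ennreal \<bar>\<phi> t\<bar> * tail D t * indicator {0<..<R} t) \<partial>lborel)"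
  unfolding l1 J by (subst nn_integral_add) (auto simp: nn_integral_cmult)
 also have "... = (\<integral>\<^sup>+t. ennreal \<bar>\<phi> t\<bar> * G t * indicator {0<..<R} t \<partial>lborel)"
  by (intro nn_integral_cong) (auto simp: G_def indicator_def distrib_left ac_simps)
 also have "... = (\<integral>\<^sup>+t. ennreal \<Omega> * ((ennreal \<bar>\<phi> t\<bar> * (G t / ennreal \<Omega>)) * indicator {0<..<R} t) \<partial>lborel)"
 proof (rule nn_integral_cong)
  fix t
  have "ennreal \<Omega> * (G t / ennreal \<Omega>) = G t" using \<Omega>_pos by (intro ennreal_mult_divide_cancel) auto
  then show "ennreal \<bar>\<phi> t\<bar> * G t * indicator {0<..<R} t = ennreal \<Omega> * ((ennreal \<bar>\<phi> t\<bar> * (G t / ennreal \<Omega>)) * indicator {0<..<R} t)"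
   by (metis mult.assoc mult.left_commute)
 qed
 also have "... = ennreal \<Omega> * (\<integral>\<^sup>+t. (ennreal \<bar>\<phi> t\<bar> * (G t / ennreal \<Omega>)) * indicator {0<..<R} t \<partial>lborel)"
  by (rule nn_integral_cmult) measurable
 also have "... = (\<integral>\<^sup>+x. ennreal (norm x powr (1 - n)) * (ennreal \<bar>\<phi> (norm x)\<bar> * (G (norm x) / ennreal \<Omega>)) \<partial>Lb)"
  by (rule nn_integral_ball_radial[symmetric]) measurable
 finally show ?thesis by (simp add: pair0)
qed

text \<open>
 If the bound failed on a set of positive measure, it would fail on all spheres that meet some
 compact subset \<open>K\<close>, as \<open>u\<close> is radial. Testing with profiles converging to the indicator of \<open>norm ` K\<close>
 gives a contradiction. The profile \<open>h\<close> is arbitrary, so measurability of the exceptional set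
 comes from completeness of the measure.
\<close>

lemma one_sided_bound:
 assumes \<sigma>: "\<bar>\<sigma>\<bar> = (1::real)"
 shows "AE x in Lb. ennreal (\<sigma> * u x) \<le> G (norm x) / ennreal \<Omega>"
proof -
 define \<gamma> where "\<gamma> r = enn2real (G r / ennreal \<Omega>)" for r
 have \<gamma>: "G r / ennreal \<Omega> = ennreal (\<gamma> r)" if "0 < r" for r
  using G_finite[OF that] inverse_\<Omega>_finite by (simp add: \<gamma>_def divide_ennreal_def ennreal_mult_less_top)
 have \<gamma>0: "0 \<le> \<gamma> r" for r by (simp add: \<gamma>_def)
 have \<gamma>le: "\<gamma> r \<le> \<gamma> a" if "0 < a" "a \<le> r" for a r
  using divide_right_mono_ennreal[OF G_antimono[OF that(2)], of "ennreal \<Omega>"] \<gamma>[of r] \<gamma>[of a] that \<gamma>0 by simp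
 have [measurable]: "\<gamma> \<in> borel_measurable borel" unfolding \<gamma>_def by measurable
 define d where "d x = \<sigma> * u x - \<gamma> (norm x)" for x
 have [measurable]: "d \<in> borel_measurable Lb" unfolding d_def by measurable
 define E :: "(real ^ 'n) set" where "E = {x \<in> ball 0 R. x \<noteq> 0 \<and> \<gamma> (norm x) < \<sigma> * h (norm x)}"
 have EE: "AE x in Lb. (x \<in> {x \<in> space Lb. 0 < d x}) = (x \<in> E)"
  using radial AE_Lb_nonzero AE_space by eventually_elim (auto simp: E_def d_def)
 interpret LC: complete_measure Lb by (rule complete_measure_lebesgue_on) simp
 have EL: "E \<in> sets Lb"
  by (rule LC.in_sets_AE[OF EE]) (measurable, auto simp: E_def)
 then have El: "E \<in> sets lebesgue" by (simp add: sets_restrict_space_iff)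
 have "E \<in> null_sets lebesgue"
 proof (rule ccontr)
  assume "E \<notin> null_sets lebesgue"
  then obtain K where K: "compact K" "K \<subseteq> E" "K \<notin> null_sets lebesgue"
   using compact_subset_of_positive_measure[OF El] by blast
  define C where "C = norm ` K"
  have C: "compact C" unfolding C_def using K(1) by (intro compact_continuous_image continuous_intros)
  have CR: "C \<subseteq> ball (R/2) (R/2)"
  proof
   fix r assume "r \<in> C"
   then obtain x where "x \<in> E" "r = norm x" using K(2) by (auto simp: C_def)
   then have "0 < r" "r < R" by (auto simp: E_def)
   then show "r \<in> ball (R/2) (R/2)" by (auto simp: dist_real_def abs_if field_simps)
  qed
  obtain \<phi> r where \<phi>: "r < R/2" "\<And>k. smooth (\<phi> k)" "\<And>k x. 0 \<le> \<phi> k x" "\<And>k x. \<phi> k x \<le> 1"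
   "\<And>k x. x \<notin> cball (R/2) r ==> \<phi> k x = (0::real)" "\<And>x. (\<lambda>k. \<phi> k x) \<longlonglongrightarrow> indicator C x"
   by (rule smooth_approx_indicator[OF C CR], rule that; assumption)
  define a where "a = min (R/2 - r) (R/2)"
  \<comment> \<open>\<open>[a,b]\<close> has to contain the supports of both the profiles and the cutoff\<close>
  define b where "b = max (R/2 + r) (7*R/8)"
  have a: "0 < a" "a \<le> R/2"
  proof -
   show "0 < a" using \<phi>(1) R_pos by (simp add: a_def)
   show "a \<le> R/2" unfolding a_def by (rule min.cobounded2)
  qed
  have b: "7*R/8 \<le> b" "b < R" using \<phi>(1) R_pos by (auto simp: b_def)
  have z: "\<phi> k x = 0" if "x < a \<or> b < x" for k x
   by (rule \<phi>(5)) (use that in \<open>auto simp: a_def b_def dist_real_def abs_if split: if_splits\<close>)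
  have smooth_in: "smooth_in a b (\<phi> k)" for k unfolding smooth_in_def using \<phi>(2) z by blast
  have [measurable]: "\<phi> k \<in> borel_measurable borel" for k by (rule borel_measurable_continuous_onI[OF smooth_continuous[OF \<phi>(2)]])
  have [measurable]: "C \<in> sets borel" using C by (simp add: borel_compact)
  have indz: "indicator C r = (0::real)" if "r < a" for r
   using LIMSEQ_unique[OF \<phi>(6)[of r]] z[of r] that by simp
  let ?w = "\<lambda>x::real ^ 'n. norm x powr (1 - n)" and ?V = "\<lambda>x. a powr (1 - n) * (\<bar>u x\<bar> + \<gamma> a)"
  have wb: "?w x \<le> a powr (1 - n)" if "a \<le> norm x" for x using that a n_pos by (intro powr_mono2') auto
  have V: "integrable Lb ?V" using u_int by simp
  have bound: "norm (v * (?w x * c)) \<le> ?V x" if "0 \<le> c" "c \<le> 1" "norm x < a ==> c = 0" "a \<le> norm x ==> \<bar>v\<bar> \<le> \<bar>u x\<bar> + \<gamma> a" for v c x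
  proof (cases "norm x < a")
   case True
   then show ?thesis using that \<gamma>0 by simp
  next
   case False
   then have "\<bar>v\<bar> * (?w x * c) \<le> (\<bar>u x\<bar> + \<gamma> a) * (a powr (1 - n) * 1)" using that wb[of x] \<gamma>0[of a] by (intro mult_mono) auto
   then show ?thesis using that by (simp add: abs_mult mult.commute)
  qed
  have ub: "\<bar>\<sigma> * u x\<bar> \<le> \<bar>u x\<bar> + \<gamma> a" for x using \<sigma> \<gamma>0[of a] by (simp add: abs_mult)
  have gb: "\<bar>\<gamma> (norm x)\<bar> \<le> \<bar>u x\<bar> + \<gamma> a" if "a \<le> norm x" for x using \<gamma>le[OF a(1) that] \<gamma>0[of "norm x"] by simp
  have db: "\<bar>d x\<bar> \<le> \<bar>u x\<bar> + \<gamma> a" if "a \<le> norm x" for x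
   using \<gamma>le[OF a(1) that] \<gamma>0[of "norm x"] \<sigma> unfolding d_def by (simp add: abs_mult abs_if split: if_splits)
  have int: "integrable Lb (\<lambda>x. v x * (?w x * \<phi> k (norm x)))"
   if [measurable]: "v \<in> borel_measurable Lb" and "\<And>x. a \<le> norm x ==> \<bar>v x\<bar> \<le> \<bar>u x\<bar> + \<gamma> a" for v k
   by (rule Bochner_Integration.integrable_bound[OF V]) (use bound[OF \<phi>(3,4) z that(2)] \<gamma>0[of a] in \<open>auto intro: order_trans[OF _ abs_ge_self]\<close>)
  have lim: "(\<lambda>k. LINT x|Lb. d x * (?w x * \<phi> k (norm x))) \<longlonglongrightarrow> (LINT x|Lb. d x * (?w x * indicator C (norm x)))"
  proof (rule integral_dominated_convergence[OF _ _ V])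
   show "AE x in Lb. (\<lambda>k. d x * (?w x * \<phi> k (norm x))) \<longlonglongrightarrow> d x * (?w x * indicator C (norm x))"
    by (intro AE_I2 tendsto_intros \<phi>(6))
   show "AE x in Lb. norm (d x * (?w x * \<phi> k (norm x))) \<le> ?V x" for k
    by (intro AE_I2 bound \<phi> z db) auto
  qed measurable
  have "(LINT x|Lb. d x * (?w x * \<phi> k (norm x))) \<le> 0" for k
  proof -
   have iu: "integrable Lb (\<lambda>x. \<sigma> * u x * (?w x * \<phi> k (norm x)))" by (rule int) (simp, rule ub)
   have ig: "integrable Lb (\<lambda>x. \<gamma> (norm x) * (?w x * \<phi> k (norm x)))" by (rule int) (measurable, rule gb)
   have "(LINT x|Lb. \<sigma> * u x * (?w x * \<phi> k (norm x))) = \<sigma> * (LINT x|Lb. u x * (?w x * \<phi> k (norm x)))" by (simp add: mult.assoc)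
   also have "... \<le> \<bar>LINT x|Lb. u x * (?w x * \<phi> k (norm x))\<bar>" using \<sigma> by (auto simp: abs_if split: if_splits)
   finally have "ennreal (LINT x|Lb. \<sigma> * u x * (?w x * \<phi> k (norm x))) \<le> ennreal \<bar>LINT x|Lb. u x * (?w x * \<phi> k (norm x))\<bar>" by (rule ennreal_leI)
   also note test_inequality[OF a b smooth_in]
   also have "(\<integral>\<^sup>+x. ennreal (?w x) * (ennreal \<bar>\<phi> k (norm x)\<bar> * (G (norm x) / ennreal \<Omega>)) \<partial>Lb) = (\<integral>\<^sup>+x. ennreal (\<gamma> (norm x) * (?w x * \<phi> k (norm x))) \<partial>Lb)"
    by (rule nn_integral_cong_AE, use AE_Lb_nonzero in eventually_elim) (simp add: \<gamma> \<phi>(3) \<gamma>0 ennreal_mult ac_simps)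
   also have "... = ennreal (LINT x|Lb. \<gamma> (norm x) * (?w x * \<phi> k (norm x)))"
    by (intro nn_integral_eq_integral ig AE_I2) (simp add: \<gamma>0 \<phi>(3))
   finally have "(LINT x|Lb. \<sigma> * u x * (?w x * \<phi> k (norm x))) \<le> (LINT x|Lb. \<gamma> (norm x) * (?w x * \<phi> k (norm x)))"
    by (subst (asm) ennreal_le_iff) (auto intro!: integral_nonneg_AE simp: \<gamma>0 \<phi>(3))
   then show ?thesis using Bochner_Integration.integral_diff[OF iu ig] by (simp add: d_def left_diff_distrib)
  qed
  then have le0: "(LINT x|Lb. d x * (?w x * indicator C (norm x))) \<le> 0" by (intro LIMSEQ_le_const2[OF lim]) auto
  have strict: "AE x in Lb. norm x \<in> C \<longrightarrow> 0 < d x"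
   using radial
  proof eventually_elim
   case (elim x)
   show ?case
   proof
    assume "norm x \<in> C"
    then obtain y where "y \<in> E" "norm x = norm y" using K(2) by (auto simp: C_def)
    then show "0 < d x" using elim by (simp add: E_def d_def)
   qed
  qed
  have pos: "AE x in Lb. 0 \<le> d x * (?w x * indicator C (norm x))"
   using strict by eventually_elim (auto simp: indicator_def)
  have "integrable Lb (\<lambda>x. d x * (?w x * indicator C (norm x)))"
  proof (rule Bochner_Integration.integrable_bound[OF V])
   have "norm (d x * (?w x * indicator C (norm x))) \<le> ?V x" for x by (intro bound indz db) auto
   then have "norm (d x * (?w x * indicator C (norm x))) \<le> norm (?V x)" for x by (rule order_trans) simp
   then show "AE x in Lb. norm (d x * (?w x * indicator C (norm x))) \<le> norm (?V x)" by (intro AE_I2)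
  qed measurable
  then have "AE x in Lb. d x * (?w x * indicator C (norm x)) = 0"
   using le0 integral_nonneg_AE[OF pos] integral_nonneg_eq_0_iff_AE[OF _ pos] by simp
  then have "AE x in Lb. x \<notin> K"
   using strict AE_Lb_nonzero
  proof eventually_elim
   case (elim x)
   show ?case
   proof
    assume "x \<in> K"
    then have "norm x \<in> C" by (auto simp: C_def)
    then show False using elim by simp
   qed
  qed
  moreover have "K \<subseteq> ball 0 R" using K(2) by (auto simp: E_def)
  ultimately have "AE x in lebesgue. x \<notin> K" by (auto simp: AE_restrict_space_iff elim!: eventually_mono)
  moreover have "K \<in> sets lebesgue" using K(1) by (intro lmeasurable_compact fmeasurableD)
  ultimately show False using K(3) by (simp add: AE_iff_null_sets)
 qed
 then have "E \<in> null_sets Lb" using EL by (simp add: null_sets_restrict_space E_def subset_eq)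
 then have "AE x in Lb. x \<notin> E" by (rule AE_not_in)
 with EE AE_Lb_nonzero AE_space show ?thesis
  by eventually_elim (simp add: \<gamma> d_def ennreal_leI)
qed

theorem radial_pointwise_bound:
 "AE x in Lb. ennreal \<bar>u x\<bar> \<le> G (norm x) / ennreal \<Omega>"
proof -
 have "AE x in Lb. ennreal (1 * u x) \<le> G (norm x) / ennreal \<Omega>" "AE x in Lb. ennreal (-1 * u x) \<le> G (norm x) / ennreal \<Omega>"
  by (rule one_sided_bound, simp)+
 then show ?thesis by eventually_elim (auto simp: abs_if)
qed

end

section \<open>The embedding\<close>

lemma (in unit_factor) transported_pull:
 assumes N: "ri_function_norm unit_interval N" and g: "g \<in> borel_measurable unit_interval"
 shows "N (nrearr M (pull g)) = N g"
 by (rule ri_function_norm.rearrangement_invariant[OF N _ g])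
  (auto simp: ui.equimeasurable_iff_ndist ndist_nrearr pull_measurable[OF g] ndist_pull[OF g])

context target_setting begin

lemma ball_factor_01:
 assumes "x \<noteq> 0" "norm (x :: real ^ 'n) < R" "\<beta> \<ge> 0"
 shows "0 < ball_factor \<beta> R x" "ball_factor \<beta> R x < 1"
proof -
 have "0 < norm x / R" "norm x / R < 1" using assms R_pos by auto
 moreover have "real CARD('n) + \<beta> > 0" using assms(3) by (simp add: add_pos_nonneg)
 ultimately show "0 < ball_factor \<beta> R x" "ball_factor \<beta> R x < 1"
  using powr_less_mono2[of "real CARD('n) + \<beta>" "norm x / R" 1] by (auto simp: ball_factor_def)
qed

lemma pull_theta:
 assumes x: "x \<noteq> 0" "norm (x :: real ^ 'n) < R"
 shows "L.pull (theta g) x = ennreal ((norm x / R) powr (real m - n)) * prim (nrearr unit_interval g) (ball_factor \<alpha> R x)"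
proof -
 have t: "0 < ball_factor 0 R x" "ball_factor 0 R x < 1" using ball_factor_01[OF x, of 0] by auto
 have e: "ball_factor 0 R x = (norm x / R) powr n" by (simp add: ball_factor_def n_eq)
 have "ball_factor 0 R x powr (real m / n - 1) = (norm x / R) powr (real m - n)" using n_pos by (simp add: e powr_powr algebra_simps)
 moreover have "ball_factor 0 R x powr ((n + \<alpha>) / n) = ball_factor \<alpha> R x" using n_pos by (simp add: e powr_powr) (simp add: ball_factor_def n_eq)
 ultimately show ?thesis using t by (simp add: L.pull_def theta_def)
qed

definition tail_const :: real where
 "tail_const = R powr (real m - n) * measure Lb (space Lb)"

text \<open>
 Exchanging the integrations bounds the pairing by the integral of \<open>D \<theta>\<^sub>g\<close>; conclude by
 Hardy--Littlewood and Hoelder.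
\<close>

lemma tail_pairing:
 assumes D[measurable]: "D \<in> borel_measurable Lb" and D0: "\<And>x. 0 \<le> D x"
  and g[measurable]: "g \<in> borel_measurable unit_interval" and g1: "T_assoc g \<le> 1"
 shows "(\<integral>\<^sup>+s. g s * tail D (R * s powr (1 / (n + \<alpha>))) \<partial>unit_interval) \<le> ennreal tail_const * fnorm X D"
proof -
 let ?u = unit_interval
 define p where "p = n + \<alpha>"
 have p: "p > 0" using n_pos \<alpha>_nonneg by (simp add: p_def add_pos_nonneg)
 have [measurable]: "(\<lambda>s. s) \<in> borel_measurable ?u" by (rule borel_measurable_ui) simp
 have [measurable]: "(\<lambda>x. norm x) \<in> borel_measurable Lb" by (rule borel_measurable_lebesgue_on) simp
 let ?E = "\<lambda>y. ennreal (D y * norm y powr (real m - n))"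
 interpret PS: pair_sigma_finite ?u Lb by (intro pair_sigma_finite.intro L.sigma_finite_measure_axioms ui.sigma_finite_measure_axioms)
 have "(\<integral>\<^sup>+s. g s * tail D (R * s powr (1 / p)) \<partial>?u)
  = (\<integral>\<^sup>+s. (\<integral>\<^sup>+y. g s * (?E y * indicator {(s, y). R * s powr (1 / p) < norm y} (s, y)) \<partial>Lb) \<partial>?u)"
 proof (rule nn_integral_cong)
  fix s
  have e: "indicator {(s, y). R * s powr (1 / p) < norm y} (s, y) = (indicator {R * s powr (1 / p)<..} (norm y) :: ennreal)" for y :: "real ^ 'n"
   by (simp add: indicator_def)
  show "g s * tail D (R * s powr (1 / p)) = (\<integral>\<^sup>+y. g s * (?E y * indicator {(s, y). R * s powr (1 / p) < norm y} (s, y)) \<partial>Lb)"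
   unfolding tail_def e by (rule nn_integral_cmult[symmetric]) measurable
 qed
 also have "... = (\<integral>\<^sup>+y. (\<integral>\<^sup>+s. g s * (?E y * indicator {(s, y). R * s powr (1 / p) < norm y} (s, y)) \<partial>?u) \<partial>Lb)"
  by (rule PS.Fubini'[symmetric]) measurable
 also have "... \<le> (\<integral>\<^sup>+y. ennreal (R powr (real m - n)) * (ennreal (D y) * L.pull (theta g) y) \<partial>Lb)"
 proof (rule nn_integral_mono_AE)
  show "AE y in Lb. (\<integral>\<^sup>+s. g s * (?E y * indicator {(s, y). R * s powr (1 / p) < norm y} (s, y)) \<partial>?u)
    \<le> ennreal (R powr (real m - n)) * (ennreal (D y) * L.pull (theta g) y)"
   using AE_Lb_nonzero AE_space
  proof eventually_elim
   case (elim y)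
   then have y: "y \<noteq> 0" "norm y < R" by auto
   let ?\<tau> = "ball_factor \<alpha> R y"
   have \<tau>: "0 < ?\<tau>" "?\<tau> < 1" using ball_factor_01[OF y \<alpha>_nonneg] by auto
   have yR: "0 < norm y / R" using y R_pos by simp
   have \<tau>p: "?\<tau> = (norm y / R) powr p" by (simp add: ball_factor_def p_def n_eq)
   have iff: "R * s powr (1 / p) < norm y \<longleftrightarrow> s < ?\<tau>" if "0 < s" for s
   proof -
    have "R * s powr (1 / p) < norm y \<longleftrightarrow> s powr (1 / p) < norm y / R" using R_pos by (simp add: field_simps)
    also have "norm y / R = ?\<tau> powr (1 / p)" using p yR unfolding \<tau>p powr_powr using R_pos by simp
    also have "s powr (1 / p) < ?\<tau> powr (1 / p) \<longleftrightarrow> s < ?\<tau>"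
     using powr_mono_iff[of "1 / p" ?\<tau> s] p \<tau> that by (simp add: not_le[symmetric])
    finally show ?thesis .
   qed
   have "(\<integral>\<^sup>+s. g s * (?E y * indicator {(s, y). R * s powr (1 / p) < norm y} (s, y)) \<partial>?u)
     = (\<integral>\<^sup>+s. ?E y * (g s * indicator {0<..<?\<tau>} s) \<partial>?u)"
    by (rule nn_integral_cong) (auto simp: indicator_def iff mult.commute)
   also have "... = ?E y * (\<integral>\<^sup>+s. g s * indicator {0<..<?\<tau>} s \<partial>?u)" by (rule nn_integral_cmult) measurable
   also have "... \<le> ?E y * prim (nrearr ?u g) ?\<tau>"
   proof (rule mult_left_mono)
    have "{0<..<?\<tau>} \<in> sets ?u" using \<tau> by simp
    from ui.mean_indicator_le_prim[OF g this] show "(\<integral>\<^sup>+s. g s * indicator {0<..<?\<tau>} s \<partial>?u) \<le> prim (nrearr ?u g) ?\<tau>"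
     using \<tau> by (simp add: mean_ui measure_ui_Ioo)
   qed simp
   also have "... = ennreal (R powr (real m - n)) * (ennreal (D y) * L.pull (theta g) y)"
   proof -
    have "L.pull (theta g) y = ennreal (norm y powr (real m - n) / R powr (real m - n)) * prim (nrearr ?u g) ?\<tau>"
     using R_pos by (simp add: pull_theta[OF y] powr_divide)
    then have "ennreal (R powr (real m - n)) * (ennreal (D y) * L.pull (theta g) y) =
     (ennreal (R powr (real m - n)) * ennreal (D y) * ennreal (norm y powr (real m - n) / R powr (real m - n))) * prim (nrearr ?u g) ?\<tau>"
     by (simp add: mult.assoc)
    also have "ennreal (R powr (real m - n)) * ennreal (D y) * ennreal (norm y powr (real m - n) / R powr (real m - n)) = ?E y"
     using R_pos D0[of y] by (simp add: ennreal_mult[symmetric])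
    finally show ?thesis by simp
   qed
   finally show ?case .
  qed
 qed
 also have "... = ennreal (R powr (real m - n)) * (\<integral>\<^sup>+y. ennreal (D y) * L.pull (theta g) y \<partial>Lb)"
  by (rule nn_integral_cmult) measurable
 finally have 1: "(\<integral>\<^sup>+s. g s * tail D (R * s powr (1 / p)) \<partial>?u) \<le> ennreal (R powr (real m - n)) * (\<integral>\<^sup>+y. ennreal (D y) * L.pull (theta g) y \<partial>Lb)" .
 have 2: "(\<integral>\<^sup>+y. ennreal (D y) * L.pull (theta g) y \<partial>Lb) = ennreal (measure Lb (space Lb)) * mean Lb (\<lambda>y. ennreal (D y) * L.pull (theta g) y)"
  unfolding mean_def L.emeasure_space_eq using L.total_pos by (subst ennreal_mult_divide_cancel) auto
 have "mean Lb (\<lambda>y. ennreal (D y) * L.pull (theta g) y) \<le> (\<integral>\<^sup>+t. nrearr Lb (\<lambda>y. ennreal (D y)) t * nrearr Lb (L.pull (theta g)) t \<partial>?u)"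
  by (rule L.hardy_littlewood) measurable
 also have "... = (\<integral>\<^sup>+t. nrearr ?u (nrearr Lb (\<lambda>y. ennreal (D y))) t * nrearr ?u (theta g) t \<partial>?u)"
 proof (rule nn_integral_cong)
  fix t assume "t \<in> space ?u"
  then have t: "0 \<le> t" by simp
  have "nrearr Lb (L.pull (theta g)) t = nrearr ?u (theta g) t"
   by (rule nrearr_cong_ndist[OF L.pos_finite_measure_axioms pos_finite_measure_ui _ _ _ t]) (auto simp: L.ndist_pull)
  moreover have "nrearr ?u (nrearr Lb (\<lambda>y. ennreal (D y))) t = nrearr Lb (\<lambda>y. ennreal (D y)) t"
   by (rule nrearr_cong_ndist[OF pos_finite_measure_ui L.pos_finite_measure_axioms _ _ _ t]) (auto simp: L.ndist_nrearr)
  ultimately show "nrearr Lb (\<lambda>y. ennreal (D y)) t * nrearr Lb (L.pull (theta g)) t =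
   nrearr ?u (nrearr Lb (\<lambda>y. ennreal (D y))) t * nrearr ?u (theta g) t" by simp
 qed
 also have "... \<le> Xbar (nrearr Lb (\<lambda>y. ennreal (D y))) * associate_norm ?u Xbar (theta g)"
  by (rule Xb.hardy_littlewood_hoelder) measurable
 also have "Xbar (nrearr Lb (\<lambda>y. ennreal (D y))) = fnorm X D"
  unfolding fnorm_def by (subst L.representation_norm(2)[OF X_ri]) (auto simp: D0 abs_of_nonneg)
 also have "fnorm X D * associate_norm ?u Xbar (theta g) \<le> fnorm X D * 1"
  using g1 unfolding T_assoc_eq by (rule mult_left_mono) simp
 finally have "mean Lb (\<lambda>y. ennreal (D y) * L.pull (theta g) y) \<le> fnorm X D" by simp
 then have "ennreal (R powr (real m - n)) * (ennreal (measure Lb (space Lb)) * mean Lb (\<lambda>y. ennreal (D y) * L.pull (theta g) y)) \<le>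
  ennreal (R powr (real m - n)) * (ennreal (measure Lb (space Lb)) * fnorm X D)" by (intro mult_left_mono) auto
 then have "(\<integral>\<^sup>+s. g s * tail D (R * s powr (1 / p)) \<partial>?u) \<le> ennreal (R powr (real m - n)) * (ennreal (measure Lb (space Lb)) * fnorm X D)"
  using 1 unfolding 2 by (rule order_trans[rotated])
 also have "... = ennreal tail_const * fnorm X D" by (simp add: tail_const_def ennreal_mult mult.assoc)
 finally show ?thesis by (simp add: p_def)
qed

lemma target_norm_tail:
 assumes D[measurable]: "D \<in> borel_measurable Lb" and D0: "\<And>x. 0 \<le> D x"
 shows "target (\<lambda>x. tail D (norm x)) \<le> ennreal tail_const * fnorm X D"
proof -
 let ?u = unit_interval
 define p where "p = n + \<alpha>"
 have p: "p > 0" using n_pos \<alpha>_nonneg by (simp add: p_def add_pos_nonneg)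
 define \<gamma> where "\<gamma> s = tail D (R * s powr (1 / p))" for s
 have [measurable]: "\<gamma> \<in> borel_measurable borel" unfolding \<gamma>_def by measurable
 have \<gamma>u[measurable]: "\<gamma> \<in> borel_measurable ?u" by (intro borel_measurable_ui) measurable
 interpret TN: ri_function_norm Wb "target" by (rule target_norm_ri)
 have [measurable]: "(\<lambda>x. tail D (norm x)) \<in> borel_measurable Lb" by (intro borel_measurable_lebesgue_on) measurable
 have "target (\<lambda>x. tail D (norm x)) = target (W.pull \<gamma>)"
 proof (rule TN.norm_cong_AE)
  show "(\<lambda>x. tail D (norm x)) \<in> borel_measurable Wb" by simp
  show "W.pull \<gamma> \<in> borel_measurable Wb" by (rule W.pull_measurable[OF \<gamma>u])
  show "AE x in Wb. tail D (norm x) = W.pull \<gamma> x"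
   unfolding AE_weighted_ball using AE_Lb_nonzero AE_space
  proof eventually_elim
   case (elim x)
   then have x: "x \<noteq> 0" "norm x < R" by auto
   have "0 < ball_factor \<alpha> R x" "ball_factor \<alpha> R x < 1" using ball_factor_01[OF x \<alpha>_nonneg] by auto
   moreover have "R * ball_factor \<alpha> R x powr (1 / p) = norm x"
    using p x R_pos by (simp add: ball_factor_def powr_powr p_def n_eq)
   ultimately show ?case by (simp add: W.pull_def \<gamma>_def)
  qed
 qed
 also have "... = target01 \<gamma>" unfolding target_norm_eq by (rule W.transported_pull[OF target_norm_01(1) \<gamma>u])
 also have "... \<le> associate_norm ?u (associate_norm ?u target01) \<gamma>" by (rule Tn.lorentz_luxemburg[OF \<gamma>u])
 also have "... \<le> ennreal tail_const * fnorm X D"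
 proof (rule associate_norm_least)
  fix g assume g: "g \<in> borel_measurable ?u" "associate_norm ?u target01 g \<le> 1"
  then have "T_assoc g \<le> 1" using target_norm_01(2) by simp
  from tail_pairing[OF D D0 g(1) this] show "(\<integral>\<^sup>+s. g s * \<gamma> s \<partial>?u) \<le> ennreal tail_const * fnorm X D"
   by (simp add: \<gamma>_def p_def)
 qed
 finally show ?thesis .
qed

lemma X_L1_bound:
 obtains C where "C > 0" "\<And>f. f \<in> borel_measurable Lb ==> (\<integral>\<^sup>+x. ennreal \<bar>f x\<bar> \<partial>Lb) \<le> ennreal C * fnorm X f"
proof -
 interpret X: ri_function_norm Lb X by (rule X_ri)
 obtain C :: real where C: "C > 0" "\<And>f. f \<in> borel_measurable Lb ==> (\<integral>\<^sup>+ x \<in> space Lb. f x \<partial>Lb) \<le> ennreal C * X f"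
  using X.locally_L1[of "space Lb"] L.emeasure_space_eq by auto
 have "(\<integral>\<^sup>+x. ennreal \<bar>f x\<bar> \<partial>Lb) \<le> ennreal C * fnorm X f" if [measurable]: "f \<in> borel_measurable Lb" for f
 proof -
  have "(\<integral>\<^sup>+x. ennreal \<bar>f x\<bar> \<partial>Lb) = (\<integral>\<^sup>+x\<in>space Lb. ennreal \<bar>f x\<bar> \<partial>Lb)" by (intro nn_integral_cong) auto
  also have "... \<le> ennreal C * fnorm X f" unfolding fnorm_def by (rule C(2)) measurable
  finally show ?thesis .
 qed
 then show ?thesis using that C(1) by blast
qed

lemma finite_lists_range: "finite {is :: 'n list. length is \<in> {1..m}}"
 by (rule finite_subset[OF _ finite_lists_length_le[of "UNIV :: 'n set" m]]) auto

lemma radial_sobolev_functionI: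
 assumes u: "u \<in> Sob"
 obtains h where "radial_sobolev_function m n \<alpha> R X u (weak_gradient_length (ball 0 R) m u)
   (\<lambda>is. if is = [] then u else weak_derivative (ball 0 R) is u) h"
proof -
 let ?D = "weak_gradient_length (ball 0 R) m u" and ?d = "\<lambda>is. if is = [] then u else weak_derivative (ball 0 R) is u"
 have us: "u \<in> fspace Lb X" and wd: "weakly_differentiable (ball 0 R) m u" and Ds: "?D \<in> fspace Lb X"
  using u by (auto simp: radial_sobolev_space_def sobolev_space_def)
 obtain h where h: "AE x in Lb. u x = h (norm x)" using u by (auto simp: radial_sobolev_space_def)
 obtain C where C: "C > 0" "\<And>f. f \<in> borel_measurable Lb ==> (\<integral>\<^sup>+x. ennreal \<bar>f x\<bar> \<partial>Lb) \<le> ennreal C * fnorm X f"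
  using X_L1_bound by blast
 have int: "integrable Lb f" if "f \<in> fspace Lb X" for f
 proof (rule integrableI_bounded)
  show m: "f \<in> borel_measurable Lb" using that by (simp add: fspace_def)
  have "(\<integral>\<^sup>+x. ennreal (norm (f x)) \<partial>Lb) \<le> ennreal C * fnorm X f" using C(2)[OF m] by simp
  also have "... < \<infinity>" using that by (simp add: fspace_def ennreal_mult_less_top)
  finally show "(\<integral>\<^sup>+x. ennreal (norm (f x)) \<partial>Lb) < \<infinity>" .
 qed
 have ui: "integrable Lb u" and Di: "integrable Lb ?D" using int us Ds by auto
 have loc: "locally_integrable (ball 0 R) u"
  unfolding locally_integrable_def
 proof (intro conjI allI impI)
  show "u \<in> borel_measurable Lb" using us by (simp add: fspace_def)
  fix K assume K: "compact K \<and> K \<subseteq> ball (0 :: real ^ 'n) R"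
  have "set_integrable lebesgue (ball 0 R) u"
   using ui by (simp add: set_integrable_def integrable_restrict_space)
  moreover have "K \<in> sets lebesgue" using K by (intro lmeasurable_compact fmeasurableD) auto
  ultimately show "set_integrable lebesgue K u" using K by (intro set_integrable_subset[of lebesgue "ball 0 R" u K]) auto
 qed
 have wk: "has_weak_derivative (ball 0 R) is u (?d is)" if "length is \<le> m" for "is"
 proof (cases "is = []")
  case True
  then show ?thesis using loc by (simp add: has_weak_derivative_def)
 next
  case False
  then have "length is \<in> {1..m}" using that by (cases "is") auto
  then have "\<exists>v. has_weak_derivative (ball 0 R) is u v" using wd by (simp add: weakly_differentiable_def)
  from someI_ex[OF this] show ?thesis using False by (simp add: weak_derivative_def)
 qed
 have dle: "\<bar>?d is x\<bar> \<le> ?D x" if l: "length is \<in> {1..m}" for "is" x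
 proof -
  have ne: "is \<noteq> []" using l by auto
  have "(weak_derivative (ball 0 R) is u x)\<^sup>2 \<le> (\<Sum>is | length is \<in> {1..m}. (weak_derivative (ball 0 R) is u x)\<^sup>2)"
   by (rule member_le_sum) (use l finite_lists_range in auto)
  then have "sqrt ((weak_derivative (ball 0 R) is u x)\<^sup>2) \<le> ?D x"
   unfolding weak_gradient_length_def by (rule real_sqrt_le_mono)
  then show ?thesis using ne by simp
 qed
 have D0: "0 \<le> ?D x" for x unfolding weak_gradient_length_def by (intro real_sqrt_ge_zero sum_nonneg) simp
 have "radial_sobolev_function m n \<alpha> R X u ?D ?d h"
 proof (unfold_locales)
  show "?d [] = u" by simp
  show "has_weak_derivative (ball 0 R) is u (?d is)" if "length is \<le> m" for "is" by (rule wk[OF that])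
  show "integrable Lb (?d is)" if l: "length is \<le> m" for "is"
  proof (cases "is = []")
   case True then show ?thesis using ui by simp
  next
   case False
   then have l': "length is \<in> {1..m}" using l by (cases "is") auto
   show ?thesis
   proof (rule Bochner_Integration.integrable_bound[OF Di])
    show "?d is \<in> borel_measurable Lb" using wk[OF l] by (simp add: has_weak_derivative_def locally_integrable_def)
    show "AE x in Lb. norm (?d is x) \<le> norm (?D x)" using dle[OF l'] D0 by (intro AE_I2) simp
   qed
  qed
  show "integrable Lb ?D" by (rule Di)
  show "0 \<le> ?D x" for x by (rule D0)
  show "\<bar>?d is x\<bar> \<le> ?D x" if "length is \<in> {1..m}" for "is" x by (rule dle[OF that])
  show "AE x in Lb. u x = h (norm x)" by (rule h)
 qed
 then show ?thesis by (rule that)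
qed

theorem radial_embedding:
 "embeds Sob Sob_norm
   (fspace Wb target) (fnorm target)"
proof -
 interpret TN: ri_function_norm Wb "target" by (rule target_norm_ri)
 obtain C where C: "C > 0" "\<And>f. f \<in> borel_measurable Lb ==> (\<integral>\<^sup>+x. ennreal \<bar>f x\<bar> \<partial>Lb) \<le> ennreal C * fnorm X f"
  using X_L1_bound by blast
 have "target (indicator (space Wb)) < \<infinity>"
  by (rule TN.finite_indicator) (auto simp: W.emeasure_space_eq[simplified])
 then obtain k where k: "target (indicator (space Wb)) = ennreal k" "k \<ge> 0"
  by (cases "target (indicator (space Wb))") auto
 define A where "A = pair_const m / \<Omega>"
 define B where "B = n ^ m / \<Omega>"
 have AB: "A \<ge> 0" "B \<ge> 0" using pair_const_nonneg n_pos \<Omega>_pos by (auto simp: A_def B_def)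
 define K where "K = A * C * k + B * tail_const"
 have tc: "tail_const \<ge> 0" by (simp add: tail_const_def)
 have bound: "fnorm target u \<le> ennreal K * Sob_norm u"
  if u: "u \<in> Sob" for u
 proof -
  let ?D = "weak_gradient_length (ball 0 R) m u"
  obtain h where "radial_sobolev_function m n \<alpha> R X u ?D (\<lambda>is. if is = [] then u else weak_derivative (ball 0 R) is u) h"
   using radial_sobolev_functionI[OF u] by blast
  then interpret RF: radial_sobolev_function m n \<alpha> R X u ?D "\<lambda>is. if is = [] then u else weak_derivative (ball 0 R) is u" h .
  have [measurable]: "u \<in> borel_measurable Lb" "?D \<in> borel_measurable Lb" using RF.u_int RF.D_int by auto
  have tm[measurable]: "(\<lambda>x. tail ?D (norm x)) \<in> borel_measurable Lb" by (intro borel_measurable_lebesgue_on) measurable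
  have U: "ennreal RF.U \<le> ennreal C * Sob_norm u"
  proof -
   have "ennreal RF.U = ennreal (LINT x|Lb. \<bar>u x\<bar>) + ennreal (LINT x|Lb. ?D x)"
    unfolding RF.U_def by (intro ennreal_plus integral_nonneg_AE AE_I2 RF.D_nonneg) simp
   also have "ennreal (LINT x|Lb. \<bar>u x\<bar>) = (\<integral>\<^sup>+x. ennreal \<bar>u x\<bar> \<partial>Lb)"
    by (intro nn_integral_eq_integral[symmetric] integrable_abs RF.u_int) simp
   also have "ennreal (LINT x|Lb. ?D x) = (\<integral>\<^sup>+x. ennreal \<bar>?D x\<bar> \<partial>Lb)"
    using RF.D_nonneg by (subst nn_integral_eq_integral) (auto intro: integrable_abs RF.D_int)
   also have "(\<integral>\<^sup>+x. ennreal \<bar>u x\<bar> \<partial>Lb) + (\<integral>\<^sup>+x. ennreal \<bar>?D x\<bar> \<partial>Lb) \<le> ennreal C * fnorm X u + ennreal C * fnorm X ?D"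
    by (intro add_mono C(2)) auto
   also have "... = ennreal C * Sob_norm u" by (simp add: sobolev_norm_def distrib_left)
   finally show ?thesis .
  qed
  have G: "RF.G r / ennreal \<Omega> = ennreal A * ennreal RF.U + ennreal B * tail ?D r" for r
  proof -
   have "ennreal (pair_const m * RF.U) / ennreal \<Omega> = ennreal A * ennreal RF.U"
    using pair_const_nonneg RF.U_nonneg \<Omega>_pos by (simp add: A_def divide_ennreal ennreal_mult[symmetric])
   moreover have "ennreal (n ^ m) * tail ?D r / ennreal \<Omega> = ennreal B * tail ?D r"
   proof -
    have "ennreal (n ^ m) * tail ?D r / ennreal \<Omega> = (ennreal (n ^ m) / ennreal \<Omega>) * tail ?D r"
     by (simp add: divide_ennreal_def ac_simps)
    also have "ennreal (n ^ m) / ennreal \<Omega> = ennreal B" using n_pos \<Omega>_pos by (simp add: B_def divide_ennreal)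
    finally show ?thesis .
   qed
   ultimately show ?thesis unfolding RF.G_def by (simp add: divide_ennreal_def distrib_right)
  qed
  have im[measurable]: "indicator (ball (0 :: real ^ 'n) R) \<in> borel_measurable Lb" by (rule borel_measurable_indicator) simp
  let ?a = "\<lambda>x :: real ^ 'n. ennreal (A * RF.U) * indicator (space Wb) x" and ?b = "\<lambda>x :: real ^ 'n. ennreal B * tail ?D (norm x)"
  have m1: "(\<lambda>x. ennreal \<bar>u x\<bar>) \<in> borel_measurable Wb" "?a \<in> borel_measurable Wb" "?b \<in> borel_measurable Wb"
   "indicator (space Wb) \<in> borel_measurable Wb" "(\<lambda>x. tail ?D (norm x)) \<in> borel_measurable Wb"
   by (simp_all add: im tm)
  have "AE x in Wb. ennreal \<bar>u x\<bar> \<le> ?a x + ?b x"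
   unfolding AE_weighted_ball using RF.radial_pointwise_bound AE_space
   by eventually_elim (use AB RF.U_nonneg in \<open>simp add: G ennreal_mult\<close>)
  then have "fnorm target u \<le> target (\<lambda>x. ?a x + ?b x)"
   unfolding fnorm_def by (intro TN.lattice borel_measurable_add m1)
  also have "... \<le> target ?a + target ?b"
   by (rule TN.triangle) (rule m1)+
  also have "target ?a = ennreal (A * RF.U) * ennreal k"
   unfolding k(1)[symmetric] by (rule TN.homogeneous[OF m1(4)]) (use AB RF.U_nonneg in simp)
  also have "target ?b = ennreal B * target (\<lambda>x. tail ?D (norm x))"
   by (rule TN.homogeneous[OF m1(5)]) (use AB in simp)
  also have "ennreal (A * RF.U) * ennreal k + ennreal B * target (\<lambda>x. tail ?D (norm x)) \<le>
   ennreal (A * k) * (ennreal C * Sob_norm u) + ennreal B * (ennreal tail_const * Sob_norm u)"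
  proof (rule add_mono)
   have "ennreal (A * RF.U) * ennreal k = ennreal (A * k) * ennreal RF.U" using AB k(2) RF.U_nonneg by (simp add: ennreal_mult ac_simps)
   also have "... \<le> ennreal (A * k) * (ennreal C * Sob_norm u)" by (intro mult_left_mono U) simp
   finally show "ennreal (A * RF.U) * ennreal k \<le> ennreal (A * k) * (ennreal C * Sob_norm u)" .
   have "target (\<lambda>x. tail ?D (norm x)) \<le> ennreal tail_const * fnorm X ?D"
    by (rule target_norm_tail) (use RF.D_nonneg in auto)
   also have "... \<le> ennreal tail_const * Sob_norm u" unfolding sobolev_norm_def by (intro mult_left_mono) auto
   finally show "ennreal B * target (\<lambda>x. tail ?D (norm x)) \<le> ennreal B * (ennreal tail_const * Sob_norm u)"
    by (intro mult_left_mono) auto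
  qed
  also have "... = ennreal K * Sob_norm u"
  proof -
   have "ennreal K = ennreal (A * k) * ennreal C + ennreal B * ennreal tail_const"
    unfolding K_def using AB k(2) C(1) tc by (simp add: ennreal_mult[symmetric] ennreal_plus[symmetric] ac_simps del: ennreal_plus)
   then show ?thesis by (simp add: distrib_right mult.assoc)
  qed
  finally show ?thesis .
 qed
 have "u \<in> fspace Wb target" if u: "u \<in> Sob" for u
 proof -
  have us: "u \<in> fspace Lb X" "weak_gradient_length (ball 0 R) m u \<in> fspace Lb X"
   using u by (auto simp: radial_sobolev_space_def sobolev_space_def)
  then have "Sob_norm u < \<infinity>" by (simp add: sobolev_norm_def fspace_def)
  then have "ennreal K * Sob_norm u < \<infinity>" by (simp add: ennreal_mult_less_top)
  then have "fnorm target u < \<infinity>" by (rule le_less_trans[OF bound[OF u]])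
  then show ?thesis using us(1) by (simp add: fspace_def)
 qed
 then show ?thesis unfolding embeds_def using bound by blast
qed

end

section \<open>Smooth functions and weak derivatives\<close>

lemma test_function_smooth:
 assumes "test_function \<Omega> \<phi>" shows "smooth \<phi>"
proof -
 have d: "partials is \<phi> differentiable (at x)" for "is" x using assms by (simp add: test_function_def)
 have "Ck k (partials is \<phi>)" for k "is"
 proof (induction k arbitrary: "is")
  case (Suc k)
  have "Ck k (\<lambda>x. frechet_derivative (partials is \<phi>) (at x) b)" if b: "b \<in> Basis" for b
  proof -
   obtain i where "b = axis i 1" using b by (auto simp: Basis_vec_def)
   then show ?thesis using Suc[of "i # is"] by (simp add: partials_Cons)
  qed
  then show ?case using d by simp
 qed simp
 from this[of _ "[]"] show ?thesis by (simp add: smooth_def)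
qed

lemma frechet_derivative_zero_outside:
 assumes z: "\<And>x. x \<notin> K ==> w x = (0 :: real)" and K: "closed K" and x: "x \<notin> K"
 shows "frechet_derivative w (at x) b = 0"
proof -
 have "((\<lambda>_. 0) has_derivative (\<lambda>_. 0)) (at x)" by simp
 then have "(w has_derivative (\<lambda>_. 0)) (at x)"
  by (rule has_derivative_transform_within_open[where s="- K"]) (use z K x in auto)
 from frechet_derivative_at[OF this, symmetric] show ?thesis by simp
qed

lemma partials_zero_outside:
 assumes z: "\<And>x. x \<notin> K ==> w x = 0" and K: "closed K"
 shows "x \<notin> K ==> partials is w x = 0"
 by (induction "is" arbitrary: x) (use z in \<open>auto simp: partials_Cons intro!: frechet_derivative_zero_outside[OF _ K]\<close>)

lemma lborel_integral_shift:
 fixes w :: "'a::euclidean_space => real"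
 assumes [measurable]: "w \<in> borel_measurable borel"
 shows "(LINT x|lborel. w (c + x)) = (LINT x|lborel. w x)" "integrable lborel w ==> integrable lborel (\<lambda>x. w (c + x))"
proof -
 have "(LINT x|lborel. w x) = (LINT x|distr lborel borel ((+) c). w x)" by (simp add: lborel_distr_plus)
 also have "... = (LINT x|lborel. w (c + x))" by (rule integral_distr) auto
 finally show "(LINT x|lborel. w (c + x)) = (LINT x|lborel. w x)" by simp
 assume "integrable lborel w"
 then have "integrable (distr lborel borel ((+) c)) w" by (simp add: lborel_distr_plus)
 then show "integrable lborel (\<lambda>x. w (c + x))" by (subst (asm) integrable_distr_eq) auto
qed

lemma integrable_continuous_compact_support:
 fixes w :: "'a::euclidean_space => real"
 assumes w: "continuous_on UNIV w" and z: "\<And>x. x \<notin> K ==> w x = 0" and K: "compact K"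
 shows "integrable lborel w"
proof -
 have "integrable lborel (\<lambda>x. indicator K x *\<^sub>R w x)" by (intro borel_integrable_compact K continuous_on_subset[OF w]) auto
 moreover have "(\<lambda>x. indicator K x *\<^sub>R w x) = w" by (rule ext) (use z in \<open>auto simp: indicator_def\<close>)
 ultimately show ?thesis by (simp only:)
qed

text \<open>
 Difference quotients integrate to zero by translation invariance and converge dominatedly.
\<close>

lemma integral_partial_zero:
 fixes w :: "'a::euclidean_space => real"
 assumes w: "smooth w" and z: "\<And>x. x \<notin> K ==> w x = 0" and K: "compact K" and b: "b \<in> Basis"
 shows "(LINT x|lborel. frechet_derivative w (at x) b) = 0"
proof -
 define D where "D x = frechet_derivative w (at x) b" for x
 have D: "smooth D" unfolding D_def by (rule smooth_partial[OF w b])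
 have wc: "continuous_on UNIV w" and Dc: "continuous_on UNIV D" using smooth_continuous w D by auto
 have [measurable]: "w \<in> borel_measurable borel" "D \<in> borel_measurable borel" using wc Dc by (auto intro: borel_measurable_continuous_onI)
 have Dz: "D x = 0" if "x \<notin> K" for x unfolding D_def by (rule frechet_derivative_zero_outside[OF z compact_imp_closed[OF K] that])
 obtain \<rho> where \<rho>: "\<And>x. x \<in> K ==> norm x \<le> \<rho>" using compact_imp_bounded[OF K] by (auto simp: bounded_iff)
 obtain B where B: "\<And>x. x \<in> K ==> \<bar>D x\<bar> \<le> B" using continuous_on_compact_bound[OF continuous_on_subset[OF Dc] K] by blast
 define B' where "B' = max B 0"
 have B': "\<bar>D x\<bar> \<le> B'" for x using B[of x] Dz[of x] by (cases "x \<in> K") (auto simp: B'_def)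
 have B'0: "B' \<ge> 0" by (simp add: B'_def)
 define \<epsilon> where "\<epsilon> k = inverse (real (Suc k))" for k
 have \<epsilon>: "0 < \<epsilon> k" "\<epsilon> k \<le> 1" for k by (auto simp: \<epsilon>_def field_simps)
 define s where "s k x = (w (\<epsilon> k *\<^sub>R b + x) - w x) / \<epsilon> k" for k x
 have line: "((\<lambda>t. w (t *\<^sub>R b + x)) has_real_derivative D (t *\<^sub>R b + x)) (at t)" for t x
 proof -
  have "((\<lambda>t. t *\<^sub>R b + x) has_derivative (\<lambda>h. h *\<^sub>R b)) (at t)" by (auto intro!: derivative_eq_intros)
  then have "((\<lambda>t. w (t *\<^sub>R b + x)) has_derivative (\<lambda>h. frechet_derivative w (at (t *\<^sub>R b + x)) (h *\<^sub>R b))) (at t)"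
   by (rule has_derivative_compose) (rule smooth_has_derivative[OF w])
  moreover have "frechet_derivative w (at y) (h *\<^sub>R b) = D y * h" for y h
   using linear_cmul[OF has_derivative_linear[OF smooth_has_derivative[OF w, of y]], of h b] by (simp add: D_def)
  ultimately show ?thesis by (simp add: has_field_derivative_def)
 qed
 have "(\<lambda>k. LINT x|lborel. s k x) \<longlonglongrightarrow> (LINT x|lborel. D x)"
 proof (rule integral_dominated_convergence)
  show "D \<in> borel_measurable lborel" "\<And>k. s k \<in> borel_measurable lborel" unfolding s_def by measurable
  show "integrable lborel (\<lambda>x. B' * indicator (cball (0 :: 'a) (\<rho> + norm b)) x)"
   by (intro integrable_mult_right integrable_real_indicator) (simp_all add: emeasure_bounded_finite[unfolded infinity_ennreal_def])
  show "AE x in lborel. (\<lambda>k. s k x) \<longlonglongrightarrow> D x"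
  proof (rule AE_I2)
   fix x
   have "((\<lambda>t. (w ((0 + t) *\<^sub>R b + x) - w (0 *\<^sub>R b + x)) / t) \<longlongrightarrow> D (0 *\<^sub>R b + x)) (at 0)"
    using line[of x 0] by (rule DERIV_D)
   moreover have "filterlim \<epsilon> (at 0) sequentially"
    using LIMSEQ_inverse_real_of_nat \<epsilon>(1) by (intro filterlim_atI) (auto simp: \<epsilon>_def[abs_def])
   ultimately have "((\<lambda>k. (w ((0 + \<epsilon> k) *\<^sub>R b + x) - w (0 *\<^sub>R b + x)) / \<epsilon> k) \<longlongrightarrow> D (0 *\<^sub>R b + x)) sequentially"
    by (rule filterlim_compose)
   then show "(\<lambda>k. s k x) \<longlonglongrightarrow> D x" by (simp add: s_def)
  qed
  show "AE x in lborel. norm (s k x) \<le> B' * indicator (cball (0 :: 'a) (\<rho> + norm b)) x" for k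
  proof (rule AE_I2)
   fix x
   show "norm (s k x) \<le> B' * indicator (cball (0 :: 'a) (\<rho> + norm b)) x"
   proof (cases "norm x \<le> \<rho> + norm b")
    case True
    obtain t where "w (\<epsilon> k *\<^sub>R b + x) - w (0 *\<^sub>R b + x) = (\<epsilon> k - 0) * D (t *\<^sub>R b + x)"
     using MVT2[of 0 "\<epsilon> k" "\<lambda>t. w (t *\<^sub>R b + x)" "\<lambda>t. D (t *\<^sub>R b + x)"] line \<epsilon>(1) by blast
    then have "s k x = D (t *\<^sub>R b + x)" using \<epsilon>(1)[of k] by (simp add: s_def)
    then show ?thesis using B' True by simp
   next
    case False
    have "norm (\<epsilon> k *\<^sub>R b) \<le> norm b" using \<epsilon>[of k] by (simp add: mult_left_le_one_le)
    then have "norm (\<epsilon> k *\<^sub>R b + x) > \<rho>" using False norm_triangle_ineq2[of x "- (\<epsilon> k *\<^sub>R b)"] by (simp add: add.commute)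
    moreover have "norm x > \<rho>" using False norm_ge_zero[of b] by linarith
    ultimately have "w (\<epsilon> k *\<^sub>R b + x) = 0" "w x = 0" using \<rho> z by (meson not_le)+
    then show ?thesis using False by (simp add: s_def)
   qed
  qed
 qed
 moreover have "(LINT x|lborel. s k x) = 0" for k
 proof -
  have i: "integrable lborel w" by (rule integrable_continuous_compact_support[OF wc z K])
  then show ?thesis unfolding s_def
   using lborel_integral_shift[of w "\<epsilon> k *\<^sub>R b"] by (simp add: Bochner_Integration.integral_diff)
 qed
 ultimately have "(LINT x|lborel. D x) = 0" by (simp add: LIMSEQ_const_iff)
 then show ?thesis by (simp add: D_def)
qed

lemma integration_by_parts:
 fixes u \<psi> :: "'a::euclidean_space => real"
 assumes u: "smooth u" and \<psi>: "smooth \<psi>" and z: "\<And>x. x \<notin> K ==> \<psi> x = 0" and K: "compact K" and b: "b \<in> Basis"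
 shows "(LINT x|lborel. u x * frechet_derivative \<psi> (at x) b) = - (LINT x|lborel. frechet_derivative u (at x) b * \<psi> x)"
proof -
 have 1: "((\<lambda>x. u x * \<psi> x) has_derivative (\<lambda>h. u x * frechet_derivative \<psi> (at x) h + frechet_derivative u (at x) h * \<psi> x)) (at x)" for x
  by (intro has_derivative_mult smooth_has_derivative u \<psi>)
 have D: "frechet_derivative (\<lambda>x. u x * \<psi> x) (at x) b = u x * frechet_derivative \<psi> (at x) b + frechet_derivative u (at x) b * \<psi> x" for x
  by (simp only: frechet_derivative_at[OF 1, symmetric])
 have s: "smooth (\<lambda>x. frechet_derivative \<psi> (at x) b)" "smooth (\<lambda>x. frechet_derivative u (at x) b)" using smooth_partial u \<psi> b by auto
 have i: "integrable lborel (\<lambda>x. u x * frechet_derivative \<psi> (at x) b)" "integrable lborel (\<lambda>x. frechet_derivative u (at x) b * \<psi> x)"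
  by (rule integrable_continuous_compact_support[OF smooth_continuous _ K], intro smooth_mult u \<psi> s,
    simp add: frechet_derivative_zero_outside[OF z compact_imp_closed[OF K]] z)+
 have "(LINT x|lborel. frechet_derivative (\<lambda>x. u x * \<psi> x) (at x) b) = 0"
  by (rule integral_partial_zero[OF smooth_mult[OF u \<psi>] _ K b]) (simp add: z)
 then show ?thesis unfolding D using Bochner_Integration.integral_add[OF i] by simp
qed

lemma integral_partials:
 fixes u \<phi> :: "real ^ 'n => real"
 assumes \<phi>: "smooth \<phi>" and z: "\<And>x. x \<notin> K ==> \<phi> x = 0" and K: "compact K"
 shows "smooth u ==> (LINT x|lborel. u x * partials is \<phi> x) = (-1) ^ length is * (LINT x|lborel. partials (rev is) u x * \<phi> x)"
proof (induction "is" arbitrary: u)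
 case (Cons i js)
 have ax: "axis i 1 \<in> (Basis :: (real ^ 'n) set)" by (simp add: axis_in_Basis_iff)
 have "(LINT x|lborel. u x * partials (i # js) \<phi> x) = - (LINT x|lborel. partials [i] u x * partials js \<phi> x)"
  unfolding partials_Cons partials_Nil
  by (rule integration_by_parts[OF Cons.prems smooth_partials[OF \<phi>] partials_zero_outside[OF z compact_imp_closed[OF K]] K ax])
 also have "(LINT x|lborel. partials [i] u x * partials js \<phi> x) = (-1) ^ length js * (LINT x|lborel. partials (rev js) (partials [i] u) x * \<phi> x)"
  by (rule Cons.IH[OF smooth_partials[OF Cons.prems]])
 finally show ?case by (simp add: partials_append)
qed simp

lemma locally_integrable_continuous:
 assumes u: "continuous_on UNIV u" shows "locally_integrable \<Omega> u"
 unfolding locally_integrable_def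
proof (intro conjI allI impI)
 have [measurable]: "u \<in> borel_measurable borel" by (rule borel_measurable_continuous_onI[OF u])
 show "u \<in> borel_measurable (lebesgue_on \<Omega>)" by (rule borel_measurable_lebesgue_on) measurable
 fix K assume K: "compact K \<and> K \<subseteq> \<Omega>"
 then have [measurable]: "K \<in> sets borel" by (auto intro: borel_compact)
 have "integrable lborel (\<lambda>x. indicator K x *\<^sub>R u x)" using K by (intro borel_integrable_compact continuous_on_subset[OF u]) auto
 then show "set_integrable lebesgue K u" unfolding set_integrable_def by (subst integrable_completion) auto
qed

lemma integral_lebesgue_on_zero_outside:
 fixes h :: "'a::euclidean_space => real"
 assumes [measurable]: "h \<in> borel_measurable borel" and z: "\<And>x. x \<notin> \<Omega> ==> h x = 0" and \<Omega>: "\<Omega> \<in> sets lebesgue"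
 shows "(LINT x|lebesgue_on \<Omega>. h x) = (LINT x|lborel. h x)"
proof -
 have 1: "(\<lambda>x. indicator \<Omega> x *\<^sub>R h x) = h" by (rule ext) (use z in \<open>auto simp: indicator_def\<close>)
 have "(LINT x|lebesgue_on \<Omega>. h x) = (LINT x|lebesgue. indicator \<Omega> x *\<^sub>R h x)"
  by (rule integral_restrict_space) (use \<Omega> in simp)
 moreover have "(LINT x|lebesgue. h x) = (LINT x|lborel. h x)" by (rule integral_completion) simp
 ultimately show ?thesis unfolding 1 by simp
qed

theorem smooth_has_weak_derivative:
 fixes u :: "real ^ 'n => real"
 assumes u: "smooth u" and \<Omega>: "\<Omega> \<in> sets lebesgue"
 shows "has_weak_derivative \<Omega> is u (partials (rev is) u)"
 unfolding has_weak_derivative_def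
proof (intro conjI allI impI)
 show "locally_integrable \<Omega> u" "locally_integrable \<Omega> (partials (rev is) u)"
  by (intro locally_integrable_continuous smooth_continuous u smooth_partials)+
 fix \<phi> assume t: "test_function \<Omega> \<phi>"
 define K where "K = closure {x. \<phi> x \<noteq> 0}"
 have K: "compact K" "K \<subseteq> \<Omega>" using t by (auto simp: test_function_def K_def)
 have z: "\<phi> x = 0" if "x \<notin> K" for x using that closure_subset[of "{x. \<phi> x \<noteq> 0}"] unfolding K_def by blast
 have \<phi>: "smooth \<phi>" by (rule test_function_smooth[OF t])
 have pz: "partials js \<phi> x = 0" if "x \<notin> K" for js x by (rule partials_zero_outside[OF z compact_imp_closed[OF K(1)] that])
 have m: "f \<in> borel_measurable borel" if "smooth f" for f :: "real ^ 'n => real"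
  by (rule borel_measurable_continuous_onI[OF smooth_continuous[OF that]])
 have "(LINT x|lebesgue_on \<Omega>. u x * partials is \<phi> x) = (LINT x|lborel. u x * partials is \<phi> x)"
  using pz K(2) by (intro integral_lebesgue_on_zero_outside m smooth_mult u smooth_partials \<phi> \<Omega>) auto
 moreover have "(LINT x|lebesgue_on \<Omega>. partials (rev is) u x * \<phi> x) = (LINT x|lborel. partials (rev is) u x * \<phi> x)"
  using z K(2) by (intro integral_lebesgue_on_zero_outside m smooth_mult u smooth_partials \<phi> \<Omega>) auto
 ultimately show "(LINT x|lebesgue_on \<Omega>. u x * partials is \<phi> x) = (- 1) ^ length is * (LINT x|lebesgue_on \<Omega>. partials (rev is) u x * \<phi> x)"
  using integral_partials[OF \<phi> z K(1) u, of "is"] by simp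
qed

text \<open>
 Uniqueness of weak derivatives, testing with approximations of the indicator of a compact set.
\<close>

lemma weak_derivative_le:
 assumes v: "has_weak_derivative (ball z R) is u v" and w: "has_weak_derivative (ball z R) is u w"
 shows "AE x in lebesgue_on (ball z R). v x \<le> w x"
proof -
 let ?B = "lebesgue_on (ball z R)"
 have vw: "locally_integrable (ball z R) v" "locally_integrable (ball z R) w" using v w by (auto simp: has_weak_derivative_def)
 have [measurable]: "v \<in> borel_measurable ?B" "w \<in> borel_measurable ?B" using vw by (auto simp: locally_integrable_def)
 define d where "d x = v x - w x" for x
 have [measurable]: "d \<in> borel_measurable ?B" unfolding d_def by measurable
 define S where "S = {x \<in> space ?B. 0 < d x}"
 have S: "S \<in> sets ?B" unfolding S_def by measurable
 then have Sl: "S \<in> sets lebesgue" "S \<subseteq> ball z R" by (auto simp: sets_restrict_space_iff S_def)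
 have "S \<in> null_sets lebesgue"
 proof (rule ccontr)
  assume "S \<notin> null_sets lebesgue"
  then obtain K where K: "compact K" "K \<subseteq> S" "K \<notin> null_sets lebesgue" using compact_subset_of_positive_measure[OF Sl(1)] by blast
  obtain \<phi> r where \<phi>: "r < R" "\<And>k::nat. smooth (\<phi> k)" "\<And>k x. 0 \<le> \<phi> k x" "\<And>k x. \<phi> k x \<le> 1"
   "\<And>k x. x \<notin> cball z r ==> \<phi> k x = 0" "\<And>x. (\<lambda>k. \<phi> k x) \<longlonglongrightarrow> indicator K x"
   by (rule smooth_approx_indicator[OF K(1) subset_trans[OF K(2) Sl(2)]]) (rule that, assumption+)
  have C: "cball z r \<subseteq> ball z R" using \<phi>(1) by auto
  have i: "integrable ?B (\<lambda>x. indicator (cball z r) x * f x)" if "locally_integrable (ball z R) f" for f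
  proof -
   have "integrable lebesgue (\<lambda>x. indicator (cball z r) x *\<^sub>R f x)"
    using that C by (auto simp: locally_integrable_def set_integrable_def)
   moreover have "(\<lambda>x. indicator (ball z R) x *\<^sub>R (indicator (cball z r) x * f x)) = (\<lambda>x. indicator (cball z r) x *\<^sub>R f x)"
    using C by (intro ext) (auto simp: indicator_def)
   ultimately show ?thesis by (subst integrable_restrict_space) simp_all
  qed
  have id: "integrable ?B (\<lambda>x. indicator (cball z r) x * d x)"
   using Bochner_Integration.integrable_diff[OF i[OF vw(1)] i[OF vw(2)]] by (simp add: d_def right_diff_distrib)
  have \<phi>m[measurable]: "\<phi> k \<in> borel_measurable ?B" for k
   by (rule borel_measurable_lebesgue_on) (rule borel_measurable_continuous_onI[OF smooth_continuous[OF \<phi>(2)]])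
  have [measurable]: "indicator K \<in> borel_measurable ?B"
   using K(1) by (intro borel_measurable_lebesgue_on borel_measurable_indicator) (auto intro: borel_compact)
  have b: "\<bar>f x * \<phi> k x\<bar> \<le> \<bar>indicator (cball z r) x * f x\<bar>" for f k x
   using \<phi>(3,4)[of k x] \<phi>(5)[of x k] by (cases "x \<in> cball z r") (auto simp: abs_mult intro: mult_right_le_one_le)
  have lim: "(\<lambda>k. LINT x|?B. d x * \<phi> k x) \<longlonglongrightarrow> (LINT x|?B. d x * indicator K x)"
  proof (rule integral_dominated_convergence)
   show "integrable ?B (\<lambda>x. \<bar>indicator (cball z r) x * d x\<bar>)" using id by (rule integrable_abs)
   show "AE x in ?B. (\<lambda>k. d x * \<phi> k x) \<longlonglongrightarrow> d x * indicator K x" by (intro AE_I2 tendsto_mult tendsto_const \<phi>)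
   show "AE x in ?B. norm (d x * \<phi> k x) \<le> \<bar>indicator (cball z r) x * d x\<bar>" for k using b by simp
  qed measurable
  have "(LINT x|?B. d x * \<phi> k x) = 0" for k
  proof -
   have t: "test_function (ball z R) (\<phi> k)" by (rule test_functionI[OF \<phi>(2) \<phi>(5) _ C]) simp_all
   have fi: "integrable ?B (\<lambda>x. f x * \<phi> k x)" if f: "locally_integrable (ball z R) f" for f
   proof (rule Bochner_Integration.integrable_bound[OF i[OF f]])
    show "(\<lambda>x. f x * \<phi> k x) \<in> borel_measurable ?B" using f by (auto simp: locally_integrable_def)
    show "AE x in ?B. norm (f x * \<phi> k x) \<le> norm (indicator (cball z r) x * f x)" using b by simp
   qed
   have "(LINT x|?B. v x * \<phi> k x) = (LINT x|?B. w x * \<phi> k x)" using v w t by (simp add: has_weak_derivative_def)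
   then show ?thesis using Bochner_Integration.integral_diff[OF fi[OF vw(1)] fi[OF vw(2)]] by (simp add: d_def left_diff_distrib)
  qed
  then have 0: "(LINT x|?B. d x * indicator K x) = 0" using lim by (simp add: LIMSEQ_const_iff)
  have Kr: "K \<subseteq> cball z r"
  proof
   fix x assume "x \<in> K"
   then show "x \<in> cball z r" using \<phi>(5)[of x] \<phi>(6)[of x] by (cases "x \<in> cball z r") (auto simp: LIMSEQ_const_iff)
  qed
  have "integrable ?B (\<lambda>x. d x * indicator K x)"
  proof (rule Bochner_Integration.integrable_bound[OF id])
   show "(\<lambda>x. d x * indicator K x) \<in> borel_measurable ?B" by measurable
   show "AE x in ?B. norm (d x * indicator K x) \<le> norm (indicator (cball z r) x * d x)"
    by (intro AE_I2) (use Kr in \<open>auto simp: indicator_def abs_mult\<close>)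
  qed
  moreover have "AE x in ?B. 0 \<le> d x * indicator K x" using K(2) by (intro AE_I2) (auto simp: S_def indicator_def)
  ultimately have "AE x in ?B. d x * indicator K x = 0" using 0 integral_nonneg_eq_0_iff_AE[of ?B "\<lambda>x. d x * indicator K x"] by simp
  then have "AE x in ?B. x \<notin> K"
  proof eventually_elim
   case (elim x)
   then show ?case using K(2) by (auto simp: S_def)
  qed
  then have "AE x in lebesgue. x \<in> ball z R \<longrightarrow> x \<notin> K" by (simp add: AE_restrict_space_iff)
  then have "AE x in lebesgue. x \<notin> K" by eventually_elim (use K(2) Sl(2) in blast)
  moreover have "K \<in> sets lebesgue" using K(1) by (intro lmeasurable_compact fmeasurableD)
  ultimately show False using K(3) by (simp add: AE_iff_null_sets)
 qed
 then have "AE x in lebesgue. x \<notin> S" by (rule AE_not_in)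
 then have "AE x in ?B. x \<notin> S" by (auto simp: AE_restrict_space_iff elim: eventually_mono)
 then show ?thesis using AE_space by eventually_elim (auto simp: S_def d_def)
qed

lemma weak_derivative_smooth:
 assumes u: "smooth u"
 shows "AE x in lebesgue_on (ball z R). weak_derivative (ball z R) is u x = partials (rev is) u x"
proof -
 have s: "has_weak_derivative (ball z R) is u (partials (rev is) u)" by (rule smooth_has_weak_derivative[OF u]) simp
 then have w: "has_weak_derivative (ball z R) is u (weak_derivative (ball z R) is u)"
  unfolding weak_derivative_def by (rule someI[where P="has_weak_derivative (ball z R) is u"])
 show ?thesis using weak_derivative_le[OF s w] weak_derivative_le[OF w s] by eventually_elim simp
qed

section \<open>Radial averages\<close>

text \<open>
 Differentiation under the integral sign for a merely integrable factor \<open>F\<close>, by dominated convergence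
 of difference quotients.
\<close>

lemma DERIV_integral_dominated:
 fixes q q' :: "real => real => real"
 assumes F: "integrable lborel F" and q[measurable]: "\<And>r. q r \<in> borel_measurable borel" and q'[measurable]: "q' x \<in> borel_measurable borel"
  and d: "\<And>r s. F s \<noteq> 0 ==> ((\<lambda>r. q r s) has_real_derivative q' r s) (at r)"
  and B: "\<And>r s. F s \<noteq> 0 ==> \<bar>q' r s\<bar> \<le> B" and i: "\<And>r. integrable lborel (\<lambda>s. F s * q r s)"
 shows "((\<lambda>r. LINT s|lborel. F s * q r s) has_real_derivative (LINT s|lborel. F s * q' x s)) (at x)"
proof -
 let ?I = "\<lambda>r. LINT s|lborel. F s * q r s"
 have [measurable]: "F \<in> borel_measurable borel" using F by auto
 have "((\<lambda>y. (?I y - ?I x) / (y - x)) \<longlongrightarrow> (LINT s|lborel. F s * q' x s)) (at x)"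
  unfolding tendsto_at_iff_sequentially
 proof (intro allI impI)
  fix y :: "nat => real" assume y: "\<forall>i. y i \<in> UNIV - {x}" "y \<longlonglongrightarrow> x"
  have yx: "y k \<noteq> x" for k using y(1) by auto
  have "(\<lambda>k. LINT s|lborel. F s * ((q (y k) s - q x s) / (y k - x))) \<longlonglongrightarrow> (LINT s|lborel. F s * q' x s)"
  proof (rule integral_dominated_convergence)
   show "integrable lborel (\<lambda>s. \<bar>F s\<bar> * B)" using F by (intro integrable_mult_left integrable_abs)
   show "AE s in lborel. (\<lambda>k. F s * ((q (y k) s - q x s) / (y k - x))) \<longlonglongrightarrow> F s * q' x s"
   proof (rule AE_I2)
    fix s
    show "(\<lambda>k. F s * ((q (y k) s - q x s) / (y k - x))) \<longlonglongrightarrow> F s * q' x s"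
    proof (cases "F s = 0")
     case False
     have "((\<lambda>y. (q y s - q x s) / (y - x)) \<longlongrightarrow> q' x s) (at x)" using d[OF False, of x] by (simp add: has_field_derivative_iff)
     moreover have "filterlim y (at x) sequentially" using y yx by (intro filterlim_atI) auto
     ultimately have "(\<lambda>k. (q (y k) s - q x s) / (y k - x)) \<longlonglongrightarrow> q' x s" by (rule filterlim_compose)
     then show ?thesis by (intro tendsto_mult tendsto_const)
    qed simp
   qed
   show "AE s in lborel. norm (F s * ((q (y k) s - q x s) / (y k - x))) \<le> \<bar>F s\<bar> * B" for k
   proof (rule AE_I2)
    fix s
    show "norm (F s * ((q (y k) s - q x s) / (y k - x))) \<le> \<bar>F s\<bar> * B"
    proof (cases "F s = 0")
     case False
     have "norm (q (y k) s - q x s) \<le> B * norm (y k - x)"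
      by (rule field_differentiable_bound[where S=UNIV]) (use d[OF False] B[OF False] in auto)
     then have "\<bar>(q (y k) s - q x s) / (y k - x)\<bar> \<le> B" using yx[of k] by (simp add: abs_divide divide_le_eq)
     then show ?thesis unfolding real_norm_def abs_mult by (intro mult_left_mono) auto
    qed simp
   qed
  qed measurable
  moreover have "(LINT s|lborel. F s * ((q (y k) s - q x s) / (y k - x))) = (?I (y k) - ?I x) / (y k - x)" for k
  proof -
   have "(LINT s|lborel. F s * ((q (y k) s - q x s) / (y k - x))) = (LINT s|lborel. (F s * q (y k) s - F s * q x s) / (y k - x))"
    by (simp add: right_diff_distrib)
   then show ?thesis using Bochner_Integration.integral_diff[OF i[of "y k"] i[of x]] by simp
  qed
  ultimately show "((\<lambda>y. (?I y - ?I x) / (y - x)) \<circ> y) \<longlonglongrightarrow> (LINT s|lborel. F s * q' x s)" by (simp only: comp_def)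
 qed
 then show ?thesis by (simp add: has_field_derivative_iff)
qed

text \<open>
 Bounded profiles supported in \<open>[a,R)\<close>; by monotone convergence they suffice to compute norms.
\<close>

definition radial_datum :: "real => real => (real => real) => bool" where
 "radial_datum a R F \<longleftrightarrow> 0 < a \<and> F \<in> borel_measurable borel \<and> (\<forall>s. 0 \<le> F s) \<and> (\<exists>c. \<forall>s. F s \<le> c) \<and> (\<forall>s. s < a \<or> R \<le> s \<longrightarrow> F s = 0)"

text \<open>
 Smoothing by multiplicative convolution. Differentiation and multiplication by powers of \<open>r\<close> only
 change \<open>p\<close> and \<open>\<psi>\<close>.
\<close>

definition rad :: "(real => real) => real => (real => real) => real => real" where
 "rad F p \<psi> r = (LINT s|lborel. F s * s powr (p - 1) * \<psi> (r / s))"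

lemma radial_datum_support: "radial_datum a R F ==> F s \<noteq> 0 ==> 0 < s \<and> a \<le> s \<and> s < R"
 unfolding radial_datum_def by (meson le_less_trans not_le)

lemma radial_datum_mult_bounded_integrable:
 assumes F: "radial_datum a R F" and [measurable]: "g \<in> borel_measurable borel" and b: "\<And>s. a \<le> s ==> s \<le> R ==> \<bar>g s\<bar> \<le> B"
 shows "integrable lborel (\<lambda>s. F s * g s)"
proof -
 have [measurable]: "F \<in> borel_measurable borel" using F by (simp add: radial_datum_def)
 obtain c where c: "\<And>s. F s \<le> c" using F by (auto simp: radial_datum_def)
 show ?thesis
 proof (rule Bochner_Integration.integrable_bound[of _ "\<lambda>s. (c * B) * indicator {a..R} s"])
  show "integrable lborel (\<lambda>s. (c * B) * indicator {a..R} s)"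
   by (intro integrable_mult_right integrable_real_indicator) (auto simp: emeasure_lborel_Icc_eq)
  show "AE s in lborel. norm (F s * g s) \<le> norm ((c * B) * indicator {a..R} s)"
  proof (rule AE_I2)
   fix s show "norm (F s * g s) \<le> norm ((c * B) * indicator {a..R} s)"
   proof (cases "a \<le> s \<and> s \<le> R")
    case True
    have "norm (F s * g s) \<le> c * B" unfolding real_norm_def abs_mult using F c[of s] True b[of s]
     by (intro mult_mono) (auto simp: radial_datum_def intro: order_trans[OF _ c])
    then show ?thesis using True by auto
   next
    case False
    then have "F s = 0" using F by (auto simp: radial_datum_def)
    then show ?thesis by simp
   qed
  qed
 qed measurable
qed

lemma radial_datum_powr_integrable:
 assumes F: "radial_datum a R F" shows "integrable lborel (\<lambda>s. F s * s powr q)"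
proof -
 have a: "a > 0" using F by (simp add: radial_datum_def)
 have "continuous_on {a..R} (\<lambda>s. s powr q)" using a by (intro continuous_intros) auto
 from continuous_on_compact_bound[OF this compact_Icc] obtain B where "\<And>s. s \<in> {a..R} ==> \<bar>s powr q\<bar> \<le> B" by blast
 then show ?thesis by (intro radial_datum_mult_bounded_integrable[OF F, where B=B]) auto
qed

lemma smooth_borel: "smooth f ==> f \<in> borel_measurable borel"
 by (intro borel_measurable_continuous_onI smooth_continuous)

lemma smooth_in_bounded:
 assumes "smooth_in a b \<psi>" obtains B where "B \<ge> 0" "\<And>t. \<bar>\<psi> t\<bar> \<le> B"
proof -
 have "continuous_on {a..b} \<psi>" using assms by (auto simp: smooth_in_def intro: smooth_continuous)
 from continuous_on_compact_bound[OF this compact_Icc] obtain B where B: "\<And>t. t \<in> {a..b} ==> \<bar>\<psi> t\<bar> \<le> B" by blast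
 have "\<bar>\<psi> t\<bar> \<le> max B 0" for t using B[of t] assms by (cases "t \<in> {a..b}") (auto simp: smooth_in_def)
 then show ?thesis by (intro that[of "max B 0"]) auto
qed

lemma rad_integrable:
 assumes F: "radial_datum a R F" and \<psi>: "smooth \<psi>"
 shows "integrable lborel (\<lambda>s. F s * s powr q * \<psi> (r / s))"
proof -
 have a: "a > 0" using F by (simp add: radial_datum_def)
 have [measurable]: "\<psi> \<in> borel_measurable borel" using \<psi> by (rule smooth_borel)
 have "continuous_on {a..R} (\<lambda>s. s powr q * \<psi> (r / s))" using a
  by (intro continuous_intros continuous_on_compose2[OF smooth_continuous[OF \<psi>, of UNIV]]) auto
 from continuous_on_compact_bound[OF this compact_Icc] obtain B where "\<And>s. s \<in> {a..R} ==> \<bar>s powr q * \<psi> (r / s)\<bar> \<le> B" by blast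
 then have "integrable lborel (\<lambda>s. F s * (s powr q * \<psi> (r / s)))" by (intro radial_datum_mult_bounded_integrable[OF F, where B=B]) auto
 then show ?thesis by (simp add: mult.assoc)
qed

lemma rad_has_derivative:
 assumes F: "radial_datum a R F" and \<psi>: "smooth \<psi>" "smooth_in b c (deriv \<psi>)"
 shows "(rad F p \<psi> has_real_derivative rad F (p - 1) (deriv \<psi>) r) (at r)"
proof -
 have Fs: "s > 0" "a \<le> s" if "F s * s powr (p - 1) \<noteq> 0" for s using that radial_datum_support[OF F, of s] by auto
 obtain B where B: "B \<ge> 0" "\<And>t. \<bar>deriv \<psi> t\<bar> \<le> B" using smooth_in_bounded[OF \<psi>(2)] by blast
 have [measurable]: "\<psi> \<in> borel_measurable borel" "deriv \<psi> \<in> borel_measurable borel" "F \<in> borel_measurable borel"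
  using \<psi> F by (auto simp: smooth_in_def radial_datum_def intro: smooth_borel)
 have a: "a > 0" using F by (simp add: radial_datum_def)
 have "((\<lambda>r. LINT s|lborel. (F s * s powr (p - 1)) * \<psi> (r / s)) has_real_derivative
   (LINT s|lborel. (F s * s powr (p - 1)) * (deriv \<psi> (r / s) / s))) (at r)"
 proof (rule DERIV_integral_dominated[where B="B / a"])
  show "integrable lborel (\<lambda>s. F s * s powr (p - 1))" by (rule radial_datum_powr_integrable[OF F])
  show "integrable lborel (\<lambda>s. F s * s powr (p - 1) * \<psi> (r / s))" for r by (rule rad_integrable[OF F \<psi>(1)])
  show "((\<lambda>r. \<psi> (r / s)) has_real_derivative deriv \<psi> (r / s) / s) (at r)" if "F s * s powr (p - 1) \<noteq> 0" for r s
  proof -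
   have "((\<lambda>r. r / s) has_real_derivative 1 / s) (at r)" using Fs[OF that] by (auto intro!: derivative_eq_intros)
   from DERIV_chain2[OF smooth_real_has_derivative[OF \<psi>(1)] this] show ?thesis by simp
  qed
  show "\<bar>deriv \<psi> (r / s) / s\<bar> \<le> B / a" if "F s * s powr (p - 1) \<noteq> 0" for r s
  proof -
   have "a \<le> s" by (rule Fs[OF that])
   then show ?thesis unfolding abs_divide using B a by (intro frac_le) auto
  qed
 qed measurable
 moreover have "(LINT s|lborel. (F s * s powr (p - 1)) * (deriv \<psi> (r / s) / s)) = rad F (p - 1) (deriv \<psi>) r"
  unfolding rad_def
 proof (rule Bochner_Integration.integral_cong[OF refl])
  fix s show "(F s * s powr (p - 1)) * (deriv \<psi> (r / s) / s) = F s * s powr (p - 1 - 1) * deriv \<psi> (r / s)"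
  proof (cases "F s = 0")
   case False
   then have "s > 0" using radial_datum_support[OF F] by blast
   then have "s powr (p - 1 - 1) = s powr (p - 1) / s" using powr_diff[of s "p - 1" 1] by simp
   then show ?thesis by (simp only: times_divide_eq_right times_divide_eq_left)
  qed simp
 qed
 ultimately show ?thesis unfolding rad_def[abs_def] by simp
qed

lemma rad_zero:
 assumes F: "radial_datum a R F" and z: "\<And>t. t < b ==> \<psi> t = 0" and b: "b \<ge> 0" and r: "r < a * b"
 shows "rad F p \<psi> r = 0"
proof -
 have "F s * s powr (p - 1) * \<psi> (r / s) = 0" for s
 proof (cases "a \<le> s")
  case True
  have "a > 0" using F by (simp add: radial_datum_def)
  then have s: "s > 0" using True by simp
  have "r < s * b" using r mult_right_mono[OF True b] by linarith
  then have "r / s < b" using s by (simp add: divide_less_eq mult.commute)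
  then show ?thesis using z by simp
 next
  case False
  then show ?thesis using F by (simp add: radial_datum_def)
 qed
 then show ?thesis unfolding rad_def by (simp only: Bochner_Integration.integral_zero)
qed

lemma smooth_rad:
 assumes F: "radial_datum a R F" and \<psi>: "smooth \<psi>" "smooth_in b c (deriv \<psi>)"
 shows "smooth (rad F p \<psi>)"
 unfolding smooth_def
proof
 fix k show "Ck k (rad F p \<psi>)" using \<psi>
 proof (induction k arbitrary: p \<psi>)
  case (Suc k)
  have "Ck k (rad F (p - 1) (deriv \<psi>))" by (rule Suc.IH[OF smooth_deriv[OF Suc.prems(1)] smooth_in_deriv[OF Suc.prems(2)]])
  then show ?case by (rule Ck_realI[OF rad_has_derivative[OF F Suc.prems]])
 qed simp
qed

lemma rad_mult_inverse:
 assumes F: "radial_datum a R F" and r: "0 \<le> r"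
 shows "rad F p \<psi> r * r powr (-1) = rad F (p - 1) (\<lambda>t. \<psi> t * t powr (-1)) r"
proof -
 have "F s * s powr (p - 1) * \<psi> (r / s) * r powr (-1) = F s * s powr (p - 1 - 1) * (\<psi> (r / s) * (r / s) powr (-1))" for s
 proof (cases "a \<le> s")
  case True
  then have s: "s > 0" using F by (simp add: radial_datum_def)
  have "(r / s) powr (-1) = r powr (-1) * s" using s r by (simp add: powr_minus_divide powr_divide abs_of_pos)
  moreover have "s powr (p - 1) = s powr (p - 1 - 1) * s" using s powr_diff[of s "p - 1" 1] by simp
  ultimately show ?thesis by (simp only: ac_simps)
 next
  case False
  then have "F s = 0" using F by (simp add: radial_datum_def)
  then show ?thesis by simp
 qed
 then have "(\<lambda>s. F s * s powr (p - 1) * \<psi> (r / s) * r powr (-1)) = (\<lambda>s. F s * s powr (p - 1 - 1) * (\<psi> (r / s) * (r / s) powr (-1)))" by (rule ext)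
 then show ?thesis unfolding rad_def integral_mult_left_zero[symmetric] by (simp only:)
qed

lemma radial_rad:
 fixes x :: "real ^ 'n"
 assumes F: "radial_datum a R F" and \<psi>: "smooth \<psi>" "smooth_in (1/2) 1 (deriv \<psi>)" "\<And>t. t < 1/2 ==> \<psi> t = 0"
 shows "smooth (\<lambda>x :: real ^ 'n. rad F p \<psi> (norm x))"
  "frechet_derivative (\<lambda>x. rad F p \<psi> (norm x)) (at x) (axis j 1) = x $ j * rad F (p - 2) (\<lambda>t. deriv \<psi> t * t powr (-1)) (norm x)"
proof -
 have a: "a * (1/2) > 0" using F by (simp add: radial_datum_def)
 have s: "smooth (rad F p \<psi>)" by (rule smooth_rad[OF F \<psi>(1,2)])
 have z: "rad F p \<psi> r = 0" if "r < a * (1/2)" for r by (rule rad_zero[OF F \<psi>(3) _ that]) auto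
 show "smooth (\<lambda>x :: real ^ 'n. rad F p \<psi> (norm x))" by (rule smooth_norm_compose[OF s a z])
 have "frechet_derivative (\<lambda>x. rad F p \<psi> (norm x)) (at x) (axis j 1) = deriv (rad F p \<psi>) (norm x) * norm x powr (-1) * (axis j 1 \<bullet> x)"
  by (simp only: frechet_derivative_at[OF norm_compose_has_derivative[OF s a z], symmetric])
 also have "deriv (rad F p \<psi>) (norm x) = rad F (p - 1) (deriv \<psi>) (norm x)" by (rule DERIV_imp_deriv[OF rad_has_derivative[OF F \<psi>(1,2)]])
 also have "rad F (p - 1) (deriv \<psi>) (norm x) * norm x powr (-1) = rad F (p - 2) (\<lambda>t. deriv \<psi> t * t powr (-1)) (norm x)"
  by (subst rad_mult_inverse[OF F]) (simp_all add: algebra_simps)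
 finally show "frechet_derivative (\<lambda>x. rad F p \<psi> (norm x)) (at x) (axis j 1) = x $ j * rad F (p - 2) (\<lambda>t. deriv \<psi> t * t powr (-1)) (norm x)"
  by (simp add: inner_axis' mult.commute)
qed

lemma smooth_in_mult_powr: "smooth_in a b f ==> a > 0 ==> smooth_in a b (\<lambda>t. f t * t powr q)"
 unfolding smooth_in_def using smooth_mult_powr[of f a q] by auto

text \<open>
 Operators \<open>F \<mapsto> G F\<close> whose values scale like \<open>|x|\<^sup>p\<close>. Operators rather than functions, so that the
 constants in the bounds are uniform in \<open>F\<close>.
\<close>

inductive radial_op :: "real => ((real => real) => real ^ 'n => real) => bool" where
 base: "smooth_in (1/2) 1 \<psi> ==> radial_op p (\<lambda>F x. rad F p \<psi> (norm x))"
| coord: "radial_op p G ==> radial_op (p + 1) (\<lambda>F x. x $ i * G F x)"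
| add: "radial_op p G ==> radial_op p H ==> radial_op p (\<lambda>F x. G F x + H F x)"

lemma radial_op_partial:
 fixes G :: "(real => real) => real ^ 'n => real"
 assumes "radial_op p G"
 shows "\<exists>H. radial_op (p - 1) H \<and> (\<forall>a R F. radial_datum a R F \<longrightarrow> smooth (G F) \<and> (\<forall>x. frechet_derivative (G F) (at x) (axis j 1) = H F x))"
 using assms
proof induction
 case (base \<psi> p)
 have s: "smooth \<psi>" "smooth_in (1/2) 1 (deriv \<psi>)" "\<And>t. t < 1/2 ==> \<psi> t = 0" using base smooth_in_deriv[OF base] by (auto simp: smooth_in_def)
 have "radial_op (p - 2 + 1) (\<lambda>F x. x $ j * rad F (p - 2) (\<lambda>t. deriv \<psi> t * t powr (-1)) (norm (x :: real ^ 'n)))"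
  by (intro radial_op.coord radial_op.base smooth_in_mult_powr s(2)) simp
 moreover have "p - 2 + 1 = p - 1" by simp
 ultimately show ?case using radial_rad[OF _ s] by (intro exI[of _ "\<lambda>F x. x $ j * rad F (p - 2) (\<lambda>t. deriv \<psi> t * t powr (-1)) (norm x)"]) auto
next
 case (coord p G i)
 then obtain H where H: "radial_op (p - 1) H" "\<And>a R F. radial_datum a R F ==> smooth (G F)"
  "\<And>a R F x. radial_datum a R F ==> frechet_derivative (G F) (at x) (axis j 1) = H F x" by blast
 have e: "(\<lambda>x :: real ^ 'n. x $ i) = (\<lambda>x. x \<bullet> axis i 1)" by (simp add: inner_axis)
 have sx: "smooth (\<lambda>x :: real ^ 'n. x $ i)" unfolding e by (rule smooth_inner)
 have H1: "radial_op (p + 1 - 1) (\<lambda>F x. x $ i * H F x)" using radial_op.coord[OF H(1), of i] by simp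
 have D: "frechet_derivative (\<lambda>x. x $ i * G F x) (at x) (axis j 1) = x $ i * H F x + (axis j 1 :: real ^ 'n) $ i * G F x" if F: "radial_datum a R F" for a R F and x :: "real ^ 'n"
 proof -
  have 1: "((\<lambda>x. x $ i * G F x) has_derivative (\<lambda>h. x $ i * frechet_derivative (G F) (at x) h + h $ i * G F x)) (at x)"
   by (intro has_derivative_mult smooth_has_derivative H(2)[OF F] bounded_linear_imp_has_derivative bounded_linear_vec_nth)
  show ?thesis by (simp only: frechet_derivative_at[OF 1, symmetric] H(3)[OF F])
 qed
 have S: "smooth (\<lambda>x. x $ i * G F x)" if "radial_datum a R F" for a R F by (intro smooth_mult sx H(2)[OF that])
 show ?case
 proof (cases "i = j")
  case True
  have "radial_op (p + 1 - 1) (\<lambda>F x. x $ i * H F x + G F x)" by (rule radial_op.add[OF H1]) (use coord in simp)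
  then show ?thesis using D True by (intro exI[of _ "\<lambda>F x. x $ i * H F x + G F x"]) (auto intro: S[unfolded True])
 next
  case False
  then show ?thesis using D H1 by (intro exI[of _ "\<lambda>F x. x $ i * H F x"]) (auto intro: S simp: axis_def)
 qed
next
 case (add p G H)
 then obtain G' H' where G': "radial_op (p - 1) G'" "\<And>a R F. radial_datum a R F ==> smooth (G F)"
  "\<And>a R F x. radial_datum a R F ==> frechet_derivative (G F) (at x) (axis j 1) = G' F x"
  and H': "radial_op (p - 1) H'" "\<And>a R F. radial_datum a R F ==> smooth (H F)"
  "\<And>a R F x. radial_datum a R F ==> frechet_derivative (H F) (at x) (axis j 1) = H' F x" by blast
 have D: "frechet_derivative (\<lambda>x. G F x + H F x) (at x) (axis j 1) = G' F x + H' F x" if F: "radial_datum a R F" for a R F x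
 proof -
  have 1: "((\<lambda>x. G F x + H F x) has_derivative (\<lambda>h. frechet_derivative (G F) (at x) h + frechet_derivative (H F) (at x) h)) (at x)"
   by (intro has_derivative_add smooth_has_derivative G'(2)[OF F] H'(2)[OF F])
  show ?thesis by (simp only: frechet_derivative_at[OF 1, symmetric] G'(3)[OF F] H'(3)[OF F])
 qed
 show ?case using radial_op.add[OF G'(1) H'(1)] D by (intro exI[of _ "\<lambda>F x. G' F x + H' F x"]) (auto intro: smooth_add G'(2) H'(2))
qed

text \<open>
 The average of \<open>F\<close> over \<open>[r, 2r]\<close>.
\<close>

definition dilation_average :: "(real => real) => real => real" where
 "dilation_average F r = (LINT s|lborel. indicator {0..1} s * F (r * (1 + s)))"

lemma dilation_average_integrable:
 assumes F: "radial_datum a R F" shows "integrable lborel (\<lambda>s. indicator {0..1} s * F (r * (1 + s)))" "0 \<le> dilation_average F r"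
proof -
 have [measurable]: "F \<in> borel_measurable borel" using F by (simp add: radial_datum_def)
 obtain c where c: "\<And>s. F s \<le> c" using F by (auto simp: radial_datum_def)
 have F0: "0 \<le> F s" for s using F by (simp add: radial_datum_def)
 show "integrable lborel (\<lambda>s. indicator {0..1} s * F (r * (1 + s)))"
 proof (rule Bochner_Integration.integrable_bound[of _ "\<lambda>s. c * indicator {0..1} s"])
  show "integrable lborel (\<lambda>s. c * indicator {0..1::real} s)" by (intro integrable_mult_right integrable_real_indicator) auto
  have "F t \<le> \<bar>c\<bar>" for t using c[of t] by linarith
  then show "AE s in lborel. norm (indicator {0..1} s * F (r * (1 + s))) \<le> norm (c * indicator {0..1} s)"
   by (intro AE_I2) (auto simp: indicator_def abs_of_nonneg F0)
 qed measurable
 show "0 \<le> dilation_average F r" unfolding dilation_average_def by (intro integral_nonneg_AE AE_I2) (simp add: F0)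
qed

text \<open>
 For \<open>\<psi>\<close> supported in \<open>[1/2,1]\<close> only \<open>s \<in> [r, 2r]\<close> contributes; substitute \<open>s = r (1 + t)\<close>.
\<close>

lemma rad_bound:
 assumes \<psi>: "smooth_in (1/2) 1 \<psi>"
 obtains C where "C \<ge> 0" "\<And>a R F r. radial_datum a R F ==> r > 0 ==> \<bar>rad F p \<psi> r\<bar> \<le> C * r powr p * dilation_average F r"
proof -
 obtain B where B: "B \<ge> 0" "\<And>t. \<bar>\<psi> t\<bar> \<le> B" using smooth_in_bounded[OF \<psi>] by blast
 have "continuous_on {0..1} (\<lambda>s::real. (1 + s) powr (p - 1))" by (intro continuous_intros) auto
 from continuous_on_compact_bound[OF this compact_Icc] obtain A where A: "\<And>s. s \<in> {0..1} ==> \<bar>(1 + s) powr (p - 1)\<bar> \<le> A" by blast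
 have A0: "A \<ge> 0" using A[of 0] by simp
 show ?thesis
 proof (rule that[of "A * B"])
  show "A * B \<ge> 0" using A0 B by simp
  fix a R F and r :: real assume F: "radial_datum a R F" and r: "r > 0"
  have F0: "0 \<le> F s" for s using F by (simp add: radial_datum_def)
  have sub: "(LINT s|lborel. f s) = \<bar>r\<bar> *\<^sub>R (LINT s|lborel. f (r + r * s))" for f :: "real => real"
   using lborel_integral_real_affine[of r f r] r by simp
  have "rad F p \<psi> r = r * (LINT s|lborel. F (r + r * s) * (r + r * s) powr (p - 1) * \<psi> (r / (r + r * s)))"
   unfolding rad_def by (subst sub) (use r in simp)
  then have "\<bar>rad F p \<psi> r\<bar> = r * \<bar>LINT s|lborel. F (r + r * s) * (r + r * s) powr (p - 1) * \<psi> (r / (r + r * s))\<bar>" using r by (simp add: abs_mult)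
  also have "... \<le> r * (LINT s|lborel. A * B * r powr (p - 1) * (indicator {0..1} s * F (r * (1 + s))))"
  proof (intro mult_left_mono integral_abs_bound_integral[THEN order_trans] less_imp_le[OF r])
   show "integrable lborel (\<lambda>s. A * B * r powr (p - 1) * (indicator {0..1} s * F (r * (1 + s))))"
    by (intro integrable_mult_right dilation_average_integrable[OF F])
   have "integrable lborel (\<lambda>s. F s * s powr (p - 1) * \<psi> (r / s))" using \<psi> by (intro rad_integrable[OF F]) (simp add: smooth_in_def)
   from lborel_integrable_real_affine[OF this, of r r] r
   show "integrable lborel (\<lambda>s. F (r + r * s) * (r + r * s) powr (p - 1) * \<psi> (r / (r + r * s)))" by simp
   fix s :: real
   show "\<bar>F (r + r * s) * (r + r * s) powr (p - 1) * \<psi> (r / (r + r * s))\<bar> \<le> A * B * r powr (p - 1) * (indicator {0..1} s * F (r * (1 + s)))"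
   proof (cases "0 \<le> s \<and> s \<le> 1")
    case True
    have e: "r + r * s = r * (1 + s)" by (simp add: algebra_simps)
    have "\<bar>(r * (1 + s)) powr (p - 1)\<bar> \<le> r powr (p - 1) * A" using True A[of s] r by (simp add: powr_mult)
    then have "\<bar>F (r + r * s) * (r + r * s) powr (p - 1) * \<psi> (r / (r + r * s))\<bar> \<le> F (r * (1 + s)) * (r powr (p - 1) * A) * B"
     unfolding abs_mult e using F0 A0 B by (intro mult_mono) auto
    then show ?thesis using True by (simp add: ac_simps)
   next
    case False
    have "\<psi> (r / (r + r * s)) = 0 \<or> F (r + r * s) = 0"
    proof (cases "r + r * s \<le> 0")
     case True then show ?thesis using F by (auto simp: radial_datum_def)
    next
     case pos: False
     then have "r / (r + r * s) < 1/2 \<or> r / (r + r * s) > 1" using False r by (auto simp: field_simps mult_less_0_iff)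
     then show ?thesis using \<psi> by (auto simp: smooth_in_def)
    qed
    then show ?thesis using False by auto
   qed
  qed auto
  also have "... = A * B * r powr p * dilation_average F r"
   using r by (simp add: dilation_average_def powr_diff)
  finally show "\<bar>rad F p \<psi> r\<bar> \<le> A * B * r powr p * dilation_average F r" .
 qed
qed

lemma radial_op_bound:
 fixes G :: "(real => real) => real ^ 'n => real"
 assumes "radial_op p G"
 shows "\<exists>C\<ge>0. \<forall>a R F x. radial_datum a R F \<longrightarrow> x \<noteq> 0 \<longrightarrow> \<bar>G F x\<bar> \<le> C * norm x powr p * dilation_average F (norm x)"
 using assms
proof induction
 case (base \<psi> p)
 show ?case by (rule rad_bound[OF base, of p]) auto
next
 case (coord p G i)
 then obtain C where C: "C \<ge> 0" "\<And>a R F x. radial_datum a R F ==> x \<noteq> 0 ==> \<bar>G F x\<bar> \<le> C * norm x powr p * dilation_average F (norm x)" by blast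
 have "\<bar>x $ i * G F x\<bar> \<le> C * norm x powr (p + 1) * dilation_average F (norm x)" if "radial_datum a R F" "x \<noteq> 0" for a R F x
 proof -
  have "\<bar>x $ i * G F x\<bar> \<le> norm x * (C * norm x powr p * dilation_average F (norm x))"
   unfolding abs_mult by (intro mult_mono C(2)[OF that] component_le_norm_cart) auto
  then show ?thesis by (simp add: powr_add ac_simps)
 qed
 then show ?case using C(1) by blast
next
 case (add p G H)
 then obtain C D where C: "C \<ge> 0" "\<And>a R F x. radial_datum a R F ==> x \<noteq> 0 ==> \<bar>G F x\<bar> \<le> C * norm x powr p * dilation_average F (norm x)"
  and D: "D \<ge> 0" "\<And>a R F x. radial_datum a R F ==> x \<noteq> 0 ==> \<bar>H F x\<bar> \<le> D * norm x powr p * dilation_average F (norm x)" by blast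
 have "\<bar>G F x + H F x\<bar> \<le> (C + D) * norm x powr p * dilation_average F (norm x)" if "radial_datum a R F" "x \<noteq> 0" for a R F x
  using C(2)[OF that] D(2)[OF that] by (simp add: algebra_simps)
 then show ?case using C(1) D(1) by (intro exI[of _ "C + D"]) auto
qed

lemma radial_op_partials:
 fixes G :: "(real => real) => real ^ 'n => real"
 assumes "radial_op p G"
 shows "\<exists>H. radial_op (p - real (length is)) H \<and> (\<forall>a R F. radial_datum a R F \<longrightarrow> partials is (G F) = H F)"
proof (induction "is")
 case Nil
 show ?case using assms by auto
next
 case (Cons i "is")
 then obtain H where H: "radial_op (p - real (length is)) H" "\<And>a R F. radial_datum a R F ==> partials is (G F) = H F" by blast
 from radial_op_partial[OF H(1), of i] obtain H' where H': "radial_op (p - real (length is) - 1) H'"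
  "\<And>a R F x. radial_datum a R F ==> frechet_derivative (H F) (at x) (axis i 1) = H' F x" by blast
 have "partials (i # is) (G F) = H' F" if "radial_datum a R F" for a R F
  unfolding partials_Cons H(2)[OF that] by (rule ext) (rule H'(2)[OF that])
 moreover have "radial_op (p - real (length (i # is))) H'" using H'(1) by (simp add: algebra_simps)
 ultimately show ?case by blast
qed

section \<open>Test functions for the optimality\<close>

text \<open>
 Equal to 1 for \<open>t \<le> 1/2\<close> and to 0 for \<open>t \<ge> 1\<close>.
\<close>

definition step :: "real => real" where
 "step t = 1 - integral {0..t} (cutoff 1)"

lemma step: "smooth step" "smooth_in (1/2) 1 (deriv step)" "t \<le> 1/2 ==> step t = 1" "1 \<le> t ==> step t = 0" "0 \<le> step t" "step t \<le> 1"
proof -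
 let ?\<kappa> = "cutoff 1"
 note \<kappa> = cutoff[OF zero_less_one]
 have t: "smooth_in (1/2) 1 ?\<kappa>" by (rule smooth_in_mono[OF \<kappa>(1)]) auto
 have c: "continuous_on S ?\<kappa>" for S using \<kappa>(1) by (intro smooth_continuous) (simp add: smooth_in_def)
 have z: "x < 1/2 ==> ?\<kappa> x = 0" "1 < x ==> ?\<kappa> x = 0" for x using t by (auto simp: smooth_in_def)
 define P where "P t = integral {0..t} ?\<kappa>" for t
 have P: "(P has_real_derivative ?\<kappa> t) (at t)" for t unfolding P_def[abs_def] by (rule prim_has_derivative[OF c _ z(1), of "1/2"]) auto
 have e: "step t = 1 - P t" for t by (simp add: step_def P_def)
 have D: "(step has_real_derivative (-1) * ?\<kappa> t) (at t)" for t unfolding e[abs_def] using P[of t] by (auto intro!: derivative_eq_intros)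
 have s: "smooth (\<lambda>t. (-1) * ?\<kappa> t)" using t by (intro smooth_mult smooth_const) (simp add: smooth_in_def)
 have d: "deriv step = (\<lambda>t. (-1) * ?\<kappa> t)" by (rule ext) (rule DERIV_imp_deriv[OF D])
 have P1: "P t = 1" if "1 \<le> t" for t unfolding P_def using integral_beyond_support[OF c z(2) _ that] \<kappa>(3) by simp
 have P0: "P t = 0" if "t \<le> 1/2" for t
 proof -
  have "P t = integral {0..t} (\<lambda>_. 0)" unfolding P_def by (rule integral_spike[of "{1/2}"]) (use z that in \<open>auto simp: less_le\<close>)
  then show ?thesis by simp
 qed
 have Pn: "0 \<le> P t" for t unfolding P_def by (intro integral_nonneg integrable_continuous_interval c \<kappa>(2))
 have Pm: "P t \<le> 1" for t
 proof (cases "t \<le> 1")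
  case True
  have "P t \<le> P 1" by (rule DERIV_nonneg_imp_nondecreasing[OF True]) (use P \<kappa>(2) in blast)
  then show ?thesis using P1[of 1] by simp
 qed (use P1 in simp)
 show "smooth step" by (rule smooth_realI[OF D s])
 show "smooth_in (1/2) 1 (deriv step)" unfolding d using s z by (auto simp: smooth_in_def)
 show "t \<le> 1/2 ==> step t = 1" "1 \<le> t ==> step t = 0" "0 \<le> step t" "step t \<le> 1"
  using P1[of t] P0[of t] Pn[of t] Pm[of t] by (auto simp: e)
qed

lemma indicator_average_diff_le:
 assumes [measurable]: "g \<in> borel_measurable borel"
 shows "(\<integral>\<^sup>+s. indicator {0..1::real} s * g s \<partial>lborel) - ennreal l \<le> (\<integral>\<^sup>+s. indicator {0..1} s * (g s - ennreal l) \<partial>lborel)"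
proof -
 have "(\<integral>\<^sup>+s. indicator {0..1::real} s * g s \<partial>lborel) \<le> (\<integral>\<^sup>+s. ennreal l * indicator {0..1::real} s + indicator {0..1} s * (g s - ennreal l) \<partial>lborel)"
  by (intro nn_integral_mono) (auto simp: indicator_def intro: ennreal_le_add_diff)
 also have "... = ennreal l + (\<integral>\<^sup>+s. indicator {0..1} s * (g s - ennreal l) \<partial>lborel)"
  by (subst nn_integral_add) (auto simp: nn_integral_cmult_indicator)
 finally show ?thesis by (subst ennreal_minus_le_iff) auto
qed

context target_setting begin

lemma nn_integral_Lb_radial:
 assumes "\<phi> \<in> borel_measurable borel"
 shows "(\<integral>\<^sup>+x. \<phi> (norm x) \<partial>Lb) = (\<integral>\<^sup>+r. \<phi> r * (ennreal (\<Omega> * r powr (n - 1)) * indicator {0<..<R} r) \<partial>lborel)"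
 using nn_integral_weighted_radial[OF assms, of 0 R, where 'n='n] by (simp add: weighted_ball_zero sphere_area_n n_eq[symmetric])

text \<open>
 For \<open>s \<ge> 0\<close> the map \<open>r \<mapsto> (1 + s a) r + s b\<close> increases radii and expands, so composing with it decreases
 the integrals of \<open>(g - l)\<^sup>+\<close> for all \<open>l\<close>. Jensen's inequality transfers this to the average. The case
 \<open>a = 1, b = 0\<close> gives dilations, \<open>a = 0, b = R\<close> translations.
\<close>

lemma norm_average_le:
 assumes [measurable]: "g \<in> borel_measurable borel" and z: "\<And>r. R \<le> r ==> g r = 0" and ab: "0 \<le> a" "0 \<le> b"
 shows "X (\<lambda>x. \<integral>\<^sup>+s. indicator {0..1} s * g ((1 + s * a) * norm x + s * b) \<partial>lborel) \<le> X (\<lambda>x. g (norm x))"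
proof (rule L.norm_le_if_mean_le[OF X_ri])
 show "(\<lambda>x. \<integral>\<^sup>+s. indicator {0..1} s * g ((1 + s * a) * norm x + s * b) \<partial>lborel) \<in> borel_measurable Lb"
  by (rule borel_measurable_lebesgue_on) measurable
 show "(\<lambda>x. g (norm x)) \<in> borel_measurable Lb" by (rule borel_measurable_lebesgue_on) measurable
 fix l :: real assume "l \<ge> 0"
 define \<phi> where "\<phi> t = g t - ennreal l" for t
 have [measurable]: "\<phi> \<in> borel_measurable borel" unfolding \<phi>_def by measurable
 have \<phi>z: "\<phi> r = 0" if "R \<le> r" for r using z[OF that] by (simp add: \<phi>_def)
 define w where "w r = ennreal (\<Omega> * r powr (n - 1)) * indicator {0<..<R} r" for r
 have [measurable]: "w \<in> borel_measurable borel" unfolding w_def by measurable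
 have inner: "(\<integral>\<^sup>+r. \<phi> ((1 + s * a) * r + s * b) * w r \<partial>lborel) \<le> (\<integral>\<^sup>+r. \<phi> r * w r \<partial>lborel)" if s: "0 \<le> s" for s
 proof -
  let ?k = "1 + s * a"
  have k: "?k \<ge> 1" using s ab by simp
  have "(\<integral>\<^sup>+r. \<phi> (?k * r + s * b) * w r \<partial>lborel) \<le> (\<integral>\<^sup>+r. ennreal ?k * (\<phi> (s * b + ?k * r) * w (s * b + ?k * r)) \<partial>lborel)"
  proof (rule nn_integral_mono)
   fix r
   show "\<phi> (?k * r + s * b) * w r \<le> ennreal ?k * (\<phi> (s * b + ?k * r) * w (s * b + ?k * r))"
   proof (cases "r \<in> {0<..<R} \<and> ?k * r + s * b < R")
    case True
    have rk: "r \<le> ?k * r" using True k by (simp add: mult_le_cancel_right1)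
    then have le: "r \<le> ?k * r + s * b" using mult_nonneg_nonneg[OF s ab(2)] by linarith
    have "r powr (n - 1) \<le> (?k * r + s * b) powr (n - 1)" using True n_pos le by (intro powr_mono2) auto
    then have "w r \<le> w (s * b + ?k * r)" using True le \<Omega>_pos by (auto simp: w_def add.commute intro!: ennreal_leI)
    then have "\<phi> (?k * r + s * b) * w r \<le> \<phi> (s * b + ?k * r) * w (s * b + ?k * r)" by (simp add: add.commute mult_left_mono)
    also have "... = 1 * (\<phi> (s * b + ?k * r) * w (s * b + ?k * r))" by simp
    also have "... \<le> ennreal ?k * (\<phi> (s * b + ?k * r) * w (s * b + ?k * r))" using k by (intro mult_right_mono) auto
    finally show ?thesis .
   next
    case False
    then have "\<phi> (?k * r + s * b) * w r = 0" using \<phi>z by (auto simp: w_def)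
    then show ?thesis by (rule order_trans[OF eq_refl]) simp
   qed
  qed
  also have "... = ennreal ?k * (\<integral>\<^sup>+r. \<phi> (s * b + ?k * r) * w (s * b + ?k * r) \<partial>lborel)" by (rule nn_integral_cmult) measurable
  also have "... = (\<integral>\<^sup>+r. \<phi> r * w r \<partial>lborel)" using k by (subst nn_integral_real_affine[where c="?k" and t="s * b"]) auto
  finally show ?thesis .
 qed
 have "(\<integral>\<^sup>+x. (\<integral>\<^sup>+s. indicator {0..1} s * g ((1 + s * a) * norm x + s * b) \<partial>lborel) - ennreal l \<partial>Lb)
  \<le> (\<integral>\<^sup>+x. (\<integral>\<^sup>+s. indicator {0..1} s * \<phi> ((1 + s * a) * norm x + s * b) \<partial>lborel) \<partial>Lb)"
  unfolding \<phi>_def by (intro nn_integral_mono indicator_average_diff_le) measurable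
 also have "... = (\<integral>\<^sup>+r. (\<integral>\<^sup>+s. indicator {0..1} s * \<phi> ((1 + s * a) * r + s * b) \<partial>lborel) * w r \<partial>lborel)"
  unfolding w_def by (rule nn_integral_Lb_radial) measurable
 also have "... = (\<integral>\<^sup>+r. (\<integral>\<^sup>+s. indicator {0..1} s * \<phi> ((1 + s * a) * r + s * b) * w r \<partial>lborel) \<partial>lborel)"
  by (intro nn_integral_cong nn_integral_multc[symmetric]) measurable
 also have "... = (\<integral>\<^sup>+s. (\<integral>\<^sup>+r. indicator {0..1} s * \<phi> ((1 + s * a) * r + s * b) * w r \<partial>lborel) \<partial>lborel)"
  by (rule lborel_pair.Fubini') measurable
 also have "... = (\<integral>\<^sup>+s. indicator {0..1} s * (\<integral>\<^sup>+r. \<phi> ((1 + s * a) * r + s * b) * w r \<partial>lborel) \<partial>lborel)"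
  by (intro nn_integral_cong) (simp add: mult.assoc nn_integral_cmult)
 also have "... \<le> (\<integral>\<^sup>+s. indicator {0..1::real} s * (\<integral>\<^sup>+r. \<phi> r * w r \<partial>lborel) \<partial>lborel)"
  by (intro nn_integral_mono) (auto simp: indicator_def intro: inner)
 also have "... = (\<integral>\<^sup>+r. \<phi> r * w r \<partial>lborel)" by (subst nn_integral_multc) auto
 also have "... = (\<integral>\<^sup>+x. g (norm x) - ennreal l \<partial>Lb)" unfolding w_def by (subst nn_integral_Lb_radial[symmetric]) (auto simp: \<phi>_def)
 finally show "(\<integral>\<^sup>+x. (\<integral>\<^sup>+s. indicator {0..1} s * g ((1 + s * a) * norm x + s * b) \<partial>lborel) - ennreal l \<partial>Lb)
  \<le> (\<integral>\<^sup>+x. g (norm x) - ennreal l \<partial>Lb)" .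
qed

definition test_fun :: "(real => real) => real ^ 'n => real" where
 "test_fun F x = rad F (real m) step (norm x)"

text \<open>
 The complementary function \<open>1 - step\<close> vanishes near 0, so the results for kernels supported away
 from 0 apply to the difference from a constant.
\<close>

lemma test_fun_partial:
 assumes F: "radial_datum a R F"
 shows "smooth (test_fun F)"
  "partials [j] (test_fun F) = (\<lambda>x. x $ j * rad F (real m - 2) (\<lambda>t. deriv step t * t powr (-1)) (norm x))"
proof -
 define \<psi> where "\<psi> t = 1 - step t" for t
 have "((\<lambda>t. 1 - step t) has_real_derivative (-1) * deriv step t) (at t)" for t
  using smooth_real_has_derivative[OF step(1), of t] by (auto intro!: derivative_eq_intros)
 then have d: "deriv \<psi> = (\<lambda>t. (-1) * deriv step t)" unfolding \<psi>_def[abs_def] by (intro ext DERIV_imp_deriv)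
 have \<psi>: "smooth \<psi>" unfolding \<psi>_def[abs_def] by (intro smooth_diff smooth_const step)
 have "smooth (\<lambda>t. (-1) * deriv step t)" using step(2) by (intro smooth_mult smooth_const) (simp add: smooth_in_def)
 then have t: "smooth_in (1/2) 1 (deriv \<psi>)" unfolding d smooth_in_def using step(2) by (simp add: smooth_in_def)
 have z: "\<psi> t = 0" if "t < 1/2" for t using step(3)[of t] that by (simp add: \<psi>_def)
 define c where "c = (LINT s|lborel. F s * s powr (real m - 1))"
 have e: "test_fun F = (\<lambda>x. c - rad F (real m) \<psi> (norm x))"
 proof
  fix x :: "real ^ 'n"
  have "test_fun F x + rad F (real m) \<psi> (norm x) = (LINT s|lborel. F s * s powr (real m - 1) * step (norm x / s) + F s * s powr (real m - 1) * \<psi> (norm x / s))"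
   unfolding test_fun_def rad_def by (intro Bochner_Integration.integral_add[symmetric] rad_integrable[OF F] step(1) \<psi>)
  also have "... = c" unfolding c_def by (intro Bochner_Integration.integral_cong) (simp_all add: \<psi>_def algebra_simps)
  finally show "test_fun F x = c - rad F (real m) \<psi> (norm x)" by simp
 qed
 note r = radial_rad[OF F \<psi> t z]
 show "smooth (test_fun F)" unfolding e by (intro smooth_diff smooth_const r)
 show "partials [j] (test_fun F) = (\<lambda>x. x $ j * rad F (real m - 2) (\<lambda>t. deriv step t * t powr (-1)) (norm x))"
 proof
  fix x :: "real ^ 'n"
  have 1: "((\<lambda>x. c - rad F (real m) \<psi> (norm x)) has_derivative (\<lambda>h. 0 - frechet_derivative (\<lambda>x. rad F (real m) \<psi> (norm x)) (at x) h)) (at x)"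
   by (intro has_derivative_diff has_derivative_const smooth_has_derivative r)
  have "partials [j] (test_fun F) x = - (x $ j * rad F (real m - 2) (\<lambda>t. deriv \<psi> t * t powr (-1)) (norm x))"
   unfolding partials_Cons partials_Nil e by (simp only: frechet_derivative_at[OF 1, symmetric] r(2))
  also have "rad F (real m - 2) (\<lambda>t. deriv \<psi> t * t powr (-1)) (norm x) = - rad F (real m - 2) (\<lambda>t. deriv step t * t powr (-1)) (norm x)"
   unfolding rad_def d integral_minus[symmetric] by (intro Bochner_Integration.integral_cong) simp_all
  finally show "partials [j] (test_fun F) x = x $ j * rad F (real m - 2) (\<lambda>t. deriv step t * t powr (-1)) (norm x)" by simp
 qed
qed

lemma test_fun_partials_bound:
 assumes l: "length is \<in> {1..m}"
 shows "\<exists>C\<ge>0. \<forall>a F x. radial_datum a R F \<longrightarrow> x \<noteq> 0 \<longrightarrow> norm x < R \<longrightarrow> \<bar>partials is (test_fun F) x\<bar> \<le> C * dilation_average F (norm x)"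
proof -
 obtain js j where isj: "is = js @ [j]" using l by (cases "is" rule: rev_cases) auto
 have "radial_op (real m - 2 + 1) (\<lambda>F (x :: real ^ 'n). x $ j * rad F (real m - 2) (\<lambda>t. deriv step t * t powr (-1)) (norm x))"
  by (intro radial_op.coord radial_op.base smooth_in_mult_powr step(2)) simp
 from radial_op_partials[OF this, of js] obtain H where H: "radial_op (real m - 2 + 1 - real (length js)) H"
  "\<And>a R F. radial_datum a R F ==> partials js (\<lambda>x. x $ j * rad F (real m - 2) (\<lambda>t. deriv step t * t powr (-1)) (norm x)) = H F" by blast
 define q where "q = real m - 2 + 1 - real (length js)"
 have q: "q \<ge> 0" using l unfolding q_def isj by simp
 obtain C where C: "C \<ge> 0" "\<And>a R F x. radial_datum a R F ==> x \<noteq> 0 ==> \<bar>H F x\<bar> \<le> C * norm x powr q * dilation_average F (norm x)"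
  using radial_op_bound[OF H(1)] unfolding q_def by blast
 have "\<bar>partials is (test_fun F) x\<bar> \<le> (C * R powr q) * dilation_average F (norm x)" if F: "radial_datum a R F" "x \<noteq> 0" "norm x < R" for a F x
 proof -
  have "partials is (test_fun F) x = H F x" unfolding isj partials_append test_fun_partial(2)[OF F(1)] H(2)[OF F(1)] ..
  then have "\<bar>partials is (test_fun F) x\<bar> \<le> C * norm x powr q * dilation_average F (norm x)" using C(2)[OF F(1,2)] by simp
  also have "... \<le> (C * R powr q) * dilation_average F (norm x)"
   using F q C(1) dilation_average_integrable(2)[OF F(1)] by (intro mult_right_mono mult_left_mono powr_mono2) auto
  finally show ?thesis .
 qed
 then show ?thesis using C(1) by (intro exI[of _ "C * R powr q"]) auto
qed

lemma weak_gradient_test_fun: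
 obtains C where "C \<ge> 0" "\<And>a F. radial_datum a R F ==> AE x in Lb. weak_gradient_length (ball 0 R) m (test_fun F) x \<le> C * dilation_average F (norm x)"
proof -
 let ?I = "{is :: 'n list. length is \<in> {1..m}}"
 have "\<forall>is. is \<in> ?I \<longrightarrow> (\<exists>C\<ge>0. \<forall>a F x. radial_datum a R F \<longrightarrow> x \<noteq> 0 \<longrightarrow> norm x < R \<longrightarrow> \<bar>partials (rev is) (test_fun F) x\<bar> \<le> C * dilation_average F (norm x))"
  using test_fun_partials_bound[of "rev is" for "is"] by simp
 then obtain K where K: "\<And>is. is \<in> ?I ==> 0 \<le> K is"
  "\<And>is a F x. is \<in> ?I ==> radial_datum a R F ==> x \<noteq> 0 ==> norm x < R ==> \<bar>partials (rev is) (test_fun F) x\<bar> \<le> K is * dilation_average F (norm x)"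
  by metis
 show ?thesis
 proof (rule that[of "sum K ?I"])
  show "0 \<le> sum K ?I" by (rule sum_nonneg) (rule K)
  fix a F assume F: "radial_datum a R F"
  have fin: "finite ?I" by (rule finite_lists_range)
  have "AE x in Lb. \<forall>is\<in>?I. weak_derivative (ball 0 R) is (test_fun F) x = partials (rev is) (test_fun F) x"
   by (rule AE_finite_allI[OF fin]) (rule weak_derivative_smooth[OF test_fun_partial(1)[OF F]])
  then show "AE x in Lb. weak_gradient_length (ball 0 R) m (test_fun F) x \<le> sum K ?I * dilation_average F (norm x)"
   using AE_Lb_nonzero AE_space
  proof eventually_elim
   case (elim x)
   then have x: "x \<noteq> 0" "norm x < R" by auto
   have "weak_gradient_length (ball 0 R) m (test_fun F) x = L2_set (\<lambda>is. partials (rev is) (test_fun F) x) ?I"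
    unfolding weak_gradient_length_def L2_set_def using elim(1) by (intro arg_cong[where f=sqrt] sum.cong) auto
   also have "... \<le> (\<Sum>is\<in>?I. \<bar>partials (rev is) (test_fun F) x\<bar>)" by (rule L2_set_le_sum_abs)
   also have "... \<le> (\<Sum>is\<in>?I. K is * dilation_average F (norm x))" by (intro sum_mono K(2)[OF _ F x])
   also have "... = sum K ?I * dilation_average F (norm x)" by (simp add: sum_distrib_right)
   finally show ?case .
  qed
 qed
qed

end

section \<open>Optimality of the target\<close>

context target_setting begin

lemma test_fun_nn:
 assumes F: "radial_datum a R F"
 shows "ennreal (rad F (real m) step r) = (\<integral>\<^sup>+s. ennreal (F s * s powr (real m - 1) * step (r / s)) \<partial>lborel)" "0 \<le> rad F (real m) step r"
proof -
 have "0 \<le> F s * s powr (real m - 1) * step (r / s)" for s using F step(5) by (simp add: radial_datum_def)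
 then show "ennreal (rad F (real m) step r) = (\<integral>\<^sup>+s. ennreal (F s * s powr (real m - 1) * step (r / s)) \<partial>lborel)" "0 \<le> rad F (real m) step r"
  unfolding rad_def by (auto intro!: nn_integral_eq_integral[symmetric] rad_integrable[OF F step(1)] integral_nonneg_AE)
qed

text \<open>
 The test function is at most a multiple of \<open>\<integral>\<^sub>r\<^sup>R F\<close>, hence of an average of translates of \<open>F\<close>.
\<close>

lemma test_fun_le:
 assumes F: "radial_datum a R F" and r: "0 \<le> r"
 shows "ennreal (rad F (real m) step r) \<le> ennreal (R powr real m) * (\<integral>\<^sup>+s. indicator {0..1} s * ennreal (F ((1 + s * 0) * r + s * R)) \<partial>lborel)"
proof -
 have [measurable]: "F \<in> borel_measurable borel" using F by (simp add: radial_datum_def)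
 have F0: "0 \<le> F s" for s using F by (simp add: radial_datum_def)
 have "ennreal (rad F (real m) step r) \<le> (\<integral>\<^sup>+s. ennreal (R powr (real m - 1)) * (ennreal (F s) * indicator {r<..} s) \<partial>lborel)"
  unfolding test_fun_nn(1)[OF F]
 proof (rule nn_integral_mono)
  fix s :: real
  show "ennreal (F s * s powr (real m - 1) * step (r / s)) \<le> ennreal (R powr (real m - 1)) * (ennreal (F s) * indicator {r<..} s)"
  proof (cases "F s = 0 \<or> s \<le> r")
   case True
   moreover have "F s = 0 \<or> step (r / s) = 0" if "s \<le> r"
   proof (cases "F s = 0")
    case False
    then have "1 \<le> r / s" using radial_datum_support[OF F False] that by (simp add: le_divide_eq)
    then show ?thesis by (intro disjI2 step(4))
   qed simp
   ultimately show ?thesis by auto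
  next
   case False
   then have s: "0 < s" "s < R" "r < s" using radial_datum_support[OF F, of s] by auto
   have "s powr (real m - 1) \<le> R powr (real m - 1)" using s m_pos by (intro powr_mono2) auto
   then have "F s * s powr (real m - 1) * step (r / s) \<le> F s * R powr (real m - 1) * 1"
    using F0 step by (intro mult_mono) auto
   then show ?thesis using s F0 by (simp add: ennreal_mult[symmetric] mult.commute ennreal_leI)
  qed
 qed
 also have "... = ennreal (R powr (real m - 1)) * (\<integral>\<^sup>+s. ennreal (F s) * indicator {r<..} s \<partial>lborel)" by (rule nn_integral_cmult) measurable
 also have "(\<integral>\<^sup>+s. ennreal (F s) * indicator {r<..} s \<partial>lborel) = ennreal R * (\<integral>\<^sup>+s. ennreal (F (r + R * s)) * indicator {r<..} (r + R * s) \<partial>lborel)"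
  using R_pos by (subst nn_integral_real_affine[where c=R and t=r]) auto
 also have "(\<integral>\<^sup>+s. ennreal (F (r + R * s)) * indicator {r<..} (r + R * s) \<partial>lborel) = (\<integral>\<^sup>+s. indicator {0..1} s * ennreal (F ((1 + s * 0) * r + s * R)) \<partial>lborel)"
 proof (rule nn_integral_cong_AE)
  have z: "F (r + R * s) = 0" if "1 < s" for s
  proof -
   have "R \<le> R * s" using that R_pos by simp
   then have "R \<le> r + R * s" using r by linarith
   then show ?thesis using F by (simp add: radial_datum_def)
  qed
  have "AE s in lborel. s \<noteq> (0 :: real)" by (rule AE_lborel_singleton)
  then show "AE s in lborel. ennreal (F (r + R * s)) * indicator {r<..} (r + R * s) = indicator {0..1} s * ennreal (F ((1 + s * 0) * r + s * R))"
   by eventually_elim (use z R_pos in \<open>auto simp: indicator_def zero_less_mult_iff mult.commute not_le\<close>)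
 qed
 finally show ?thesis using R_pos by (simp add: mult.assoc[symmetric] ennreal_mult[symmetric] powr_mult_base mult.commute[of _ R])
qed

lemma radial_datum_norm_finite:
 assumes F: "radial_datum a R F" shows "X (\<lambda>x. ennreal (F (norm x))) < \<infinity>"
proof -
 interpret X: ri_function_norm Lb X by (rule X_ri)
 have [measurable]: "F \<in> borel_measurable borel" using F by (simp add: radial_datum_def)
 obtain c where c: "\<And>s. F s \<le> c" using F by (auto simp: radial_datum_def)
 have c0: "0 \<le> c" using c[of 0] F by (auto simp: radial_datum_def intro: order_trans)
 let ?B = "ball (0 :: real ^ 'n) R"
 have im: "(indicator ?B :: real ^ 'n => ennreal) \<in> borel_measurable Lb" by (rule borel_measurable_indicator) simp
 have "X (\<lambda>x. ennreal (F (norm x))) \<le> X (\<lambda>x. ennreal c * indicator ?B x)"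
 proof (rule X.norm_mono)
  show "(\<lambda>x. ennreal (F (norm x))) \<in> borel_measurable Lb" by (rule borel_measurable_lebesgue_on) measurable
  show "(\<lambda>x. ennreal c * indicator ?B x) \<in> borel_measurable Lb" using im by measurable
 qed (use c in \<open>auto intro!: ennreal_leI\<close>)
 also have "... = ennreal c * X (indicator ?B)" by (rule X.homogeneous[OF im c0])
 also have "... < \<infinity>"
  using X.finite_indicator[of ?B] L.emeasure_space_eq by (auto simp: ennreal_mult_less_top)
 finally show ?thesis .
qed

lemma weak_gradient_length_measurable:
 assumes "\<And>is. length is \<in> {1..m} ==> weak_derivative \<Omega>' is u \<in> borel_measurable (lebesgue_on \<Omega>')"
 shows "weak_gradient_length \<Omega>' m u \<in> borel_measurable (lebesgue_on \<Omega>')"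
proof -
 have "(\<lambda>x. \<Sum>is | length is \<in> {1..m}. (weak_derivative \<Omega>' is u x)\<^sup>2) \<in> borel_measurable (lebesgue_on \<Omega>')"
  by (intro borel_measurable_sum borel_measurable_power) (use assms in auto)
 then have "(\<lambda>x. sqrt (\<Sum>is | length is \<in> {1..m}. (weak_derivative \<Omega>' is u x)\<^sup>2)) \<in> borel_measurable (lebesgue_on \<Omega>')" by measurable
 then show ?thesis by (simp only: weak_gradient_length_def[abs_def])
qed

lemma test_fun_sobolev:
 obtains C where "C \<ge> 0" "\<And>a F. radial_datum a R F ==> test_fun F \<in> Sob"
  "\<And>a F. radial_datum a R F ==> Sob_norm (test_fun F) \<le> ennreal C * X (\<lambda>x. ennreal (F (norm x)))"
proof -
 interpret X: ri_function_norm Lb X by (rule X_ri)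
 obtain C where C: "C \<ge> 0" "\<And>a F. radial_datum a R F ==> AE x in Lb. weak_gradient_length (ball 0 R) m (test_fun F) x \<le> C * dilation_average F (norm x)"
  by (rule weak_gradient_test_fun) (rule that)
 show ?thesis
 proof (rule that[of "R powr real m + C"])
  show "0 \<le> R powr real m + C" using C(1) by simp
  fix a F assume F: "radial_datum a R F"
  have [measurable]: "F \<in> borel_measurable borel" using F by (simp add: radial_datum_def)
  have F0: "0 \<le> F s" for s using F by (simp add: radial_datum_def)
  let ?u = "test_fun F" and ?N = "X (\<lambda>x. ennreal (F (norm x)))" and ?W = "weak_gradient_length (ball 0 R) m (test_fun F)"
  have u: "smooth ?u" by (rule test_fun_partial(1)[OF F])
  have hw: "has_weak_derivative (ball 0 R) is ?u (partials (rev is) ?u)" for "is" by (rule smooth_has_weak_derivative[OF u]) simp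
  then have "has_weak_derivative (ball 0 R) is ?u (weak_derivative (ball 0 R) is ?u)" for "is"
   unfolding weak_derivative_def by (rule someI[where P="has_weak_derivative (ball 0 R) is ?u"])
  then have Wm: "?W \<in> borel_measurable Lb" by (intro weak_gradient_length_measurable) (simp add: has_weak_derivative_def locally_integrable_def)
  have um: "?u \<in> borel_measurable Lb" by (intro borel_measurable_lebesgue_on smooth_borel u)
  have avg: "X (\<lambda>x. \<integral>\<^sup>+s. indicator {0..1} s * ennreal (F ((1 + s * a) * norm x + s * b)) \<partial>lborel) \<le> ?N" if "0 \<le> a" "0 \<le> b" for a b
   by (rule norm_average_le[OF _ _ that]) (use F in \<open>auto simp: radial_datum_def\<close>)
  have avm: "(\<lambda>x :: real ^ 'n. \<integral>\<^sup>+s. indicator {0..1} s * ennreal (F ((1 + s * a) * norm x + s * b)) \<partial>lborel) \<in> borel_measurable Lb" for a b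
   by (rule borel_measurable_lebesgue_on) measurable
  have avm': "(\<lambda>x :: real ^ 'n. ennreal k * (\<integral>\<^sup>+s. indicator {0..1} s * ennreal (F ((1 + s * a) * norm x + s * b)) \<partial>lborel)) \<in> borel_measurable Lb" for a b k
   using avm[of a b] by measurable
  have um': "(\<lambda>x. ennreal \<bar>?u x\<bar>) \<in> borel_measurable Lb" and Wm': "(\<lambda>x. ennreal \<bar>?W x\<bar>) \<in> borel_measurable Lb" using um Wm by measurable
  have "fnorm X ?u \<le> X (\<lambda>x. ennreal (R powr real m) * (\<integral>\<^sup>+s. indicator {0..1} s * ennreal (F ((1 + s * 0) * norm x + s * R)) \<partial>lborel))"
   unfolding fnorm_def
  proof (rule X.norm_mono)
   fix x show "ennreal \<bar>?u x\<bar> \<le> ennreal (R powr real m) * (\<integral>\<^sup>+s. indicator {0..1} s * ennreal (F ((1 + s * 0) * norm x + s * R)) \<partial>lborel)"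
    using test_fun_le[OF F norm_ge_zero] test_fun_nn(2)[OF F] by (simp add: test_fun_def abs_of_nonneg)
  qed (rule um' avm')+
  also have "... = ennreal (R powr real m) * X (\<lambda>x. \<integral>\<^sup>+s. indicator {0..1} s * ennreal (F ((1 + s * 0) * norm x + s * R)) \<partial>lborel)"
   by (rule X.homogeneous[OF avm]) simp
  also have "... \<le> ennreal (R powr real m) * ?N" using R_pos by (intro mult_left_mono avg) auto
  finally have 1: "fnorm X ?u \<le> ennreal (R powr real m) * ?N" .
  have dil: "ennreal (dilation_average F r) = (\<integral>\<^sup>+s. indicator {0..1} s * ennreal (F ((1 + s * 1) * r + s * 0)) \<partial>lborel)" for r
  proof -
   have "ennreal (dilation_average F r) = (\<integral>\<^sup>+s. ennreal (indicator {0..1} s * F (r * (1 + s))) \<partial>lborel)"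
    unfolding dilation_average_def by (intro nn_integral_eq_integral[symmetric] dilation_average_integrable[OF F]) (simp add: F0)
   also have "... = (\<integral>\<^sup>+s. indicator {0..1} s * ennreal (F ((1 + s * 1) * r + s * 0)) \<partial>lborel)"
    by (intro nn_integral_cong) (auto simp: indicator_def mult.commute)
   finally show ?thesis .
  qed
  have W0: "0 \<le> ?W x" for x unfolding weak_gradient_length_def by (intro real_sqrt_ge_zero sum_nonneg) simp
  have "fnorm X ?W \<le> X (\<lambda>x. ennreal C * (\<integral>\<^sup>+s. indicator {0..1} s * ennreal (F ((1 + s * 1) * norm x + s * 0)) \<partial>lborel))"
   unfolding fnorm_def
  proof (rule X.lattice)
   show "AE x in Lb. ennreal \<bar>?W x\<bar> \<le> ennreal C * (\<integral>\<^sup>+s. indicator {0..1} s * ennreal (F ((1 + s * 1) * norm x + s * 0)) \<partial>lborel)"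
    using C(2)[OF F]
    by eventually_elim (unfold dil[symmetric], use W0 C(1) dilation_average_integrable(2)[OF F] in \<open>simp add: ennreal_mult[symmetric] abs_of_nonneg ennreal_leI\<close>)
  qed (rule Wm' avm')+
  also have "... = ennreal C * X (\<lambda>x. \<integral>\<^sup>+s. indicator {0..1} s * ennreal (F ((1 + s * 1) * norm x + s * 0)) \<partial>lborel)"
   by (rule X.homogeneous[OF avm C(1)])
  also have "... \<le> ennreal C * ?N" by (intro mult_left_mono avg) auto
  finally have 2: "fnorm X ?W \<le> ennreal C * ?N" .
  show "Sob_norm ?u \<le> ennreal (R powr real m + C) * ?N"
   unfolding sobolev_norm_def using add_mono[OF 1 2] C(1) by (simp add: distrib_right)
  have "fnorm X ?u < \<infinity>" "fnorm X ?W < \<infinity>"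
   using le_less_trans[OF 1] le_less_trans[OF 2] radial_datum_norm_finite[OF F] by (auto simp: ennreal_mult_less_top)
  then show "?u \<in> Sob"
   unfolding radial_sobolev_space_def sobolev_space_def fspace_def weakly_differentiable_def using um Wm hw
   by (auto simp: test_fun_def intro!: exI[of _ "rad F (real m) step"])
 qed
qed

text \<open>
 On the left, \<open>\<integral> f \<theta>\<^sub>g\<close> is \<open>\<integral> F(r) r\<^bsup>m-1\<^esup> \<integral>\<^sub>0\<^bsup>(r/R)^p\<^esup> g\<^sup>* dr\<close>. Scaling the inner limit by \<open>2\<^bsup>-p\<^esup>\<close> costs a
 factor, and after Fubini the condition \<open>s < (r/2R)\<^sup>p\<close> is the region where the step equals 1.
\<close>

lemma test_fun_pairing:
 assumes F: "radial_datum a R F" and g: "g \<in> borel_measurable unit_interval"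
 shows "(\<integral>\<^sup>+t. ennreal (F (R * t powr (1 / n))) * theta g t \<partial>unit_interval)
  \<le> ennreal (\<Omega> * R powr (n - real m) / measure Lb (space Lb) * 2 powr (n + \<alpha>)) * (\<integral>\<^sup>+s. nrearr unit_interval g s * ennreal (rad F (real m) step (R * s powr (1 / (n + \<alpha>)))) \<partial>unit_interval)"
proof -
 let ?u = unit_interval
 define p where "p = n + \<alpha>"
 have p: "p > 0" using n_pos \<alpha>_nonneg by (simp add: p_def add_pos_nonneg)
 have [measurable]: "F \<in> borel_measurable borel" using F by (simp add: radial_datum_def)
 have F0: "0 \<le> F s" for s using F by (simp add: radial_datum_def)
 let ?g = "nrearr ?u g"
 have [measurable]: "step \<in> borel_measurable borel" by (rule smooth_borel[OF step(1)])
 define E where "E s = ennreal (F s * s powr (real m - 1))" for s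
 have [measurable]: "E \<in> borel_measurable borel" unfolding E_def by measurable
 have E0: "E s = 0" if "\<not> (0 < s \<and> s < R)" for s
 proof -
  have "F s = 0" using radial_datum_support[OF F, of s] that by blast
  then show ?thesis by (simp add: E_def)
 qed
 define c where "c = \<Omega> * R powr (n - real m)"
 have c: "c \<ge> 0" using \<Omega>_pos by (simp add: c_def)
 define \<phi> where "\<phi> t = ennreal (F (R * t powr (1 / n))) * theta g t" for t
 have [measurable]: "\<phi> \<in> borel_measurable borel" unfolding \<phi>_def by measurable
 have \<phi>u: "\<phi> \<in> borel_measurable ?u" by (intro borel_measurable_ui) measurable
 have "(\<integral>\<^sup>+x. L.pull \<phi> x \<partial>Lb) = (\<integral>\<^sup>+x. ennreal (F (norm x)) * (ennreal ((norm x / R) powr (real m - n)) * prim ?g ((norm x / R) powr p)) \<partial>Lb)"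
 proof (rule nn_integral_cong_AE)
  show "AE x in Lb. L.pull \<phi> x = ennreal (F (norm x)) * (ennreal ((norm x / R) powr (real m - n)) * prim ?g ((norm x / R) powr p))"
   using AE_Lb_nonzero AE_space
  proof eventually_elim
   case (elim x)
   then have x: "x \<noteq> 0" "norm x < R" by auto
   have t: "0 < ball_factor 0 R x" "ball_factor 0 R x < 1" using ball_factor_01[OF x, of 0] by auto
   have "R * ball_factor 0 R x powr (1 / n) = norm x" using n_pos R_pos by (simp add: ball_factor_def n_eq[symmetric] powr_powr)
   then have "L.pull \<phi> x = ennreal (F (norm x)) * L.pull (theta g) x" using t by (simp add: L.pull_def \<phi>_def)
   then show ?case unfolding pull_theta[OF x] by (simp add: ball_factor_def p_def n_eq)
  qed
 qed
 also have "... = (\<integral>\<^sup>+r. ennreal (F r) * (ennreal ((r / R) powr (real m - n)) * prim ?g ((r / R) powr p)) * (ennreal (\<Omega> * r powr (n - 1)) * indicator {0<..<R} r) \<partial>lborel)"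
  by (rule nn_integral_Lb_radial) measurable
 also have "... = (\<integral>\<^sup>+r. ennreal c * (E r * prim ?g ((r / R) powr p)) \<partial>lborel)"
 proof (rule nn_integral_cong)
  fix r :: real
  show "ennreal (F r) * (ennreal ((r / R) powr (real m - n)) * prim ?g ((r / R) powr p)) * (ennreal (\<Omega> * r powr (n - 1)) * indicator {0<..<R} r) = ennreal c * (E r * prim ?g ((r / R) powr p))"
  proof (cases "0 < r \<and> r < R")
   case True
   have "(r / R) powr (real m - n) = r powr (real m - n) * R powr (n - real m)"
    using True R_pos by (simp add: powr_divide powr_diff)
   moreover have "r powr (real m - n) * r powr (n - 1) = r powr (real m - 1)" by (simp add: powr_add[symmetric])
   ultimately have "F r * (r / R) powr (real m - n) * (\<Omega> * r powr (n - 1)) = c * (F r * r powr (real m - 1))" by (simp add: c_def ac_simps)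
   then have "ennreal (F r) * ennreal ((r / R) powr (real m - n)) * ennreal (\<Omega> * r powr (n - 1)) = ennreal c * E r"
    unfolding E_def using F0[of r] \<Omega>_pos c by (simp add: ennreal_mult[symmetric])
   then have "(ennreal (F r) * ennreal ((r / R) powr (real m - n)) * ennreal (\<Omega> * r powr (n - 1))) * prim ?g ((r / R) powr p) = (ennreal c * E r) * prim ?g ((r / R) powr p)" by simp
   then show ?thesis using True by (simp add: ac_simps)
  next
   case False
   then show ?thesis using E0[of r] by simp
  qed
 qed
 also have "... = ennreal c * (\<integral>\<^sup>+r. E r * prim ?g ((r / R) powr p) \<partial>lborel)" by (rule nn_integral_cmult) measurable
 finally have 1: "(\<integral>\<^sup>+x. L.pull \<phi> x \<partial>Lb) = ennreal c * (\<integral>\<^sup>+r. E r * prim ?g ((r / R) powr p) \<partial>lborel)" .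
 have 2: "(\<integral>\<^sup>+r. E r * prim ?g ((r / R) powr p) \<partial>lborel) \<le> ennreal (2 powr p) * (\<integral>\<^sup>+r. E r * prim ?g ((r / (2 * R)) powr p) \<partial>lborel)"
 proof -
  have "(\<integral>\<^sup>+r. E r * prim ?g ((r / R) powr p) \<partial>lborel) \<le> (\<integral>\<^sup>+r. ennreal (2 powr p) * (E r * prim ?g ((r / (2 * R)) powr p)) \<partial>lborel)"
  proof (rule nn_integral_mono)
   fix r :: real
   show "E r * prim ?g ((r / R) powr p) \<le> ennreal (2 powr p) * (E r * prim ?g ((r / (2 * R)) powr p))"
   proof (cases "0 < r \<and> r < R")
    case True
    have s: "0 \<le> (r / R) powr p" "(r / R) powr p \<le> 1" using True p R_pos powr_le1[of p "r / R"] by auto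
    have l: "0 < 2 powr (- p)" "2 powr (- p) \<le> (1 :: real)" using p by (auto simp: powr_minus intro!: inverse_le_1_iff[THEN iffD2] ge_one_powr_ge_zero)
    have e: "2 powr (- p) * (r / R) powr p = (r / (2 * R)) powr p" using True R_pos by (simp add: powr_divide powr_mult powr_minus field_simps)
    have "ennreal (2 powr p) * (ennreal (2 powr (- p)) * prim ?g ((r / R) powr p)) \<le> ennreal (2 powr p) * prim ?g ((r / (2 * R)) powr p)"
     using prim_nrearr_scale[OF g l s] unfolding e by (intro mult_left_mono) auto
    moreover have "ennreal (2 powr p) * (ennreal (2 powr (- p)) * prim ?g ((r / R) powr p)) = prim ?g ((r / R) powr p)"
     by (simp add: mult.assoc[symmetric] ennreal_mult[symmetric] powr_add[symmetric])
    ultimately have "prim ?g ((r / R) powr p) \<le> ennreal (2 powr p) * prim ?g ((r / (2 * R)) powr p)" by simp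
    then have "E r * prim ?g ((r / R) powr p) \<le> E r * (ennreal (2 powr p) * prim ?g ((r / (2 * R)) powr p))" by (rule mult_left_mono) simp
    then show ?thesis by (simp add: ac_simps)
   next
    case False
    then show ?thesis using E0[of r] by simp
   qed
  qed
  also have "... = ennreal (2 powr p) * (\<integral>\<^sup>+r. E r * prim ?g ((r / (2 * R)) powr p) \<partial>lborel)" by (rule nn_integral_cmult) measurable
  finally show ?thesis .
 qed
 have 3: "(\<integral>\<^sup>+r. E r * prim ?g ((r / (2 * R)) powr p) \<partial>lborel) \<le> (\<integral>\<^sup>+s. ?g s * ennreal (rad F (real m) step (R * s powr (1 / p))) \<partial>?u)"
 proof -
  have e: "prim ?g s = (\<integral>\<^sup>+t. ?g t * indicator {t. 0 < t \<and> t < 1 \<and> t < s} t \<partial>lborel)" for s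
   unfolding prim_def by (subst nn_integral_lebesgue_on_borel) (auto intro!: nn_integral_cong simp: indicator_def)
  have "(\<integral>\<^sup>+r. E r * prim ?g ((r / (2 * R)) powr p) \<partial>lborel)
   = (\<integral>\<^sup>+r. (\<integral>\<^sup>+t. E r * (?g t * indicator {(t, r). 0 < t \<and> t < 1 \<and> t < (r / (2 * R)) powr p} (t, r)) \<partial>lborel) \<partial>lborel)"
   unfolding e by (intro nn_integral_cong) (subst nn_integral_cmult[symmetric], auto intro!: nn_integral_cong simp: indicator_def)
  also have "... = (\<integral>\<^sup>+t. (\<integral>\<^sup>+r. E r * (?g t * indicator {(t, r). 0 < t \<and> t < 1 \<and> t < (r / (2 * R)) powr p} (t, r)) \<partial>lborel) \<partial>lborel)"
   by (rule lborel_pair.Fubini') measurable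
  also have "... \<le> (\<integral>\<^sup>+t. ?g t * ennreal (rad F (real m) step (R * t powr (1 / p))) * indicator {0<..<1} t \<partial>lborel)"
  proof (rule nn_integral_mono)
   fix t :: real
   show "(\<integral>\<^sup>+r. E r * (?g t * indicator {(t, r). 0 < t \<and> t < 1 \<and> t < (r / (2 * R)) powr p} (t, r)) \<partial>lborel) \<le> ?g t * ennreal (rad F (real m) step (R * t powr (1 / p))) * indicator {0<..<1} t"
   proof (cases "0 < t \<and> t < 1")
    case True
    have "(\<integral>\<^sup>+r. E r * (?g t * indicator {(t, r). 0 < t \<and> t < 1 \<and> t < (r / (2 * R)) powr p} (t, r)) \<partial>lborel)
     \<le> (\<integral>\<^sup>+r. ?g t * ennreal (F r * r powr (real m - 1) * step (R * t powr (1 / p) / r)) \<partial>lborel)"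
    proof (rule nn_integral_mono)
     fix r :: real
     show "E r * (?g t * indicator {(t, r). 0 < t \<and> t < 1 \<and> t < (r / (2 * R)) powr p} (t, r)) \<le> ?g t * ennreal (F r * r powr (real m - 1) * step (R * t powr (1 / p) / r))"
     proof (cases "0 < r \<and> r < R \<and> t < (r / (2 * R)) powr p")
      case r: True
      have "t powr (1 / p) \<le> ((r / (2 * R)) powr p) powr (1 / p)" using r True p by (intro powr_mono2) auto
      then have "t powr (1 / p) \<le> r / (2 * R)" using r p R_pos by (simp add: powr_powr)
      then have "R * t powr (1 / p) / r \<le> 1 / 2" using r R_pos by (simp add: field_simps)
      then have "step (R * t powr (1 / p) / r) = 1" by (rule step(3))
      then show ?thesis by (simp add: E_def indicator_def mult.commute)
     next
      case False
      then have "E r = 0 \<or> \<not> t < (r / (2 * R)) powr p" using E0 by blast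
      then show ?thesis by auto
     qed
    qed
    also have "... = ?g t * ennreal (rad F (real m) step (R * t powr (1 / p)))"
     unfolding test_fun_nn(1)[OF F] by (rule nn_integral_cmult) measurable
    finally show ?thesis using True by simp
   next
    case False
    then have "(\<lambda>r. E r * (?g t * indicator {(t, r). 0 < t \<and> t < 1 \<and> t < (r / (2 * R)) powr p} (t, r))) = (\<lambda>r. 0)"
     by (intro ext) auto
    then show ?thesis by (simp only: nn_integral_const mult_zero_left zero_le)
   qed
  qed
  also have "... = (\<integral>\<^sup>+s. ?g s * ennreal (rad F (real m) step (R * s powr (1 / p))) \<partial>?u)"
  proof -
   have [measurable]: "rad F (real m) step \<in> borel_measurable borel" by (rule smooth_borel[OF smooth_rad[OF F step(1,2)]])
   show ?thesis by (rule nn_integral_lebesgue_on_borel[symmetric]) measurable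
  qed
  finally show ?thesis .
 qed
 let ?V = "measure Lb (space Lb)"
 have "(\<integral>\<^sup>+t. \<phi> t \<partial>?u) = (\<integral>\<^sup>+x. L.pull \<phi> x \<partial>Lb) / ennreal ?V"
  using L.mean_pull[OF \<phi>u] by (simp only: mean_def L.emeasure_space_eq)
 also have "... = ennreal (c / ?V) * (\<integral>\<^sup>+r. E r * prim ?g ((r / R) powr p) \<partial>lborel)"
  unfolding 1 using L.total_pos c by (simp add: divide_ennreal[symmetric] divide_ennreal_def ac_simps)
 also have "... \<le> ennreal (c / ?V) * (ennreal (2 powr p) * (\<integral>\<^sup>+s. ?g s * ennreal (rad F (real m) step (R * s powr (1 / p))) \<partial>?u))"
  by (rule mult_left_mono, rule order_trans[OF 2], rule mult_left_mono[OF 3]) auto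
 also have "... = ennreal (c / ?V * 2 powr p) * (\<integral>\<^sup>+s. ?g s * ennreal (rad F (real m) step (R * s powr (1 / p))) \<partial>?u)"
 proof -
  have "0 \<le> c / ?V" using c by simp
  from ennreal_mult[OF this, of "2 powr p"] show ?thesis by (simp only: mult.assoc powr_ge_zero)
 qed
 finally show ?thesis by (simp add: \<phi>_def c_def p_def)
qed

text \<open>
 An associate norm is computed by testing with bounded profiles \<open>F\<close> supported away from 0. For these, the
 embedding into \<open>Z\<close> applied to the test function bounds the pairing with \<open>g\<close>, so the functional
 defining the target is at most a multiple of the associate norm of \<open>Z\<close>. Dualizing gives the
 inclusion.
\<close>

theorem optimal_target:
 assumes Z: "ri_function_norm Wb Z"
  and emb: "embeds Sob Sob_norm (fspace Wb Z) (fnorm Z)"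
 shows "embeds (fspace Wb target) (fnorm target) (fspace Wb Z) (fnorm Z)"
proof -
 let ?u = unit_interval
 define p where "p = n + \<alpha>"
 have p: "p > 0" using n_pos \<alpha>_nonneg by (simp add: p_def add_pos_nonneg)
 interpret Z: ri_function_norm Wb Z by fact
 define Zb where "Zb = representation_norm Wb Z"
 interpret Zb: ri_norm_ui Zb unfolding Zb_def by (rule ri_norm_ui.intro, rule W.representation_norm(1)[OF Z])
 interpret Za: ri_norm_ui "associate_norm ?u Zb" by (rule ri_norm_ui.intro, rule Zb.associate_norm_ri)
 obtain C where C: "C \<ge> 0" "\<And>a F. radial_datum a R F ==> test_fun F \<in> Sob"
  "\<And>a F. radial_datum a R F ==> Sob_norm (test_fun F) \<le> ennreal C * X (\<lambda>x. ennreal (F (norm x)))"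
  by (rule test_fun_sobolev) (rule that, assumption+)
 obtain D0 where D0: "\<And>u. u \<in> Sob ==> fnorm Z u \<le> ennreal D0 * Sob_norm u"
  using emb unfolding embeds_def by blast
 define B where "B = \<Omega> * R powr (n - real m) / measure Lb (space Lb) * 2 powr (n + \<alpha>)"
 \<comment> \<open>an embedding constant may be negative\<close>
 define K where "K = B * (max D0 0 * C)"
 have B: "B \<ge> 0" using \<Omega>_pos by (simp add: B_def)
 have core: "(\<integral>\<^sup>+t. ennreal (F (R * t powr (1 / n))) * theta g t \<partial>?u) \<le> ennreal K * X (\<lambda>x. ennreal (F (norm x))) * associate_norm ?u Zb g"
  if F: "radial_datum a R F" and g: "g \<in> borel_measurable ?u" for a F g
 proof -
  define \<gamma> where "\<gamma> s = ennreal (rad F (real m) step (R * s powr (1 / p)))" for s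
  have [measurable]: "rad F (real m) step \<in> borel_measurable borel" by (rule smooth_borel[OF smooth_rad[OF F step(1,2)]])
  have [measurable]: "\<gamma> \<in> borel_measurable borel" unfolding \<gamma>_def by measurable
  have \<gamma>u: "\<gamma> \<in> borel_measurable ?u" by (intro borel_measurable_ui) measurable
  have "Zb \<gamma> = Z (W.pull \<gamma>)" unfolding Zb_def by (rule W.norm_pull[OF Z \<gamma>u, symmetric])
  also have "... = fnorm Z (test_fun F)"
   unfolding fnorm_def
  proof (rule Z.norm_cong_AE)
   show "W.pull \<gamma> \<in> borel_measurable Wb" by (rule W.pull_measurable[OF \<gamma>u])
   have "test_fun F \<in> borel_measurable Lb" by (intro borel_measurable_lebesgue_on smooth_borel test_fun_partial(1)[OF F])
   then show "(\<lambda>x. ennreal \<bar>test_fun F x\<bar>) \<in> borel_measurable Wb" by simp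
   show "AE x in Wb. W.pull \<gamma> x = ennreal \<bar>test_fun F x\<bar>"
    unfolding AE_weighted_ball using AE_Lb_nonzero AE_space
   proof eventually_elim
    case (elim x)
    then have x: "x \<noteq> 0" "norm x < R" by auto
    have t: "0 < ball_factor \<alpha> R x" "ball_factor \<alpha> R x < 1" using ball_factor_01[OF x \<alpha>_nonneg] by auto
    have e: "R * ball_factor \<alpha> R x powr (1 / p) = norm x"
     using p x R_pos by (simp add: ball_factor_def powr_powr p_def n_eq)
    have "W.pull \<gamma> x = ennreal (test_fun F x)" using t by (simp only: W.pull_def \<gamma>_def e test_fun_def) simp
    then show ?case using test_fun_nn(2)[OF F] by (simp add: test_fun_def abs_of_nonneg)
   qed
  qed
  also have "... \<le> ennreal D0 * Sob_norm (test_fun F)" by (rule D0[OF C(2)[OF F]])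
  also have "... \<le> ennreal (max D0 0) * (ennreal C * X (\<lambda>x. ennreal (F (norm x))))" by (intro mult_mono C(3)[OF F] ennreal_leI) auto
  finally have Zg: "Zb \<gamma> \<le> ennreal (max D0 0) * (ennreal C * X (\<lambda>x. ennreal (F (norm x))))" .
  have "(\<integral>\<^sup>+t. ennreal (F (R * t powr (1 / n))) * theta g t \<partial>?u) \<le> ennreal B * (\<integral>\<^sup>+s. nrearr ?u g s * \<gamma> s \<partial>?u)"
   using test_fun_pairing[OF F g] by (simp add: B_def \<gamma>_def p_def)
  also have "(\<integral>\<^sup>+s. nrearr ?u g s * \<gamma> s \<partial>?u) = (\<integral>\<^sup>+s. \<gamma> s * nrearr ?u g s \<partial>?u)" by (simp add: mult.commute)
  finally have 1: "(\<integral>\<^sup>+t. ennreal (F (R * t powr (1 / n))) * theta g t \<partial>?u) \<le> ennreal B * (\<integral>\<^sup>+s. \<gamma> s * nrearr ?u g s \<partial>?u)" .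
  have "(\<integral>\<^sup>+s. \<gamma> s * nrearr ?u g s \<partial>?u) \<le> Zb \<gamma> * associate_norm ?u Zb (nrearr ?u g)" by (rule Zb.hoelder[OF Zb.ui_fin \<gamma>u nrearr_measurable_ui])
  also have "associate_norm ?u Zb (nrearr ?u g) = associate_norm ?u Zb g" by (rule Za.norm_nrearr[OF g])
  finally have 2: "(\<integral>\<^sup>+s. \<gamma> s * nrearr ?u g s \<partial>?u) \<le> Zb \<gamma> * associate_norm ?u Zb g" .
  note 1
  also have "ennreal B * (\<integral>\<^sup>+s. \<gamma> s * nrearr ?u g s \<partial>?u) \<le> ennreal B * ((ennreal (max D0 0) * (ennreal C * X (\<lambda>x. ennreal (F (norm x))))) * associate_norm ?u Zb g)"
   by (rule mult_left_mono, rule order_trans[OF 2], rule mult_right_mono[OF Zg]) auto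
  also have "... = ennreal K * X (\<lambda>x. ennreal (F (norm x))) * associate_norm ?u Zb g"
   using B C(1) by (simp add: K_def ennreal_mult ac_simps)
  finally show ?thesis .
 qed
 have T: "T_assoc g \<le> ennreal K * associate_norm ?u Zb g" if g: "g \<in> borel_measurable ?u" for g
  unfolding T_assoc_eq
 proof (rule associate_norm_least)
  fix f assume f: "f \<in> borel_measurable ?u" and f1: "Xbar f \<le> 1"
  have "(\<lambda>t. f t * indicator {0<..<1} t) \<in> borel_measurable lebesgue"
   using f by (subst (asm) borel_measurable_restrict_space_iff_ennreal) auto
  then obtain f0 where f0[measurable]: "f0 \<in> borel_measurable lborel" and f0e: "AE t in lborel. f t * indicator {0<..<1} t = f0 t"
   using completion_ex_borel_measurable[of "\<lambda>t. f t * indicator {0<..<1} t" lborel] by blast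
  have [measurable]: "f0 \<in> borel_measurable borel" using f0 by simp
  have ae: "AE t in ?u. f0 t = f t"
  proof -
   have "AE t in lebesgue. f t * indicator {0<..<1} t = f0 t" using f0e by (rule AE_completion)
   then have "AE t in lebesgue. t \<in> {0<..<1} \<longrightarrow> f0 t = f t" by eventually_elim auto
   then show ?thesis by (simp add: AE_restrict_space_iff)
  qed
  \<comment> \<open>truncated in height and off the origin; \<open>k + 2\<close> keeps the interval proper for \<open>k = 0\<close>\<close>
  define F where "F k r = enn2real (min (f0 ((r / R) powr n)) (of_nat k)) * indicator {R / (real k + 2)..<R} r" for k :: nat and r
  have [measurable]: "F k \<in> borel_measurable borel" for k unfolding F_def by measurable
  have datum: "radial_datum (R / (real k + 2)) R (F k)" for k
  proof -
   have "F k r \<le> real k" for r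
    unfolding F_def using enn2real_mono[of "min (f0 ((r / R) powr n)) (of_nat k)" "of_nat k"] of_nat_less_top[of k] by (auto simp: indicator_def)
   then show ?thesis unfolding radial_datum_def using R_pos by (auto simp: F_def)
  qed
  have Fe: "ennreal (F k r) = min (f0 ((r / R) powr n)) (of_nat k) * indicator {R / (real k + 2)..<R} r" for k r
  proof -
   have "min (f0 ((r / R) powr n)) (of_nat k) < top" by (simp add: min_less_iff_disj of_nat_less_top)
   then show ?thesis by (simp add: F_def ennreal_mult indicator_def)
  qed
  have Fle: "ennreal (F k r) \<le> f0 ((r / R) powr n)" for k r unfolding Fe by (auto simp: indicator_def)
  have XF: "X (\<lambda>x. ennreal (F k (norm x))) \<le> 1" for k
  proof -
   interpret X: ri_function_norm Lb X by (rule X_ri)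
   have "X (\<lambda>x. ennreal (F k (norm x))) \<le> X (L.pull f0)"
   proof (rule X.lattice)
    show "(\<lambda>x. ennreal (F k (norm x))) \<in> borel_measurable Lb" by (rule borel_measurable_lebesgue_on) measurable
    show "L.pull f0 \<in> borel_measurable Lb" by (intro L.pull_measurable borel_measurable_ui) measurable
    show "AE x in Lb. ennreal (F k (norm x)) \<le> L.pull f0 x" using AE_Lb_nonzero AE_space
    proof eventually_elim
     case (elim x)
     then have x: "x \<noteq> 0" "norm x < R" by auto
     show ?case using ball_factor_01[OF x, of 0] Fle[of k "norm x"] by (simp add: L.pull_def ball_factor_def n_eq)
    qed
   qed
   also have "... = Xbar f0" by (rule L.norm_pull[OF X_ri]) (intro borel_measurable_ui, measurable)
   also have "... = Xbar f" by (rule Xb.norm_cong_AE[OF _ f ae]) (intro borel_measurable_ui, measurable)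
   finally show ?thesis using f1 by simp
  qed
  have inc: "F k r \<le> F l r" if "k \<le> l" for k l r
  proof -
   have "R / (real l + 2) \<le> R / (real k + 2)" using that R_pos by (intro divide_left_mono) auto
   then have "ennreal (F k r) \<le> ennreal (F l r)" unfolding Fe using that by (intro mult_mono min.mono) (auto simp: indicator_def)
   then show ?thesis using datum[of l] by (simp add: radial_datum_def)
  qed
  have sup: "(SUP k. ennreal (F k (R * t powr (1 / n)))) = f0 t" if t: "0 < t" "t < 1" for t
  proof -
   define \<rho> where "\<rho> = R * t powr (1 / n)"
   have e: "(\<rho> / R) powr n = t" using t n_pos R_pos by (simp add: \<rho>_def powr_powr)
   have r: "0 < \<rho>" "\<rho> < R" using t R_pos powr_lt_1[of t "1 / n"] n_pos by (auto simp: \<rho>_def)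
   define k0 where "k0 = nat \<lceil>R / \<rho>\<rceil>"
   have k0: "R / \<rho> \<le> real k0" unfolding k0_def by (rule real_nat_ceiling_ge)
   have ge: "min (f0 t) (of_nat k) \<le> ennreal (F k \<rho>)" if "k0 \<le> k" for k
   proof -
    have "real k0 \<le> real k + 2" using that by simp
    with k0 have "R / \<rho> \<le> real k + 2" by (rule order_trans)
    then have "R / (real k + 2) \<le> \<rho>" using r by (simp add: pos_divide_le_eq mult.commute)
    then have "indicator {R / (real k + 2)..<R} \<rho> = (1 :: ennreal)" using r(2) by simp
    then show ?thesis unfolding Fe e by simp
   qed
   let ?S = "SUP k. ennreal (F k \<rho>)"
   have "f0 t \<le> ?S"
   proof (rule ccontr)
    assume "\<not> f0 t \<le> ?S"
    then have less: "?S < f0 t" by simp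
    have "?S < top" by (rule less_le_trans[OF less top_greatest])
    then obtain j :: nat where j: "?S < of_nat j" using ennreal_Ex_less_of_nat by blast
    have "of_nat j \<le> (of_nat (max j k0) :: ennreal)" by simp
    then have "?S < of_nat (max j k0)" by (rule less_le_trans[OF j])
    then have "?S < min (f0 t) (of_nat (max j k0))" using less by (simp only: min_less_iff_conj)
    also have "... \<le> ennreal (F (max j k0) \<rho>)" by (rule ge) simp
    also have "... \<le> ?S" by (rule SUP_upper) simp
    finally show False by simp
   qed
   moreover have "?S \<le> f0 t" using Fle[of _ \<rho>] unfolding e by (rule SUP_least)
   ultimately show ?thesis unfolding \<rho>_def by (rule antisym[rotated])
  qed
  have "(\<integral>\<^sup>+t. f t * theta g t \<partial>?u) = (\<integral>\<^sup>+t. (SUP k. ennreal (F k (R * t powr (1 / n))) * theta g t) \<partial>?u)"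
  proof (rule nn_integral_cong_AE)
   show "AE t in ?u. f t * theta g t = (SUP k. ennreal (F k (R * t powr (1 / n))) * theta g t)"
    using ae AE_space
   proof eventually_elim
    case (elim t)
    then show ?case by (simp add: SUP_mult_right_ennreal[symmetric] sup)
   qed
  qed
  also have "... = (SUP k. \<integral>\<^sup>+t. ennreal (F k (R * t powr (1 / n))) * theta g t \<partial>?u)"
  proof (rule nn_integral_monotone_convergence_SUP)
   show "incseq (\<lambda>k t. ennreal (F k (R * t powr (1 / n))) * theta g t)"
    by (intro incseq_SucI le_funI mult_right_mono ennreal_leI inc) auto
   show "(\<lambda>t. ennreal (F k (R * t powr (1 / n))) * theta g t) \<in> borel_measurable ?u" for k
    by (intro borel_measurable_ui) measurable
  qed
  also have "... \<le> ennreal K * associate_norm ?u Zb g"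
  proof (rule SUP_least)
   fix k
   have "(\<integral>\<^sup>+t. ennreal (F k (R * t powr (1 / n))) * theta g t \<partial>?u) \<le> ennreal K * X (\<lambda>x. ennreal (F k (norm x))) * associate_norm ?u Zb g"
    by (rule core[OF datum g])
   also have "... \<le> ennreal K * 1 * associate_norm ?u Zb g" by (intro mult_right_mono mult_left_mono XF) auto
   finally show "(\<integral>\<^sup>+t. ennreal (F k (R * t powr (1 / n))) * theta g t \<partial>?u) \<le> ennreal K * associate_norm ?u Zb g" by simp
  qed
  finally show "(\<integral>\<^sup>+t. f t * theta g t \<partial>?u) \<le> ennreal K * associate_norm ?u Zb g" .
 qed
 have bound: "Zb h \<le> ennreal K * target01 h" if h: "h \<in> borel_measurable ?u" for h
 proof -
  have "Zb h \<le> associate_norm ?u (associate_norm ?u Zb) h" by (rule Zb.lorentz_luxemburg[OF h])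
  also have "... \<le> ennreal K * target01 h"
  proof (rule associate_norm_least)
   fix g assume g: "g \<in> borel_measurable ?u" and g1: "associate_norm ?u Zb g \<le> 1"
   have "(\<integral>\<^sup>+t. g t * h t \<partial>?u) = (\<integral>\<^sup>+t. h t * g t \<partial>?u)" by (simp add: mult.commute)
   also have "... \<le> target01 h * associate_norm ?u target01 g" by (rule Tn.hoelder[OF Tn.ui_fin h g])
   also have "associate_norm ?u target01 g = T_assoc g" by (rule target_norm_01(2)[OF g])
   finally have 1: "(\<integral>\<^sup>+t. g t * h t \<partial>?u) \<le> target01 h * T_assoc g" .
   have "T_assoc g \<le> ennreal K * 1" using T[OF g] mult_left_mono[OF g1, of "ennreal K"] by simp
   then have "target01 h * T_assoc g \<le> target01 h * (ennreal K * 1)" by (rule mult_left_mono) simp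
   with 1 show "(\<integral>\<^sup>+t. g t * h t \<partial>?u) \<le> ennreal K * target01 h" by (simp add: mult.commute)
  qed
  finally show ?thesis .
 qed
 have bound': "fnorm Z u \<le> ennreal K * fnorm target u" if u: "u \<in> borel_measurable Wb" for u
 proof -
  have um: "(\<lambda>x. ennreal \<bar>u x\<bar>) \<in> borel_measurable Wb" using u by measurable
  have "fnorm Z u = Zb (nrearr Wb (\<lambda>x. ennreal \<bar>u x\<bar>))"
   unfolding fnorm_def Zb_def by (rule W.representation_norm(2)[OF Z um])
  also have "... \<le> ennreal K * target01 (nrearr Wb (\<lambda>x. ennreal \<bar>u x\<bar>))" by (rule bound[OF nrearr_measurable_ui])
  finally show ?thesis by (simp add: fnorm_def target_norm_eq)
 qed
 have "u \<in> fspace Wb Z" if "u \<in> fspace Wb target" for u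
 proof -
  have u: "u \<in> borel_measurable Wb" "fnorm target u < \<infinity>" using that by (auto simp: fspace_def)
  then have "fnorm Z u < \<infinity>" using bound'[OF u(1)] by (auto intro: le_less_trans simp: ennreal_mult_less_top)
  then show ?thesis using u by (simp add: fspace_def)
 qed
 moreover have "\<forall>u\<in>fspace Wb target. fnorm Z u \<le> ennreal K * fnorm target u"
  using bound' by (simp add: fspace_def)
 ultimately show ?thesis unfolding embeds_def by blast
qed

end

theorem corollary4p2:
 fixes m :: nat and \<alpha> R :: real
  and X :: "(real ^ 'n \<Rightarrow> ennreal) \<Rightarrow> ennreal"
 assumes "m \<ge> 1" and "CARD('n) \<ge> 2" and "\<alpha> \<ge> 0" and "R > 0"
  and "ri_function_norm (lebesgue_on (ball 0 R)) X"
 shows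
  "ri_function_norm unit_interval (target_norm_01 m \<alpha> R X) \<and>
   (\<forall>g \<in> borel_measurable unit_interval.
    associate_norm unit_interval (target_norm_01 m \<alpha> R X) g = target_associate m \<alpha> R X g) \<and>
   ri_function_norm (weighted_ball \<alpha> R) (target_norm m \<alpha> R X) \<and>
   embeds (radial_sobolev_space (ball 0 R) m X) (sobolev_norm (ball 0 R) m X)
    (fspace (weighted_ball \<alpha> R) (target_norm m \<alpha> R X)) (fnorm (target_norm m \<alpha> R X)) \<and>
   (\<forall>Z. ri_function_norm (weighted_ball \<alpha> R) Z \<and>
     embeds (radial_sobolev_space (ball 0 R) m X) (sobolev_norm (ball 0 R) m X)
      (fspace (weighted_ball \<alpha> R) Z) (fnorm Z) \<longrightarrow>
     embeds (fspace (weighted_ball \<alpha> R) (target_norm m \<alpha> R X)) (fnorm (target_norm m \<alpha> R X))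
      (fspace (weighted_ball \<alpha> R) Z) (fnorm Z))"
proof -
 interpret target_setting m "real CARD('n)" \<alpha> R X
  using assms by (intro target_setting.intro) auto
 show ?thesis
  using target_norm_01 target_norm_ri radial_embedding optimal_target by blast
qed

end
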